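(* Let $m\in\mathbb{N}$ with $m\ge[\frac n2+3]$, and let $u$ be a local solution on $[0,T]$ of the problem $$u_{tt}-c^2\Delta u=\alpha\varepsilon u_tu_{tt}+\beta\varepsilon\nabla u\cdot\nabla u_t,\quad x\in\mathbb{R}^n,\qquad u(x,0)=u_0(x),\quad u_t(x,0)=u_1(x),$$ satisfying $$u\in C^r([0,T];H^{m+1-r}(\mathbb{R}^n))\ \text{ for } 0\le r\le m,$$ $$\forall t\in[0,T],\quad\|u_t(t)\|_{L^\infty(\mathbb{R}^n)}<\tfrac1{2\alpha\varepsilon},\quad\|u\|_{L^\infty(\mathbb{R}^n)}<M_1,\quad\|\nabla u\|_{L^\infty(\mathbb{R}^n)}<M_2.$$ Then for $t\in[0,T]$ $$E_m[u](t)\le B\,E_m[u](0)+D_m\max(\alpha,\beta)\varepsilon\int_0^tE_{m-1}[u](\tau)^{\frac12}E_m[u](\tau)\,d\tau,$$ with a constant $D_m>0$, depending only on $m$, on $n$ and on $c$, and with $B=\frac{3+2c^2}{\min(1/2,c^2)}$.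
   Context: $\alpha,\beta,c,\varepsilon,M_1,M_2$ are positive constants, $n\in\mathbb{N}^*$, $[\cdot]$ is the integer part, and for $k\in\mathbb{N}$ $$E_k[u](t)=\|\nabla u(t)\|_{H^k(\mathbb{R}^n)}^2+\sum_{i=1}^{k+1}\|\partial_t^iu(t)\|_{H^{k+1-i}(\mathbb{R}^n)}^2.$$ *)

theory Defs
  imports "HOL-Probability.Essential_Supremum"
begin

definition pderiv_at :: "'n \<Rightarrow> (real^'n \<Rightarrow> real) \<Rightarrow> real^'n::finite \<Rightarrow> real" where
  "pderiv_at i f x = frechet_derivative f (at x) (axis i 1)"

fun iter_pderiv :: "'n list \<Rightarrow> (real^'n \<Rightarrow> real) \<Rightarrow> real^'n::finite \<Rightarrow> real" where
  "iter_pderiv [] f = f"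
| "iter_pderiv (i # is) f = pderiv_at i (iter_pderiv is f)"

definition test_function :: "(real^'n::finite \<Rightarrow> real) \<Rightarrow> bool" where
  "test_function \<phi> \<longleftrightarrow>
     (\<forall>is x. iter_pderiv is \<phi> differentiable (at x)) \<and> compact (closure {x. \<phi> x \<noteq> 0})"

definition locally_integrable :: "(real^'n::finite \<Rightarrow> real) \<Rightarrow> bool" where
  "locally_integrable f \<longleftrightarrow> (\<forall>K. compact K \<longrightarrow> set_integrable lebesgue K f)"

text \<open>Throughout, a function \<open>f\<close> stands for its class modulo equality almost everywhere.
  A multi-index is a function \<open>\<alpha> :: 'n \<Rightarrow> nat\<close>; the lists \<open>is\<close> with \<open>count_list is = \<alpha>\<close> are
  the orders in which the derivative of a test function of multi-index \<open>\<alpha>\<close> can be taken,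
  and they all give the same function.\<close>

definition mi_order :: "('n::finite \<Rightarrow> nat) \<Rightarrow> nat" where
  "mi_order \<alpha> = (\<Sum>i\<in>UNIV. \<alpha> i)"

definition mi_unit :: "'n \<Rightarrow> 'n::finite \<Rightarrow> nat" where
  "mi_unit i = (\<lambda>j. if j = i then 1 else 0)"

definition is_weak_deriv ::
  "('n \<Rightarrow> nat) \<Rightarrow> (real^'n::finite \<Rightarrow> real) \<Rightarrow> (real^'n \<Rightarrow> real) \<Rightarrow> bool" where
  "is_weak_deriv \<alpha> f g \<longleftrightarrow> locally_integrable f \<and> locally_integrable g \<and>
     (\<forall>\<phi> is. test_function \<phi> \<and> count_list is = \<alpha> \<longrightarrow>
        (LINT x|lebesgue. f x * iter_pderiv is \<phi> x)
          = (- 1) ^ mi_order \<alpha> * (LINT x|lebesgue. g x * \<phi> x))"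

definition weak_deriv :: "('n \<Rightarrow> nat) \<Rightarrow> (real^'n::finite \<Rightarrow> real) \<Rightarrow> real^'n \<Rightarrow> real" where
  "weak_deriv \<alpha> f = (SOME g. is_weak_deriv \<alpha> f g)"

definition weak_grad :: "(real^'n::finite \<Rightarrow> real) \<Rightarrow> real^'n \<Rightarrow> real^'n" where
  "weak_grad f x = (\<chi> i. weak_deriv (mi_unit i) f x)"

definition weak_laplacian :: "(real^'n::finite \<Rightarrow> real) \<Rightarrow> real^'n \<Rightarrow> real" where
  "weak_laplacian f x = (\<Sum>i\<in>UNIV. weak_deriv (\<lambda>j. 2 * mi_unit i j) f x)"

definition L2_space :: "(real^'n::finite \<Rightarrow> real) set" where
  "L2_space = {f. f \<in> borel_measurable lebesgue \<and> integrable lebesgue (\<lambda>x. (f x)\<^sup>2)}"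

definition sobolev :: "nat \<Rightarrow> (real^'n::finite \<Rightarrow> real) set" where
  "sobolev s = {f \<in> L2_space. \<forall>\<alpha>. mi_order \<alpha> \<le> s \<longrightarrow> (\<exists>g\<in>L2_space. is_weak_deriv \<alpha> f g)}"

definition sobolev_norm :: "nat \<Rightarrow> (real^'n::finite \<Rightarrow> real) \<Rightarrow> real" where
  "sobolev_norm s f = sqrt (\<Sum>\<alpha> | mi_order \<alpha> \<le> s. LINT x|lebesgue. (weak_deriv \<alpha> f x)\<^sup>2)"

text \<open>\<open>has_time_deriv s T u g t\<close>: at the time \<open>t\<close>, the curve \<open>u : [0,T] \<rightarrow> H\<^sup>s\<close> has the
  derivative \<open>g\<close> in the norm of \<open>H\<^sup>s\<close> (one-sided at \<open>0\<close> and \<open>T\<close>).\<close>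

definition has_time_deriv ::
  "nat \<Rightarrow> real \<Rightarrow> (real \<Rightarrow> real^'n::finite \<Rightarrow> real) \<Rightarrow> (real^'n \<Rightarrow> real) \<Rightarrow> real \<Rightarrow> bool" where
  "has_time_deriv s T u g t \<longleftrightarrow> (\<forall>\<tau>\<in>{0..T}. u \<tau> \<in> sobolev s) \<and> g \<in> sobolev s \<and>
     ((\<lambda>\<tau>. sobolev_norm s (\<lambda>x. (u \<tau> x - u t x) / (\<tau> - t) - g x)) \<longlongrightarrow> 0) (at t within {0..T})"

definition continuous_in_sobolev ::
  "nat \<Rightarrow> real \<Rightarrow> (real \<Rightarrow> real^'n::finite \<Rightarrow> real) \<Rightarrow> bool" where
  "continuous_in_sobolev s T u \<longleftrightarrow> (\<forall>t\<in>{0..T}. u t \<in> sobolev s \<and>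
     ((\<lambda>\<tau>. sobolev_norm s (\<lambda>x. u \<tau> x - u t x)) \<longlongrightarrow> 0) (at t within {0..T}))"

text \<open>The space \<open>C\<^sup>r([0,T]; H\<^sup>s)\<close>; \<open>v j\<close> is the \<open>j\<close>-th derivative.\<close>

definition C_sobolev :: "nat \<Rightarrow> nat \<Rightarrow> real \<Rightarrow> (real \<Rightarrow> real^'n::finite \<Rightarrow> real) set" where
  "C_sobolev r s T = {u. \<exists>v. v 0 = u \<and> (\<forall>j\<le>r. continuous_in_sobolev s T (v j)) \<and>
     (\<forall>j<r. \<forall>t\<in>{0..T}. has_time_deriv s T (v j) (v (Suc j) t) t)}"

text \<open>The derivative in time is taken in \<open>H\<^sup>0 = L\<^sup>2\<close>; a derivative in the norm of some \<open>H\<^sup>s\<close> is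
  also one in \<open>L\<^sup>2\<close>, and the latter is unique up to equality almost everywhere if \<open>T > 0\<close>.\<close>

definition time_deriv ::
  "real \<Rightarrow> (real \<Rightarrow> real^'n::finite \<Rightarrow> real) \<Rightarrow> real \<Rightarrow> real^'n \<Rightarrow> real" where
  "time_deriv T u t = (SOME g. has_time_deriv 0 T u g t)"

definition Linf_norm :: "(real^'n::finite \<Rightarrow> 'b::real_normed_vector) \<Rightarrow> ereal" where
  "Linf_norm f = esssup lebesgue (\<lambda>x. ereal (norm (f x)))"

definition energy :: "real \<Rightarrow> nat \<Rightarrow> (real \<Rightarrow> real^'n::finite \<Rightarrow> real) \<Rightarrow> real \<Rightarrow> real" where
  "energy T k u t = (\<Sum>i\<in>UNIV. (sobolev_norm k (\<lambda>x. weak_grad (u t) x $ i))\<^sup>2)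
     + (\<Sum>i=1..k+1. (sobolev_norm (k + 1 - i) ((time_deriv T ^^ i) u t))\<^sup>2)"

definition kuznetsov_solution ::
  "real \<Rightarrow> real \<Rightarrow> real \<Rightarrow> real \<Rightarrow> real \<Rightarrow> (real^'n::finite \<Rightarrow> real) \<Rightarrow> (real^'n \<Rightarrow> real)
     \<Rightarrow> (real \<Rightarrow> real^'n \<Rightarrow> real) \<Rightarrow> bool" where
  "kuznetsov_solution T c \<alpha> \<beta> \<epsilon> u0 u1 u \<longleftrightarrow>
     (\<forall>t\<in>{0..T}. AE x in lebesgue.
        (time_deriv T ^^ 2) u t x - c\<^sup>2 * weak_laplacian (u t) x
          = \<alpha> * \<epsilon> * time_deriv T u t x * (time_deriv T ^^ 2) u t x
            + \<beta> * \<epsilon> * (weak_grad (u t) x \<bullet> weak_grad (time_deriv T u t) x)) \<and>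
     (AE x in lebesgue. u 0 x = u0 x) \<and> (AE x in lebesgue. time_deriv T u 0 x = u1 x)"

end

theory Submission
  imports Defs "HOL-Computational_Algebra.Polynomial"
begin

text \<open>For a space-time multi-index \<open>p\<close> of order at most \<open>m\<close>, the derivative \<open>z = \<partial>\<^sup>p u\<close> solves the
  linearized equation \<open>(1 - \<alpha> \<epsilon> u\<^sub>t) z\<^sub>t\<^sub>t - c\<^sup>2 \<Delta> z - \<beta> \<epsilon> \<nabla>u \<bullet> \<nabla>z\<^sub>t = F\<close>, where \<open>F\<close> is a sum of
  products of two derivatives of \<open>u\<close> of order at least 2 and of total order \<open>\<bar>p\<bar> + 3\<close>, with coefficients
  \<open>\<alpha> \<epsilon>\<close> and \<open>\<beta> \<epsilon>\<close>.
  Pairing with \<open>z\<^sub>t\<close> gives an identity for the energy \<open>\<integral> (1 - \<alpha> \<epsilon> u\<^sub>t) z\<^sub>t\<^sup>2 + c\<^sup>2 \<bar>\<nabla>z\<bar>\<^sup>2\<close>, which is equivalent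
  to \<open>\<integral> z\<^sub>t\<^sup>2 + \<bar>\<nabla>z\<bar>\<^sup>2\<close> because \<open>\<bar>\<alpha> \<epsilon> u\<^sub>t\<bar> \<le> 1/2\<close>. Its cubic right-hand side is bounded by the product estimate
  \<open>H\<^sup>r \<times> H\<^sup>s \<rightarrow> L\<^sup>2\<close> for \<open>r + s > n/2\<close>, spending the missing derivatives on a factor of low order, which then is
  controlled by \<open>E\<^sub>m\<^sub>-\<^sub>1\<^sup>1\<^sup>/\<^sup>2\<close>. When \<open>p\<close> has order \<open>m\<close>, the second derivatives of \<open>z\<close> are not in \<open>L\<^sup>2\<close>, and the identity is
  derived for difference quotients of derivatives of order \<open>m - 1\<close>. Finally the energies of all \<open>p\<close> are
  added with weights that produce the constant \<open>B\<close>.\<close>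

text \<open>The hypothesis on m says exactly n < 2 (m - 2): second derivatives, differentiated m - 2
  more times, have order m, so their sup norms are controlled by E_(m-1)^(1/2). The product estimate
  is obtained from averages over small cubes instead of Fourier transforms. Averages, products and
  difference quotients are all compatible with translations; for that reason spatial derivatives are
  taken in the strong sense, as derivatives of translates in L2. Time derivatives are given only up
  to order m, whereas E_m contains the one of order m + 1. That it exists and is continuous in L2
  has to be extracted from the equation, solved for its highest time derivative. A mixed derivative
  occurs in the energy of each of its predecessors, up to n + 1 times; with equal weights B would
  grow with n. Difference quotients in time look forward and need room before T, so the estimate is
  derived on [0, T) and reaches T by continuity.\<close>

section \<open>The Hilbert space of square integrable functions\<close>

text \<open>Here the representatives are Borel functions, not Lebesgue measurable ones as in \<open>L2_space\<close>:
  their composites with continuous maps such as \<open>(x, y) \<mapsto> x - y\<close> are again measurable.\<close>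

definition sqint :: "(real^'n::finite \<Rightarrow> real) \<Rightarrow> bool" where
  "sqint f \<longleftrightarrow> f \<in> borel_measurable borel \<and> integrable lborel (\<lambda>x. (f x)\<^sup>2)"

lemma sqint_measurable [measurable_dest]: "sqint f \<Longrightarrow> f \<in> borel_measurable borel"
  and sqint_integrable: "sqint f \<Longrightarrow> integrable lborel (\<lambda>x. (f x)\<^sup>2)"
  by (auto simp: sqint_def)

lemma sqint_mult_integrable:
  assumes "sqint f" "sqint g"
  shows "integrable lborel (\<lambda>x. f x * g x)"
proof (rule Bochner_Integration.integrable_bound)
  show "integrable lborel (\<lambda>x. (f x)\<^sup>2 + (g x)\<^sup>2)"
    using assms by (auto simp: sqint_def)
  show "(\<lambda>x. f x * g x) \<in> borel_measurable lborel"
    using assms by (auto simp: sqint_def)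
  show "AE x in lborel. norm (f x * g x) \<le> norm ((f x)\<^sup>2 + (g x)\<^sup>2)"
  proof (rule AE_I2)
    fix x
    have "0 \<le> (\<bar>f x\<bar> - \<bar>g x\<bar>)\<^sup>2" by simp
    hence "2 * \<bar>f x * g x\<bar> \<le> (f x)\<^sup>2 + (g x)\<^sup>2"
      by (simp add: power2_diff abs_mult)
    moreover have "0 \<le> \<bar>f x * g x\<bar>" by simp
    ultimately show "norm (f x * g x) \<le> norm ((f x)\<^sup>2 + (g x)\<^sup>2)" by simp
  qed
qed

lemma sqint_zero: "sqint (\<lambda>x. 0)"
  by (simp add: sqint_def)

lemma sqint_add:
  assumes "sqint f" "sqint g" shows "sqint (\<lambda>x. f x + g x)"
proof -
  have "integrable lborel (\<lambda>x. (f x)\<^sup>2 + (g x)\<^sup>2 + 2 * (f x * g x))"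
    using sqint_mult_integrable[OF assms] assms by (auto simp: sqint_def)
  thus ?thesis using assms by (auto simp: sqint_def power2_sum mult.assoc)
qed

lemma sqint_scale: assumes "sqint f" shows "sqint (\<lambda>x. c * f x)"
  using assms by (auto simp: sqint_def power_mult_distrib)

lemma sqint_uminus: assumes "sqint f" shows "sqint (\<lambda>x. - f x)"
  using assms by (auto simp: sqint_def)

lemma sqint_diff: assumes "sqint f" "sqint g" shows "sqint (\<lambda>x. f x - g x)"
  using sqint_add[OF assms(1) sqint_uminus[OF assms(2)]] by simp

lemma sqint_bound:
  assumes "sqint g" "f \<in> borel_measurable borel" "AE x in lborel. \<bar>f x\<bar> \<le> C * \<bar>g x\<bar>"
  shows "sqint f"
proof -
  have "integrable lborel (\<lambda>x. (f x)\<^sup>2)"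
  proof (rule Bochner_Integration.integrable_bound)
    show "integrable lborel (\<lambda>x. (C * g x)\<^sup>2)"
      using sqint_scale[OF assms(1), of C] by (auto simp: sqint_def)
    show "(\<lambda>x. (f x)\<^sup>2) \<in> borel_measurable lborel" using assms(2) by simp
    show "AE x in lborel. norm ((f x)\<^sup>2) \<le> norm ((C * g x)\<^sup>2)"
      using assms(3)
    proof eventually_elim
      case (elim x)
      have "C * \<bar>g x\<bar> \<le> \<bar>C * g x\<bar>" by (simp add: abs_mult mult_right_mono)
      hence "\<bar>f x\<bar> \<le> \<bar>C * g x\<bar>" using elim by linarith
      thus ?case by (simp add: abs_le_square_iff)
    qed
  qed
  thus ?thesis using assms(2) by (simp add: sqint_def)
qed

\<comment> \<open>As a type of class \<open>real_inner\<close>, the classes admit the library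
  calculus of limits and vector derivatives; a time dependent solution becomes a curve in this
  type.\<close>
quotient_type 'n l2 = "real^'n::finite \<Rightarrow> real" /
  partial: "\<lambda>f g. sqint f \<and> sqint g \<and> (AE x in lborel. f x = g x)"
proof (rule part_equivpI)
  show "\<exists>f::real^'n \<Rightarrow> real. sqint f \<and> sqint f \<and> (AE x in lborel. f x = f x)"
    using sqint_zero by (intro exI[of _ "\<lambda>x. 0"]) simp
  show "symp (\<lambda>f g::real^'n \<Rightarrow> real. sqint f \<and> sqint g \<and> (AE x in lborel. f x = g x))"
    by (rule sympI) (auto elim: eventually_mono)
  show "transp (\<lambda>f g::real^'n \<Rightarrow> real. sqint f \<and> sqint g \<and> (AE x in lborel. f x = g x))"
    by (rule transpI) (auto elim!: eventually_elim2)
qed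

lemma integral_mult_cong_AE:
  assumes "sqint f" "sqint f'" "sqint g" "sqint g'"
    "AE x in lborel. f x = f' x" "AE x in lborel. g x = g' x"
  shows "(LINT x|lborel. f x * g x) = (LINT x|lborel. f' x * g' x)"
  using assms by (intro integral_cong_AE) (auto simp: sqint_def elim: eventually_elim2)

instantiation l2 :: (finite) real_inner
begin

lift_definition zero_l2 :: "'a l2" is "\<lambda>x. 0" by (simp add: sqint_zero)
lift_definition plus_l2 :: "'a l2 \<Rightarrow> 'a l2 \<Rightarrow> 'a l2" is "\<lambda>f g x. f x + g x"
  by (auto intro: sqint_add elim!: eventually_elim2)
lift_definition minus_l2 :: "'a l2 \<Rightarrow> 'a l2 \<Rightarrow> 'a l2" is "\<lambda>f g x. f x - g x"
  by (auto intro: sqint_diff elim!: eventually_elim2)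
lift_definition uminus_l2 :: "'a l2 \<Rightarrow> 'a l2" is "\<lambda>f x. - f x"
  by (auto intro: sqint_uminus)
lift_definition scaleR_l2 :: "real \<Rightarrow> 'a l2 \<Rightarrow> 'a l2" is "\<lambda>c f x. c * f x"
  by (auto intro: sqint_scale elim!: eventually_mono)
lift_definition inner_l2 :: "'a l2 \<Rightarrow> 'a l2 \<Rightarrow> real" is "\<lambda>f g. LINT x|lborel. f x * g x"
  by (auto intro: integral_mult_cong_AE)
definition norm_l2 :: "'a l2 \<Rightarrow> real" where "norm_l2 f = sqrt (inner f f)"
definition dist_l2 :: "'a l2 \<Rightarrow> 'a l2 \<Rightarrow> real" where "dist_l2 f g = norm (f - g)"
definition sgn_l2 :: "'a l2 \<Rightarrow> 'a l2" where "sgn_l2 f = inverse (norm f) *\<^sub>R f"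
definition uniformity_l2 :: "('a l2 \<times> 'a l2) filter"
  where "uniformity_l2 = (INF e\<in>{0<..}. principal {(x, y). dist x y < e})"
definition open_l2 :: "'a l2 set \<Rightarrow> bool"
  where "open_l2 U = (\<forall>x\<in>U. \<forall>\<^sub>F (x', y) in uniformity. x' = x \<longrightarrow> y \<in> U)"

instance
proof
  fix f g h :: "'a l2" and a b :: real
  show "f + g + h = f + (g + h)"
    by transfer (auto simp: add.assoc intro!: sqint_add)
  show "f + g = g + f"
    by transfer (auto simp: add.commute intro!: sqint_add)
  show "0 + f = f" by transfer auto
  show "- f + f = 0" by transfer (auto simp: sqint_zero)
  show "f - g = f + - g"
    by transfer (auto intro!: sqint_add sqint_diff sqint_uminus intro: sqint_diff[unfolded diff_conv_add_uminus])
  show "a *\<^sub>R (f + g) = a *\<^sub>R f + a *\<^sub>R g"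
    by transfer (auto simp: algebra_simps intro!: sqint_add sqint_scale)
  show "(a + b) *\<^sub>R f = a *\<^sub>R f + b *\<^sub>R f"
  proof (transfer fixing: a b)
    fix f :: "real^'a \<Rightarrow> real" assume f: "sqint f \<and> sqint f \<and> (AE x in lborel. f x = f x)"
    have "sqint (\<lambda>x. (a + b) * f x)" "sqint (\<lambda>x. a * f x + b * f x)"
      using f by (auto intro!: sqint_add sqint_scale)
    thus "sqint (\<lambda>x. (a + b) * f x) \<and> sqint (\<lambda>x. a * f x + b * f x) \<and> (AE x in lborel. (a + b) * f x = a * f x + b * f x)"
      by (simp add: distrib_right)
  qed
  show "a *\<^sub>R b *\<^sub>R f = (a * b) *\<^sub>R f"
    by transfer (auto simp: mult.assoc intro!: sqint_scale)
  show "1 *\<^sub>R f = f" by transfer auto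
  show "dist f g = norm (f - g)" by (simp add: dist_l2_def)
  show "sgn f = inverse (norm f) *\<^sub>R f" by (simp add: sgn_l2_def)
  show "uniformity = (INF e\<in>{0<..}. principal {(x, y::'a l2). dist x y < e})"
    by (simp add: uniformity_l2_def)
  show "open U = (\<forall>x\<in>U. \<forall>\<^sub>F (x', y) in uniformity. x' = x \<longrightarrow> y \<in> U)" for U :: "'a l2 set"
    by (simp add: open_l2_def)
  show "inner f g = inner g f" by transfer (simp add: mult.commute)
  show "inner (f + g) h = inner f h + inner g h"
    by transfer (simp add: distrib_right sqint_mult_integrable)
  show "inner (a *\<^sub>R f) g = a * inner f g"
    by transfer (simp add: mult.assoc)
  show "0 \<le> inner f f" by transfer simp
  show "norm f = sqrt (inner f f)" by (simp add: norm_l2_def)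
  show "(inner f f = 0) = (f = 0)"
  proof (transfer)
    fix f :: "real^'a \<Rightarrow> real" assume f: "sqint f \<and> sqint f \<and> (AE x in lborel. f x = f x)"
    hence "((LINT x|lborel. f x * f x) = 0) = (AE x in lborel. f x * f x = 0)"
      by (intro integral_nonneg_eq_0_iff_AE) (auto intro: sqint_mult_integrable)
    also have "\<dots> = (AE x in lborel. f x = 0)" by simp
    finally show "((LINT x|lborel. f x * f x) = 0) = (sqint f \<and> sqint (\<lambda>x. 0) \<and> (AE x in lborel. f x = 0))"
      using f by (simp add: sqint_zero)
  qed
qed

end

lemma sqint_rep [simp]: "sqint (rep_l2 f)"
  using Quotient3_rep_reflp[OF Quotient3_l2, of f] by simp

lemma rep_measurable [measurable]: "rep_l2 f \<in> borel_measurable borel"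
  using sqint_rep sqint_measurable by blast

lemma abs_rep [simp]: "abs_l2 (rep_l2 f) = f"
  by (rule Quotient3_abs_rep[OF Quotient3_l2])

lemma abs_eq_iff:
  assumes "sqint f" "sqint g"
  shows "abs_l2 f = abs_l2 g \<longleftrightarrow> (AE x in lborel. f x = g x)"
  using Quotient3_rel[OF Quotient3_l2, of f g] assms by simp

lemma l2_eq_iff: "f = g \<longleftrightarrow> (AE x in lborel. rep_l2 f x = rep_l2 g x)"
  using abs_eq_iff[of "rep_l2 f" "rep_l2 g"] by simp

lemma rep_abs: "sqint f \<Longrightarrow> AE x in lborel. rep_l2 (abs_l2 f) x = f x"
  using abs_eq_iff[of "rep_l2 (abs_l2 f)" f] by simp

lemma rep_add: "AE x in lborel. rep_l2 (f + g) x = rep_l2 f x + rep_l2 g x"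
  using rep_abs[OF sqint_add[OF sqint_rep sqint_rep], of f g]
  by (simp add: plus_l2.abs_eq[symmetric])

lemma rep_diff: "AE x in lborel. rep_l2 (f - g) x = rep_l2 f x - rep_l2 g x"
  using rep_abs[OF sqint_diff[OF sqint_rep sqint_rep], of f g]
  by (simp add: minus_l2.abs_eq[symmetric])

lemma rep_scaleR: "AE x in lborel. rep_l2 (c *\<^sub>R f) x = c * rep_l2 f x"
  using rep_abs[OF sqint_scale[OF sqint_rep], of c f]
  by (simp add: scaleR_l2.abs_eq[symmetric])

lemma inner_rep: "inner f g = (LINT x|lborel. rep_l2 f x * rep_l2 g x)"
  using inner_l2.abs_eq[of "rep_l2 f" "rep_l2 g"] by simp

lemma inner_abs:
  assumes "sqint f" "sqint g"
  shows "inner (abs_l2 f) (abs_l2 g) = (LINT x|lborel. f x * g x)"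
  using assms inner_l2.abs_eq[of f g] by simp

lemma norm_rep: "(norm f)\<^sup>2 = (LINT x|lborel. (rep_l2 f x)\<^sup>2)"
  unfolding power2_norm_eq_inner inner_rep by (simp add: power2_eq_square)

lemma norm_abs: "sqint f \<Longrightarrow> (norm (abs_l2 f))\<^sup>2 = (LINT x|lborel. (f x)\<^sup>2)"
  unfolding power2_norm_eq_inner by (simp add: inner_abs power2_eq_square)

lemma abs_diff: "sqint f \<Longrightarrow> sqint g \<Longrightarrow> abs_l2 f - abs_l2 g = abs_l2 (\<lambda>x. f x - g x)"
  by (simp add: minus_l2.abs_eq)

lemma abs_add: "sqint f \<Longrightarrow> sqint g \<Longrightarrow> abs_l2 f + abs_l2 g = abs_l2 (\<lambda>x. f x + g x)"
  by (simp add: plus_l2.abs_eq)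

lemma abs_scaleR: "sqint f \<Longrightarrow> c *\<^sub>R abs_l2 f = abs_l2 (\<lambda>x. c * f x)"
  by (simp add: scaleR_l2.abs_eq)

lemma norm_l2_mono:
  assumes "AE x in lborel. \<bar>rep_l2 f x\<bar> \<le> C * \<bar>rep_l2 g x\<bar>" "0 \<le> C"
  shows "norm f \<le> C * norm g"
proof -
  have "(norm f)\<^sup>2 \<le> (C * norm g)\<^sup>2"
    unfolding power_mult_distrib norm_rep integral_mult_right_zero[symmetric]
  proof (rule integral_mono_AE)
    show "AE x in lborel. (rep_l2 f x)\<^sup>2 \<le> C\<^sup>2 * (rep_l2 g x)\<^sup>2"
      using assms(1)
    proof eventually_elim
      case (elim x)
      hence "\<bar>rep_l2 f x\<bar>\<^sup>2 \<le> (C * \<bar>rep_l2 g x\<bar>)\<^sup>2" by (intro power_mono) auto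
      thus ?case by (simp add: power_mult_distrib)
    qed
  qed (auto intro: sqint_integrable)
  thus ?thesis using assms(2) by (simp add: abs_le_square_iff[symmetric])
qed

lemma tendsto_abs_dominated:
  fixes f :: "real^'n::finite \<Rightarrow> real"
  assumes s: "\<And>i. s i \<in> borel_measurable borel" and f: "f \<in> borel_measurable borel" and w: "sqint w"
    and lim: "AE x in lborel. (\<lambda>i. s i x) \<longlonglongrightarrow> f x"
    and bound: "\<And>i. AE x in lborel. \<bar>s i x\<bar> \<le> \<bar>w x\<bar>"
  shows "sqint f" "\<And>i. sqint (s i)" "(\<lambda>i. abs_l2 (s i)) \<longlonglongrightarrow> abs_l2 f"
proof -
  have "AE x in lborel. \<forall>i. \<bar>s i x\<bar> \<le> \<bar>w x\<bar>"
    using bound by (simp add: AE_all_countable)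
  with lim have fb: "AE x in lborel. \<bar>f x\<bar> \<le> \<bar>w x\<bar>"
  proof eventually_elim
    case (elim x)
    thus ?case
      by (intro LIMSEQ_le_const2[OF tendsto_rabs[OF elim(1)]]) auto
  qed
  show sf: "sqint f" using sqint_bound[OF w f, of 1] fb by simp
  show ss: "\<And>i. sqint (s i)" using sqint_bound[OF w s, of _ 1] bound by simp
  have "(\<lambda>i. LINT x|lborel. (s i x - f x)\<^sup>2) \<longlonglongrightarrow> (LINT x|(lborel::(real^'n) measure). (0::real))"
  \<comment> \<open>Both \<open>s i\<close> and its limit are bounded by |w|, so their difference is
    bounded by 2 |w|.\<close>
  proof (rule integral_dominated_convergence[where w = "\<lambda>x. 4 * (w x)\<^sup>2"])
    show "integrable lborel (\<lambda>x. 4 * (w x)\<^sup>2)" using w by (auto simp: sqint_def)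
    show "AE x in lborel. (\<lambda>i. (s i x - f x)\<^sup>2) \<longlonglongrightarrow> 0"
      using lim
    proof eventually_elim
      case (elim x)
      from tendsto_power[OF tendsto_diff[OF elim tendsto_const[of "f x"]], of 2] show ?case by simp
    qed
    show "AE x in lborel. norm ((s i x - f x)\<^sup>2) \<le> 4 * (w x)\<^sup>2" for i
      using bound[of i] fb
    proof eventually_elim
      case (elim x)
      hence "\<bar>s i x - f x\<bar> \<le> 2 * \<bar>w x\<bar>" by linarith
      from power_mono[OF this, of 2] show ?case by (simp add: power_mult_distrib)
    qed
  qed (use s f in auto)
  hence "(\<lambda>i. (norm (abs_l2 (s i) - abs_l2 f))\<^sup>2) \<longlonglongrightarrow> 0"
    using ss sf by (simp add: abs_diff norm_abs sqint_diff)
  hence "(\<lambda>i. sqrt ((norm (abs_l2 (s i) - abs_l2 f))\<^sup>2)) \<longlonglongrightarrow> sqrt 0" by (rule tendsto_real_sqrt)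
  hence "(\<lambda>i. norm (abs_l2 (s i) - abs_l2 f)) \<longlonglongrightarrow> 0" by simp
  thus "(\<lambda>i. abs_l2 (s i)) \<longlonglongrightarrow> abs_l2 f" by (rule LIM_zero_cancel[OF tendsto_norm_zero_cancel])
qed

section \<open>Pointwise products of classes\<close>

text \<open>\<open>pmult f g\<close> is the pointwise product; it is only meaningful under \<open>pmult_ok f g\<close>, i.e. when
  the product is square integrable.\<close>

definition pmult_ok :: "'n::finite l2 \<Rightarrow> 'n l2 \<Rightarrow> bool" where
  "pmult_ok f g \<longleftrightarrow> sqint (\<lambda>x. rep_l2 f x * rep_l2 g x)"

definition pmult :: "'n::finite l2 \<Rightarrow> 'n l2 \<Rightarrow> 'n l2" where
  "pmult f g = abs_l2 (\<lambda>x. rep_l2 f x * rep_l2 g x)"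

definition bounded_by :: "real \<Rightarrow> 'n::finite l2 \<Rightarrow> bool" where
  "bounded_by M f \<longleftrightarrow> (AE x in lborel. \<bar>rep_l2 f x\<bar> \<le> M)"

lemma rep_pmult: "pmult_ok f g \<Longrightarrow> AE x in lborel. rep_l2 (pmult f g) x = rep_l2 f x * rep_l2 g x"
  unfolding pmult_ok_def pmult_def by (rule rep_abs)

lemma pmult_okI:
  assumes "sqint h" "AE x in lborel. rep_l2 f x * rep_l2 g x = h x"
  shows "pmult_ok f g"
  unfolding pmult_ok_def
  by (rule sqint_bound[OF assms(1), where C = 1]) (use assms(2) in auto)

lemma pmult_eqI:
  assumes "AE x in lborel. rep_l2 f x * rep_l2 g x = rep_l2 h x"
  shows "pmult f g = h"
proof -
  have "pmult_ok f g" using assms by (intro pmult_okI[of "rep_l2 h"]) auto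
  from rep_pmult[OF this] assms show ?thesis
    unfolding l2_eq_iff by eventually_elim simp
qed

lemma pmult_ok_commute: "pmult_ok f g \<longleftrightarrow> pmult_ok g f"
  by (simp add: pmult_ok_def mult.commute)

lemma pmult_commute: "pmult f g = pmult g f"
  by (simp add: pmult_def mult.commute)

lemma pmult_ok_add:
  assumes "pmult_ok f h" "pmult_ok g h"
  shows "pmult_ok (f + g) h"
  using assms rep_add[of f g] unfolding pmult_ok_def
  by (intro pmult_okI[OF sqint_add[OF assms[unfolded pmult_ok_def]], unfolded pmult_ok_def])
     (auto elim!: eventually_mono simp: algebra_simps)

lemma pmult_ok_scaleR:
  assumes "pmult_ok f h"
  shows "pmult_ok (c *\<^sub>R f) h"
  using assms rep_scaleR[of c f] unfolding pmult_ok_def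
  by (intro pmult_okI[OF sqint_scale[OF assms[unfolded pmult_ok_def]], unfolded pmult_ok_def])
     (auto elim!: eventually_mono simp: algebra_simps)

lemma pmult_ok_diff:
  assumes "pmult_ok f h" "pmult_ok g h"
  shows "pmult_ok (f - g) h"
  using pmult_ok_add[OF assms(1) pmult_ok_scaleR[OF assms(2), of "-1"]] by simp

lemma pmult_add_left:
  assumes "pmult_ok f h" "pmult_ok g h"
  shows "pmult (f + g) h = pmult f h + pmult g h"
  by (rule pmult_eqI)
     (use rep_add[of f g] rep_add[of "pmult f h" "pmult g h"] rep_pmult[OF assms(1)] rep_pmult[OF assms(2)]
      in eventually_elim, simp add: algebra_simps)

lemma pmult_scaleR_left:
  assumes "pmult_ok f h"
  shows "pmult (c *\<^sub>R f) h = c *\<^sub>R pmult f h"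
  by (rule pmult_eqI)
     (use rep_scaleR[of c f] rep_scaleR[of c "pmult f h"] rep_pmult[OF assms(1)]
      in eventually_elim, simp add: algebra_simps)

lemma pmult_diff_left:
  assumes "pmult_ok f h" "pmult_ok g h"
  shows "pmult (f - g) h = pmult f h - pmult g h"
  using pmult_add_left[OF assms(1) pmult_ok_scaleR[OF assms(2), of "-1"]]
    pmult_scaleR_left[OF assms(2), of "-1"] by simp

lemma pmult_diff_right:
  "pmult_ok h f \<Longrightarrow> pmult_ok h g \<Longrightarrow> pmult h (f - g) = pmult h f - pmult h g"
  by (metis pmult_diff_left pmult_commute pmult_ok_commute)

lemma pmult_scaleR_right:
  "pmult_ok h f \<Longrightarrow> pmult h (c *\<^sub>R f) = c *\<^sub>R pmult h f"
  by (metis pmult_scaleR_left pmult_commute pmult_ok_commute)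

lemma inner_pmult_swap:
  assumes "pmult_ok f g" "pmult_ok f h"
  shows "inner (pmult f g) h = inner g (pmult f h)"
  unfolding inner_rep
proof (rule integral_cong_AE)
  show "AE x in lborel. rep_l2 (pmult f g) x * rep_l2 h x = rep_l2 g x * rep_l2 (pmult f h) x"
    using rep_pmult[OF assms(1)] rep_pmult[OF assms(2)] by eventually_elim simp
qed auto

lemma bounded_by_pmult:
  assumes "bounded_by M f" "0 \<le> M"
  shows "pmult_ok f g" "norm (pmult f g) \<le> M * norm g"
proof -
  have "AE x in lborel. \<bar>rep_l2 f x * rep_l2 g x\<bar> \<le> M * \<bar>rep_l2 g x\<bar>"
    using assms(1) unfolding bounded_by_def
    by eventually_elim (auto simp: abs_mult intro: mult_right_mono)
  thus ok: "pmult_ok f g"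
    unfolding pmult_ok_def by (intro sqint_bound[OF sqint_rep[of g]]) auto
  show "norm (pmult f g) \<le> M * norm g"
  proof (rule norm_l2_mono[OF _ assms(2)])
    show "AE x in lborel. \<bar>rep_l2 (pmult f g) x\<bar> \<le> M * \<bar>rep_l2 g x\<bar>"
      using rep_pmult[OF ok] assms(1) unfolding bounded_by_def
      by eventually_elim (auto simp: abs_mult intro: mult_right_mono)
  qed
qed

lemma bounded_by_add:
  assumes "bounded_by M f" "bounded_by N g" shows "bounded_by (M + N) (f + g)"
  using assms rep_add[of f g] unfolding bounded_by_def by eventually_elim auto

text \<open>Norm convergence gives convergence almost everywhere along a subsequence, and Fatou's
  lemma then carries the bound to the product of the limits. In this way estimates for bounded
  approximants extend to their limits without any convergence of the products being known.\<close>

lemma pmult_limit_bound: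
  fixes F G :: "nat \<Rightarrow> 'n::finite l2"
  assumes F: "F \<longlonglongrightarrow> f" and G: "G \<longlonglongrightarrow> g"
    and ok: "\<And>k. pmult_ok (F k) (G k)" and le: "\<And>k. norm (pmult (F k) (G k)) \<le> C"
  shows "pmult_ok f g" "norm (pmult f g) \<le> C"
proof -
  have C0: "0 \<le> C" using le[of 0] norm_ge_zero order_trans by blast
  have sub: "\<exists>r. strict_mono r \<and> (AE x in lborel. (\<lambda>k. rep_l2 (H (r k)) x) \<longlonglongrightarrow> rep_l2 h x)"
    if H: "H \<longlonglongrightarrow> h" for H :: "nat \<Rightarrow> 'n l2" and h
  proof -
    have "\<exists>r::nat\<Rightarrow>nat. strict_mono r \<and> (AE x in lborel. (\<lambda>k. (rep_l2 (H (r k) - h) x)\<^sup>2) \<longlonglongrightarrow> 0)"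
    proof (rule tendsto_L1_AE_subseq)
      have "(\<lambda>k. norm (H k - h)) \<longlonglongrightarrow> 0" using H by (simp add: tendsto_norm_zero LIM_zero)
      hence "(\<lambda>k. (norm (H k - h))\<^sup>2) \<longlonglongrightarrow> 0" by (auto intro: tendsto_eq_intros)
      thus "(\<lambda>k. LINT x|lborel. norm ((rep_l2 (H k - h) x)\<^sup>2)) \<longlonglongrightarrow> 0"
        by (simp add: norm_rep)
    qed (auto intro: sqint_integrable)
    then obtain r where r: "strict_mono r" "AE x in lborel. (\<lambda>k. (rep_l2 (H (r k) - h) x)\<^sup>2) \<longlonglongrightarrow> 0" by blast
    have "AE x in lborel. \<forall>k. rep_l2 (H k - h) x = rep_l2 (H k) x - rep_l2 h x"
      unfolding AE_all_countable using rep_diff by blast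
    with r(2) have "AE x in lborel. (\<lambda>k. rep_l2 (H (r k)) x) \<longlonglongrightarrow> rep_l2 h x"
    proof eventually_elim
      case (elim x)
      hence "(\<lambda>k. sqrt ((rep_l2 (H (r k)) x - rep_l2 h x)\<^sup>2)) \<longlonglongrightarrow> sqrt 0"
        by (intro tendsto_real_sqrt) simp
      hence "(\<lambda>k. \<bar>rep_l2 (H (r k)) x - rep_l2 h x\<bar>) \<longlonglongrightarrow> 0" by simp
      thus ?case by (simp add: LIM_zero_cancel tendsto_rabs_zero_iff)
    qed
    thus ?thesis using r(1) by blast
  qed
  obtain r where r: "strict_mono r" "AE x in lborel. (\<lambda>k. rep_l2 (F (r k)) x) \<longlonglongrightarrow> rep_l2 f x"
    using sub[OF F] by blast
  \<comment> \<open>The second subsequence is taken inside the first, so that both factors converge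
    almost everywhere along it.\<close>
  have "(\<lambda>k. G (r k)) \<longlonglongrightarrow> g" using LIMSEQ_subseq_LIMSEQ[OF G r(1)] by (simp add: o_def)
  from sub[OF this] obtain q where q: "strict_mono q" "AE x in lborel. (\<lambda>k. rep_l2 (G (r (q k))) x) \<longlonglongrightarrow> rep_l2 g x"
    by blast
  define s where "s k = r (q k)" for k
  have lim: "AE x in lborel. (\<lambda>k. rep_l2 (F (s k)) x * rep_l2 (G (s k)) x) \<longlonglongrightarrow> rep_l2 f x * rep_l2 g x"
    using r(2) q(2)
  proof eventually_elim
    case (elim x)
    from LIMSEQ_subseq_LIMSEQ[OF elim(1) q(1)] elim(2) show ?case
      by (auto simp: o_def s_def intro: tendsto_mult)
  qed
  let ?p = "\<lambda>k x. rep_l2 (F (s k)) x * rep_l2 (G (s k)) x"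
  have "(\<integral>\<^sup>+x. ennreal ((rep_l2 f x * rep_l2 g x)\<^sup>2) \<partial>lborel) \<le> (\<integral>\<^sup>+x. liminf (\<lambda>k. ennreal ((?p k x)\<^sup>2)) \<partial>lborel)"
  proof (rule nn_integral_mono_AE)
    show "AE x in lborel. ennreal ((rep_l2 f x * rep_l2 g x)\<^sup>2) \<le> liminf (\<lambda>k. ennreal ((?p k x)\<^sup>2))"
      using lim
    proof eventually_elim
      case (elim x)
      have "(\<lambda>k. ennreal ((?p k x)\<^sup>2)) \<longlonglongrightarrow> ennreal ((rep_l2 f x * rep_l2 g x)\<^sup>2)"
        by (intro tendsto_ennrealI tendsto_power elim)
      from lim_imp_Liminf[OF _ this] show ?case by simp
    qed
  qed
  also have "\<dots> \<le> liminf (\<lambda>k. \<integral>\<^sup>+x. ennreal ((?p k x)\<^sup>2) \<partial>lborel)"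
    by (rule nn_integral_liminf) measurable
  also have "\<dots> \<le> ennreal (C\<^sup>2)"
  proof -
    have "(\<integral>\<^sup>+x. ennreal ((?p k x)\<^sup>2) \<partial>lborel) \<le> ennreal (C\<^sup>2)" for k
    proof -
      have "sqint (?p k)" using ok[of "s k"] by (simp add: pmult_ok_def)
      hence "(\<integral>\<^sup>+x. ennreal ((?p k x)\<^sup>2) \<partial>lborel) = ennreal (LINT x|lborel. (?p k x)\<^sup>2)"
        by (intro nn_integral_eq_integral) (auto intro: sqint_integrable)
      also have "(LINT x|lborel. (?p k x)\<^sup>2) = (norm (pmult (F (s k)) (G (s k))))\<^sup>2"
        using \<open>sqint (?p k)\<close> by (simp add: pmult_def norm_abs)
      also have "\<dots> \<le> C\<^sup>2" using le[of "s k"] by (intro power_mono) auto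
      finally show ?thesis by (simp add: ennreal_leI)
    qed
    hence "liminf (\<lambda>k. \<integral>\<^sup>+x. ennreal ((?p k x)\<^sup>2) \<partial>lborel) \<le> liminf (\<lambda>k. ennreal (C\<^sup>2))"
      by (intro Liminf_mono) auto
    thus ?thesis by (simp add: Liminf_const)
  qed
  finally have nn: "(\<integral>\<^sup>+x. ennreal ((rep_l2 f x * rep_l2 g x)\<^sup>2) \<partial>lborel) \<le> ennreal (C\<^sup>2)" .
  have int: "integrable lborel (\<lambda>x. (rep_l2 f x * rep_l2 g x)\<^sup>2)"
  proof (rule integrableI_nonneg)
    show "(\<integral>\<^sup>+x. ennreal ((rep_l2 f x * rep_l2 g x)\<^sup>2) \<partial>lborel) < \<infinity>"
      using nn ennreal_less_top le_less_trans by (metis infinity_ennreal_def)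
  qed auto
  thus ok': "pmult_ok f g" by (simp add: pmult_ok_def sqint_def)
  have "ennreal ((norm (pmult f g))\<^sup>2) = (\<integral>\<^sup>+x. ennreal ((rep_l2 f x * rep_l2 g x)\<^sup>2) \<partial>lborel)"
    using ok' int unfolding pmult_ok_def pmult_def
    by (simp add: norm_abs nn_integral_eq_integral)
  with nn have "ennreal ((norm (pmult f g))\<^sup>2) \<le> ennreal (C\<^sup>2)" by simp
  hence "(norm (pmult f g))\<^sup>2 \<le> C\<^sup>2" by (subst (asm) ennreal_le_iff) auto
  thus "norm (pmult f g) \<le> C" using C0 by (simp add: abs_le_square_iff[symmetric])
qed

section \<open>Test functions\<close>

definition smooth_fun :: "(real^'n::finite \<Rightarrow> real) \<Rightarrow> bool" where
  "smooth_fun f \<longleftrightarrow> (\<forall>is x. iter_pderiv is f differentiable (at x))"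

lemma pderiv_at_eq:
  assumes "(f has_derivative f') (at x)" shows "pderiv_at i f x = f' (axis i 1)"
  unfolding pderiv_at_def using frechet_derivative_at[OF assms] by simp

lemma iter_pderiv_append: "iter_pderiv (is @ js) f = iter_pderiv is (iter_pderiv js f)"
  by (induction "is") auto

lemma smooth_fun_iter: "smooth_fun f \<Longrightarrow> smooth_fun (iter_pderiv js f)"
  unfolding smooth_fun_def by (metis iter_pderiv_append)

lemma smooth_fun_pderiv: "smooth_fun f \<Longrightarrow> smooth_fun (pderiv_at i f)"
  using smooth_fun_iter[of f "[i]"] by simp

lemma smooth_fun_differentiable: "smooth_fun f \<Longrightarrow> f differentiable (at x)"
  unfolding smooth_fun_def by (metis iter_pderiv.simps(1))

lemma smooth_fun_continuous: "smooth_fun f \<Longrightarrow> continuous_on UNIV f"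
  by (intro continuous_at_imp_continuous_on ballI differentiable_imp_continuous_within smooth_fun_differentiable)

lemma smooth_fun_measurable: "smooth_fun f \<Longrightarrow> f \<in> borel_measurable borel"
  by (intro borel_measurable_continuous_onI smooth_fun_continuous)

lemma has_derivative_frechet:
  assumes "smooth_fun f" shows "(f has_derivative frechet_derivative f (at x)) (at x)"
  using smooth_fun_differentiable[OF assms] frechet_derivative_works by blast

lemma pderiv_at_add:
  assumes "f differentiable (at x)" "g differentiable (at x)"
  shows "pderiv_at i (\<lambda>x. f x + g x) x = pderiv_at i f x + pderiv_at i g x"
  using pderiv_at_eq[OF has_derivative_add[OF assms[unfolded frechet_derivative_works]], of i]
  by (simp add: pderiv_at_def)

lemma pderiv_at_mult:
  assumes "f differentiable (at x)" "g differentiable (at x)"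
  shows "pderiv_at i (\<lambda>x. f x * g x) x = pderiv_at i f x * g x + f x * pderiv_at i g x"
  using pderiv_at_eq[OF has_derivative_mult[OF assms[unfolded frechet_derivative_works]], of i]
  by (simp add: pderiv_at_def)

text \<open>Differentiability is required only up to the order \<open>length is\<close>, because in
  the induction for \<open>smooth_fun_mult\<close> it is known for the two products only up to that
  order.\<close>

lemma iter_pderiv_add:
  assumes "\<And>js x. length js \<le> length is \<Longrightarrow> iter_pderiv js f differentiable (at x)"
    and "\<And>js x. length js \<le> length is \<Longrightarrow> iter_pderiv js g differentiable (at x)"
  shows "iter_pderiv is (\<lambda>x. f x + g x) = (\<lambda>x. iter_pderiv is f x + iter_pderiv is g x)"
  using assms
proof (induction "is")
  case (Cons i "is")
  have "iter_pderiv is (\<lambda>x. f x + g x) = (\<lambda>x. iter_pderiv is f x + iter_pderiv is g x)"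
    using Cons.prems by (intro Cons.IH) auto
  moreover have "pderiv_at i (\<lambda>x. iter_pderiv is f x + iter_pderiv is g x) x
      = pderiv_at i (iter_pderiv is f) x + pderiv_at i (iter_pderiv is g) x" for x
    using Cons.prems by (intro pderiv_at_add) auto
  hence "pderiv_at i (\<lambda>x. iter_pderiv is f x + iter_pderiv is g x)
      = (\<lambda>x. pderiv_at i (iter_pderiv is f) x + pderiv_at i (iter_pderiv is g) x)" by (rule ext)
  ultimately show ?case by (simp only: iter_pderiv.simps)
qed simp

lemma smooth_fun_const: "smooth_fun (\<lambda>x::real^'n::finite. c)"
proof -
  have *: "\<exists>d. iter_pderiv is (\<lambda>x::real^'n. c) = (\<lambda>x. d)" for "is"
  proof (induction "is")
    case (Cons i "is")
    then obtain d where "iter_pderiv is (\<lambda>x::real^'n. c) = (\<lambda>x. d)" by blast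
    moreover have "pderiv_at i (\<lambda>x::real^'n. d) = (\<lambda>x. 0)"
      by (rule ext) (rule pderiv_at_eq[OF has_derivative_const[of d]])
    ultimately show ?case by auto
  qed auto
  show ?thesis unfolding smooth_fun_def
  proof (intro allI)
    fix "is" and x :: "real^'n"
    from *[of "is"] obtain d where "iter_pderiv is (\<lambda>x::real^'n. c) = (\<lambda>x. d)" ..
    thus "iter_pderiv is (\<lambda>x. c) differentiable (at x)" by simp
  qed
qed

text \<open>The innermost derivative is split off by the product rule. What remains is a shorter
  list of derivatives of a sum of two products of smooth functions, and the induction hypothesis
  applies to each of them.\<close>

lemma smooth_fun_mult:
  assumes "smooth_fun f" "smooth_fun g"
  shows "smooth_fun (\<lambda>x. f x * g x)"
proof -
  have "\<forall>x. iter_pderiv is (\<lambda>x. f x * g x) differentiable (at x)" for "is"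
    using assms
  proof (induction "length is" arbitrary: f g "is" rule: less_induct)
    case less
    show ?case
    proof (cases "is" rule: rev_cases)
      case Nil
      thus ?thesis using less.prems smooth_fun_differentiable by (auto intro!: differentiable_mult)
    next
      case (snoc js i)
      let ?a = "\<lambda>x. pderiv_at i f x * g x" and ?b = "\<lambda>x. f x * pderiv_at i g x"
      have "pderiv_at i (\<lambda>x. f x * g x) = (\<lambda>x. ?a x + ?b x)"
        using less.prems by (auto simp: fun_eq_iff intro!: pderiv_at_mult smooth_fun_differentiable)
      hence eq: "iter_pderiv is (\<lambda>x. f x * g x) = iter_pderiv js (\<lambda>x. ?a x + ?b x)"
        by (simp add: snoc iter_pderiv_append)
      have a: "iter_pderiv ks ?a differentiable (at x)" "iter_pderiv ks ?b differentiable (at x)"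
        if "length ks \<le> length js" for ks x
        using that less.prems less.hyps[of ks] by (auto simp: snoc smooth_fun_pderiv)
      hence "iter_pderiv js (\<lambda>x. ?a x + ?b x) = (\<lambda>x. iter_pderiv js ?a x + iter_pderiv js ?b x)"
        by (intro iter_pderiv_add) auto
      thus ?thesis using a eq by (auto intro!: differentiable_add)
    qed
  qed
  thus ?thesis by (simp add: smooth_fun_def)
qed

lemma smooth_fun_add: "smooth_fun f \<Longrightarrow> smooth_fun g \<Longrightarrow> smooth_fun (\<lambda>x. f x + g x)"
  unfolding smooth_fun_def
  by (intro allI, subst iter_pderiv_add) (auto intro!: differentiable_add)

lemma smooth_fun_prod:
  assumes "\<And>i. i \<in> I \<Longrightarrow> smooth_fun (f i)"
  shows "smooth_fun (\<lambda>x. \<Prod>i\<in>I. f i x)"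
  using assms
  by (induction I rule: infinite_finite_induct) (auto intro: smooth_fun_const smooth_fun_mult)

lemma pderiv_at_shift:
  assumes "h differentiable (at (x + y))"
  shows "pderiv_at i (\<lambda>x. h (x + y)) x = pderiv_at i h (x + y)"
proof -
  have h: "(h has_derivative frechet_derivative h (at (x + y))) (at (x + y))"
    using assms frechet_derivative_works by blast
  have "((\<lambda>x. x + y) has_derivative (\<lambda>v. v)) (at x)" by (auto intro!: derivative_eq_intros)
  from pderiv_at_eq[OF has_derivative_compose[OF this h]] show ?thesis by (simp add: pderiv_at_def)
qed

lemma iter_pderiv_shift:
  assumes "smooth_fun f"
  shows "iter_pderiv is (\<lambda>x. f (x + y)) = (\<lambda>x. iter_pderiv is f (x + y))"
proof (induction "is")
  case (Cons i "is")
  have "pderiv_at i (\<lambda>x. iter_pderiv is f (x + y)) x = pderiv_at i (iter_pderiv is f) (x + y)" for x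
    by (intro pderiv_at_shift smooth_fun_differentiable smooth_fun_iter assms)
  thus ?case by (simp add: Cons)
qed simp

lemma smooth_fun_shift:
  assumes "smooth_fun f" shows "smooth_fun (\<lambda>x. f (x + y))"
  unfolding smooth_fun_def
proof (intro allI)
  fix "is" x
  have h: "(iter_pderiv is f has_derivative frechet_derivative (iter_pderiv is f) (at (x + y))) (at (x + y))"
    using has_derivative_frechet[OF smooth_fun_iter[OF assms]] .
  have "((\<lambda>x. x + y) has_derivative (\<lambda>v. v)) (at x)" by (auto intro!: derivative_eq_intros)
  from has_derivative_compose[OF this h] show "iter_pderiv is (\<lambda>x. f (x + y)) differentiable (at x)"
    by (auto simp: iter_pderiv_shift[OF assms] differentiable_def)
qed

section \<open>Flat functions and cutoffs of boxes\<close>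

text \<open>The family over all polynomials \<open>p\<close> is closed under derivatives.\<close>

definition flat :: "real poly \<Rightarrow> real \<Rightarrow> real" where
  "flat p t = (if 0 < t then poly p (1 / t) * exp (- 1 / t) else 0)"

text \<open>With s = 1/t, the derivative of p(s) exp(-s) with respect to t is s^2 (p(s) - p'(s))
  exp(-s).\<close>

definition flat_deriv :: "real poly \<Rightarrow> real poly" where
  "flat_deriv p = [:0, 0, 1:] * (p - pderiv p)"

lemma poly_exp_at_top: "((\<lambda>s. s ^ k * poly p s * exp (- s)) \<longlongrightarrow> (0::real)) at_top"
proof (induction p arbitrary: k)
  case (pCons a p)
  have "((\<lambda>s. a * (s ^ k / exp s) + s ^ Suc k * poly p s * exp (- s)) \<longlongrightarrow> a * 0 + 0) at_top"
    by (intro tendsto_intros tendsto_power_div_exp_0 pCons.IH)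
  thus ?case by (simp add: algebra_simps exp_minus divide_inverse)
qed simp

lemma DERIV_flat: "(flat p has_field_derivative flat (flat_deriv p) t) (at t)"
proof -
  consider "0 < t" | "t < 0" | "t = 0" by linarith
  thus ?thesis
  proof cases
    case 1
    have "((\<lambda>t. poly p (1 / t) * exp (- 1 / t)) has_field_derivative
        poly (pderiv p) (1 / t) * (- (1 / t\<^sup>2)) * exp (- 1 / t) + poly p (1 / t) * (exp (- 1 / t) * (1 / t\<^sup>2))) (at t)"
      using 1 by (auto intro!: derivative_eq_intros poly_DERIV simp: power2_eq_square divide_simps)
    also have "poly (pderiv p) (1 / t) * (- (1 / t\<^sup>2)) * exp (- 1 / t) + poly p (1 / t) * (exp (- 1 / t) * (1 / t\<^sup>2))
        = flat (flat_deriv p) t"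
      using 1 by (simp add: flat_def flat_deriv_def power2_eq_square field_simps)
    finally show ?thesis
      by (rule has_field_derivative_transform_within_open[where S = "{0<..}"]) (use 1 in \<open>auto simp: flat_def\<close>)
  next
    case 2
    have "((\<lambda>t. 0) has_field_derivative flat (flat_deriv p) t) (at t)"
      using 2 by (simp add: flat_def)
    thus ?thesis
      by (rule has_field_derivative_transform_within_open[where S = "{..<0}"]) (use 2 in \<open>auto simp: flat_def\<close>)
  next
    case 3
    have "((\<lambda>h. flat p h / h) \<longlongrightarrow> 0) (at 0)"
      unfolding filterlim_at_split
    proof
      show "((\<lambda>h. flat p h / h) \<longlongrightarrow> 0) (at_left 0)"
        by (rule tendsto_eventually) (auto simp: flat_def eventually_at_left_real intro!: eventually_at_leftI[of "-1"])
      \<comment> \<open>The substitution s = 1/h turns the difference quotient at 0 into s p(s)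
        exp(-s) with s tending to infinity.\<close>
      have "((\<lambda>h. (1 / h) ^ 1 * poly p (1 / h) * exp (- (1 / h))) \<longlongrightarrow> 0) (at_right 0)"
        using filterlim_compose[OF poly_exp_at_top[of 1 p] filterlim_inverse_at_top_right]
        by (simp add: inverse_eq_divide)
      moreover have "\<forall>\<^sub>F h in at_right 0. (1 / h) ^ 1 * poly p (1 / h) * exp (- (1 / h)) = flat p h / h"
        by (rule eventually_at_rightI[of 0 1]) (auto simp: flat_def)
      ultimately show "((\<lambda>h. flat p h / h) \<longlongrightarrow> 0) (at_right 0)"
        by (rule Lim_transform_eventually)
    qed
    thus ?thesis using 3 by (simp add: DERIV_def flat_def)
  qed
qed

lemma smooth_fun_flat: "smooth_fun (\<lambda>x::real^'n::finite. flat p (c * x $ i + d))"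
proof -
  have 1: "((\<lambda>x::real^'n. flat p (c * x $ i + d)) has_derivative (\<lambda>v. c * v $ i * flat (flat_deriv p) (c * x $ i + d))) (at x)" for p x
  proof -
    have "((\<lambda>x::real^'n. c * x $ i + d) has_derivative (\<lambda>v. c * v $ i)) (at x)"
      by (auto intro!: derivative_eq_intros bounded_linear.has_derivative[OF bounded_linear_vec_nth])
    from has_derivative_compose[OF this DERIV_flat[of p "c * x $ i + d", unfolded has_field_derivative_def]]
    show ?thesis by (simp add: mult.commute)
  qed
  have 2: "\<exists>q. iter_pderiv is (\<lambda>x::real^'n. flat p (c * x $ i + d)) = (\<lambda>x. flat q (c * x $ i + d))" for "is"
  proof (induction "is")
    case (Cons j "is")
    then obtain q where q: "iter_pderiv is (\<lambda>x::real^'n. flat p (c * x $ i + d)) = (\<lambda>x. flat q (c * x $ i + d))"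
      by blast
    have "pderiv_at j (\<lambda>x::real^'n. flat q (c * x $ i + d)) x
        = flat (smult (if i = j then c else 0) (flat_deriv q)) (c * x $ i + d)" for x
      unfolding pderiv_at_eq[OF 1[of q x], of j] by (auto simp: flat_def axis_def)
    hence "pderiv_at j (\<lambda>x::real^'n. flat q (c * x $ i + d))
        = (\<lambda>x. flat (smult (if i = j then c else 0) (flat_deriv q)) (c * x $ i + d))"
      by (rule ext)
    hence "iter_pderiv (j # is) (\<lambda>x::real^'n. flat p (c * x $ i + d))
        = (\<lambda>x. flat (smult (if i = j then c else 0) (flat_deriv q)) (c * x $ i + d))"
      by (simp only: q iter_pderiv.simps)
    thus ?case by blast
  qed auto
  show ?thesis
    unfolding smooth_fun_def
  proof (intro allI)
    fix "is" and x :: "real^'n"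
    from 2[of "is"] obtain q where "iter_pderiv is (\<lambda>x::real^'n. flat p (c * x $ i + d)) = (\<lambda>x. flat q (c * x $ i + d))" ..
    thus "iter_pderiv is (\<lambda>x::real^'n. flat p (c * x $ i + d)) differentiable (at x)"
      using 1[of q x] by (auto simp: differentiable_def)
  qed
qed

lemma test_function_iff: "test_function \<phi> \<longleftrightarrow> smooth_fun \<phi> \<and> bounded {x. \<phi> x \<noteq> 0}"
  by (simp add: test_function_def smooth_fun_def)

lemma test_function_smooth: "test_function \<phi> \<Longrightarrow> smooth_fun \<phi>"
  by (simp add: test_function_iff)

lemma test_function_add:
  assumes "test_function \<phi>" "test_function \<psi>" shows "test_function (\<lambda>x. \<phi> x + \<psi> x)"
proof -
  have "{x. \<phi> x + \<psi> x \<noteq> 0} \<subseteq> {x. \<phi> x \<noteq> 0} \<union> {x. \<psi> x \<noteq> 0}" by auto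
  thus ?thesis using assms by (auto simp: test_function_iff intro: smooth_fun_add bounded_subset[OF bounded_Un[THEN iffD2]])
qed

lemma test_function_scale:
  assumes "test_function \<phi>" shows "test_function (\<lambda>x. c * \<phi> x)"
proof -
  have "{x. c * \<phi> x \<noteq> 0} \<subseteq> {x. \<phi> x \<noteq> 0}" by auto
  thus ?thesis using assms
    by (auto simp: test_function_iff intro: bounded_subset smooth_fun_mult smooth_fun_const)
qed

lemma test_function_shift:
  assumes "test_function \<phi>" shows "test_function (\<lambda>x. \<phi> (x + y))"
proof -
  have "{x. \<phi> (x + y) \<noteq> 0} = (\<lambda>z. - y + z) ` {x. \<phi> x \<noteq> 0}"
  proof (rule set_eqI)
    fix x show "x \<in> {x. \<phi> (x + y) \<noteq> 0} \<longleftrightarrow> x \<in> (\<lambda>z. - y + z) ` {x. \<phi> x \<noteq> 0}"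
      by (auto simp: image_iff algebra_simps intro!: exI[of _ "x + y"])
  qed
  thus ?thesis using assms bounded_translation[of "{x. \<phi> x \<noteq> 0}" "- y"]
    by (auto simp: test_function_iff smooth_fun_shift)
qed

lemma pderiv_at_support:
  assumes "x \<notin> closure {x. f x \<noteq> 0}" shows "pderiv_at i f x = 0"
proof -
  have "(f has_derivative (\<lambda>v. 0)) (at x)"
    by (rule has_derivative_transform_within_open[where f = "\<lambda>x. 0" and s = "- closure {x. f x \<noteq> 0}"])
       (use assms closure_subset[of "{x. f x \<noteq> 0}"] in auto)
  thus ?thesis using pderiv_at_eq by fastforce
qed

lemma test_function_pderiv:
  assumes "test_function \<phi>" shows "test_function (pderiv_at i \<phi>)"
proof -
  have "{x. pderiv_at i \<phi> x \<noteq> 0} \<subseteq> closure {x. \<phi> x \<noteq> 0}"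
    using pderiv_at_support by blast
  thus ?thesis using assms
    by (auto simp: test_function_iff intro: bounded_subset smooth_fun_pderiv)
qed

lemma test_function_iter: "test_function \<phi> \<Longrightarrow> test_function (iter_pderiv is \<phi>)"
  by (induction "is") (auto intro: test_function_pderiv)

lemma test_function_bounds:
  assumes "test_function \<phi>"
  obtains B R where "0 < B" "0 < R" "\<And>x. \<bar>\<phi> x\<bar> \<le> B" "\<And>x. R < norm x \<Longrightarrow> \<phi> x = 0"
proof -
  have "bounded {x. \<phi> x \<noteq> 0}" using assms by (simp add: test_function_iff)
  then obtain R where R: "0 < R" "\<And>x. \<phi> x \<noteq> 0 \<Longrightarrow> norm x \<le> R" by (auto simp: bounded_pos)
  have "compact (\<phi> ` cball 0 R)"
    using smooth_fun_continuous[OF test_function_smooth[OF assms]]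
    by (intro compact_continuous_image) (auto intro: continuous_on_subset)
  then obtain B where B: "0 < B" "\<And>x. norm x \<le> R \<Longrightarrow> \<bar>\<phi> x\<bar> \<le> B"
    by (auto simp: bounded_pos dest!: compact_imp_bounded)
  have "\<bar>\<phi> x\<bar> \<le> B" for x using B R(2)[of x] by (cases "\<phi> x = 0") auto
  moreover have "\<phi> x = 0" if "R < norm x" for x using R(2)[of x] that by auto
  ultimately show thesis using that R B by blast
qed

lemma sqint_cball: "sqint (\<lambda>x. B * indicator (cball (0::real^'n::finite) R) x)"
proof -
  have "emeasure lborel (cball (0::real^'n) R) < \<infinity>"
    by (rule emeasure_bounded_finite) simp
  hence "integrable lborel (\<lambda>x. B\<^sup>2 * indicat_real (cball (0::real^'n) R) x)"
    by (intro integrable_mult_right integrable_real_indicator) auto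
  moreover have "(\<lambda>x. (B * indicat_real (cball (0::real^'n) R) x)\<^sup>2) = (\<lambda>x. B\<^sup>2 * indicat_real (cball (0::real^'n) R) x)"
    by (auto simp: fun_eq_iff power_mult_distrib indicator_def)
  moreover have "(\<lambda>x. B * indicat_real (cball (0::real^'n) R) x) \<in> borel_measurable borel"
    by (intro borel_measurable_times borel_measurable_indicator) auto
  ultimately show ?thesis by (simp only: sqint_def)
qed

lemma test_function_sqint: assumes "test_function \<phi>" shows "sqint \<phi>"
proof -
  obtain B R where "0 < B" "\<And>x. \<bar>\<phi> x\<bar> \<le> B" "\<And>x. R < norm x \<Longrightarrow> \<phi> x = 0"
    using test_function_bounds[OF assms] by metis
  hence "\<bar>\<phi> x\<bar> \<le> 1 * \<bar>B * indicator (cball 0 R) x\<bar>" for x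
    by (cases "norm x \<le> R") auto
  thus ?thesis
    by (intro sqint_bound[OF sqint_cball, of \<phi> 1 B R] AE_I2) (intro smooth_fun_measurable test_function_smooth assms)
qed

text \<open>Test functions \<open>0 \<le> \<phi>\<^sub>k \<le> 1\<close> supported in a box and increasing to 1 inside it: multiplying
  the argument of \<open>exp (- 1 / t)\<close> by \<open>k\<close> amounts to taking the \<open>k\<close>-th root.\<close>

lemma box_test_functions:
  fixes a b :: "real^'n::finite"
  obtains \<phi> where "\<And>k::nat. test_function (\<phi> k)" "\<And>k x. \<bar>\<phi> k x\<bar> \<le> indicator (box a b) x"
    "\<And>x. (\<lambda>k. \<phi> k x) \<longlonglongrightarrow> indicator (box a b) x"
proof -
  define \<phi> where "\<phi> k x = (\<Prod>i\<in>UNIV. flat 1 (real (Suc k) * x $ i + - (real (Suc k) * a $ i))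
      * flat 1 ((- real (Suc k)) * x $ i + real (Suc k) * b $ i))" for k and x :: "real^'n"
  have flat_eq: "flat 1 (real (Suc k) * x $ i + - (real (Suc k) * a $ i)) * flat 1 ((- real (Suc k)) * x $ i + real (Suc k) * b $ i)
      = (if a $ i < x $ i \<and> x $ i < b $ i then exp (- (1 / (x $ i - a $ i) + 1 / (b $ i - x $ i)) * (1 / real (Suc k))) else 0)"
    for x :: "real^'n" and i k
  proof -
    have e: "real (Suc k) * x $ i + - (real (Suc k) * a $ i) = real (Suc k) * (x $ i - a $ i)"
      "(- real (Suc k)) * x $ i + real (Suc k) * b $ i = real (Suc k) * (b $ i - x $ i)"
      by (simp_all add: algebra_simps)
    have c: "0 < real (Suc k)" by simp
    show ?thesis
      unfolding e flat_def using c
      by (auto simp: zero_less_mult_iff exp_add[symmetric] divide_simps simp del: of_nat_Suc)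
         (simp add: algebra_simps del: of_nat_Suc)?
  qed
  have out: "\<phi> k x = 0" if "x \<notin> box a b" for k x
    unfolding \<phi>_def flat_eq using that by (auto simp: mem_box_cart)
  have inn: "\<phi> k x = (\<Prod>i\<in>UNIV. exp (- (1 / (x $ i - a $ i) + 1 / (b $ i - x $ i)) * (1 / real (Suc k))))"
    if "x \<in> box a b" for k x
    unfolding \<phi>_def flat_eq using that by (auto simp: mem_box_cart intro!: prod.cong)
  show thesis
  proof (rule that[of \<phi>])
    show "test_function (\<phi> k)" for k
      unfolding test_function_iff
    proof
      show "smooth_fun (\<phi> k)"
        unfolding \<phi>_def by (intro smooth_fun_prod smooth_fun_mult smooth_fun_flat)
      have "{x. \<phi> k x \<noteq> 0} \<subseteq> box a b" using out by blast
      thus "bounded {x. \<phi> k x \<noteq> 0}" using bounded_box bounded_subset by blast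
    qed
    show "\<bar>\<phi> k x\<bar> \<le> indicator (box a b) x" for k x
    proof (cases "x \<in> box a b")
      case True
      hence "0 < x $ i - a $ i \<and> 0 < b $ i - x $ i" for i by (simp add: mem_box_cart)
      hence "0 \<le> (1 / (x $ i - a $ i) + 1 / (b $ i - x $ i)) * (1 / real (Suc k))" for i
        by (intro mult_nonneg_nonneg add_nonneg_nonneg) (auto simp: less_imp_le)
      hence "exp (- (1 / (x $ i - a $ i) + 1 / (b $ i - x $ i)) * (1 / real (Suc k))) \<le> 1" for i
        unfolding exp_le_one_iff minus_mult_left[symmetric] by (simp del: of_nat_Suc)
      hence "\<phi> k x \<le> 1" "0 \<le> \<phi> k x"
        unfolding inn[OF True] by (auto intro!: prod_le_1 prod_nonneg simp del: exp_le_one_iff)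
      thus ?thesis using True by simp
    qed (simp add: out)
    show "(\<lambda>k. \<phi> k x) \<longlonglongrightarrow> indicator (box a b) x" for x
    proof (cases "x \<in> box a b")
      case True
      have "(\<lambda>k. \<phi> k x) \<longlonglongrightarrow> (\<Prod>i\<in>(UNIV::'n set). exp (- (1 / (x $ i - a $ i) + 1 / (b $ i - x $ i)) * 0))"
        unfolding inn[OF True] by (intro tendsto_intros LIMSEQ_Suc lim_1_over_n)
      thus ?thesis using True by simp
    qed (simp add: out)
  qed
qed

section \<open>Functions determined by their integrals against test functions\<close>

lemma box_Int_box_cart: "\<exists>c d. box a b \<inter> box a' b' = box c (d::real^'n::finite)"
  by (intro exI[of _ "\<chi> i. max (a $ i) (a' $ i)"] exI[of _ "\<chi> i. min (b $ i) (b' $ i)"])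
     (auto simp: mem_box_cart)

text \<open>Dynkin's theorem: open boxes are stable under intersection and generate the Borel sets.
  The empty set, required of a Dynkin system, is a degenerate box.\<close>

lemma borel_box_induct [consumes 1, case_names box compl union]:
  fixes P :: "(real^'n::finite) set \<Rightarrow> bool"
  assumes A: "A \<in> sets borel" and box: "\<And>a b. P (box a b)"
    and compl: "\<And>A. A \<in> sets borel \<Longrightarrow> P A \<Longrightarrow> P (- A)"
    and union: "\<And>A::nat \<Rightarrow> _. disjoint_family A \<Longrightarrow> (\<And>i. A i \<in> sets borel) \<Longrightarrow> (\<And>i. P (A i)) \<Longrightarrow> P (\<Union>i. A i)"
  shows "P A"
proof -
  let ?G = "range (\<lambda>(a, b). box a b :: (real^'n) set)"
  have b: "sets borel = sigma_sets UNIV ?G" by (simp add: borel_eq_box)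
  have "Int_stable ?G"
    using box_Int_box_cart by (fastforce simp: Int_stable_def image_iff)
  moreover have "?G \<subseteq> Pow UNIV" by simp
  moreover have "A \<in> sigma_sets UNIV ?G" using A b by simp
  ultimately show ?thesis
  proof (induction rule: sigma_sets_induct_disjoint)
    case (basic A) thus ?case using box by auto
  next
    case empty
    have "box 0 0 = ({}::(real^'n) set)" by (auto simp: mem_box_cart)
    thus ?case using box[of 0 0] by simp
  next
    case (compl A) thus ?case using assms(3)[of A] b by (simp add: Compl_eq_Diff_UNIV)
  next
    case (union A) thus ?case using assms(4)[of A] b by blast
  qed
qed

text \<open>The whole space is not a box, so the vanishing of the total integral is a separate
  assumption; it carries Dynkin's argument through complements. Uniqueness of densities
  concludes.\<close>

lemma integral_zero_on_boxes:
  fixes G :: "real^'n::finite \<Rightarrow> real"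
  assumes G: "integrable lborel G" and total: "(LINT x|lborel. G x) = 0"
    and box: "\<And>a b. (LINT x:box a b|lborel. G x) = 0"
  shows "AE x in lborel. G x = 0"
proof -
  have si: "set_integrable lborel A G" if "A \<in> sets borel" for A
    using G that unfolding set_integrable_def by (intro integrable_mult_indicator) auto
  have "(LINT x:A|lborel. G x) = 0" if "A \<in> sets borel" for A
    using that
  proof (induction rule: borel_box_induct)
    case (box a b) thus ?case using assms(3) .
  next
    case (compl A)
    have "(LINT x:A \<union> -A|lborel. G x) = (LINT x:A|lborel. G x) + (LINT x:-A|lborel. G x)"
      using compl by (intro set_integral_Un si) auto
    thus ?case using compl total by (simp add: set_lebesgue_integral_def)
  next
    case (union A)
    have "(LINT x:(\<Union>i. A i)|lborel. G x) = (\<Sum>i. (LINT x:(A i)|lborel. G x))"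
      using union by (intro lebesgue_integral_countable_add si) (auto simp: disjoint_family_on_def)
    thus ?case using union by simp
  qed
  thus ?thesis
    using density_unique_real[of lborel G "\<lambda>x. 0"] G by (simp add: set_lebesgue_integral_def)
qed

lemma box_exhaustion: "\<exists>N::nat. (x::real^'n::finite) \<in> box (\<chi> i. - real N) (\<chi> i. real N)"
proof -
  obtain N :: nat where N: "norm x < real N" using reals_Archimedean2 by blast
  have "\<bar>x $ i\<bar> < real N" for i using component_le_norm_cart[of x i] N by linarith
  hence "- real N < x $ i \<and> x $ i < real N" for i by (simp add: abs_less_iff minus_less_iff)
  thus ?thesis by (auto simp: mem_box_cart)
qed

text \<open>This is the fundamental lemma of the calculus of variations. Cutoffs converging to the
  indicator of a box turn the hypothesis into vanishing integrals over boxes; inside a large box f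
  is integrable and Dynkin's argument applies.\<close>

lemma locally_integrable_AE_zero:
  fixes f :: "real^'n::finite \<Rightarrow> real"
  assumes f: "locally_integrable f"
    and zero: "\<And>\<phi>. test_function \<phi> \<Longrightarrow> (LINT x|lebesgue. f x * \<phi> x) = 0"
  shows "AE x in lebesgue. f x = 0"
proof -
  have box0: "(LINT x|lebesgue. indicator (box a b) x * f x) = 0" for a b
  proof -
    obtain \<phi> :: "nat \<Rightarrow> real^'n \<Rightarrow> real" where \<phi>: "\<And>k. test_function (\<phi> k)" "\<And>k x. \<bar>\<phi> k x\<bar> \<le> indicator (box a b) x"
      "\<And>x. (\<lambda>k. \<phi> k x) \<longlonglongrightarrow> indicator (box a b) x" using box_test_functions by metis
    \<comment> \<open>As f is only locally integrable, its restriction to the closed box serves as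
      the integrable bound for dominated convergence.\<close>
    define F where "F x = indicat_real (cbox a b) x * f x" for x
    have F: "integrable lebesgue F"
      using f[unfolded locally_integrable_def, rule_format, of "cbox a b"]
      by (simp add: set_integrable_def F_def[abs_def])
    have eq: "f x * \<phi> k x = F x * \<phi> k x" for k x
    proof (cases "x \<in> cbox a b")
      case False
      hence "x \<notin> box a b" using box_subset_cbox by blast
      thus ?thesis using \<phi>(2)[of k x] by simp
    qed (simp add: F_def)
    have eq2: "indicator (box a b) x * f x = F x * indicator (box a b) x" for x
      using box_subset_cbox[of a b] by (auto simp: F_def indicator_def)
    have m: "\<phi> k \<in> borel_measurable lebesgue" for k
      using smooth_fun_measurable[OF test_function_smooth[OF \<phi>(1)]] by (intro measurable_completion) auto
    have "(\<lambda>k. LINT x|lebesgue. F x * \<phi> k x) \<longlonglongrightarrow> (LINT x|lebesgue. F x * indicator (box a b) x)"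
    proof (rule integral_dominated_convergence[where w = "\<lambda>x. norm (F x)"])
      show "(\<lambda>x. F x * indicat_real (box a b) x) \<in> borel_measurable lebesgue"
        using F by (intro borel_measurable_times borel_measurable_indicator) auto
      show "(\<lambda>x. F x * \<phi> k x) \<in> borel_measurable lebesgue" for k
        using F m by (intro borel_measurable_times) auto
      show "integrable lebesgue (\<lambda>x. norm (F x))" using F by (rule integrable_norm)
      show "AE x in lebesgue. (\<lambda>k. F x * \<phi> k x) \<longlonglongrightarrow> F x * indicator (box a b) x"
        by (intro AE_I2 tendsto_mult tendsto_const \<phi>(3))
      show "AE x in lebesgue. norm (F x * \<phi> k x) \<le> norm (F x)" for k
      proof (rule AE_I2)
        fix x have "\<bar>\<phi> k x\<bar> \<le> 1" using \<phi>(2)[of k x] by (cases "x \<in> box a b") auto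
        thus "norm (F x * \<phi> k x) \<le> norm (F x)" by (simp add: abs_mult mult_left_le)
      qed
    qed
    moreover have "(LINT x|lebesgue. F x * \<phi> k x) = 0" for k
      using zero[OF \<phi>(1)] by (simp add: eq)
    ultimately show ?thesis by (simp add: eq2 LIMSEQ_const_iff)
  qed
  have "AE x in lebesgue. indicator (box (\<chi> i. - real N) (\<chi> i. real N)) x * f x = 0" for N :: nat
  proof -
    define K :: "(real^'n) set" where "K = box (\<chi> i. - real N) (\<chi> i. real N)"
    have "set_integrable lebesgue (cbox (\<chi> i. - real N) (\<chi> i. real N)) f"
      using f by (simp add: locally_integrable_def)
    hence "set_integrable lebesgue K f"
      by (rule set_integrable_subset) (auto simp: K_def box_subset_cbox)
    hence int: "integrable lebesgue (\<lambda>x. indicator K x * f x)" by (simp add: set_integrable_def)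
    \<comment> \<open>The argument over boxes and the uniqueness of densities work with Borel
      functions, so the restriction of f to K is replaced by a Borel version.\<close>
    then obtain G where G: "G \<in> borel_measurable lborel" "AE x in lborel. indicator K x * f x = G x"
      using completion_ex_borel_measurable_real[OF borel_measurable_integrable] by blast
    have G_AE: "AE x in lebesgue. indicator K x * f x = G x" using G(2) by (rule AE_completion)
    have Gm: "G \<in> borel_measurable lebesgue" using G(1) by (rule measurable_completion)
    have "integrable lebesgue G"
      using int G_AE Gm by (subst integrable_cong_AE[where g = "\<lambda>x. indicator K x * f x"]) (auto elim: eventually_mono)
    hence Gi: "integrable lborel G" using G(1) by (simp add: integrable_completion)
    have val: "(LINT x:A|lborel. G x) = (LINT x|lebesgue. indicator (A \<inter> K) x * f x)" if A: "A \<in> sets borel" for A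
    proof -
      have "(LINT x:A|lborel. G x) = (LINT x|lebesgue. indicator A x * G x)"
        using A G(1) unfolding set_lebesgue_integral_def
        by (subst integral_completion) (auto intro!: borel_measurable_times borel_measurable_indicator)
      also have "\<dots> = (LINT x|lebesgue. indicator A x * (indicator K x * f x))"
      proof (rule integral_cong_AE)
        have "A \<in> sets lebesgue" using A by auto
        thus "(\<lambda>x. indicat_real A x * G x) \<in> borel_measurable lebesgue"
          "(\<lambda>x. indicat_real A x * (indicat_real K x * f x)) \<in> borel_measurable lebesgue"
          using Gm int by (auto intro!: borel_measurable_times borel_measurable_indicator)
        show "AE x in lebesgue. indicat_real A x * G x = indicat_real A x * (indicat_real K x * f x)"
          using G_AE by eventually_elim simp
      qed
      also have "\<dots> = (LINT x|lebesgue. indicator (A \<inter> K) x * f x)"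
        by (rule Bochner_Integration.integral_cong) (auto simp: indicator_def)
      finally show ?thesis .
    qed
    have "AE x in lborel. G x = 0"
    proof (rule integral_zero_on_boxes[OF Gi])
      show "(LINT x|lborel. G x) = 0"
        using val[of UNIV] box0[of "\<chi> i. - real N" "\<chi> i. real N"] by (simp add: set_lebesgue_integral_def K_def)
      show "(LINT x:box a b|lborel. G x) = 0" for a b
      proof -
        obtain c d where "box a b \<inter> K = box c d" using box_Int_box_cart unfolding K_def by metis
        thus ?thesis using val[of "box a b"] box0[of c d] by simp
      qed
    qed
    hence "AE x in lebesgue. G x = 0" by (rule AE_completion)
    with G_AE show ?thesis unfolding K_def[symmetric] by eventually_elim simp
  qed
  hence "AE x in lebesgue. \<forall>N::nat. indicator (box (\<chi> i. - real N) (\<chi> i. real N)) x * f x = 0"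
    unfolding AE_all_countable by blast
  thus ?thesis
  proof eventually_elim
    case (elim x)
    obtain N :: nat where "x \<in> box (\<chi> i. - real N) (\<chi> i. real N)" using box_exhaustion by blast
    with elim show ?case by (auto dest: spec[of _ N])
  qed
qed

section \<open>Density of the test functions in L2\<close>

definition test_class :: "'n::finite l2 set" where
  "test_class = abs_l2 ` {\<phi>. test_function \<phi>}"

lemma test_closure_add:
  assumes "f \<in> closure test_class" "g \<in> closure test_class"
  shows "a *\<^sub>R f + b *\<^sub>R g \<in> closure test_class"
proof -
  obtain F G where F: "\<And>k. F k \<in> test_class" "F \<longlonglongrightarrow> f" and G: "\<And>k. G k \<in> test_class" "G \<longlonglongrightarrow> g"
    using assms unfolding closure_sequential by blast
  have "a *\<^sub>R F k + b *\<^sub>R G k \<in> test_class" for k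
  proof -
    obtain \<phi> \<psi> where "test_function \<phi>" "F k = abs_l2 \<phi>" "test_function \<psi>" "G k = abs_l2 \<psi>"
      using F(1)[of k] G(1)[of k] by (auto simp: test_class_def)
    moreover from this have "a *\<^sub>R F k + b *\<^sub>R G k = abs_l2 (\<lambda>x. a * \<phi> x + b * \<psi> x)"
      by (simp add: abs_scaleR abs_add test_function_sqint sqint_scale)
    ultimately show ?thesis
      unfolding test_class_def by (auto intro!: imageI test_function_add test_function_scale)
  qed
  moreover have "(\<lambda>k. a *\<^sub>R F k + b *\<^sub>R G k) \<longlonglongrightarrow> a *\<^sub>R f + b *\<^sub>R g"
    by (intro tendsto_intros F G)
  ultimately show ?thesis unfolding closure_sequential by (intro exI[of _ "\<lambda>k. a *\<^sub>R F k + b *\<^sub>R G k"]) auto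
qed

text \<open>Membership in the closure of the test functions is stated for functions instead of
  classes, so that pointwise limits and sums can be used.\<close>

definition test_limit :: "(real^'n::finite \<Rightarrow> real) \<Rightarrow> bool" where
  "test_limit h \<longleftrightarrow> sqint h \<and> abs_l2 h \<in> closure test_class"

lemma test_limit_lin:
  assumes "test_limit f" "test_limit g" shows "test_limit (\<lambda>x. a * f x + b * g x)"
  using assms test_closure_add[of "abs_l2 f" "abs_l2 g" a b] unfolding test_limit_def
  by (auto simp: abs_scaleR abs_add sqint_scale intro: sqint_add)

lemma test_limit_zero: "test_limit (\<lambda>x. 0)"
proof -
  have "test_function (\<lambda>x::real^'n. 0)" by (simp add: test_function_iff smooth_fun_const)
  thus ?thesis unfolding test_limit_def test_class_def
    by (auto intro!: closure_subset[THEN subsetD] imageI simp: sqint_zero)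
qed

lemma test_limit_sum:
  assumes "finite I" "\<And>i. i \<in> I \<Longrightarrow> test_limit (f i)"
  shows "test_limit (\<lambda>x. \<Sum>i\<in>I. c i * f i x)"
  using assms
proof (induction I)
  case (insert i I)
  from test_limit_lin[of "f i" "\<lambda>x. \<Sum>i\<in>I. c i * f i x" "c i" 1] insert show ?case by simp
qed (simp add: test_limit_zero)

lemma test_limit_dominated:
  assumes s: "\<And>i. test_limit (s i)" and f: "f \<in> borel_measurable borel" and w: "sqint w"
    and lim: "\<And>x. (\<lambda>i. s i x) \<longlonglongrightarrow> f x" and bound: "\<And>i x. \<bar>s i x\<bar> \<le> \<bar>w x\<bar>"
  shows "test_limit f"
proof -
  have m: "s i \<in> borel_measurable borel" for i using s[of i] by (auto simp: test_limit_def sqint_def)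
  note * = tendsto_abs_dominated[of s f w, OF m f w AE_I2[OF lim] AE_I2[OF bound]]
  have "abs_l2 f \<in> closure (closure test_class)"
    unfolding closure_sequential[of _ "closure test_class"]
    using *(3) s by (intro exI[of _ "\<lambda>i. abs_l2 (s i)"]) (auto simp: test_limit_def)
  thus ?thesis using *(1) by (simp add: test_limit_def)
qed

lemma sqint_indicator:
  assumes "A \<in> sets borel" "bounded A"
  shows "sqint (indicat_real (A :: (real^'n::finite) set))"
proof -
  obtain R where "\<And>x. x \<in> A \<Longrightarrow> norm x \<le> R" using assms(2) by (auto simp: bounded_iff)
  hence "\<bar>indicat_real A x\<bar> \<le> 1 * \<bar>1 * indicator (cball 0 R) x\<bar>" for x by (auto simp: indicator_def)
  thus ?thesis using assms(1) by (intro sqint_bound[OF sqint_cball, of _ 1 1 R] AE_I2) auto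
qed

text \<open>Intersecting with a fixed box gives all these indicators one square integrable bound:
  countable unions pass to the limit by dominated convergence, and complements become differences
  with the indicator of the box.\<close>

lemma test_limit_indicator:
  fixes A :: "(real^'n::finite) set"
  assumes "A \<in> sets borel"
  shows "test_limit (indicator (A \<inter> box c d))"
proof -
  have box: "test_limit (indicator (box a b))" for a b :: "real^'n"
  proof -
    obtain \<phi> :: "nat \<Rightarrow> real^'n \<Rightarrow> real" where \<phi>: "\<And>k. test_function (\<phi> k)" "\<And>k x. \<bar>\<phi> k x\<bar> \<le> indicator (box a b) x"
      "\<And>x. (\<lambda>k. \<phi> k x) \<longlonglongrightarrow> indicator (box a b) x" using box_test_functions by metis
    show ?thesis
    proof (rule test_limit_dominated[where s = \<phi>])
      show "test_limit (\<phi> i)" for i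
        using \<phi>(1)[of i] closure_subset[of test_class, THEN subsetD, of "abs_l2 (\<phi> i)"]
        by (auto simp: test_function_sqint test_limit_def test_class_def)
    qed (use \<phi> in \<open>auto intro: sqint_indicator[of "box a b"] order_trans\<close>)
  qed
  from assms show ?thesis
  proof (induction rule: borel_box_induct)
    case (box a b)
    obtain a' b' where "box a b \<inter> box c d = box a' b'" using box_Int_box_cart by metis
    thus ?case using \<open>\<And>a b. test_limit (indicator (box a b))\<close> by simp
  next
    case (compl A)
    have "indicat_real (- A \<inter> box c d) = (\<lambda>x. 1 * indicator (box c d) x + (-1) * indicator (A \<inter> box c d) x)"
      by (auto simp: indicator_def)
    thus ?case using test_limit_lin[OF box[of c d] compl(2), of 1 "-1"] by simp
  next
    case (union A)
    show ?case
    proof (rule test_limit_dominated[where w = "indicator (box c d)"])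
      show "test_limit (\<lambda>x. \<Sum>i\<in>{..<k}. 1 * indicator (A i \<inter> box c d) x)" for k :: nat
        by (rule test_limit_sum) (use union in auto)
      have *: "(\<Sum>i\<in>{..<k}. 1 * indicat_real (A i \<inter> box c d) x) = indicator ((\<Union>i<k. A i) \<inter> box c d) x" for k :: nat and x
      proof (induction k)
        case (Suc k)
        have "A k \<inter> A i = {}" if "i < k" for i
          using union(1) that unfolding disjoint_family_on_def by (metis UNIV_I less_irrefl)
        hence "A k \<inter> (\<Union>i<k. A i) = {}" by blast
        hence disj: "x \<in> A k \<Longrightarrow> x \<notin> (\<Union>i<k. A i)" by blast
        have "(\<Union>i<Suc k. A i) = A k \<union> (\<Union>i<k. A i)" by (auto simp: lessThan_Suc)
        thus ?case using disj unfolding sum.lessThan_Suc Suc.IH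
          by (cases "x \<in> A k"; cases "x \<in> (\<Union>i<k. A i)"; cases "x \<in> box c d"; simp)
      qed simp
      show "(\<lambda>k. \<Sum>i\<in>{..<k}. 1 * indicat_real (A i \<inter> box c d) x) \<longlonglongrightarrow> indicator ((\<Union>i. A i) \<inter> box c d) x" for x
      proof (cases "x \<in> (\<Union>i. A i)")
        case True
        then obtain j where "x \<in> A j" by blast
        hence "\<forall>\<^sub>F k in sequentially. indicat_real ((\<Union>i<k. A i) \<inter> box c d) x = indicator ((\<Union>i. A i) \<inter> box c d) x"
          by (intro eventually_sequentiallyI[of "Suc j"]) (auto simp: indicator_def)
        thus ?thesis unfolding * by (rule tendsto_eventually)
      qed (auto simp: indicator_def)
      show "\<bar>\<Sum>i\<in>{..<k}. 1 * indicat_real (A i \<inter> box c d) x\<bar> \<le> \<bar>indicat_real (box c d) x\<bar>" for k :: nat and x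
        unfolding * by (auto simp: indicator_def)
      show "indicat_real ((\<Union>i. A i) \<inter> box c d) \<in> borel_measurable borel"
        using union(2) by (intro borel_measurable_indicator) auto
    qed (auto intro: sqint_indicator)
  qed
qed

text \<open>Simple functions bounded by 2 |f| converge to f pointwise. Cut off by growing boxes,
  they are finite combinations of indicators of bounded Borel sets, and 2 |f| dominates
  them.\<close>

lemma test_class_dense: "closure (test_class :: 'n::finite l2 set) = UNIV"
proof -
  have "f \<in> closure test_class" for f :: "'n l2"
  proof -
    define K where "K N = (box (\<chi> i. - real N) (\<chi> i. real N) :: (real^'n) set)" for N :: nat
    let ?f = "rep_l2 f"
    obtain s where s: "\<And>i. simple_function borel (s i)" "\<And>x. (\<lambda>i. s i x) \<longlonglongrightarrow> ?f x"
        "\<And>i x. dist (s i x) 0 \<le> 2 * dist (?f x) 0"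
      using borel_measurable_implies_sequence_metric[OF rep_measurable[of f], of 0] by auto
    have "test_limit ?f"
    proof (rule test_limit_dominated[where s = "\<lambda>N x. s N x * indicator (K N) x" and w = "\<lambda>x. 2 * ?f x"])
      show "test_limit (\<lambda>x. s N x * indicator (K N) x)" for N
      proof -
        have fin: "finite (range (s N))" using s(1)[of N] by (simp add: simple_function_def)
        have "s N \<in> borel_measurable borel" using s(1)[of N] by (rule borel_measurable_simple_function)
        hence m: "s N -` {y} \<in> sets borel" for y by (simp add: measurable_sets_borel)
        have "test_limit (\<lambda>x. \<Sum>y\<in>range (s N). y * indicator (s N -` {y} \<inter> K N) x)"
          unfolding K_def by (intro test_limit_sum fin test_limit_indicator m)
        moreover have "(\<Sum>y\<in>range (s N). y * indicator (s N -` {y} \<inter> K N) x) = s N x * indicator (K N) x" for x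
        proof -
          have "(\<Sum>y\<in>range (s N). y * indicator (s N -` {y} \<inter> K N) x)
              = (\<Sum>y\<in>range (s N). if y = s N x then s N x * indicator (K N) x else 0)"
            by (rule sum.cong) (auto simp: indicator_def)
          thus ?thesis using fin by simp
        qed
        ultimately show ?thesis by simp
      qed
      show "(\<lambda>N. s N x * indicator (K N) x) \<longlonglongrightarrow> ?f x" for x
      proof -
        obtain N0 where N0: "x \<in> K N0" using box_exhaustion unfolding K_def by blast
        have "x \<in> K N" if "N0 \<le> N" for N
        proof -
          have "real N0 \<le> real N" using that by simp
          moreover have "- real N0 < x $ i \<and> x $ i < real N0" for i using N0 by (simp add: K_def mem_box_cart)
          ultimately have "- real N < x $ i \<and> x $ i < real N" for i
            by (smt (verit))
          thus ?thesis by (simp add: K_def mem_box_cart)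
        qed
        hence "\<forall>\<^sub>F N in sequentially. s N x = s N x * indicator (K N) x"
          by (intro eventually_sequentiallyI[of N0]) auto
        from Lim_transform_eventually[OF s(2) this] show ?thesis .
      qed
      show "\<bar>s N x * indicator (K N) x\<bar> \<le> \<bar>2 * ?f x\<bar>" for N x
        using s(3)[of N x] by (auto simp: indicator_def)
    qed (auto intro: sqint_scale)
    thus ?thesis by (simp add: test_limit_def)
  qed
  thus ?thesis by blast
qed

lemma test_approx:
  fixes f :: "'n::finite l2"
  assumes "0 < e" obtains \<phi> where "test_function \<phi>" "norm (f - abs_l2 \<phi>) < e"
proof -
  have "f \<in> closure test_class" by (simp add: test_class_dense)
  then obtain g where "g \<in> test_class" "dist g f < e" using assms closure_approachable by blast
  thus thesis using that by (auto simp: test_class_def dist_norm norm_minus_commute)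
qed

text \<open>Test functions tending to f are inserted in the hypothesis; in the limit f is paired
  with itself.\<close>

lemma norm_le_by_test:
  fixes f :: "'n::finite l2"
  assumes "0 \<le> K" "\<And>\<phi>. test_function \<phi> \<Longrightarrow> inner f (abs_l2 \<phi>) \<le> K * norm (abs_l2 \<phi>)"
  shows "norm f \<le> K"
proof -
  have "f \<in> closure test_class" by (simp add: test_class_dense)
  then obtain g where g: "\<And>k. g k \<in> test_class" "g \<longlonglongrightarrow> f" unfolding closure_sequential by blast
  have "inner f (g k) \<le> K * norm (g k)" for k using g(1)[of k] assms by (auto simp: test_class_def)
  moreover have "(\<lambda>k. inner f (g k)) \<longlonglongrightarrow> inner f f" "(\<lambda>k. K * norm (g k)) \<longlonglongrightarrow> K * norm f"
    using g(2) by (auto intro!: tendsto_intros)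
  ultimately have "inner f f \<le> K * norm f" by (intro LIMSEQ_le) auto
  hence *: "norm f * norm f \<le> K * norm f" by (simp add: dot_square_norm power2_eq_square)
  show ?thesis using * assms(1) by (cases "norm f = 0") auto
qed

section \<open>Strong and weak derivatives\<close>

lemma has_vector_derivative_iff_quotient:
  "(F has_vector_derivative F') (at t within S)
    \<longleftrightarrow> ((\<lambda>s. (F s - F t) /\<^sub>R (s - t)) \<longlongrightarrow> F') (at t within S)"
proof -
  have eq: "\<forall>\<^sub>F s in at t within S. norm ((1 / norm (s - t)) *\<^sub>R (F s - (F t + (s - t) *\<^sub>R F')))
      = norm ((F s - F t) /\<^sub>R (s - t) - F')"
    unfolding eventually_at_filter
  proof (intro always_eventually allI impI)
    fix s assume s: "s \<noteq> t"
    have "(F s - F t) /\<^sub>R (s - t) - F' = inverse (s - t) *\<^sub>R (F s - (F t + (s - t) *\<^sub>R F'))"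
      using s by (simp add: diff_diff_eq[symmetric] scaleR_diff_right)
    thus "norm ((1 / norm (s - t)) *\<^sub>R (F s - (F t + (s - t) *\<^sub>R F'))) = norm ((F s - F t) /\<^sub>R (s - t) - F')"
      using s by (simp add: divide_inverse abs_inverse)
  qed
  have "(F has_vector_derivative F') (at t within S)
      \<longleftrightarrow> ((\<lambda>s. norm ((1 / norm (s - t)) *\<^sub>R (F s - (F t + (s - t) *\<^sub>R F')))) \<longlongrightarrow> 0) (at t within S)"
    unfolding has_vector_derivative_def has_derivative_within tendsto_norm_zero_iff
    by (simp add: bounded_linear_scaleR_left)
  also have "\<dots> \<longleftrightarrow> ((\<lambda>s. norm ((F s - F t) /\<^sub>R (s - t) - F')) \<longlongrightarrow> 0) (at t within S)"
    by (rule filterlim_cong[OF refl refl eq])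
  also have "\<dots> \<longleftrightarrow> ((\<lambda>s. (F s - F t) /\<^sub>R (s - t)) \<longlongrightarrow> F') (at t within S)"
    unfolding tendsto_norm_zero_iff by (rule Lim_null[symmetric])
  finally show ?thesis .
qed

section \<open>Translations of square integrable functions\<close>

lemma lborel_shift:
  fixes f :: "real^'n::finite \<Rightarrow> real"
  assumes "f \<in> borel_measurable borel"
  shows integral_shift: "(LINT x|lborel. f (x + y)) = (LINT x|lborel. f x)"
    and integrable_shift: "integrable lborel (\<lambda>x. f (x + y)) \<longleftrightarrow> integrable lborel f"
proof -
  have d: "distr lborel borel ((+) y) = (lborel :: (real^'n) measure)" by (rule lborel_distr_plus)
  have m: "(+) y \<in> measurable lborel borel" by simp
  show "(LINT x|lborel. f (x + y)) = (LINT x|lborel. f x)"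
    using integral_distr[OF m assms] by (simp add: d add.commute)
  show "integrable lborel (\<lambda>x. f (x + y)) \<longleftrightarrow> integrable lborel f"
    using integrable_distr_eq[OF m assms] by (simp add: d add.commute)
qed

lemma measurable_shift: "f \<in> borel_measurable borel \<Longrightarrow> (\<lambda>x::real^'n::finite. f (x + y)) \<in> borel_measurable borel"
  by (rule measurable_compose[of "\<lambda>x. x + y" borel borel f]) auto

lemma AE_shift:
  fixes P :: "real^'n::finite \<Rightarrow> bool"
  assumes "AE x in lborel. P x" "{x. P x} \<in> sets borel"
  shows "AE x in lborel. P (x + y)"
proof -
  have d: "distr lborel borel ((+) y) = (lborel :: (real^'n) measure)" by (rule lborel_distr_plus)
  have "AE x in distr lborel borel ((+) y). P x" unfolding d by (rule assms(1))
  hence "AE x in lborel. P (y + x)" using assms(2) by (subst (asm) AE_distr_iff) auto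
  thus ?thesis by (simp add: add.commute)
qed

lemma sqint_shift: "sqint f \<Longrightarrow> sqint (\<lambda>x. f (x + y))"
  unfolding sqint_def using integrable_shift[of "\<lambda>x. (f x)\<^sup>2" y] by (auto intro: measurable_shift)

definition tau :: "real^'n::finite \<Rightarrow> 'n l2 \<Rightarrow> 'n l2" where
  "tau y f = abs_l2 (\<lambda>x. rep_l2 f (x + y))"

lemma AE_eq_shift:
  fixes f g :: "real^'n::finite \<Rightarrow> real"
  assumes "f \<in> borel_measurable borel" "g \<in> borel_measurable borel" "AE x in lborel. f x = g x"
  shows "AE x in lborel. f (x + y) = g (x + y)"
proof (rule AE_shift[OF assms(3)])
  have "{x \<in> space borel. f x = g x} \<in> sets borel" using assms(1,2) by (rule borel_measurable_eq)
  thus "{x. f x = g x} \<in> sets borel" by simp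
qed

lemma tau_abs: "sqint f \<Longrightarrow> tau y (abs_l2 f) = abs_l2 (\<lambda>x. f (x + y))"
  unfolding tau_def
  by (subst abs_eq_iff) (auto intro!: sqint_shift AE_eq_shift rep_abs sqint_measurable)

lemma rep_tau: "AE x in lborel. rep_l2 (tau y f) x = rep_l2 f (x + y)"
  unfolding tau_def by (intro rep_abs sqint_shift sqint_rep)

lemma tau_zero [simp]: "tau 0 f = f"
  by (simp add: tau_def)

lemma tau_tau: "tau y (tau z f) = tau (y + z) f"
  using tau_abs[OF sqint_shift[OF sqint_rep], of y f z]
  by (simp add: tau_def[of z] tau_def[of "y + z"] add.assoc)

lemma tau_add: "tau y (f + g) = tau y f + tau y g"
  using tau_abs[OF sqint_add[OF sqint_rep sqint_rep], of y f g]
    abs_add[OF sqint_shift[OF sqint_rep] sqint_shift[OF sqint_rep], of f y g y]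
  by (simp add: tau_def[of y f] tau_def[of y g] abs_add[symmetric])

lemma tau_scaleR: "tau y (c *\<^sub>R f) = c *\<^sub>R tau y f"
  using tau_abs[OF sqint_scale[OF sqint_rep], of y c f]
    abs_scaleR[OF sqint_shift[OF sqint_rep], of c f y]
  by (simp add: tau_def[of y f] abs_scaleR[symmetric])

lemma tau_diff: "tau y (f - g) = tau y f - tau y g"
  using tau_add[of y f "- g"] tau_scaleR[of y "-1" g] by simp

lemma inner_tau: "inner (tau y f) (tau y g) = inner f g"
proof -
  have "inner (tau y f) (tau y g) = (LINT x|lborel. rep_l2 f (x + y) * rep_l2 g (x + y))"
    unfolding tau_def by (intro inner_abs sqint_shift sqint_rep)
  also have "\<dots> = (LINT x|lborel. rep_l2 f x * rep_l2 g x)"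
    by (rule integral_shift[of "\<lambda>x. rep_l2 f x * rep_l2 g x" y]) measurable
  finally show ?thesis by (simp add: inner_rep)
qed

lemma norm_tau [simp]: "norm (tau y f) = norm f"
  by (simp add: norm_eq_sqrt_inner inner_tau)

lemma inner_tau_left: "inner (tau y f) g = inner f (tau (- y) g)"
  using inner_tau[of y f "tau (- y) g"] by (simp add: tau_tau)

lemma bounded_linear_tau: "bounded_linear (tau y)"
  by (rule bounded_linear_intro[of _ 1]) (auto simp: tau_add tau_scaleR)

lemma rep_pmult_tau:
  assumes "pmult_ok f g"
  shows "AE x in lborel. rep_l2 (tau y f) x * rep_l2 (tau y g) x = rep_l2 (tau y (pmult f g)) x"
proof -
  have "AE x in lborel. rep_l2 (pmult f g) (x + y) = rep_l2 f (x + y) * rep_l2 g (x + y)"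
    by (rule AE_eq_shift[OF _ _ rep_pmult[OF assms]]) measurable
  thus ?thesis using rep_tau[of y f] rep_tau[of y g] rep_tau[of y "pmult f g"]
    by eventually_elim simp
qed

lemma pmult_tau: "pmult_ok f g \<Longrightarrow> pmult (tau y f) (tau y g) = tau y (pmult f g)"
  by (rule pmult_eqI[OF rep_pmult_tau])

lemma tau_test_sequence:
  assumes \<phi>: "test_function \<phi>" and Y: "Y \<longlonglongrightarrow> 0"
  shows "(\<lambda>k. tau (Y k) (abs_l2 \<phi>)) \<longlonglongrightarrow> abs_l2 \<phi>"
proof -
  obtain B R where BR: "0 < B" "0 < R" "\<And>x. \<bar>\<phi> x\<bar> \<le> B" "\<And>x. R < norm x \<Longrightarrow> \<phi> x = 0"
    using test_function_bounds[OF \<phi>] by metis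
  obtain M where M: "\<And>k. norm (Y k) \<le> M"
    using convergent_imp_Bseq[OF convergentI[OF Y]] by (auto simp: Bseq_def)
  have "(\<lambda>k. abs_l2 (\<lambda>x. \<phi> (x + Y k))) \<longlonglongrightarrow> abs_l2 \<phi>"
  \<comment> \<open>A convergent sequence of shifts is bounded by some M, so all translates vanish
    outside the ball of radius R + M.\<close>
  proof (rule tendsto_abs_dominated(3)[where w = "\<lambda>x. B * indicator (cball 0 (R + M)) x"])
    have c: "continuous_on UNIV \<phi>" by (intro smooth_fun_continuous test_function_smooth \<phi>)
    show "AE x in lborel. (\<lambda>k. \<phi> (x + Y k)) \<longlonglongrightarrow> \<phi> x"
    proof (rule AE_I2)
      fix x have "(\<lambda>k. x + Y k) \<longlonglongrightarrow> x + 0" by (intro tendsto_intros Y)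
      from continuous_on_tendsto_compose[OF c this] show "(\<lambda>k. \<phi> (x + Y k)) \<longlonglongrightarrow> \<phi> x" by simp
    qed
    show "AE x in lborel. \<bar>\<phi> (x + Y k)\<bar> \<le> \<bar>B * indicat_real (cball 0 (R + M)) x\<bar>" for k
    proof (rule AE_I2)
      fix x show "\<bar>\<phi> (x + Y k)\<bar> \<le> \<bar>B * indicat_real (cball 0 (R + M)) x\<bar>"
      proof (cases "norm x \<le> R + M")
        case False
        hence "R < norm (x + Y k)" using M[of k] norm_triangle_ineq4[of "x + Y k" "Y k"] by simp
        thus ?thesis by (simp add: BR(4))
      qed (use BR in simp)
    qed
    show "sqint (\<lambda>x. B * indicator (cball 0 (R + M)) x)" by (rule sqint_cball)
    show "\<phi> \<in> borel_measurable borel" by (intro smooth_fun_measurable test_function_smooth \<phi>)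
    thus "(\<lambda>x. \<phi> (x + Y k)) \<in> borel_measurable borel" for k by (rule measurable_shift)
  qed
  thus ?thesis using \<phi> by (simp add: tau_abs test_function_sqint)
qed

text \<open>Translations are isometries, so it suffices to approximate f within e/3 by a test
  function, for which continuity at 0 is known. The group law moves the statement to the other
  points.\<close>

lemma tau_continuous: "continuous_on UNIV (\<lambda>y. tau y f)"
proof -
  have 0: "((\<lambda>y. tau y f) \<longlongrightarrow> f) (at 0)" for f :: "'a l2"
    unfolding tendsto_at_iff_sequentially o_def
  proof (intro allI impI)
    fix Y :: "nat \<Rightarrow> real^'a" assume Y: "Y \<longlonglongrightarrow> 0"
    show "(\<lambda>k. tau (Y k) f) \<longlonglongrightarrow> f"
      unfolding lim_sequentially
    proof (intro allI impI)
      fix e :: real assume e: "0 < e"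
      then obtain \<phi> where \<phi>: "test_function \<phi>" "norm (f - abs_l2 \<phi>) < e / 3"
        using test_approx[of "e / 3" f] by auto
      have "\<forall>\<^sub>F k in sequentially. dist (tau (Y k) (abs_l2 \<phi>)) (abs_l2 \<phi>) < e / 3"
        using tendstoD[OF tau_test_sequence[OF \<phi>(1) Y], of "e / 3"] e by simp
      then obtain N where N: "\<And>k. N \<le> k \<Longrightarrow> dist (tau (Y k) (abs_l2 \<phi>)) (abs_l2 \<phi>) < e / 3"
        by (auto simp: eventually_sequentially)
      have "dist (tau (Y k) f) f < e" if "N \<le> k" for k
      proof -
        have "tau (Y k) f - f = tau (Y k) (f - abs_l2 \<phi>) + (tau (Y k) (abs_l2 \<phi>) - abs_l2 \<phi>) - (f - abs_l2 \<phi>)"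
          by (simp add: tau_diff)
        also have "norm \<dots> \<le> norm (f - abs_l2 \<phi>) + norm (tau (Y k) (abs_l2 \<phi>) - abs_l2 \<phi>) + norm (f - abs_l2 \<phi>)"
          using norm_triangle_ineq4[of "tau (Y k) (f - abs_l2 \<phi>) + (tau (Y k) (abs_l2 \<phi>) - abs_l2 \<phi>)" "f - abs_l2 \<phi>"]
            norm_triangle_ineq[of "tau (Y k) (f - abs_l2 \<phi>)" "tau (Y k) (abs_l2 \<phi>) - abs_l2 \<phi>"]
          by simp
        finally show ?thesis using N[OF that] \<phi>(2) by (simp add: dist_norm)
      qed
      thus "\<exists>no. \<forall>n\<ge>no. dist (tau (Y n) f) f < e" by blast
    qed
  qed
  show ?thesis
    unfolding continuous_on_def
  proof
    fix z :: "real^'a"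
    have "((\<lambda>y. tau z (tau y f)) \<longlongrightarrow> tau z f) (at 0)"
      by (intro bounded_linear.tendsto[OF bounded_linear_tau] 0)
    hence "((\<lambda>y. tau (z + y) f) \<longlongrightarrow> tau z f) (at 0)" by (simp add: tau_tau)
    thus "((\<lambda>y. tau y f) \<longlongrightarrow> tau z f) (at z within UNIV)"
      using LIM_offset_zero_cancel[of "\<lambda>y. tau y f" z] by simp
  qed
qed

text \<open>The generator of the translations along an axis, written as a vector derivative of a
  curve in L2. Uniqueness and linearity then come from the library, and one product rule serves for
  space and time derivatives alike.\<close>

definition has_D :: "'n::finite \<Rightarrow> 'n l2 \<Rightarrow> 'n l2 \<Rightarrow> bool" where
  "has_D i f g \<longleftrightarrow> ((\<lambda>h. tau (h *\<^sub>R axis i 1) f) has_vector_derivative g) (at 0)"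

lemma has_D_quotient: "has_D i f g \<longleftrightarrow> ((\<lambda>h. (tau (h *\<^sub>R axis i 1) f - f) /\<^sub>R h) \<longlongrightarrow> g) (at 0)"
  by (simp add: has_D_def has_vector_derivative_iff_quotient)

lemma has_D_unique: "has_D i f g \<Longrightarrow> has_D i f h \<Longrightarrow> g = h"
  unfolding has_D_def using vector_derivative_unique_at by blast

lemma has_D_add: "has_D i f f' \<Longrightarrow> has_D i g g' \<Longrightarrow> has_D i (f + g) (f' + g')"
  unfolding has_D_def tau_add by (rule has_vector_derivative_add)

lemma has_D_scaleR:
  assumes "has_D i f f'" shows "has_D i (c *\<^sub>R f) (c *\<^sub>R f')"
  using bounded_linear.has_vector_derivative[OF bounded_linear_scaleR_right assms[unfolded has_D_def], of c]
  by (simp add: has_D_def tau_scaleR)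

lemma has_D_diff: "has_D i f f' \<Longrightarrow> has_D i g g' \<Longrightarrow> has_D i (f - g) (f' - g')"
  using has_D_add[of i f f' "(-1) *\<^sub>R g" "(-1) *\<^sub>R g'"] has_D_scaleR[of i g g' "-1"] by simp

lemma has_D_zero: "has_D i 0 0"
  by (simp add: has_D_def linear_simps(3)[OF bounded_linear_tau])

lemma has_D_bounded_linear:
  assumes "bounded_linear L" "\<And>y f. L (tau y f) = tau y (L f)" "has_D i f g"
  shows "has_D i (L f) (L g)"
  using bounded_linear.has_vector_derivative[OF assms(1) assms(3)[unfolded has_D_def]]
  by (simp add: has_D_def assms(2))

lemma has_D_tau: "has_D i f g \<Longrightarrow> has_D i (tau y f) (tau y g)"
  by (rule has_D_bounded_linear[OF bounded_linear_tau]) (simp_all add: tau_tau add.commute)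

lemma has_D_curve:
  assumes "has_D i f g"
  shows "((\<lambda>h. tau (h *\<^sub>R axis i 1) f) has_vector_derivative tau (h *\<^sub>R axis i 1) g) (at h)"
proof -
  have "((\<lambda>s. tau (s *\<^sub>R axis i 1) (tau (h *\<^sub>R axis i 1) f)) has_vector_derivative tau (h *\<^sub>R axis i 1) g) (at 0)"
    using has_D_tau[OF assms] by (simp add: has_D_def)
  hence "((\<lambda>s. tau ((s + h) *\<^sub>R axis i 1) f) has_vector_derivative tau (h *\<^sub>R axis i 1) g) (at 0)"
    by (simp add: tau_tau scaleR_add_left)
  hence *: "((\<lambda>s. tau ((s + h) *\<^sub>R axis i 1) f) has_vector_derivative tau (h *\<^sub>R axis i 1) g) (at (h - h))"
    by simp
  have "((\<lambda>s. s - h) has_vector_derivative 1) (at h)" by (auto intro!: derivative_eq_intros)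
  from vector_diff_chain_at[OF this *] show ?thesis by (simp add: o_def)
qed

text \<open>The curve of translates has a derivative of constant norm, and the mean value inequality
  applies along it. This bounds difference quotients in space uniformly in the step.\<close>

lemma tau_difference_bound:
  assumes "has_D i f g"
  shows "norm (tau (h *\<^sub>R axis i 1) f - f) \<le> \<bar>h\<bar> * norm g"
proof -
  have "norm (tau (h *\<^sub>R axis i 1) f - tau (0 *\<^sub>R axis i 1) f) \<le> norm g * norm (h - 0)"
  proof (rule differentiable_bound[where S = UNIV and f' = "\<lambda>h s. s *\<^sub>R tau (h *\<^sub>R axis i 1) g"])
    show "((\<lambda>h. tau (h *\<^sub>R axis i 1) f) has_derivative (\<lambda>s. s *\<^sub>R tau (h *\<^sub>R axis i 1) g)) (at h within UNIV)" for h
      using has_D_curve[OF assms] by (simp add: has_vector_derivative_def)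
    show "onorm (\<lambda>s. s *\<^sub>R tau (h *\<^sub>R axis i 1) g) \<le> norm g" for h
      by (rule onorm_le) (simp add: mult.commute)
  qed auto
  thus ?thesis by (simp add: mult.commute)
qed

text \<open>Integration by parts: both sides are the derivative at h = 0 of the same function,
  written once as <tau_h f, g> and once as <f, tau_(-h) g>.\<close>

lemma inner_has_D:
  assumes "has_D i f f'" "has_D i g g'"
  shows "inner f' g = - inner f g'"
proof -
  have 1: "((\<lambda>h. inner (tau (h *\<^sub>R axis i 1) f) g) has_real_derivative inner f' g) (at 0)"
    using bounded_linear.has_vector_derivative[OF bounded_linear_inner_left assms(1)[unfolded has_D_def]]
    by (simp add: has_real_derivative_iff_has_vector_derivative)
  have "((\<lambda>h. tau (h *\<^sub>R axis i 1) g) has_vector_derivative g') (at (- 0))"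
    using assms(2) by (simp add: has_D_def)
  hence "((\<lambda>h. tau (h *\<^sub>R axis i 1) g) \<circ> uminus has_vector_derivative (- 1) *\<^sub>R g') (at 0)"
    by (intro vector_diff_chain_at) (auto intro!: derivative_eq_intros)
  from bounded_linear.has_vector_derivative[OF bounded_linear_inner_right[of f] this]
  have "((\<lambda>h. inner f (tau (- (h *\<^sub>R axis i 1)) g)) has_real_derivative - inner f g') (at 0)"
    by (simp add: has_real_derivative_iff_has_vector_derivative o_def)
  hence 2: "((\<lambda>h. inner (tau (h *\<^sub>R axis i 1) f) g) has_real_derivative - inner f g') (at 0)"
    by (simp add: inner_tau_left)
  show ?thesis using DERIV_unique[OF 1 2] .
qed

lemma pderiv_line:
  assumes "smooth_fun \<phi>"
  shows "((\<lambda>s. \<phi> (x + s *\<^sub>R axis i 1)) has_real_derivative pderiv_at i \<phi> (x + s *\<^sub>R axis i 1)) (at s)"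
proof -
  have "((\<lambda>s. x + s *\<^sub>R axis i 1) has_vector_derivative axis i 1) (at s)"
    by (auto intro!: derivative_eq_intros)
  from vector_derivative_diff_chain_within[OF this has_derivative_at_withinI[OF has_derivative_frechet[OF assms]]]
  show ?thesis
    by (simp add: has_real_derivative_iff_has_vector_derivative o_def pderiv_at_def)
qed

lemma test_has_D:
  assumes \<phi>: "test_function \<phi>"
  shows "has_D i (abs_l2 \<phi>) (abs_l2 (pderiv_at i \<phi>))"
  unfolding has_D_quotient tendsto_at_iff_sequentially o_def
proof (intro allI impI)
  fix X :: "nat \<Rightarrow> real" assume X0: "\<forall>k. X k \<in> UNIV - {0}" and X: "X \<longlonglongrightarrow> 0"
  have sm: "smooth_fun \<phi>" using \<phi> by (rule test_function_smooth)
  obtain B' R' where 1: "\<And>x. R' < norm x \<Longrightarrow> \<phi> x = 0" using test_function_bounds[OF \<phi>] by metis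
  obtain B R where 2: "0 < B" "\<And>x. \<bar>pderiv_at i \<phi> x\<bar> \<le> B" "\<And>x. R < norm x \<Longrightarrow> pderiv_at i \<phi> x = 0"
    using test_function_bounds[OF test_function_pderiv[OF \<phi>]] by metis
  obtain M where M: "\<And>k. \<bar>X k\<bar> \<le> M"
    using convergent_imp_Bseq[OF convergentI[OF X]] by (auto simp: Bseq_def)
  let ?q = "\<lambda>k x. (\<phi> (x + X k *\<^sub>R axis i 1) - \<phi> x) / X k"
  \<comment> \<open>Difference quotients of a test function are bounded by the supremum of its
    derivative and vanish outside a fixed ball; this makes dominated convergence available.\<close>
  have lip: "\<bar>\<phi> (x + h *\<^sub>R axis i 1) - \<phi> x\<bar> \<le> B * \<bar>h\<bar>" for x h
  proof -
    have "norm (\<phi> (x + h *\<^sub>R axis i 1) - \<phi> (x + 0 *\<^sub>R axis i 1)) \<le> B * norm (h - 0)"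
      by (rule field_differentiable_bound[where S = UNIV and f' = "\<lambda>s. pderiv_at i \<phi> (x + s *\<^sub>R axis i 1)"])
         (simp_all add: 2 pderiv_line[OF sm])
    thus ?thesis by simp
  qed
  have m: "\<phi> \<in> borel_measurable borel" by (rule smooth_fun_measurable[OF sm])
  have "(\<lambda>k. abs_l2 (?q k)) \<longlonglongrightarrow> abs_l2 (pderiv_at i \<phi>)"
  proof (rule tendsto_abs_dominated(3)[where w = "\<lambda>x. B * indicator (cball 0 (R' + M)) x"])
    show "?q k \<in> borel_measurable borel" for k
      using m measurable_shift[OF m] by (intro borel_measurable_divide borel_measurable_diff) auto
    show "pderiv_at i \<phi> \<in> borel_measurable borel"
      by (intro smooth_fun_measurable test_function_smooth test_function_pderiv \<phi>)
    show "sqint (\<lambda>x. B * indicator (cball 0 (R' + M)) x)" by (rule sqint_cball)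
    show "AE x in lborel. (\<lambda>k. ?q k x) \<longlonglongrightarrow> pderiv_at i \<phi> x"
    proof (rule AE_I2)
      fix x
      have "((\<lambda>h. (\<phi> (x + h *\<^sub>R axis i 1) - \<phi> x) / h) \<longlongrightarrow> pderiv_at i \<phi> x) (at 0)"
        using pderiv_line[OF sm, of x i 0] by (simp add: DERIV_def)
      thus "(\<lambda>k. ?q k x) \<longlonglongrightarrow> pderiv_at i \<phi> x"
        unfolding tendsto_at_iff_sequentially o_def using X0 X by blast
    qed
    show "AE x in lborel. \<bar>?q k x\<bar> \<le> \<bar>B * indicator (cball 0 (R' + M)) x\<bar>" for k
    proof (rule AE_I2)
      fix x show "\<bar>?q k x\<bar> \<le> \<bar>B * indicator (cball 0 (R' + M)) x\<bar>"
      proof (cases "norm x \<le> R' + M")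
        case True
        thus ?thesis using lip[of x "X k"] 2(1) X0 by (auto simp: divide_simps)
      next
        case False
        have "0 \<le> M" using M[of 0] by linarith
        hence "R' < norm x" using False by linarith
        moreover have "R' < norm (x + X k *\<^sub>R axis i 1)"
          using False M[of k] norm_triangle_ineq4[of "x + X k *\<^sub>R axis i 1" "X k *\<^sub>R axis i 1"]
          by (simp add: norm_axis_1)
        ultimately show ?thesis by (simp add: 1)
      qed
    qed
  qed
  moreover have "abs_l2 (?q k) = (tau (X k *\<^sub>R axis i 1) (abs_l2 \<phi>) - abs_l2 \<phi>) /\<^sub>R X k" for k
  proof -
    have s: "sqint \<phi>" using \<phi> by (rule test_function_sqint)
    have "(tau (X k *\<^sub>R axis i 1) (abs_l2 \<phi>) - abs_l2 \<phi>) /\<^sub>R X k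
        = inverse (X k) *\<^sub>R abs_l2 (\<lambda>x. \<phi> (x + X k *\<^sub>R axis i 1) - \<phi> x)"
      using s by (simp add: tau_abs abs_diff sqint_shift)
    also have "\<dots> = abs_l2 (\<lambda>x. inverse (X k) * (\<phi> (x + X k *\<^sub>R axis i 1) - \<phi> x))"
      by (intro abs_scaleR sqint_diff sqint_shift s)
    finally show ?thesis by (simp add: divide_inverse mult.commute)
  qed
  ultimately show "(\<lambda>k. (tau (X k *\<^sub>R axis i 1) (abs_l2 \<phi>) - abs_l2 \<phi>) /\<^sub>R X k) \<longlonglongrightarrow> abs_l2 (pderiv_at i \<phi>)"
    by simp
qed

text \<open>A weak derivative in \<open>L\<^sup>2\<close> is a strong derivative of the translation group: tested against
  \<open>\<phi>\<close>, the difference \<open>\<tau>\<^sub>h f - f - h g\<close> is \<open>\<integral>\<^sub>0\<^sup>h \<langle>\<tau>\<^sub>s g - g, \<phi>\<rangle> ds\<close>.\<close>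

lemma has_D_weak:
  fixes f g :: "'n::finite l2"
  assumes weak: "\<And>\<phi>. test_function \<phi> \<Longrightarrow> inner f (abs_l2 (pderiv_at i \<phi>)) = - inner g (abs_l2 \<phi>)"
  shows "has_D i f g"
  unfolding has_D_quotient LIM_eq
proof (intro allI impI)
  fix e :: real assume e: "0 < e"
  let ?T = "\<lambda>h. tau (h *\<^sub>R axis i 1 :: real^'n)"
  have "continuous_on UNIV (\<lambda>h. ?T h g)"
    by (rule continuous_on_compose2[OF tau_continuous]) (auto intro!: continuous_intros)
  hence "isCont (\<lambda>h. ?T h g) 0" by (simp add: continuous_on_eq_continuous_at)
  then obtain d where d: "0 < d" "\<And>h. \<bar>h\<bar> < d \<Longrightarrow> norm (?T h g - g) < e / 2"
    using e unfolding continuous_at_eps_delta by (auto simp: dist_norm dest: spec[of _ "e / 2"])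
  have bound: "norm (?T h f - f - h *\<^sub>R g) \<le> \<bar>h\<bar> * (e / 2)" if h: "\<bar>h\<bar> < d" for h
  proof (rule norm_le_by_test)
    fix \<phi> :: "real^'n \<Rightarrow> real" assume \<phi>: "test_function \<phi>"
    let ?\<Phi> = "abs_l2 \<phi>"
    define c where "c s = inner (?T s f) ?\<Phi> - s * inner g ?\<Phi>" for s
    \<comment> \<open>The translation is moved to the test function, where it can be differentiated,
      and \<open>weak\<close> is applied to the translated test function.\<close>
    have c': "(c has_real_derivative inner (?T s g - g) ?\<Phi>) (at s)" for s
    proof -
      have "((\<lambda>s. ?T s ?\<Phi>) has_vector_derivative ?T (- s) (abs_l2 (pderiv_at i \<phi>))) (at (- s))"
        by (rule has_D_curve[OF test_has_D[OF \<phi>]])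
      hence "((\<lambda>s. ?T s ?\<Phi>) \<circ> uminus has_vector_derivative (- 1) *\<^sub>R ?T (- s) (abs_l2 (pderiv_at i \<phi>))) (at s)"
        by (intro vector_diff_chain_at) (auto intro!: derivative_eq_intros)
      from bounded_linear.has_vector_derivative[OF bounded_linear_inner_right[of f] this]
      have 1: "((\<lambda>s. inner (?T s f) ?\<Phi>) has_real_derivative - inner f (?T (- s) (abs_l2 (pderiv_at i \<phi>)))) (at s)"
        by (simp add: has_real_derivative_iff_has_vector_derivative o_def inner_tau_left)
      have "?T (- s) (abs_l2 (pderiv_at i \<phi>)) = abs_l2 (pderiv_at i (\<lambda>x. \<phi> (x + (- s) *\<^sub>R axis i 1)))"
        using test_function_sqint[OF test_function_pderiv[OF \<phi>]]
          iter_pderiv_shift[OF test_function_smooth[OF \<phi>], of "[i]" "(- s) *\<^sub>R axis i 1"]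
        by (simp add: tau_abs)
      hence "- inner f (?T (- s) (abs_l2 (pderiv_at i \<phi>))) = inner g (abs_l2 (\<lambda>x. \<phi> (x + (- s) *\<^sub>R axis i 1)))"
        using weak[OF test_function_shift[OF \<phi>, of "(- s) *\<^sub>R axis i 1"]] by simp
      also have "\<dots> = inner (?T s g) ?\<Phi>"
        using test_function_sqint[OF \<phi>] by (simp add: inner_tau_left tau_abs)
      finally have 2: "- inner f (?T (- s) (abs_l2 (pderiv_at i \<phi>))) = inner (?T s g) ?\<Phi>" .
      show ?thesis
        unfolding c_def using 1 unfolding 2 by (auto intro!: derivative_eq_intros simp: inner_diff_left)
    qed
    have "norm (c h - c 0) \<le> (e / 2 * norm ?\<Phi>) * norm (h - 0)"
    proof (rule field_differentiable_bound[where S = "{s. \<bar>s\<bar> < d}" and f' = "\<lambda>s. inner (?T s g - g) ?\<Phi>"])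
      have "{s. \<bar>s\<bar> < d} = ball 0 d" by (auto simp: dist_real_def)
      thus "convex {s::real. \<bar>s\<bar> < d}" by simp
      show "norm (inner (?T s g - g) ?\<Phi>) \<le> e / 2 * norm ?\<Phi>" if "s \<in> {s. \<bar>s\<bar> < d}" for s
      proof -
        have "norm (?T s g - g) * norm ?\<Phi> \<le> e / 2 * norm ?\<Phi>"
          using d(2)[of s] that by (intro mult_right_mono) auto
        thus ?thesis using Cauchy_Schwarz_ineq2[of "?T s g - g" ?\<Phi>] by simp
      qed
    qed (use h d(1) c' in \<open>auto intro: has_field_derivative_at_within\<close>)
    hence "\<bar>c h - c 0\<bar> \<le> \<bar>h\<bar> * (e / 2) * norm ?\<Phi>" by (simp add: mult_ac)
    hence "c h - c 0 \<le> \<bar>h\<bar> * (e / 2) * norm ?\<Phi>" by (rule order_trans[OF abs_ge_self])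
    thus "inner (?T h f - f - h *\<^sub>R g) ?\<Phi> \<le> \<bar>h\<bar> * (e / 2) * norm ?\<Phi>"
      by (simp add: c_def inner_diff_left)
  qed (use e in simp)
  show "\<exists>s>0. \<forall>h. h \<noteq> 0 \<and> norm (h - 0) < s \<longrightarrow> norm ((?T h f - f) /\<^sub>R h - g) < e"
  proof (intro exI[of _ d] conjI d(1) allI impI)
    fix h :: real assume h: "h \<noteq> 0 \<and> norm (h - 0) < d"
    have "(?T h f - f) /\<^sub>R h - g = inverse h *\<^sub>R (?T h f - f - h *\<^sub>R g)"
      using h by (simp add: algebra_simps)
    hence "norm ((?T h f - f) /\<^sub>R h - g) = inverse \<bar>h\<bar> * norm (?T h f - f - h *\<^sub>R g)" by (simp add: abs_inverse)
    also have "\<dots> \<le> inverse \<bar>h\<bar> * (\<bar>h\<bar> * (e / 2))" using bound[of h] h by (intro mult_left_mono) auto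
    also have "\<dots> < e" using h e by simp
    finally show "norm ((?T h f - f) /\<^sub>R h - g) < e" .
  qed
qed

section \<open>Averages over symmetric sets\<close>

lemma integral_reflect:
  fixes f :: "real^'n::finite \<Rightarrow> real"
  assumes "f \<in> borel_measurable borel"
  shows "(LINT x|lborel. f (- x)) = (LINT x|lborel. f x)"
proof -
  have d: "distr lborel borel uminus = (lborel :: (real^'n) measure)"
    using lborel_affine[of "-1" "0::real^'n"] by (simp add: density_1 uminus_add_conv_diff[symmetric] del: uminus_add_conv_diff)
  show ?thesis
    using integral_distr[of uminus lborel borel f] assms by (simp add: d)
qed

text \<open>The symmetry of Q makes the average self-adjoint, so that its square is a nonnegative
  operator; the positive volume normalizes it.\<close>

locale averaging_box =
  fixes Q :: "(real^'n::finite) set"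
  assumes Q_borel: "Q \<in> sets borel" and Q_bounded: "bounded Q"
    and Q_sym: "\<And>y. - y \<in> Q \<longleftrightarrow> y \<in> Q" and Q_pos: "0 < measure lborel Q"
begin

abbreviation V :: real where "V \<equiv> measure lborel Q"

definition pavg :: "(real^'n \<Rightarrow> real) \<Rightarrow> real^'n \<Rightarrow> real" where
  "pavg g x = (LINT y|lborel. indicator Q y * g (x + y)) / V"

lemma sqint_Q: "sqint (indicat_real Q)"
  by (intro sqint_indicator Q_borel Q_bounded)

lemma integral_Q: "(LINT y|lborel. (indicat_real Q y)\<^sup>2) = V" "integrable lborel (indicat_real Q)" "(LINT y|lborel. indicat_real Q y) = V"
proof -
  have eq: "(\<lambda>y. (indicat_real Q y)\<^sup>2) = indicat_real Q" by (auto simp: indicator_def)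
  have "emeasure lborel Q < \<infinity>" by (rule emeasure_bounded_finite[OF Q_bounded])
  thus "integrable lborel (indicat_real Q)" using Q_borel by (intro integrable_real_indicator) auto
  show "(LINT y|lborel. indicat_real Q y) = V" by simp
  thus "(LINT y|lborel. (indicat_real Q y)\<^sup>2) = V" by (simp only: eq)
qed

lemma sqint_shift': "sqint g \<Longrightarrow> sqint (\<lambda>y. g (x + y))"
  using sqint_shift[of g x] by (simp add: add.commute)

lemma pavg_integrable: "sqint g \<Longrightarrow> integrable lborel (\<lambda>y. indicator Q y * g (x + y))"
  by (intro sqint_mult_integrable sqint_Q sqint_shift')

text \<open>Cauchy-Schwarz against the indicator of Q, whose squared norm is V.\<close>

lemma pavg_square:
  assumes g: "sqint g"
  shows "(pavg g x)\<^sup>2 \<le> (LINT y|lborel. indicator Q y * (g (x + y))\<^sup>2) / V"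
proof -
  have s: "sqint (\<lambda>y. indicator Q y * g (x + y))"
  proof (rule sqint_bound[OF sqint_shift'[OF g, of x], of _ 1])
    show "(\<lambda>y. indicator Q y * g (x + y)) \<in> borel_measurable borel"
      using Q_borel sqint_shift'[OF g, of x]
      by (intro borel_measurable_times borel_measurable_indicator) (auto simp: sqint_def)
  qed (auto simp: indicator_def)
  have "V * pavg g x = inner (abs_l2 (indicator Q)) (abs_l2 (\<lambda>y. indicator Q y * g (x + y)))"
    using Q_pos s sqint_Q
    by (simp add: pavg_def inner_abs mult.assoc[symmetric] indicator_times_eq_if(1)[symmetric] indicator_inter_arith[symmetric])
  hence "(V * pavg g x)\<^sup>2 \<le> (norm (abs_l2 (indicat_real Q)))\<^sup>2 * (norm (abs_l2 (\<lambda>y. indicator Q y * g (x + y))))\<^sup>2"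
    using Cauchy_Schwarz_ineq[of "abs_l2 (indicat_real Q)" "abs_l2 (\<lambda>y. indicator Q y * g (x + y))"]
    by (simp add: power2_norm_eq_inner)
  also have "(norm (abs_l2 (indicat_real Q)))\<^sup>2 = V" using sqint_Q by (simp only: norm_abs integral_Q)
  also have "(norm (abs_l2 (\<lambda>y. indicator Q y * g (x + y))))\<^sup>2 = (LINT y|lborel. indicator Q y * (g (x + y))\<^sup>2)"
    using s unfolding norm_abs[OF s]
    by (intro Bochner_Integration.integral_cong) (auto simp: indicator_def)
  finally show ?thesis using Q_pos by (simp add: power_mult_distrib power2_eq_square field_simps)
qed

text \<open>Averaging gains boundedness at the price V^(-1/2), which is the origin of the factor
  2^(kn/2) in the dyadic estimates.\<close>

lemma pavg_sup:
  assumes g: "sqint g"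
  shows "\<bar>pavg g x\<bar> \<le> sqrt (1 / V) * norm (abs_l2 g)"
proof -
  have "(LINT y|lborel. indicator Q y * (g (x + y))\<^sup>2) \<le> (LINT y|lborel. (g (x + y))\<^sup>2)"
  proof (rule integral_mono')
    show "integrable lborel (\<lambda>y. (g (x + y))\<^sup>2)" using sqint_shift'[OF g, of x] by (simp add: sqint_def)
  qed (auto simp: indicator_def)
  also have "\<dots> = (norm (abs_l2 g))\<^sup>2"
    using integral_shift[of "\<lambda>x. (g x)\<^sup>2" x] g by (simp add: norm_abs sqint_def add.commute)
  finally have "(pavg g x)\<^sup>2 \<le> (norm (abs_l2 g))\<^sup>2 / V"
    using pavg_square[OF g, of x] Q_pos by (meson divide_right_mono less_imp_le order_trans)
  hence "sqrt ((pavg g x)\<^sup>2) \<le> sqrt ((norm (abs_l2 g))\<^sup>2 / V)" by (rule real_sqrt_le_mono)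
  thus ?thesis by (simp add: real_sqrt_divide)
qed

lemma pair_measurable:
  fixes g :: "real^'n \<Rightarrow> real"
  assumes "g \<in> borel_measurable borel"
  shows "(\<lambda>(x, y). indicator Q y * g (x + y)) \<in> borel_measurable (lborel \<Otimes>\<^sub>M lborel)"
proof -
  have "(\<lambda>p. indicat_real Q (snd p)) \<in> borel_measurable (lborel \<Otimes>\<^sub>M lborel)"
    using Q_borel by (intro measurable_compose[OF measurable_snd] borel_measurable_indicator) auto
  moreover have "(\<lambda>p. g (fst p + snd p)) \<in> borel_measurable (lborel \<Otimes>\<^sub>M lborel)"
    by (rule measurable_compose[OF _ assms]) auto
  ultimately show ?thesis unfolding case_prod_beta' by (rule borel_measurable_times)
qed

lemma pavg_measurable:
  assumes "g \<in> borel_measurable borel" shows "pavg g \<in> borel_measurable borel"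
proof -
  have "(\<lambda>x. LINT y|lborel. indicator Q y * g (x + y)) \<in> borel_measurable lborel"
    by (rule lborel.borel_measurable_lebesgue_integral[OF pair_measurable[OF assms]])
  thus ?thesis unfolding pavg_def[abs_def] by (intro borel_measurable_divide) auto
qed

text \<open>\<open>pavg_square\<close> is integrated over x; after the exchange of integrals every
  translate contributes the same integral of g^2.\<close>

lemma sqint_pavg:
  assumes g: "sqint g" shows "sqint (pavg g)"
proof -
  have gm: "g \<in> borel_measurable borel" and gi: "integrable lborel (\<lambda>x. (g x)\<^sup>2)" using g by (auto simp: sqint_def)
  have m2: "(\<lambda>x. (g x)\<^sup>2) \<in> borel_measurable borel" using gm by simp
  have ii: "integrable lborel (\<lambda>y. indicator Q y * (g (x + y))\<^sup>2)" for x
  proof (rule Bochner_Integration.integrable_bound)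
    show "integrable lborel (\<lambda>y. (g (x + y))\<^sup>2)" using sqint_shift'[OF g, of x] by (simp add: sqint_def)
    show "(\<lambda>y. indicator Q y * (g (x + y))\<^sup>2) \<in> borel_measurable lborel"
      using Q_borel sqint_shift'[OF g, of x] by (intro borel_measurable_times borel_measurable_indicator) (auto simp: sqint_def)
  qed (auto simp: indicator_def)
  have "(\<integral>\<^sup>+x. ennreal ((pavg g x)\<^sup>2) \<partial>lborel)
      \<le> (\<integral>\<^sup>+x. ennreal (1 / V) * (\<integral>\<^sup>+y. ennreal (indicator Q y * (g (x + y))\<^sup>2) \<partial>lborel) \<partial>lborel)"
  proof (rule nn_integral_mono)
    fix x
    have "ennreal ((pavg g x)\<^sup>2) \<le> ennreal (1 / V * (LINT y|lborel. indicator Q y * (g (x + y))\<^sup>2))"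
      using pavg_square[OF g, of x] by (intro ennreal_leI) simp
    also have "\<dots> = ennreal (1 / V) * ennreal (LINT y|lborel. indicator Q y * (g (x + y))\<^sup>2)"
      using Q_pos by (intro ennreal_mult) auto
    also have "ennreal (LINT y|lborel. indicator Q y * (g (x + y))\<^sup>2) = (\<integral>\<^sup>+y. ennreal (indicator Q y * (g (x + y))\<^sup>2) \<partial>lborel)"
      by (intro nn_integral_eq_integral[symmetric] ii) auto
    finally show "ennreal ((pavg g x)\<^sup>2) \<le> ennreal (1 / V) * (\<integral>\<^sup>+y. ennreal (indicator Q y * (g (x + y))\<^sup>2) \<partial>lborel)" .
  qed
  also have "\<dots> = ennreal (1 / V) * (\<integral>\<^sup>+x. (\<integral>\<^sup>+y. ennreal (indicator Q y * (g (x + y))\<^sup>2) \<partial>lborel) \<partial>lborel)"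
  proof (rule nn_integral_cmult)
    have "(\<lambda>(x, y). ennreal (indicator Q y * (g (x + y))\<^sup>2)) \<in> borel_measurable (lborel \<Otimes>\<^sub>M lborel)"
      using pair_measurable[OF m2] by (simp add: case_prod_beta')
    thus "(\<lambda>x. \<integral>\<^sup>+y. ennreal (indicator Q y * (g (x + y))\<^sup>2) \<partial>lborel) \<in> borel_measurable lborel"
      by (rule lborel.borel_measurable_nn_integral)
  qed
  also have "(\<integral>\<^sup>+x. (\<integral>\<^sup>+y. ennreal (indicator Q y * (g (x + y))\<^sup>2) \<partial>lborel) \<partial>lborel)
      = (\<integral>\<^sup>+y. (\<integral>\<^sup>+x. ennreal (indicator Q y * (g (x + y))\<^sup>2) \<partial>lborel) \<partial>lborel)"
    using pair_measurable[OF m2]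
    by (intro lborel_pair.Fubini'[symmetric]) (simp add: case_prod_beta')
  also have "\<dots> = (\<integral>\<^sup>+y. ennreal (indicator Q y) * ennreal (LINT x|lborel. (g x)\<^sup>2) \<partial>lborel)"
  proof (rule nn_integral_cong)
    fix y
    have "(\<integral>\<^sup>+x. ennreal (indicator Q y * (g (x + y))\<^sup>2) \<partial>lborel) = ennreal (indicator Q y) * (\<integral>\<^sup>+x. ennreal ((g (x + y))\<^sup>2) \<partial>lborel)"
      by (cases "y \<in> Q") auto
    also have "(\<integral>\<^sup>+x. ennreal ((g (x + y))\<^sup>2) \<partial>lborel) = ennreal (LINT x|lborel. (g (x + y))\<^sup>2)"
      using integrable_shift[OF m2, of y] gi by (intro nn_integral_eq_integral) auto
    also have "(LINT x|lborel. (g (x + y))\<^sup>2) = (LINT x|lborel. (g x)\<^sup>2)" by (rule integral_shift[OF m2])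
    finally show "(\<integral>\<^sup>+x. ennreal (indicator Q y * (g (x + y))\<^sup>2) \<partial>lborel)
      = ennreal (indicator Q y) * ennreal (LINT x|lborel. (g x)\<^sup>2)" .
  qed
  finally have le: "(\<integral>\<^sup>+x. ennreal ((pavg g x)\<^sup>2) \<partial>lborel) \<le> ennreal (1 / V) *
      (\<integral>\<^sup>+y. ennreal (indicator Q y) * ennreal (LINT x|lborel. (g x)\<^sup>2) \<partial>lborel)" .
  have "(\<integral>\<^sup>+y. ennreal (indicator Q y) * ennreal (LINT x|lborel. (g x)\<^sup>2) \<partial>lborel) < \<infinity>"
    using Q_borel emeasure_bounded_finite[OF Q_bounded]
    by (subst nn_integral_multc) (auto simp: ennreal_mult_less_top ennreal_indicator)
  hence "ennreal (1 / V) * (\<integral>\<^sup>+y. ennreal (indicator Q y) * ennreal (LINT x|lborel. (g x)\<^sup>2) \<partial>lborel) < \<infinity>"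
    by (auto simp: ennreal_mult_less_top)
  with le have "(\<integral>\<^sup>+x. ennreal ((pavg g x)\<^sup>2) \<partial>lborel) < \<infinity>" by (rule le_less_trans)
  hence "integrable lborel (\<lambda>x. (pavg g x)\<^sup>2)"
    using pavg_measurable[OF gm] by (intro integrableI_nonneg) auto
  thus ?thesis using pavg_measurable[OF gm] by (simp add: sqint_def)
qed

lemma pavg_cong:
  assumes "sqint f" "sqint g" "AE x in lborel. f x = g x"
  shows "pavg f = pavg g"
proof
  fix x
  have "AE y in lborel. f (y + x) = g (y + x)"
    using assms by (intro AE_eq_shift) (auto simp: sqint_def)
  hence "(LINT y|lborel. indicator Q y * f (x + y)) = (LINT y|lborel. indicator Q y * g (x + y))"
    using pavg_integrable[OF assms(1), of x] pavg_integrable[OF assms(2), of x]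
    by (intro integral_cong_AE borel_measurable_integrable) (auto simp: add.commute elim: eventually_mono)
  thus "pavg f x = pavg g x" by (simp add: pavg_def)
qed

definition avg :: "'n l2 \<Rightarrow> 'n l2" where "avg f = abs_l2 (pavg (rep_l2 f))"

lemma avg_abs: "sqint f \<Longrightarrow> avg (abs_l2 f) = abs_l2 (pavg f)"
  unfolding avg_def using pavg_cong[of "rep_l2 (abs_l2 f)" f] rep_abs[of f] by simp

lemma avg_bounded_by: "bounded_by (sqrt (1 / V) * norm f) (avg f)"
  using rep_abs[OF sqint_pavg[OF sqint_rep[of f]]] pavg_sup[OF sqint_rep[of f]]
  unfolding avg_def bounded_by_def abs_rep by (auto elim!: eventually_mono)

lemma avg_tau: "avg (tau y f) = tau y (avg f)"
proof -
  have "pavg (\<lambda>x. rep_l2 f (x + y)) = (\<lambda>x. pavg (rep_l2 f) (x + y))"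
    by (rule ext) (simp add: pavg_def ac_simps(1) add.assoc add.commute[of y])
  thus ?thesis
    unfolding tau_def[of y f] avg_def[of f]
    by (simp add: avg_abs sqint_shift tau_abs sqint_pavg)
qed

text \<open>Fubini's theorem identifies the pointwise average with the weak mean of the translates.
  Contractivity and self-adjointness of \<open>avg\<close>, and through the latter its linearity,
  follow from this formula without further pointwise arguments.\<close>

lemma inner_avg:
  "inner (avg f) k = (LINT y|lborel. indicator Q y * inner (tau y f) k) / V"
proof -
  let ?f = "rep_l2 f" and ?k = "rep_l2 k"
  let ?h = "\<lambda>x y. indicator Q y * ?f (x + y) * ?k x"
  have sa: "sqint (\<lambda>x. \<bar>?f x\<bar>)" by (rule sqint_bound[OF sqint_rep[of f], of _ 1]) auto
  have ska: "sqint (\<lambda>x. \<bar>?k x\<bar>)" by (rule sqint_bound[OF sqint_rep[of k], of _ 1]) auto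
  have "integrable (lborel \<Otimes>\<^sub>M lborel) (\<lambda>(x, y). ?h x y)"
  proof (rule lborel_pair.Fubini_integrable)
    note [measurable] = Q_borel
    show "(\<lambda>(x, y). ?h x y) \<in> borel_measurable (lborel \<Otimes>\<^sub>M lborel)" by measurable
    have "(LINT y|lborel. norm (case (x, y) of (x, y) \<Rightarrow> ?h x y)) = V * (pavg (\<lambda>x. \<bar>?f x\<bar>) x * \<bar>?k x\<bar>)" for x
      using Q_pos by (simp add: pavg_def abs_mult)
    thus "integrable lborel (\<lambda>x. LINT y|lborel. norm (case (x, y) of (x, y) \<Rightarrow> ?h x y))"
      using sqint_mult_integrable[OF sqint_pavg[OF sa] ska] by simp
    show "AE x in lborel. integrable lborel (\<lambda>y. case (x, y) of (x, y) \<Rightarrow> ?h x y)"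
      using pavg_integrable[OF sqint_rep[of f]] by simp
  qed
  from lborel_pair.Fubini_integral[OF this]
  have fub: "(LINT y|lborel. LINT x|lborel. ?h x y) = (LINT x|lborel. LINT y|lborel. ?h x y)" .
  have "V * inner (avg f) k = (LINT x|lborel. V * (pavg ?f x * ?k x))"
    unfolding avg_def using inner_abs[OF sqint_pavg[OF sqint_rep[of f]] sqint_rep[of k]] by simp
  also have "\<dots> = (LINT x|lborel. LINT y|lborel. ?h x y)"
    using Q_pos by (intro Bochner_Integration.integral_cong refl) (simp add: pavg_def)
  also have "\<dots> = (LINT y|lborel. indicator Q y * inner (tau y f) k)"
    unfolding fub[symmetric]
  proof (rule Bochner_Integration.integral_cong[OF refl])
    fix y
    have "inner (tau y f) k = (LINT x|lborel. ?f (x + y) * ?k x)"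
      unfolding tau_def using inner_abs[OF sqint_shift[OF sqint_rep[of f]] sqint_rep[of k]] by simp
    thus "(LINT x|lborel. ?h x y) = indicator Q y * inner (tau y f) k" by (simp add: mult.assoc)
  qed
  finally show ?thesis using Q_pos by (simp add: field_simps)
qed

lemma inner_tau_measurable: "(\<lambda>y. inner (tau y f) k) \<in> borel_measurable borel"
  by (intro borel_measurable_continuous_onI continuous_on_inner tau_continuous continuous_on_const)

lemma inner_avg_le:
  assumes "\<And>y. y \<in> Q \<Longrightarrow> inner (tau y f) k \<le> C"
  shows "inner (avg f) k \<le> C"
proof -
  have "(LINT y|lborel. indicator Q y * inner (tau y f) k) \<le> (LINT y|lborel. indicator Q y * C)"
  proof (rule integral_mono)
    show "integrable lborel (\<lambda>y. indicator Q y * C)" using integral_Q(2) by simp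
    show "integrable lborel (\<lambda>y. indicator Q y * inner (tau y f) k)"
    proof (rule Bochner_Integration.integrable_bound)
      show "integrable lborel (\<lambda>y. indicator Q y * (norm f * norm k))" using integral_Q(2) by simp
      show "(\<lambda>y. indicator Q y * inner (tau y f) k) \<in> borel_measurable lborel"
        using Q_borel inner_tau_measurable by (intro borel_measurable_times borel_measurable_indicator) auto
      show "AE y in lborel. norm (indicator Q y * inner (tau y f) k) \<le> norm (indicator Q y * (norm f * norm k))"
        using Cauchy_Schwarz_ineq2[of "tau _ f" k] by (intro AE_I2) (auto simp: indicator_def)
    qed
  qed (use assms in \<open>auto simp: indicator_def\<close>)
  also have "\<dots> = V * C" using integral_Q(3) by simp
  finally show ?thesis unfolding inner_avg using Q_pos by (simp add: divide_simps mult.commute)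
qed

lemma norm_avg: "norm (avg f) \<le> norm f"
proof -
  have "inner (avg f) (avg f) \<le> norm f * norm (avg f)"
    by (rule inner_avg_le) (metis norm_cauchy_schwarz norm_tau)
  thus ?thesis by (cases "avg f = 0") (auto simp: dot_square_norm power2_eq_square)
qed

text \<open>The substitution of -y for y, under which Q is invariant, moves the translation to the
  other argument.\<close>

lemma avg_self_adjoint: "inner (avg f) k = inner f (avg k)"
proof -
  have "(LINT y|lborel. indicator Q y * inner (tau y f) k) = (LINT y|lborel. indicator Q (- y) * inner (tau (- y) f) k)"
    using Q_borel inner_tau_measurable
    by (intro integral_reflect[symmetric] borel_measurable_times borel_measurable_indicator) auto
  also have "\<dots> = (LINT y|lborel. indicator Q y * inner (tau y k) f)"
  proof (rule Bochner_Integration.integral_cong[OF refl])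
    fix y
    have "inner (tau (- y) f) k = inner (tau y k) f"
      by (subst inner_tau_left) (simp add: inner_commute)
    thus "indicator Q (- y) * inner (tau (- y) f) k = indicator Q y * inner (tau y k) f"
      by (simp add: Q_sym indicator_def)
  qed
  finally show ?thesis unfolding inner_avg inner_commute[of f "avg k"] by simp
qed

lemma norm_avg_diff:
  assumes "\<And>y. y \<in> Q \<Longrightarrow> norm (tau y f - f) \<le> d"
  shows "norm (avg f - f) \<le> d"
proof -
  let ?k = "avg f - f"
  have "inner (avg f) ?k \<le> inner f ?k + d * norm ?k"
  proof (rule inner_avg_le)
    fix y assume "y \<in> Q"
    hence "norm (tau y f - f) * norm ?k \<le> d * norm ?k" using assms by (intro mult_right_mono) auto
    with norm_cauchy_schwarz[of "tau y f - f" ?k] show "inner (tau y f) ?k \<le> inner f ?k + d * norm ?k"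
      by (simp add: inner_diff_left)
  qed
  hence *: "norm ?k * norm ?k \<le> d * norm ?k"
    by (simp add: dot_square_norm[symmetric] power2_eq_square[symmetric] inner_diff_left)
  have "Q \<noteq> {}" using Q_pos by auto
  hence "0 \<le> d" using assms norm_ge_zero order_trans by blast
  thus ?thesis using * by (cases "?k = 0") auto
qed

text \<open>Linearity is inherited through self-adjointness, since <avg (f + g), k> = <f + g, avg k>
  is additive in f and g.\<close>

lemma bounded_linear_avg: "bounded_linear avg"
proof (rule bounded_linear_intro[where K = 1])
  fix f g :: "'n l2" and c :: real
  show "avg (f + g) = avg f + avg g"
  proof (rule vector_eq_rdot[THEN iffD1, rule_format])
    fix k
    show "inner (avg (f + g)) k = inner (avg f + avg g) k" unfolding avg_self_adjoint inner_add_left by simp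
  qed
  show "avg (c *\<^sub>R f) = c *\<^sub>R avg f"
  proof (rule vector_eq_rdot[THEN iffD1, rule_format])
    fix k
    show "inner (avg (c *\<^sub>R f)) k = inner (c *\<^sub>R avg f) k" unfolding inner_scaleR_left avg_self_adjoint by simp
  qed
  show "norm (avg f) \<le> norm f * 1" using norm_avg by simp
qed

end

section \<open>Sobolev product estimate\<close>

lemma bounded_by_mono: "bounded_by M f \<Longrightarrow> M \<le> N \<Longrightarrow> bounded_by N f"
  unfolding bounded_by_def by (auto elim!: eventually_mono)

primrec Hs :: "nat \<Rightarrow> 'n::finite l2 set" where
  "Hs 0 = UNIV"
| "Hs (Suc s) = {f. \<forall>i. \<exists>g\<in>Hs s. has_D i f g}"

definition Dop :: "'n::finite \<Rightarrow> 'n l2 \<Rightarrow> 'n l2" where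
  "Dop i f = (THE g. has_D i f g)"

text \<open>On \<open>Hs s\<close> this is the sum of the L2 norms of all iterated derivatives of
  length at most s, one summand for every order of differentiation: an equivalent norm of H^s that
  suits induction.\<close>

primrec hn :: "nat \<Rightarrow> 'n::finite l2 \<Rightarrow> real" where
  "hn 0 f = norm f"
| "hn (Suc s) f = norm f + (\<Sum>i\<in>UNIV. hn s (Dop i f))"

lemma Dop_eq: "has_D i f g \<Longrightarrow> Dop i f = g"
  unfolding Dop_def by (rule the_equality) (auto intro: has_D_unique)

lemma Hs_D: "f \<in> Hs (Suc s) \<Longrightarrow> has_D i f (Dop i f)" "f \<in> Hs (Suc s) \<Longrightarrow> Dop i f \<in> Hs s"
  using Dop_eq by fastforce+

lemma Hs_SucI: "(\<And>i. has_D i f (g i)) \<Longrightarrow> (\<And>i. g i \<in> Hs s) \<Longrightarrow> f \<in> Hs (Suc s)"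
  by auto

lemma hn_nonneg [simp]: "0 \<le> hn s f"
  by (induction s arbitrary: f) (auto intro!: add_nonneg_nonneg sum_nonneg)

lemma norm_le_hn: "norm f \<le> hn s f"
  by (cases s) (auto intro!: sum_nonneg)

lemma Hs_add_hn:
  "f \<in> Hs s \<Longrightarrow> g \<in> Hs s \<Longrightarrow> f + g \<in> Hs s \<and> hn s (f + g) \<le> hn s f + hn s g"
proof (induction s arbitrary: f g)
  case (Suc s)
  have d: "has_D i (f + g) (Dop i f + Dop i g)" for i
    using Suc.prems by (intro has_D_add Hs_D(1))
  have ih: "Dop i f + Dop i g \<in> Hs s \<and> hn s (Dop i f + Dop i g) \<le> hn s (Dop i f) + hn s (Dop i g)" for i
    using Suc.prems by (intro Suc.IH Hs_D(2))
  have "(\<Sum>i\<in>UNIV. hn s (Dop i (f + g))) \<le> (\<Sum>i\<in>UNIV. hn s (Dop i f) + hn s (Dop i g))"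
    using ih by (intro sum_mono) (simp add: Dop_eq[OF d])
  hence "hn (Suc s) (f + g) \<le> hn (Suc s) f + hn (Suc s) g"
    using norm_triangle_ineq[of f g] by (simp add: sum.distrib)
  thus ?case using ih Hs_SucI[OF d] by blast
qed (simp add: norm_triangle_ineq)

lemma Hs_scaleR_hn: "f \<in> Hs s \<Longrightarrow> c *\<^sub>R f \<in> Hs s \<and> hn s (c *\<^sub>R f) = \<bar>c\<bar> * hn s f"
proof (induction s arbitrary: f)
  case (Suc s)
  have d: "has_D i (c *\<^sub>R f) (c *\<^sub>R Dop i f)" for i
    using Suc.prems by (intro has_D_scaleR Hs_D(1))
  have ih: "c *\<^sub>R Dop i f \<in> Hs s \<and> hn s (c *\<^sub>R Dop i f) = \<bar>c\<bar> * hn s (Dop i f)" for i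
    using Suc.prems by (intro Suc.IH Hs_D(2))
  have "hn (Suc s) (c *\<^sub>R f) = \<bar>c\<bar> * hn (Suc s) f"
    using ih by (simp add: Dop_eq[OF d] sum_distrib_left distrib_left)
  thus ?case using ih Hs_SucI[OF d] by blast
qed simp

lemma Hs_diff: "f \<in> Hs s \<Longrightarrow> g \<in> Hs s \<Longrightarrow> f - g \<in> Hs s"
  using Hs_add_hn[of f s "(-1) *\<^sub>R g"] Hs_scaleR_hn[of g s "-1"] by simp

text \<open>Commuting with translations, such an operator commutes with derivatives, and therefore
  increases none of the norms \<open>hn s\<close>.\<close>

definition invariant_contraction :: "('n::finite l2 \<Rightarrow> 'n l2) \<Rightarrow> bool" where
  "invariant_contraction L \<longleftrightarrow> bounded_linear L \<and> (\<forall>y f. L (tau y f) = tau y (L f)) \<and> (\<forall>f. norm (L f) \<le> norm f)"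

lemma invariant_contraction_D:
  "invariant_contraction L \<Longrightarrow> has_D i f g \<Longrightarrow> has_D i (L f) (L g)"
  unfolding invariant_contraction_def by (blast intro: has_D_bounded_linear)

lemma invariant_contraction_hn:
  assumes L: "invariant_contraction L"
  shows "f \<in> Hs s \<Longrightarrow> L f \<in> Hs s \<and> hn s (L f) \<le> hn s f"
proof (induction s arbitrary: f)
  case (Suc s)
  have d: "has_D i (L f) (L (Dop i f))" for i
    using Suc.prems by (intro invariant_contraction_D[OF L] Hs_D(1))
  have ih: "L (Dop i f) \<in> Hs s \<and> hn s (L (Dop i f)) \<le> hn s (Dop i f)" for i
    using Suc.prems by (intro Suc.IH Hs_D(2))
  have "hn (Suc s) (L f) \<le> hn (Suc s) f"
    using ih L by (auto simp: Dop_eq[OF d] invariant_contraction_def intro!: add_mono sum_mono)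
  thus ?case using ih Hs_SucI[OF d] by blast
qed (use L in \<open>simp add: invariant_contraction_def\<close>)

lemma invariant_contraction_norm: "invariant_contraction L \<Longrightarrow> norm (L f) \<le> norm f"
  by (simp add: invariant_contraction_def)

lemma invariant_contraction_comp:
  "invariant_contraction L \<Longrightarrow> invariant_contraction M \<Longrightarrow> invariant_contraction (L \<circ> M)"
  unfolding invariant_contraction_def
  by (auto intro: bounded_linear_compose[unfolded o_def[symmetric]] order_trans)

lemma invariant_contraction_id: "invariant_contraction id"
  by (simp add: invariant_contraction_def id_def bounded_linear_ident)

lemma invariant_contraction_funpow: "invariant_contraction L \<Longrightarrow> invariant_contraction (L ^^ N)"
  by (induction N) (auto intro: invariant_contraction_comp invariant_contraction_id)

text \<open>The path from 0 to y follows the coordinate directions one after the other; since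
  translations are isometries, each coordinate contributes only its own step.\<close>

lemma norm_tau_diff:
  fixes f :: "'n::finite l2"
  assumes "f \<in> Hs 1"
  shows "norm (tau y f - f) \<le> (\<Sum>i\<in>UNIV. \<bar>y $ i\<bar> * norm (Dop i f))"
proof -
  have *: "norm (tau (\<Sum>i\<in>I. (y $ i) *\<^sub>R axis i 1) f - f) \<le> (\<Sum>i\<in>I. \<bar>y $ i\<bar> * norm (Dop i f))" if "finite I" for I
    using that
  proof (induction I)
    case (insert i I)
    let ?z = "\<Sum>i\<in>I. (y $ i) *\<^sub>R axis i 1 :: real^'n" and ?a = "(y $ i) *\<^sub>R axis i 1 :: real^'n"
    have "tau (?a + ?z) f - f = tau ?a (tau ?z f - f) + (tau ?a f - f)"
      by (simp add: tau_diff tau_tau)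
    hence "norm (tau (?a + ?z) f - f) \<le> norm (tau ?a (tau ?z f - f)) + norm (tau ?a f - f)"
      by (simp only: norm_triangle_ineq)
    hence "norm (tau (?a + ?z) f - f) \<le> norm (tau ?z f - f) + norm (tau ?a f - f)"
      by (simp only: norm_tau)
    also have "\<dots> \<le> (\<Sum>i\<in>I. \<bar>y $ i\<bar> * norm (Dop i f)) + \<bar>y $ i\<bar> * norm (Dop i f)"
      using assms by (intro add_mono insert.IH tau_difference_bound Hs_D(1)[of _ 0]) simp
    finally show ?case using insert.hyps by (simp add: add.commute)
  qed simp
  have e: "(\<Sum>i\<in>UNIV. (y $ i) *\<^sub>R axis i 1) = y"
    using basis_expansion[of y] by (simp add: scalar_mult_eq_scaleR)
  from *[OF finite, of UNIV] show ?thesis unfolding e .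
qed

definition cube :: "real \<Rightarrow> (real^'n::finite) set" where
  "cube h = cbox (\<chi> i. - (h / 2)) (\<chi> i. h / 2)"

lemma measure_cube: "0 < h \<Longrightarrow> measure lborel (cube h :: (real^'n::finite) set) = h ^ CARD('n)"
proof -
  assume h: "0 < h"
  have "(0::real^'n) \<in> cube h" using h by (simp add: cube_def mem_box_cart)
  thus ?thesis unfolding cube_def by (subst content_cbox_cart) auto
qed

lemma averaging_box_cube: "0 < h \<Longrightarrow> averaging_box (cube h :: (real^'n::finite) set)"
proof
  assume h: "0 < h"
  show "0 < measure lborel (cube h :: (real^'n) set)" using h by (simp add: measure_cube)
  show "- y \<in> cube h \<longleftrightarrow> y \<in> cube h" for y :: "real^'n"
    unfolding cube_def mem_box_cart vector_uminus_component vec_lambda_beta by (rule iff_allI) linarith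
qed (auto simp: cube_def)

definition smoothing :: "real \<Rightarrow> 'n::finite l2 \<Rightarrow> 'n l2" where
  "smoothing h f = averaging_box.avg (cube h) (averaging_box.avg (cube h) f)"

definition remainder :: "real \<Rightarrow> 'n::finite l2 \<Rightarrow> 'n l2" where
  "remainder h f = f - smoothing h f"

text \<open>The smoothing operator is the square of a self-adjoint contraction, so it lies between \<open>0\<close> and
  \<open>1\<close>, and \<open>1\<close> minus it is a contraction again.\<close>

lemma invariant_contraction_remainder:
  assumes h: "0 < h" shows "invariant_contraction (remainder h :: 'n::finite l2 \<Rightarrow> _)"
proof -
  interpret averaging_box "cube h :: (real^'n) set" by (rule averaging_box_cube[OF h])
  have "norm (remainder h f) \<le> norm f" for f :: "'n l2"
  proof -
    have "(norm (f - avg (avg f)))\<^sup>2 = (norm f)\<^sup>2 - 2 * inner f (avg (avg f)) + (norm (avg (avg f)))\<^sup>2"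
      by (simp add: power2_norm_eq_inner inner_diff_left inner_diff_right inner_commute)
    also have "inner f (avg (avg f)) = (norm (avg f))\<^sup>2"
      by (simp add: avg_self_adjoint[symmetric] power2_norm_eq_inner)
    also have "(norm (avg (avg f)))\<^sup>2 \<le> (norm (avg f))\<^sup>2"
      using norm_avg by (intro power_mono) auto
    finally have "(norm (f - avg (avg f)))\<^sup>2 \<le> (norm f)\<^sup>2 - (norm (avg f))\<^sup>2" by simp
    hence "(norm (f - avg (avg f)))\<^sup>2 \<le> (norm f)\<^sup>2" using zero_le_power2[of "norm (avg f)"] by linarith
    thus ?thesis unfolding remainder_def smoothing_def by (simp add: abs_le_square_iff[symmetric])
  qed
  moreover have "bounded_linear (\<lambda>f. f - avg (avg f))"
    by (intro bounded_linear_sub bounded_linear_ident bounded_linear_compose[OF bounded_linear_avg bounded_linear_avg])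
  ultimately show ?thesis
    unfolding invariant_contraction_def remainder_def[abs_def] smoothing_def by (auto simp: tau_diff avg_tau)
qed

lemma smoothing_bounded_by:
  fixes f :: "'n::finite l2"
  assumes h: "0 < h" shows "bounded_by (sqrt (1 / h ^ CARD('n)) * norm f) (smoothing h f)"
proof -
  interpret averaging_box "cube h :: (real^'n) set" by (rule averaging_box_cube[OF h])
  have "sqrt (1 / V) * norm (avg f) \<le> sqrt (1 / V) * norm f" using norm_avg by (intro mult_left_mono) auto
  moreover have "bounded_by (sqrt (1 / V) * norm (avg f)) (smoothing h f)"
    unfolding smoothing_def by (rule avg_bounded_by)
  ultimately show ?thesis using h bounded_by_mono by (metis measure_cube)
qed

text \<open>With A the average over the cube of side h, f - A^2 f = (f - A f) + A (f - A f). Each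
  summand is at most h/2 times the sum of the norms, because |y_i| <= h/2 in the cube.\<close>

lemma remainder_norm:
  fixes f :: "'n::finite l2"
  assumes h: "0 < h" and f: "f \<in> Hs 1"
  shows "norm (remainder h f) \<le> h * (\<Sum>i\<in>UNIV. norm (Dop i f))"
proof -
  interpret averaging_box "cube h :: (real^'n) set" by (rule averaging_box_cube[OF h])
  have "norm (avg f - f) \<le> (h / 2) * (\<Sum>i\<in>UNIV. norm (Dop i f))"
  proof (rule norm_avg_diff)
    fix y :: "real^'n" assume "y \<in> cube h"
    hence "\<bar>y $ i\<bar> \<le> h / 2" for i
      unfolding cube_def mem_box_cart by (auto simp: abs_le_iff dest!: spec[of _ i])
    hence "(\<Sum>i\<in>UNIV. \<bar>y $ i\<bar> * norm (Dop i f)) \<le> (\<Sum>i\<in>UNIV. h / 2 * norm (Dop i f))"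
      by (intro sum_mono mult_right_mono) auto
    thus "norm (tau y f - f) \<le> (h / 2) * (\<Sum>i\<in>UNIV. norm (Dop i f))"
      using norm_tau_diff[OF f, of y] by (simp add: sum_distrib_left)
  qed
  moreover have "norm (avg (f - avg f)) \<le> norm (f - avg f)" by (rule norm_avg)
  moreover have "remainder h f = (f - avg f) + avg (f - avg f)"
    by (simp add: remainder_def smoothing_def linear_simps[OF bounded_linear_avg])
  moreover have "norm (f - avg f) = norm (avg f - f)" by (rule norm_minus_commute)
  moreover have "norm (f - avg f + avg (f - avg f)) \<le> norm (f - avg f) + norm (avg (f - avg f))"
    by (rule norm_triangle_ineq)
  ultimately show ?thesis by simp
qed

text \<open>The remainder commutes with derivatives, so each factor of its power trades one
  derivative for one factor h.\<close>

lemma remainder_pow_norm: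
  assumes h: "0 < h"
  shows "f \<in> Hs s \<Longrightarrow> norm ((remainder h ^^ s) f) \<le> h ^ s * hn s f"
proof (induction s arbitrary: f)
  case (Suc s)
  let ?R = "remainder h ^^ s"
  have ic: "invariant_contraction ?R"
    by (intro invariant_contraction_funpow invariant_contraction_remainder h)
  have d: "has_D i (?R f) (?R (Dop i f))" for i
    using Suc.prems by (intro invariant_contraction_D[OF ic] Hs_D(1))
  have "norm ((remainder h ^^ Suc s) f) \<le> h * (\<Sum>i\<in>UNIV. norm (Dop i (?R f)))"
    using d by (simp, intro remainder_norm h) auto
  also have "\<dots> \<le> h * (\<Sum>i\<in>UNIV. h ^ s * hn s (Dop i f))"
    using Suc h by (intro mult_left_mono sum_mono) (simp_all add: Dop_eq[OF d] Suc.IH Hs_D(2) del: Hs.simps)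
  also have "\<dots> = h ^ Suc s * (\<Sum>i\<in>UNIV. hn s (Dop i f))" by (simp add: sum_distrib_left mult.assoc)
  also have "\<dots> \<le> h ^ Suc s * hn (Suc s) f" using h by (intro mult_left_mono) auto
  finally show ?case .
qed simp

text \<open>The N - s surplus factors are contractions. One order N can therefore serve for several
  Sobolev indices.\<close>

lemma remainder_pow_norm':
  assumes h: "0 < h" and "s \<le> N" and f: "f \<in> Hs s"
  shows "norm ((remainder h ^^ N) f) \<le> h ^ s * hn s f"
proof -
  have "(remainder h ^^ N) f = (remainder h ^^ (N - s)) ((remainder h ^^ s) f)"
    using assms(2) by (simp add: funpow_add[symmetric, THEN fun_cong, unfolded o_apply])
  also have "norm \<dots> \<le> norm ((remainder h ^^ s) f)"
    by (intro invariant_contraction_norm invariant_contraction_funpow invariant_contraction_remainder h)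
  finally show ?thesis using remainder_pow_norm[OF h f] by simp
qed

text \<open>The difference telescopes into N smoothed terms, each applied to a power of the
  remainder, which does not increase the norm.\<close>

lemma smooth_part_bounded_by:
  fixes f :: "'n::finite l2"
  assumes h: "0 < h"
  shows "bounded_by (real N * (sqrt (1 / h ^ CARD('n)) * norm f)) (f - (remainder h ^^ N) f)"
proof (induction N)
  case 0
  have "AE x in lborel. rep_l2 (f - f) x = rep_l2 f x - rep_l2 f x" by (rule rep_diff)
  thus ?case by (simp add: bounded_by_def)
next
  case (Suc N)
  let ?g = "(remainder h ^^ N) f"
  have "norm ?g \<le> norm f"
    by (intro invariant_contraction_norm invariant_contraction_funpow invariant_contraction_remainder h)
  hence "sqrt (1 / h ^ CARD('n)) * norm ?g \<le> sqrt (1 / h ^ CARD('n)) * norm f"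
    using h by (intro mult_left_mono) auto
  hence b: "bounded_by (sqrt (1 / h ^ CARD('n)) * norm f) (smoothing h ?g)"
    by (rule bounded_by_mono[OF smoothing_bounded_by[OF h, of ?g]])
  have e: "f - (remainder h ^^ Suc N) f = (f - ?g) + smoothing h ?g"
    by (simp add: remainder_def[of h ?g])
  have r: "real (Suc N) * x = real N * x + x" for x by (simp add: distrib_right)
  show ?case unfolding e r by (rule bounded_by_add[OF Suc b])
qed

text \<open>A Littlewood--Paley type decomposition \<open>f = \<Sum>\<^sub>k (f\<^sub>k - f\<^sub>k\<^sub>+\<^sub>1)\<close> at the scales \<open>2\<^sup>-\<^sup>k\<close>: the piece
  \<open>f\<^sub>k - f\<^sub>k\<^sub>+\<^sub>1\<close> is small in \<open>L\<^sup>2\<close> as \<open>f\<^sub>k\<close> is a high-order remainder, and bounded as it is smoothed.\<close>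

primrec tail :: "nat \<Rightarrow> nat \<Rightarrow> 'n::finite l2 \<Rightarrow> 'n l2" where
  "tail N 0 f = f"
| "tail N (Suc k) f = (remainder ((1 / 2) ^ k) ^^ N) (tail N k f)"

definition piece :: "nat \<Rightarrow> nat \<Rightarrow> 'n::finite l2 \<Rightarrow> 'n l2" where
  "piece N k f = tail N k f - tail N (Suc k) f"

lemma sum_pieces: "(\<Sum>k<K. piece N k f) = f - tail N K f"
  by (induction K) (simp_all add: piece_def)

lemma invariant_contraction_tail: "invariant_contraction (tail N k :: 'n::finite l2 \<Rightarrow> _)"
proof (induction k)
  case 0
  have "(tail N 0 :: 'n l2 \<Rightarrow> _) = id" by (rule ext) simp
  thus ?case by (simp only: invariant_contraction_id)
next
  case (Suc k)
  have "invariant_contraction (remainder ((1 / 2) ^ k) ^^ N \<circ> tail N k :: 'n l2 \<Rightarrow> _)"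
    by (intro invariant_contraction_comp Suc invariant_contraction_funpow invariant_contraction_remainder) simp
  moreover have "(tail N (Suc k) :: 'n l2 \<Rightarrow> _) = remainder ((1 / 2) ^ k) ^^ N \<circ> tail N k" by (rule ext) simp
  ultimately show ?case by (simp only:)
qed

text \<open>The step to index k is made at the scale 2^-(k-1), twice 2^-k; this explains the factor
  2. The earlier steps do not increase \<open>hn s\<close>.\<close>

lemma tail_norm:
  assumes "s \<le> N" "f \<in> Hs s"
  shows "norm (tail N k f) \<le> (2 * (1 / 2) ^ k) ^ s * hn s f"
proof (cases k)
  case 0
  have "1 * norm f \<le> 2 ^ s * hn s f" by (intro mult_mono norm_le_hn) auto
  thus ?thesis using 0 by simp
next
  case (Suc j)
  have t: "tail N j f \<in> Hs s" "hn s (tail N j f) \<le> hn s f"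
    using invariant_contraction_hn[OF invariant_contraction_tail assms(2)] by auto
  have "norm (tail N k f) \<le> ((1 / 2) ^ j) ^ s * hn s (tail N j f)"
    unfolding Suc tail.simps using assms(1) t(1) by (intro remainder_pow_norm') auto
  also have "\<dots> \<le> ((1 / 2) ^ j) ^ s * hn s f" using t(2) by (intro mult_left_mono) auto
  finally show ?thesis using Suc by simp
qed

lemma tail_tendsto:
  assumes "s \<le> N" "f \<in> Hs s" "0 < s"
  shows "(\<lambda>K. tail N K f) \<longlonglongrightarrow> 0"
proof (rule tendsto_norm_zero_cancel, rule tendsto_sandwich[OF _ _ tendsto_const])
  show "\<forall>\<^sub>F K in sequentially. norm (tail N K f) \<le> (2 * (1 / 2) ^ K) ^ s * hn s f"
    using tail_norm[OF assms(1,2)] by simp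
  have "(\<lambda>K. (2 * (1 / 2) ^ K) ^ s * hn s f) \<longlonglongrightarrow> (2 * 0) ^ s * hn s f"
    by (intro tendsto_intros LIMSEQ_power_zero) auto
  moreover have "(2 * 0) ^ s * hn s f = 0" using assms(3) by simp
  ultimately show "(\<lambda>K. (2 * (1 / 2) ^ K) ^ s * hn s f) \<longlonglongrightarrow> 0" by (simp only:)
qed auto

lemma piece_norm:
  assumes "s \<le> N" "f \<in> Hs s"
  shows "norm (piece N k f) \<le> 2 * (2 ^ s * (1 / 2) ^ (k * s) * hn s f)"
proof -
  have "norm (tail N (Suc k) f) \<le> norm (tail N k f)"
    unfolding tail.simps
    by (intro invariant_contraction_norm invariant_contraction_funpow invariant_contraction_remainder) simp
  hence "norm (piece N k f) \<le> 2 * norm (tail N k f)"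
    unfolding piece_def using norm_triangle_ineq4[of "tail N k f" "tail N (Suc k) f"] by linarith
  thus ?thesis using tail_norm[OF assms, of k] by (simp add: power_mult_distrib power_mult)
qed

text \<open>A Bernstein inequality: smoothing over cubes of side 2^-k bounds a function by 2^(kn/2)
  times its L2 norm, which for the tail decays like 2^(-ks).\<close>

lemma piece_bounded_by:
  fixes f :: "'n::finite l2"
  assumes "s \<le> N" "f \<in> Hs s"
  shows "bounded_by (real N * (sqrt 2 ^ (k * CARD('n)) * (2 ^ s * (1 / 2) ^ (k * s) * hn s f))) (piece N k f)"
proof -
  have "sqrt (1 / ((1 / 2) ^ k) ^ CARD('n)) = sqrt 2 ^ (k * CARD('n))"
    by (simp add: power_mult[symmetric] power_divide real_sqrt_power)
  hence "bounded_by (real N * (sqrt 2 ^ (k * CARD('n)) * norm (tail N k f))) (piece N k f)"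
    using smooth_part_bounded_by[of "(1/2)^k" N "tail N k f"] by (simp add: piece_def)
  moreover have "real N * (sqrt 2 ^ (k * CARD('n)) * norm (tail N k f))
      \<le> real N * (sqrt 2 ^ (k * CARD('n)) * (2 ^ s * (1 / 2) ^ (k * s) * hn s f))"
    using tail_norm[OF assms, of k] by (intro mult_left_mono) (auto simp: power_mult_distrib power_mult)
  ultimately show ?thesis by (rule bounded_by_mono)
qed

lemma pmult_sum_left:
  fixes g :: "'n::finite l2"
  assumes "finite I" "\<And>k. k \<in> I \<Longrightarrow> pmult_ok (f k) g"
  shows "pmult_ok (\<Sum>k\<in>I. f k) g \<and> pmult (\<Sum>k\<in>I. f k) g = (\<Sum>k\<in>I. pmult (f k) g)"
  using assms
proof (induction I)
  case empty
  have "AE x in lborel. rep_l2 (0 - 0 :: 'n l2) x = rep_l2 0 x - rep_l2 0 x" by (rule rep_diff)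
  hence z: "AE x in lborel. rep_l2 0 x * rep_l2 g x = rep_l2 0 x" by eventually_elim simp
  show ?case using pmult_okI[OF sqint_rep z] pmult_eqI[OF z] by simp
qed (auto intro: pmult_ok_add simp: pmult_add_left)

lemma pmult_sum_norm:
  assumes "finite I" "\<And>k l. k \<in> I \<Longrightarrow> l \<in> I \<Longrightarrow> pmult_ok (f k) (g l)"
    and "\<And>k l. k \<in> I \<Longrightarrow> l \<in> I \<Longrightarrow> norm (pmult (f k) (g l)) \<le> B k l"
  shows "pmult_ok (\<Sum>k\<in>I. f k) (\<Sum>l\<in>I. g l) \<and> norm (pmult (\<Sum>k\<in>I. f k) (\<Sum>l\<in>I. g l)) \<le> (\<Sum>k\<in>I. \<Sum>l\<in>I. B k l)"
proof -
  have r: "pmult_ok (f k) (\<Sum>l\<in>I. g l) \<and> pmult (f k) (\<Sum>l\<in>I. g l) = (\<Sum>l\<in>I. pmult (f k) (g l))" if "k \<in> I" for k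
    using pmult_sum_left[OF assms(1), of g "f k"] assms(2)[OF that] by (simp add: pmult_commute pmult_ok_commute)
  have l: "pmult_ok (\<Sum>k\<in>I. f k) (\<Sum>l\<in>I. g l) \<and> pmult (\<Sum>k\<in>I. f k) (\<Sum>l\<in>I. g l) = (\<Sum>k\<in>I. pmult (f k) (\<Sum>l\<in>I. g l))"
    using r by (intro pmult_sum_left assms(1)) auto
  have "norm (\<Sum>k\<in>I. pmult (f k) (\<Sum>l\<in>I. g l)) \<le> (\<Sum>k\<in>I. \<Sum>l\<in>I. B k l)"
    by (rule sum_norm_le) (auto simp: r intro!: sum_norm_le assms(3))
  thus ?thesis using l by simp
qed

text \<open>The number 2^(-1/4). By integrality n < 2 s leaves a surplus s - n/2 >= 1/2, which pays
  for 2^(-k/2) = gain^(2k) at index k. In a product of pieces with indices k <= l the missing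
  gain^(l-k) comes from the derivatives of the second factor, so that each index receives its own
  geometric factor.\<close>

definition gain :: real where "gain = root 4 (1 / 2)"

lemma gain: "0 < gain" "gain < 1" "gain ^ 4 = 1 / 2" "sqrt 2 * gain\<^sup>2 = 1"
proof -
  show g0: "0 < gain" by (simp add: gain_def)
  show g4: "gain ^ 4 = 1 / 2" by (simp add: gain_def)
  show "gain < 1"
  proof (rule ccontr)
    assume "\<not> gain < 1" hence "1 \<le> gain ^ 4" by simp
    thus False using g4 by simp
  qed
  have "(sqrt 2 * gain\<^sup>2)\<^sup>2 = 1" using g4 by (simp add: power_mult_distrib power_mult[symmetric])
  moreover have "0 \<le> sqrt 2 * gain\<^sup>2" by simp
  ultimately show "sqrt 2 * gain\<^sup>2 = 1" using power2_eq_1_iff[of "sqrt 2 * gain\<^sup>2"] by linarith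
qed

lemma gain_bound:
  assumes "2 * k * n + p \<le> 4 * j"
  shows "sqrt 2 ^ (k * n) * (1 / 2) ^ j \<le> gain ^ p"
proof -
  have "sqrt 2 ^ (k * n) * (1 / 2) ^ j = sqrt 2 ^ (k * n) * gain ^ (4 * j)"
    by (simp add: power_mult gain(3))
  also have "\<dots> \<le> sqrt 2 ^ (k * n) * gain ^ (2 * (k * n) + p)"
    using assms gain by (intro mult_left_mono power_decreasing) auto
  also have "\<dots> = (sqrt 2 * gain\<^sup>2) ^ (k * n) * gain ^ p"
    by (simp add: power_add power_mult power_mult_distrib)
  finally show ?thesis by (simp add: gain(4))
qed

lemma sum_gain: "(\<Sum>k<K. gain ^ k) \<le> 1 / (1 - gain)"
proof -
  have "(\<Sum>k<K. gain ^ k) = (1 - gain ^ K) / (1 - gain)" using gain by (simp add: sum_gp_strict)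
  also have "\<dots> \<le> 1 / (1 - gain)" using gain by (intro divide_right_mono) auto
  finally show ?thesis .
qed

text \<open>The sup bounds of the pieces of f form a geometric series, as in the embedding of H^s in
  L^inf; g carries no derivatives and is left whole.\<close>

lemma product_estimate_L2:
  fixes f g :: "'n::finite l2"
  assumes s: "CARD('n) < 2 * s" and f: "f \<in> Hs s"
  shows "pmult_ok f g" "norm (pmult f g) \<le> real s * 2 ^ s / (1 - gain) * hn s f * norm g"
proof -
  have s0: "0 < s" using s by simp
  define F where "F K = (\<Sum>k<K. piece s k f)" for K
  have F: "F \<longlonglongrightarrow> f"
    unfolding F_def sum_pieces using tendsto_diff[OF tendsto_const tail_tendsto[OF order_refl f s0]] by simp
  have p: "pmult_ok (piece s k f) g" "norm (pmult (piece s k f) g) \<le> (real s * 2 ^ s * hn s f * norm g) * gain ^ k" for k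
  proof -
    define M where "M = real s * (sqrt 2 ^ (k * CARD('n)) * (2 ^ s * (1 / 2) ^ (k * s) * hn s f))"
    have M0: "0 \<le> M" by (simp add: M_def)
    have b: "bounded_by M (piece s k f)" unfolding M_def by (rule piece_bounded_by[OF order_refl f])
    show "pmult_ok (piece s k f) g" by (rule bounded_by_pmult(1)[OF b M0])
    have "k * (2 * CARD('n) + 1) \<le> k * (4 * s)" using s by (intro mult_le_mono2) simp
    hence "2 * k * CARD('n) + k \<le> 4 * (k * s)" by (simp add: algebra_simps)
    from gain_bound[OF this] have "(real s * 2 ^ s * hn s f) * (sqrt 2 ^ (k * CARD('n)) * (1 / 2) ^ (k * s)) \<le> (real s * 2 ^ s * hn s f) * gain ^ k"
      by (intro mult_left_mono) auto
    hence "M \<le> real s * 2 ^ s * hn s f * gain ^ k" by (simp add: M_def mult_ac)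
    hence "M * norm g \<le> real s * 2 ^ s * hn s f * gain ^ k * norm g" by (intro mult_right_mono) auto
    with bounded_by_pmult(2)[OF b M0, of g]
    show "norm (pmult (piece s k f) g) \<le> (real s * 2 ^ s * hn s f * norm g) * gain ^ k" by (simp add: mult_ac)
  qed
  have ok: "pmult_ok (F K) g" and le: "norm (pmult (F K) g) \<le> real s * 2 ^ s / (1 - gain) * hn s f * norm g" for K
  proof -
    have *: "pmult_ok (F K) g \<and> pmult (F K) g = (\<Sum>k<K. pmult (piece s k f) g)"
      unfolding F_def by (intro pmult_sum_left p(1)) auto
    thus "pmult_ok (F K) g" by simp
    have "norm (\<Sum>k<K. pmult (piece s k f) g) \<le> (\<Sum>k<K. (real s * 2 ^ s * hn s f * norm g) * gain ^ k)"
      by (intro sum_norm_le p(2))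
    also have "\<dots> = (real s * 2 ^ s * hn s f * norm g) * (\<Sum>k<K. gain ^ k)" by (simp add: sum_distrib_left)
    also have "\<dots> \<le> (real s * 2 ^ s * hn s f * norm g) * (1 / (1 - gain))" by (intro mult_left_mono sum_gain) auto
    finally show "norm (pmult (F K) g) \<le> real s * 2 ^ s / (1 - gain) * hn s f * norm g" using * by simp
  qed
  show "pmult_ok f g" "norm (pmult f g) \<le> real s * 2 ^ s / (1 - gain) * hn s f * norm g"
    using pmult_limit_bound[OF F tendsto_const ok le] by auto
qed

text \<open>Both factors are decomposed. In a product of two pieces the one with the smaller index,
  whose sup norm is cheaper, is taken in L^inf and the other in L2; the bounds form a product of two
  geometric series.\<close>

lemma product_estimate_pos:
  fixes f g :: "'n::finite l2"
  assumes s: "CARD('n) < 2 * (s1 + s2)" "0 < s1" "0 < s2" and f: "f \<in> Hs s1" and g: "g \<in> Hs s2"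
  shows "pmult_ok f g" "norm (pmult f g) \<le> 2 * real (s1 + s2) * 2 ^ (s1 + s2) / (1 - gain)\<^sup>2 * hn s1 f * hn s2 g"
proof -
  \<comment> \<open>A common order for both decompositions, at least as large as either Sobolev
    index, allows the factors to exchange their roles in \<open>key\<close>.\<close>
  define N where "N = s1 + s2"
  define C where "C = 2 * real N * 2 ^ (s1 + s2) * hn s1 f * hn s2 g"
  have N: "s1 \<le> N" "s2 \<le> N" by (auto simp: N_def)
  have C0: "0 \<le> C" by (simp add: C_def)
  have key: "pmult_ok (piece N k f) (piece N l g) \<and> norm (pmult (piece N k f) (piece N l g))
      \<le> 2 * real N * 2 ^ (s + t) * hn s f * hn t g * (gain ^ k * gain ^ l)"
    if "k \<le> l" "0 < t" "f \<in> Hs s" "g \<in> Hs t" "s \<le> N" "t \<le> N" "CARD('n) < 2 * (s + t)" for k l s t and f g :: "'n l2"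
  proof -
    define M where "M = real N * (sqrt 2 ^ (k * CARD('n)) * (2 ^ s * (1 / 2) ^ (k * s) * hn s f))"
    have M0: "0 \<le> M" by (simp add: M_def)
    have b: "bounded_by M (piece N k f)" unfolding M_def by (rule piece_bounded_by) (use that in auto)
    have "norm (pmult (piece N k f) (piece N l g)) \<le> M * norm (piece N l g)" by (rule bounded_by_pmult(2)[OF b M0])
    also have "\<dots> \<le> M * (2 * (2 ^ t * (1 / 2) ^ (l * t) * hn t g))"
      using that by (intro mult_left_mono piece_norm M0)
    also have "\<dots> = 2 * real N * 2 ^ (s + t) * hn s f * hn t g * (sqrt 2 ^ (k * CARD('n)) * (1 / 2) ^ (k * s + l * t))"
      by (simp add: M_def power_add mult_ac)
    also have "\<dots> \<le> 2 * real N * 2 ^ (s + t) * hn s f * hn t g * gain ^ (k + l)"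
    proof (rule mult_left_mono[OF gain_bound])
      have "k \<le> l" by (rule that(1))
      then obtain j where l: "l = k + j" using le_Suc_ex by blast
      have "k * (2 * CARD('n) + 2) \<le> k * (4 * (s + t))" using that(7) by (intro mult_le_mono2) simp
      moreover have "j \<le> 4 * (j * t)" using that(2) by (cases t) auto
      ultimately have "k * (2 * CARD('n) + 2) + j \<le> k * (4 * (s + t)) + 4 * (j * t)" by (rule add_mono)
      thus "2 * k * CARD('n) + (k + l) \<le> 4 * (k * s + l * t)" by (simp add: l algebra_simps)
    qed auto
    finally show ?thesis using bounded_by_pmult(1)[OF b M0] by (simp add: power_add)
  qed
  define F where "F K = (\<Sum>k<K. piece N k f)" for K
  define G where "G K = (\<Sum>k<K. piece N k g)" for K
  have F: "F \<longlonglongrightarrow> f"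
    unfolding F_def sum_pieces using tendsto_diff[OF tendsto_const tail_tendsto[OF N(1) f s(2)]] by simp
  have G: "G \<longlonglongrightarrow> g"
    unfolding G_def sum_pieces using tendsto_diff[OF tendsto_const tail_tendsto[OF N(2) g s(3)]] by simp
  have pp: "pmult_ok (piece N k f) (piece N l g) \<and> norm (pmult (piece N k f) (piece N l g)) \<le> C * (gain ^ k * gain ^ l)" for k l
  proof (cases "k \<le> l")
    case True
    from key[OF this s(3) f g N s(1)] show ?thesis by (simp add: C_def)
  next
    case False
    hence "l \<le> k" by simp
    from key[OF this s(2) g f N(2,1)] s(1) show ?thesis
      by (simp add: C_def pmult_commute pmult_ok_commute mult_ac add.commute)
  qed
  have ok: "pmult_ok (F K) (G K)" and le: "norm (pmult (F K) (G K)) \<le> C * (1 / (1 - gain))\<^sup>2" for K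
  proof -
    have *: "pmult_ok (F K) (G K) \<and> norm (pmult (F K) (G K)) \<le> (\<Sum>k<K. \<Sum>l<K. C * (gain ^ k * gain ^ l))"
      unfolding F_def G_def by (intro pmult_sum_norm) (use pp in auto)
    thus "pmult_ok (F K) (G K)" by simp
    have "(\<Sum>k<K. \<Sum>l<K. C * (gain ^ k * gain ^ l)) = C * (\<Sum>k<K. gain ^ k)\<^sup>2"
      unfolding power2_eq_square sum_product by (simp only: sum_distrib_left)
    also have "\<dots> \<le> C * (1 / (1 - gain))\<^sup>2"
      using gain by (intro mult_left_mono power_mono sum_gain sum_nonneg C0) auto
    finally show "norm (pmult (F K) (G K)) \<le> C * (1 / (1 - gain))\<^sup>2" using * by simp
  qed
  have "pmult_ok f g \<and> norm (pmult f g) \<le> C * (1 / (1 - gain))\<^sup>2"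
    using pmult_limit_bound[OF F G ok le] by auto
  thus "pmult_ok f g" "norm (pmult f g) \<le> 2 * real (s1 + s2) * 2 ^ (s1 + s2) / (1 - gain)\<^sup>2 * hn s1 f * hn s2 g"
    by (auto simp: C_def N_def power_divide)
qed

definition product_const :: "nat \<Rightarrow> real" where
  "product_const s = 2 * real s * 2 ^ s / (1 - gain)\<^sup>2"

lemma product_estimate:
  fixes f g :: "'n::finite l2"
  assumes s: "CARD('n) < 2 * (s1 + s2)" and f: "f \<in> Hs s1" and g: "g \<in> Hs s2"
  shows "pmult_ok f g" "norm (pmult f g) \<le> product_const (s1 + s2) * hn s1 f * hn s2 g"
proof -
  have c: "real s * 2 ^ s / (1 - gain) \<le> product_const s" for s
  proof -
    have "real s * 2 ^ s / (1 - gain) \<le> real s * 2 ^ s / (1 - gain)\<^sup>2"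
      using gain by (intro divide_left_mono) (auto simp: power2_eq_square mult_le_one)
    also have "\<dots> \<le> product_const s" unfolding product_const_def by (intro divide_right_mono) auto
    finally show ?thesis .
  qed
  have "pmult_ok f g \<and> norm (pmult f g) \<le> product_const (s1 + s2) * hn s1 f * hn s2 g"
  proof -
    consider "s2 = 0" | "s1 = 0" | "0 < s1" "0 < s2" by blast
    thus ?thesis
    proof cases
      case 1
      have "real s1 * 2 ^ s1 / (1 - gain) * hn s1 f * norm g \<le> product_const s1 * hn s1 f * norm g"
        by (intro mult_right_mono c) auto
      thus ?thesis using product_estimate_L2[of s1 f g] s f 1 by simp
    next
      case 2
      have "real s2 * 2 ^ s2 / (1 - gain) * hn s2 g * norm f \<le> product_const s2 * hn s2 g * norm f"
        by (intro mult_right_mono c) auto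
      thus ?thesis using product_estimate_L2[of s2 g f] s g 2 by (simp add: pmult_commute pmult_ok_commute mult_ac)
    next
      case 3
      thus ?thesis using product_estimate_pos[OF s 3 f g] by (simp add: product_const_def)
    qed
  qed
  thus "pmult_ok f g" "norm (pmult f g) \<le> product_const (s1 + s2) * hn s1 f * hn s2 g" by auto
qed

lemma pmult_tendsto:
  fixes f g :: "'n::finite l2"
  assumes s: "CARD('n) < 2 * (s1 + s2)" and f: "f \<in> Hs s1" and g: "g \<in> Hs s2"
    and F: "\<forall>\<^sub>F x in net. F x \<in> Hs s1" "((\<lambda>x. hn s1 (F x - f)) \<longlongrightarrow> 0) net"
    and G: "\<forall>\<^sub>F x in net. G x \<in> Hs s2" "((\<lambda>x. hn s2 (G x - g)) \<longlongrightarrow> 0) net"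
  shows "((\<lambda>x. pmult (F x) (G x)) \<longlongrightarrow> pmult f g) net"
proof -
  let ?C = "product_const (s1 + s2)"
  have C0: "0 \<le> ?C" by (simp add: product_const_def)
  have bound: "norm (pmult (F x) (G x) - pmult f g)
      \<le> ?C * hn s1 (F x - f) * (hn s2 (G x - g) + hn s2 g) + ?C * hn s1 f * hn s2 (G x - g)"
    if Fx: "F x \<in> Hs s1" and Gx: "G x \<in> Hs s2" for x
  proof -
    have Ff: "F x - f \<in> Hs s1" and Gg: "G x - g \<in> Hs s2" using Fx Gx f g by (auto intro: Hs_diff)
    note pe = product_estimate[OF s]
    have "pmult (F x) (G x) - pmult f g = pmult (F x - f) (G x) + pmult f (G x - g)"
      using pe(1) Fx Gx f g by (simp add: pmult_diff_left pmult_diff_right)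
    hence "norm (pmult (F x) (G x) - pmult f g) \<le> norm (pmult (F x - f) (G x)) + norm (pmult f (G x - g))"
      by (simp add: norm_triangle_ineq)
    also have "\<dots> \<le> ?C * hn s1 (F x - f) * hn s2 (G x) + ?C * hn s1 f * hn s2 (G x - g)"
      by (intro add_mono pe(2) Ff Gg Gx f)
    also have "hn s2 (G x) \<le> hn s2 (G x - g) + hn s2 g"
      using Hs_add_hn[OF Gg g] by simp
    finally show ?thesis using C0 by (simp add: mult_left_mono)
  qed
  have "((\<lambda>x. ?C * hn s1 (F x - f) * (hn s2 (G x - g) + hn s2 g) + ?C * hn s1 f * hn s2 (G x - g)) \<longlongrightarrow>
      ?C * 0 * (0 + hn s2 g) + ?C * hn s1 f * 0) net"
    by (intro tendsto_intros F G)
  hence lim: "((\<lambda>x. ?C * hn s1 (F x - f) * (hn s2 (G x - g) + hn s2 g) + ?C * hn s1 f * hn s2 (G x - g)) \<longlongrightarrow> 0) net"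
    by simp
  have "((\<lambda>x. pmult (F x) (G x) - pmult f g) \<longlongrightarrow> 0) net"
    by (rule Lim_null_comparison[OF _ lim]) (use eventually_conj[OF F(1) G(1)] in \<open>auto elim!: eventually_mono intro: bound\<close>)
  thus ?thesis by (rule LIM_zero_cancel)
qed

lemma hn_tendsto_of_quotient:
  assumes F: "\<And>s. s \<in> S \<Longrightarrow> F s \<in> Hs k" "t \<in> S" and F': "F' \<in> Hs k"
    and lim: "((\<lambda>s. hn k ((F s - F t) /\<^sub>R (s - t) - F')) \<longlongrightarrow> 0) (at t within S)"
  shows "((\<lambda>s. hn k (F s - F t)) \<longlongrightarrow> 0) (at t within S)"
proof -
  have l: "((\<lambda>s. \<bar>s - t\<bar> * (hn k ((F s - F t) /\<^sub>R (s - t) - F') + hn k F')) \<longlongrightarrow> \<bar>t - t\<bar> * (0 + hn k F')) (at t within S)"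
    by (intro tendsto_intros lim)
  have "\<forall>\<^sub>F s in at t within S. norm (hn k (F s - F t)) \<le> \<bar>s - t\<bar> * (hn k ((F s - F t) /\<^sub>R (s - t) - F') + hn k F')"
    unfolding eventually_at_filter
  proof (intro always_eventually allI impI)
    fix s assume s: "s \<noteq> t" "s \<in> S"
    have q: "(F s - F t) /\<^sub>R (s - t) \<in> Hs k"
      using F s by (blast intro: Hs_scaleR_hn[THEN conjunct1] Hs_diff)
    have "F s - F t = (s - t) *\<^sub>R ((F s - F t) /\<^sub>R (s - t))" using s by simp
    hence "hn k (F s - F t) = \<bar>s - t\<bar> * hn k ((F s - F t) /\<^sub>R (s - t))"
      using Hs_scaleR_hn[OF q, of "s - t"] by metis
    also have "\<dots> \<le> \<bar>s - t\<bar> * (hn k ((F s - F t) /\<^sub>R (s - t) - F') + hn k F')"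
      using Hs_add_hn[OF Hs_diff[OF q F'] F'] by (intro mult_left_mono) auto
    finally show "norm (hn k (F s - F t)) \<le> \<bar>s - t\<bar> * (hn k ((F s - F t) /\<^sub>R (s - t) - F') + hn k F')" by simp
  qed
  from Lim_null_comparison[OF this] l show ?thesis by simp
qed

text \<open>The spaces \<open>Hs\<close> are sets and not types with a norm, so differentiability in
  them is expressed by the convergence of quotients in \<open>hn\<close>. The set S is a time
  interval or, for translates, the whole line.\<close>

lemma pmult_has_vector_derivative:
  fixes F G :: "real \<Rightarrow> 'n::finite l2"
  assumes s: "CARD('n) < 2 * (s1 + s2)" and t: "t \<in> S"
    and F: "\<And>s. s \<in> S \<Longrightarrow> F s \<in> Hs s1" and F': "F' \<in> Hs s1"
    and G: "\<And>s. s \<in> S \<Longrightarrow> G s \<in> Hs s2" and G': "G' \<in> Hs s2"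
    and dF: "((\<lambda>s. hn s1 ((F s - F t) /\<^sub>R (s - t) - F')) \<longlongrightarrow> 0) (at t within S)"
    and dG: "((\<lambda>s. hn s2 ((G s - G t) /\<^sub>R (s - t) - G')) \<longlongrightarrow> 0) (at t within S)"
  shows "((\<lambda>s. pmult (F s) (G s)) has_vector_derivative pmult F' (G t) + pmult (F t) G') (at t within S)"
proof -
  let ?qF = "\<lambda>s. (F s - F t) /\<^sub>R (s - t)" and ?qG = "\<lambda>s. (G s - G t) /\<^sub>R (s - t)"
  have q: "?qF s \<in> Hs s1" "?qG s \<in> Hs s2" if "s \<in> S" for s
    using F G t that by (blast intro: Hs_scaleR_hn[THEN conjunct1] Hs_diff)+
  have ev: "\<forall>\<^sub>F s in at t within S. s \<in> S" by (simp add: eventually_at_filter)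
  have 1: "((\<lambda>s. pmult (?qF s) (G s)) \<longlongrightarrow> pmult F' (G t)) (at t within S)"
    by (intro pmult_tendsto[OF s] F' G t dF hn_tendsto_of_quotient[OF G t G' dG] eventually_mono[OF ev] q(1))
  have 2: "((\<lambda>s. pmult (F t) (?qG s)) \<longlongrightarrow> pmult (F t) G') (at t within S)"
  proof (rule pmult_tendsto[OF s F[OF t] G' _ _ _ dG])
    have "hn s1 (F t - F t) = 0" using Hs_scaleR_hn[OF F[OF t], of 0] by simp
    thus "((\<lambda>s. hn s1 (F t - F t)) \<longlongrightarrow> 0) (at t within S)" by simp
  qed (use F t q ev in \<open>auto elim: eventually_mono\<close>)
  have eq: "\<forall>\<^sub>F s in at t within S. pmult (?qF s) (G s) + pmult (F t) (?qG s)
      = (pmult (F s) (G s) - pmult (F t) (G t)) /\<^sub>R (s - t)"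
    using ev
  proof eventually_elim
    case (elim s)
    note ok = product_estimate(1)[OF \<open>CARD('n) < 2 * (s1 + s2)\<close>]
    have "pmult (?qF s) (G s) = (pmult (F s) (G s) - pmult (F t) (G s)) /\<^sub>R (s - t)"
      using ok F G t elim by (simp add: pmult_scaleR_left pmult_diff_left pmult_ok_diff)
    moreover have "pmult (F t) (?qG s) = (pmult (F t) (G s) - pmult (F t) (G t)) /\<^sub>R (s - t)"
      using ok[OF F[OF t] G[OF elim]] ok[OF F[OF t] G[OF t]] ok[OF F[OF t] Hs_diff[OF G[OF elim] G[OF t]]]
      by (simp add: pmult_scaleR_right pmult_diff_right)
    ultimately show ?case by (simp add: scaleR_diff_right)
  qed
  from Lim_transform_eventually[OF tendsto_add[OF 1 2] eq] show ?thesis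
    by (simp add: has_vector_derivative_iff_quotient)
qed

section \<open>The differentiated equation\<close>

text \<open>Space-time multi-indices: \<open>None\<close> is the time direction, \<open>Some i\<close> the \<open>i\<close>-th space direction.\<close>

type_synonym 'n idx = "'n option \<Rightarrow> nat"

definition order :: "'n::finite idx \<Rightarrow> nat" where "order p = (\<Sum>d\<in>UNIV. p d)"

definition inc :: "'n option \<Rightarrow> 'n idx \<Rightarrow> 'n idx" where "inc d p = p(d := Suc (p d))"

abbreviation zidx :: "'n idx" where "zidx \<equiv> \<lambda>_. 0"

definition tidx :: "nat \<Rightarrow> 'n idx" where "tidx j d = (if d = None then j else 0)"

lemma order_inc [simp]: "order (inc d p) = Suc (order p)"
proof -
  have "order (inc d p) = (\<Sum>e\<in>UNIV. p e + (if e = d then 1 else 0))"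
    unfolding order_def inc_def by (intro sum.cong) auto
  thus ?thesis by (simp add: order_def sum.distrib)
qed

lemma order_zero [simp]: "order zidx = 0" by (simp add: order_def)

lemma inc_commute: "inc d (inc e p) = inc e (inc d p)"
  by (auto simp: inc_def fun_eq_iff)

lemma inc_apply: "inc d p e = (if e = d then Suc (p e) else p e)"
  by (simp add: inc_def)

lemma inc_None_simps [simp]: "inc (Some i) p None = p None" "inc None p None = Suc (p None)"
  by (simp_all add: inc_apply)

lemma order_SucE:
  assumes "order p = Suc k" obtains d q where "p = inc d q" "order q = k"
proof -
  have "\<exists>d. p d \<noteq> 0"
  proof (rule ccontr)
    assume "\<nexists>d. p d \<noteq> 0" hence "p = zidx" by auto
    thus False using assms by simp
  qed
  then obtain d where d: "p d \<noteq> 0" by blast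
  have "p = inc d (p(d := p d - 1))" using d by (auto simp: inc_def fun_eq_iff)
  thus thesis using that assms by (metis order_inc Suc_inject)
qed

lemma order_zeroD: "order p = 0 \<Longrightarrow> p = zidx"
  by (auto simp: order_def fun_eq_iff)

lemma finite_order_le: "finite {p :: 'n::finite idx. order p \<le> N}"
proof (rule finite_subset)
  show "{p :: 'n idx. order p \<le> N} \<subseteq> PiE UNIV (\<lambda>_. {..N})"
  proof
    fix p :: "'n idx" assume "p \<in> {p. order p \<le> N}"
    hence "p d \<le> N" for d
      using member_le_sum[of d UNIV p] by (simp add: order_def)
    thus "p \<in> PiE UNIV (\<lambda>_. {..N})" by auto
  qed
  show "finite (PiE (UNIV :: 'n option set) (\<lambda>_. {..N}))" by (intro finite_PiE) auto
qed

lemma jet_Hs: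
  fixes X :: "'n::finite idx \<Rightarrow> 'n l2"
  assumes D: "\<And>q i. order q < M \<Longrightarrow> has_D i (X q) (X (inc (Some i) q))"
  shows "order p + r \<le> M \<Longrightarrow> X p \<in> Hs r"
proof (induction r arbitrary: p)
  case (Suc r)
  show ?case
  proof (rule Hs_SucI)
    show "has_D i (X p) (X (inc (Some i) p))" for i using Suc.prems by (intro D) simp
    show "X (inc (Some i) p) \<in> Hs r" for i using Suc.prems by (intro Suc.IH) simp
  qed
qed simp

text \<open>One unfolding of \<open>hn\<close> produces the function and its n first derivatives,
  hence a factor n + 1 per order. Spatial derivatives keep the time index, so bounds are asked only
  for such q.\<close>

lemma jet_hn:
  fixes X :: "'n::finite idx \<Rightarrow> 'n l2"
  assumes D: "\<And>q i. order q < M \<Longrightarrow> has_D i (X q) (X (inc (Some i) q))"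
  shows "order p + r \<le> M \<Longrightarrow>
    (\<And>q. q None = p None \<Longrightarrow> order p \<le> order q \<Longrightarrow> order q \<le> order p + r \<Longrightarrow> norm (X q) \<le> K) \<Longrightarrow>
    hn r (X p) \<le> real (Suc CARD('n)) ^ r * K"
proof (induction r arbitrary: p)
  case (Suc r)
  have "norm (X p) \<le> K" by (rule Suc.prems(2)) auto
  hence K0: "0 \<le> K" using norm_ge_zero order_trans by blast
  have "hn r (X (inc (Some i) p)) \<le> real (Suc CARD('n)) ^ r * K" for i
    using Suc.prems by (intro Suc.IH) auto
  moreover have "Dop i (X p) = X (inc (Some i) p)" for i
    using Suc.prems by (intro Dop_eq D) simp
  ultimately have "(\<Sum>i\<in>UNIV. hn r (Dop i (X p))) \<le> (\<Sum>i\<in>(UNIV::'n set). real (Suc CARD('n)) ^ r * K)"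
    by (intro sum_mono) simp
  moreover have "norm (X p) \<le> real (Suc CARD('n)) ^ r * K"
  proof -
    have "norm (X p) \<le> 1 * K" using Suc.prems(2)[of p] by simp
    also have "\<dots> \<le> real (Suc CARD('n)) ^ r * K" using K0 by (intro mult_right_mono one_le_power) auto
    finally show ?thesis .
  qed
  ultimately show ?case by (simp add: algebra_simps)
qed (use order_refl in auto)

lemma jet_hn_tendsto:
  fixes X :: "'b \<Rightarrow> 'n::finite idx \<Rightarrow> 'n l2"
  assumes D: "\<forall>\<^sub>F x in net. \<forall>q i. order q < M \<longrightarrow> has_D i (X x q) (X x (inc (Some i) q))"
    and pr: "order p + r \<le> M"
    and lim: "\<And>q. q None = p None \<Longrightarrow> order p \<le> order q \<Longrightarrow> order q \<le> order p + r \<Longrightarrow> ((\<lambda>x. X x q) \<longlongrightarrow> 0) net"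
  shows "((\<lambda>x. hn r (X x p)) \<longlongrightarrow> 0) net"
proof -
  define I where "I = {q :: 'n idx. q None = p None \<and> order p \<le> order q \<and> order q \<le> order p + r}"
  have fin: "finite I" unfolding I_def by (rule finite_subset[OF _ finite_order_le[of "order p + r"]]) auto
  have "((\<lambda>x. real (Suc CARD('n)) ^ r * (\<Sum>q\<in>I. norm (X x q))) \<longlongrightarrow> real (Suc CARD('n)) ^ r * (\<Sum>q\<in>I. 0)) net"
    using lim by (intro tendsto_intros tendsto_norm_zero) (auto simp: I_def)
  hence l: "((\<lambda>x. real (Suc CARD('n)) ^ r * (\<Sum>q\<in>I. norm (X x q))) \<longlongrightarrow> 0) net" by simp
  show ?thesis
  proof (rule Lim_null_comparison[OF _ l])
    show "\<forall>\<^sub>F x in net. norm (hn r (X x p)) \<le> real (Suc CARD('n)) ^ r * (\<Sum>q\<in>I. norm (X x q))"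
      using D
    proof eventually_elim
      case (elim x)
      have "hn r (X x p) \<le> real (Suc CARD('n)) ^ r * (\<Sum>q\<in>I. norm (X x q))"
        by (rule jet_hn[OF _ pr]) (use elim fin in \<open>auto simp: I_def intro!: member_le_sum[of _ I "\<lambda>q. norm (X x q)", unfolded I_def]\<close>)
      thus ?case by simp
    qed
  qed
qed

text \<open>\<open>W p\<close> plays the role of the derivative of \<open>u\<close> of multi-index \<open>p\<close>; it is meaningful for the \<open>p\<close> with
  \<open>ok p\<close>. These are all \<open>p\<close> of order at most \<open>m + 1\<close>, except possibly the pure time derivative of order
  \<open>m + 1\<close>, which is not among the data.\<close>

locale jets =
  fixes m :: nat and T c \<kappa> \<mu> :: real and W :: "'n::finite idx \<Rightarrow> real \<Rightarrow> 'n l2" and ok :: "'n idx \<Rightarrow> bool"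
  assumes m3: "3 \<le> m" and big: "CARD('n) < 2 * (m - 2)" and T: "0 < T" and c: "0 < c"
    and \<kappa>: "0 \<le> \<kappa>" and \<mu>: "0 \<le> \<mu>"
    and ok_order: "ok p \<Longrightarrow> order p \<le> Suc m" and ok_le: "order p \<le> m \<Longrightarrow> ok p"
    and ok_inc_Some: "order p \<le> m \<Longrightarrow> ok (inc (Some i) p)"
    and cont: "ok p \<Longrightarrow> continuous_on {0..T} (W p)"
    and deriv: "ok (inc None p) \<Longrightarrow> t \<in> {0..T} \<Longrightarrow> (W p has_vector_derivative W (inc None p) t) (at t within {0..T})"
    and spat: "order p \<le> m \<Longrightarrow> t \<in> {0..T} \<Longrightarrow> has_D i (W p t) (W (inc (Some i) p) t)"
    and wave: "t \<in> {0..T} \<Longrightarrow> W (inc None (inc None zidx)) t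
        - \<kappa> *\<^sub>R pmult (W (inc None zidx) t) (W (inc None (inc None zidx)) t)
      = c\<^sup>2 *\<^sub>R (\<Sum>i\<in>UNIV. W (inc (Some i) (inc (Some i) zidx)) t)
        + \<mu> *\<^sub>R (\<Sum>i\<in>UNIV. pmult (W (inc (Some i) zidx) t) (W (inc (Some i) (inc None zidx)) t))"
    and small: "t \<in> {0..T} \<Longrightarrow> bounded_by (1 / 2) (\<kappa> *\<^sub>R W (inc None zidx) t)"
begin

abbreviation "I \<equiv> {0..T}"

text \<open>Time and space directions are treated alike, so that the equation can be differentiated
  by a single induction over space-time multi-indices.\<close>

definition dirD :: "'n option \<Rightarrow> (real \<Rightarrow> 'n l2) \<Rightarrow> (real \<Rightarrow> 'n l2) \<Rightarrow> bool" where
  "dirD d A A' \<longleftrightarrow> (\<forall>t\<in>I. case d of None \<Rightarrow> (A has_vector_derivative A' t) (at t within I)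
      | Some i \<Rightarrow> has_D i (A t) (A' t))"

lemma dirD_unique:
  assumes "dirD d A A'" "dirD d B B'" "\<And>t. t \<in> I \<Longrightarrow> A t = B t" "t \<in> I"
  shows "A' t = B' t"
proof (cases d)
  case None
  have 1: "(A has_vector_derivative A' t) (at t within I)" "(B has_vector_derivative B' t) (at t within I)"
    using assms None by (auto simp: dirD_def)
  have "(A has_vector_derivative B' t) (at t within I)"
    by (rule has_vector_derivative_transform[OF assms(4) assms(3) 1(2)])
  moreover have "t \<in> cbox 0 T" "cbox 0 T = I" using assms(4) by auto
  ultimately show ?thesis using vector_derivative_unique_within_closed_interval[of 0 T t A] T 1(1)
    by (metis box_real(2))
next
  case (Some i)
  thus ?thesis using assms has_D_unique by (fastforce simp: dirD_def)
qed

lemma dirD_add: "dirD d A A' \<Longrightarrow> dirD d B B' \<Longrightarrow> dirD d (\<lambda>t. A t + B t) (\<lambda>t. A' t + B' t)"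
  unfolding dirD_def by (cases d) (auto intro: has_vector_derivative_add has_D_add)

lemma dirD_diff: "dirD d A A' \<Longrightarrow> dirD d B B' \<Longrightarrow> dirD d (\<lambda>t. A t - B t) (\<lambda>t. A' t - B' t)"
  unfolding dirD_def by (cases d) (auto intro: has_vector_derivative_diff has_D_diff)

lemma dirD_scaleR: "dirD d A A' \<Longrightarrow> dirD d (\<lambda>t. a *\<^sub>R A t) (\<lambda>t. a *\<^sub>R A' t)"
  unfolding dirD_def
  by (cases d) (auto intro: has_D_scaleR bounded_linear.has_vector_derivative[OF bounded_linear_scaleR_right])

lemma dirD_zero: "dirD d (\<lambda>t. 0) (\<lambda>t. 0)"
  unfolding dirD_def by (cases d) (auto intro: has_D_zero)

lemma dirD_sum: "(\<And>k. k \<in> J \<Longrightarrow> dirD d (A k) (A' k)) \<Longrightarrow> dirD d (\<lambda>t. \<Sum>k\<in>J. A k t) (\<lambda>t. \<Sum>k\<in>J. A' k t)"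
  by (induction J rule: infinite_finite_induct) (auto intro: dirD_add dirD_zero)

lemma W_Hs: "t \<in> I \<Longrightarrow> order p + r \<le> Suc m \<Longrightarrow> W p t \<in> Hs r"
  by (rule jet_Hs[where X = "\<lambda>p. W p t" and M = "Suc m"]) (auto intro: spat)

lemma dirD_W: "ok (inc d p) \<Longrightarrow> dirD d (W p) (W (inc d p))"
  using ok_order[of "inc d p"] by (cases d) (auto simp: dirD_def intro: deriv spat)

text \<open>The only index of order at most m + 1 that may fail to be ok is the one with time
  component m + 1. It follows that the spatial derivatives entering \<open>hn r (W p t)\<close> are
  ok together with p.\<close>

lemma ok_same_time:
  assumes "ok p" "q None = p None" "order q \<le> Suc m" shows "ok q"
proof (cases "order q \<le> m")
  case False
  hence oq: "order q = Suc m" using assms by simp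
  have split: "order r = r None + (\<Sum>i\<in>UNIV. r (Some i))" for r :: "'n idx"
    unfolding order_def by (simp add: UNIV_option_conv sum.reindex)
  show ?thesis
  proof (cases "\<exists>i. 0 < q (Some i)")
    case True
    then obtain i where i: "0 < q (Some i)" by blast
    define q' where "q' = q(Some i := q (Some i) - 1)"
    have e: "q = inc (Some i) q'" using i by (auto simp: q'_def inc_def fun_eq_iff)
    have "order q' = m" using oq e by (metis Suc_inject order_inc)
    thus ?thesis unfolding e by (intro ok_inc_Some) simp
  next
    case False
    hence z: "q (Some i) = 0" for i by auto
    hence "p None = Suc m" using split[of q] oq assms(2) by simp
    hence "p (Some i) = 0" for i using split[of p] ok_order[OF assms(1)] by simp
    hence "p d = q d" for d using z assms(2) by (cases d) auto
    hence "p = q" by (rule ext)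
    thus ?thesis using assms(1) by simp
  qed
qed (rule ok_le)

text \<open>Each spatial derivative of order at most r is differentiable in L2 as well, with the
  expected derivative; together they give differentiability in H^r. The quotient uses up one order,
  hence the bound m instead of m + 1.\<close>

lemma W_time_quotient_hn:
  assumes "ok (inc None p)" "order p + r \<le> m" "t \<in> I"
  shows "((\<lambda>s. hn r ((W p s - W p t) /\<^sub>R (s - t) - W (inc None p) t)) \<longlongrightarrow> 0) (at t within I)"
proof -
  let ?X = "\<lambda>s q. (W q s - W q t) /\<^sub>R (s - t) - W (inc None q) t"
  have "((\<lambda>s. hn r (?X s p)) \<longlongrightarrow> 0) (at t within I)"
  proof (rule jet_hn_tendsto[where X = ?X, OF _ assms(2)])
    show "\<forall>\<^sub>F s in at t within I. \<forall>q i. order q < m \<longrightarrow> has_D i (?X s q) (?X s (inc (Some i) q))"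
      unfolding eventually_at_filter using assms(3)
      by (intro always_eventually allI impI has_D_diff has_D_scaleR spat)
         (auto simp: inc_commute[of None "Some _"] intro!: spat)
    fix q :: "'n idx" assume q: "q None = p None" "order p \<le> order q" "order q \<le> order p + r"
    have "ok (inc None q)" by (rule ok_same_time[OF assms(1)]) (use q assms in auto)
    from deriv[OF this assms(3)]
    show "((\<lambda>s. ?X s q) \<longlongrightarrow> 0) (at t within I)"
      unfolding has_vector_derivative_iff_quotient by (rule LIM_zero)
  qed
  thus ?thesis .
qed

lemma W_space_quotient_hn:
  assumes "order p + r \<le> m" "t \<in> I"
  shows "((\<lambda>h. hn r ((tau (h *\<^sub>R axis i 1) (W p t) - W p t) /\<^sub>R h - W (inc (Some i) p) t)) \<longlongrightarrow> 0) (at 0)"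
proof -
  let ?X = "\<lambda>h q. (tau (h *\<^sub>R axis i 1) (W q t) - W q t) /\<^sub>R h - W (inc (Some i) q) t"
  have "((\<lambda>h. hn r (?X h p)) \<longlongrightarrow> 0) (at 0)"
  proof (rule jet_hn_tendsto[where X = ?X, OF _ assms(1)])
    show "\<forall>\<^sub>F h in at 0. \<forall>q j. order q < m \<longrightarrow> has_D j (?X h q) (?X h (inc (Some j) q))"
    proof (intro always_eventually allI impI)
      fix h :: real and q :: "'n idx" and j assume "order q < m"
      hence "has_D j (W q t) (W (inc (Some j) q) t)" "has_D j (W (inc (Some i) q) t) (W (inc (Some i) (inc (Some j) q)) t)"
        using spat[of q t j] spat[of "inc (Some i) q" t j] assms(2) by (simp_all add: inc_commute[of "Some j"])
      thus "has_D j (?X h q) (?X h (inc (Some j) q))"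
        by (intro has_D_diff has_D_scaleR has_D_tau)
    qed
    fix q :: "'n idx" assume q: "q None = p None" "order p \<le> order q" "order q \<le> order p + r"
    have "has_D i (W q t) (W (inc (Some i) q) t)" using q assms by (intro spat) auto
    thus "((\<lambda>h. ?X h q) \<longlongrightarrow> 0) (at 0)"
      unfolding has_D_quotient by (rule LIM_zero)
  qed
  thus ?thesis .
qed

lemma W_cont_hn:
  assumes "ok p" "order p + r \<le> Suc m" "t \<in> I"
  shows "((\<lambda>s. hn r (W p s - W p t)) \<longlongrightarrow> 0) (at t within I)"
proof -
  show ?thesis
  proof (rule jet_hn_tendsto[where X = "\<lambda>s q. W q s - W q t", OF _ assms(2)])
    show "\<forall>\<^sub>F s in at t within I. \<forall>q i. order q < Suc m \<longrightarrow> has_D i (W q s - W q t) (W (inc (Some i) q) s - W (inc (Some i) q) t)"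
      unfolding eventually_at_filter
    proof (intro always_eventually allI impI)
      fix s and q :: "'n idx" and i assume "s \<noteq> t" "s \<in> I" "order q < Suc m"
      thus "has_D i (W q s - W q t) (W (inc (Some i) q) s - W (inc (Some i) q) t)"
        using assms(3) by (intro has_D_diff spat) auto
    qed
    fix q :: "'n idx" assume q: "q None = p None" "order p \<le> order q" "order q \<le> order p + r"
    have "ok q" by (rule ok_same_time[OF assms(1)]) (use q assms in auto)
    hence "(W q \<longlongrightarrow> W q t) (at t within I)" using cont assms(3) by (auto simp: continuous_on_def)
    thus "((\<lambda>s. W q s - W q t) \<longlongrightarrow> 0) (at t within I)" by (rule LIM_zero)
  qed
qed

lemma big_le: "m - 2 \<le> s \<Longrightarrow> CARD('n) < 2 * s"
  using big by linarith

text \<open>The two factors have 2 (m + 1) - (order p + order q) >= m - 2 derivatives to spare,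
  which exceeds n/2.\<close>

lemma W_pmult_ok:
  assumes "t \<in> I" "order p \<le> Suc m" "order q \<le> Suc m" "order p + order q \<le> m + 4"
  shows "pmult_ok (W p t) (W q t)"
proof (rule product_estimate(1)[where ?s1.0 = "Suc m - order p" and ?s2.0 = "Suc m - order q"])
  show "CARD('n) < 2 * ((Suc m - order p) + (Suc m - order q))"
    by (rule big_le) (use assms in linarith)
qed (use assms in \<open>auto intro: W_Hs\<close>)

text \<open>One derivative of each factor is reserved for the quotient; 2 m - (order p + order q) >=
  m - 2 remain for the product estimate.\<close>

lemma dirD_pmult:
  assumes "ok (inc d p)" "ok (inc d q)" "order p + order q \<le> m + 2"
  shows "dirD d (\<lambda>t. pmult (W p t) (W q t))
     (\<lambda>t. pmult (W (inc d p) t) (W q t) + pmult (W p t) (W (inc d q) t))"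
proof -
  have le: "order p \<le> m" "order q \<le> m" using ok_order assms(1,2) by fastforce+
  have s: "CARD('n) < 2 * ((m - order p) + (m - order q))"
    by (rule big_le) (use assms le in linarith)
  show ?thesis
  proof (cases d)
    case None
    show ?thesis
      unfolding dirD_def None option.case
      by (intro ballI pmult_has_vector_derivative[OF s] W_Hs W_time_quotient_hn)
         (use assms le None in auto)
  next
    case (Some i)
    have "has_D i (pmult (W p t) (W q t)) (pmult (W (inc d p) t) (W q t) + pmult (W p t) (W (inc d q) t))" if t: "t \<in> I" for t
    proof -
      let ?F = "\<lambda>p h. tau (h *\<^sub>R axis i 1) (W p t)"
      have H: "?F r h \<in> Hs (m - order r)" if "order r \<le> m" for r h
      proof -
        have "W r t \<in> Hs (m - order r)" using that t by (intro W_Hs) auto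
        moreover have "invariant_contraction (tau (h *\<^sub>R axis i 1))"
          by (simp add: invariant_contraction_def bounded_linear_tau tau_tau add.commute)
        ultimately show ?thesis using invariant_contraction_hn by blast
      qed
      have "((\<lambda>h. pmult (?F p h) (?F q h)) has_vector_derivative
          pmult (W (inc d p) t) (?F q 0) + pmult (?F p 0) (W (inc d q) t)) (at 0 within UNIV)"
        by (intro pmult_has_vector_derivative[OF s] H W_Hs)
           (use W_space_quotient_hn[of p "m - order p" t i] W_space_quotient_hn[of q "m - order q" t i] le t Some in auto)
      moreover have "pmult (?F p h) (?F q h) = tau (h *\<^sub>R axis i 1) (pmult (W p t) (W q t))" for h
        using le t assms by (intro pmult_tau W_pmult_ok) auto
      ultimately show ?thesis by (simp add: has_D_def)
    qed
    thus ?thesis by (simp add: dirD_def Some)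
  qed
qed

lemma pmult_continuous:
  assumes "ok p" "ok q" "order p + order q \<le> m + 4"
  shows "continuous_on I (\<lambda>t. pmult (W p t) (W q t))"
  unfolding continuous_on_def
proof
  fix t assume t: "t \<in> I"
  have le: "order p \<le> Suc m" "order q \<le> Suc m" using ok_order assms by auto
  have s: "CARD('n) < 2 * ((Suc m - order p) + (Suc m - order q))"
    by (rule big_le) (use assms le in linarith)
  have ev: "\<forall>\<^sub>F s in at t within I. s \<in> I" by (simp add: eventually_at_filter)
  show "((\<lambda>t. pmult (W p t) (W q t)) \<longlongrightarrow> pmult (W p t) (W q t)) (at t within I)"
    by (rule pmult_tendsto[OF s])
       (use le t assms ev in \<open>auto intro!: W_Hs W_cont_hn elim!: eventually_mono\<close>)
qed

end

lemma product_const_mono: "s \<le> t \<Longrightarrow> product_const s \<le> product_const t"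
  unfolding product_const_def by (intro divide_right_mono mult_mono power_increasing) auto

lemma product_const_nonneg: "0 \<le> product_const s"
  by (simp add: product_const_def)

text \<open>The product rule doubles the number of terms at each differentiation, and the commutator
  adds 1 + n.\<close>

primrec quad_count :: "nat \<Rightarrow> nat \<Rightarrow> nat" where
  "quad_count n 0 = 0"
| "quad_count n (Suc k) = 2 * quad_count n k + 1 + n"

text \<open>The exponent 2 m + 1 bounds the sum of the Sobolev indices m + 1 - order p and m - order
  q used below, uniformly in p and q.\<close>

definition jet_const :: "nat \<Rightarrow> nat \<Rightarrow> real" where
  "jet_const n m = product_const (2 * m + 1) * real (Suc n) ^ (2 * m + 1)"

lemma jet_const_nonneg: "0 \<le> jet_const n m"
  by (simp add: jet_const_def product_const_nonneg)

section \<open>Source terms and the linearized equations\<close>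

context jets
begin

abbreviation "iT \<equiv> inc None zidx"
abbreviation "iX i \<equiv> inc (Some i) zidx"
abbreviation "tt p \<equiv> inc None (inc None p)"
abbreviation "xx i p \<equiv> inc (Some i) (inc (Some i) p)"
abbreviation "xt i p \<equiv> inc (Some i) (inc None p)"

definition \<delta> :: real where "\<delta> = max \<kappa> \<mu>"

lemma \<delta>: "0 \<le> \<delta>" "\<bar>\<kappa>\<bar> \<le> \<delta>" "\<bar>\<mu>\<bar> \<le> \<delta>" "\<kappa> \<le> \<delta>" "\<mu> \<le> \<delta>"
  using \<kappa> \<mu> by (auto simp: \<delta>_def)

text \<open>The error terms of the differentiated equation: \<open>quad k N F\<close> says that \<open>F\<close> is a sum of \<open>N\<close>
  products of two derivatives of the solution, each of order at least 2, of total order \<open>k + 3\<close>.\<close>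

inductive quad :: "nat \<Rightarrow> nat \<Rightarrow> (real \<Rightarrow> 'n l2) \<Rightarrow> bool" where
  quad_zero: "quad k 0 (\<lambda>t. 0)"
| quad_add: "quad k N F \<Longrightarrow> 2 \<le> order p \<Longrightarrow> 2 \<le> order q \<Longrightarrow> order p + order q = k + 3 \<Longrightarrow> \<bar>a\<bar> \<le> \<delta> \<Longrightarrow>
    quad k (Suc N) (\<lambda>t. F t + a *\<^sub>R pmult (W p t) (W q t))"

lemma quad_sum:
  assumes "finite J" "quad k N F"
    "\<And>i. i \<in> J \<Longrightarrow> 2 \<le> order (p i) \<and> 2 \<le> order (q i) \<and> order (p i) + order (q i) = k + 3"
  shows "quad k (N + card J) (\<lambda>t. F t + \<mu> *\<^sub>R (\<Sum>i\<in>J. pmult (W (p i) t) (W (q i) t)))"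
  using assms(1,3)
proof (induction J)
  case (insert j J)
  have "quad k (N + card J) (\<lambda>t. F t + \<mu> *\<^sub>R (\<Sum>i\<in>J. pmult (W (p i) t) (W (q i) t)))"
    using insert by auto
  from quad_add[OF this, of "p j" "q j" \<mu>] insert \<delta>(3)
  have "quad k (Suc (N + card J)) (\<lambda>t. F t + \<mu> *\<^sub>R (\<Sum>i\<in>J. pmult (W (p i) t) (W (q i) t)) + \<mu> *\<^sub>R pmult (W (p j) t) (W (q j) t))"
    by auto
  moreover have "(\<lambda>t. F t + \<mu> *\<^sub>R (\<Sum>i\<in>J. pmult (W (p i) t) (W (q i) t)) + \<mu> *\<^sub>R pmult (W (p j) t) (W (q j) t))
      = (\<lambda>t. F t + \<mu> *\<^sub>R (\<Sum>i\<in>insert j J. pmult (W (p i) t) (W (q i) t)))"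
    using insert.hyps by (simp add: scaleR_add_right add_ac)
  moreover have "Suc (N + card J) = N + card (insert j J)" using insert.hyps by simp
  ultimately show ?case by metis
qed (simp add: assms(2))

text \<open>Both factors have order at least 2 and total order k + 3, so each has order at most k +
  1, and at most k + 2 after differentiation.\<close>

lemma quad_dir:
  assumes "quad k N F" and "\<And>p. order p \<le> k + 2 \<Longrightarrow> ok p" "k + 1 \<le> m"
  shows "\<exists>F'. dirD d F F' \<and> quad (Suc k) (2 * N) F'"
  using assms
proof (induction rule: quad.induct)
  case (quad_zero k)
  thus ?case using dirD_zero quad.quad_zero by (intro exI[of _ "\<lambda>t. 0"]) auto
next
  case (quad_add k N F p q a)
  then obtain F' where F': "dirD d F F'" "quad (Suc k) (2 * N) F'" by blast
  let ?A = "\<lambda>t. pmult (W (inc d p) t) (W q t)" and ?B = "\<lambda>t. pmult (W p t) (W (inc d q) t)"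
  have "dirD d (\<lambda>t. F t + a *\<^sub>R pmult (W p t) (W q t)) (\<lambda>t. F' t + a *\<^sub>R (?A t + ?B t))"
    using quad_add by (intro dirD_add F'(1) dirD_scaleR dirD_pmult) auto
  moreover have "quad (Suc k) (Suc (Suc (2 * N))) (\<lambda>t. F' t + a *\<^sub>R ?A t + a *\<^sub>R ?B t)"
    using quad_add by (intro quad.quad_add F'(2)) auto
  ultimately show ?case by (intro exI[of _ "\<lambda>t. F' t + a *\<^sub>R (?A t + ?B t)"]) (simp add: scaleR_add_right add.assoc)
qed

lemma quad_continuous:
  assumes "quad k N F" and "\<And>p. order p \<le> k + 1 \<Longrightarrow> ok p" "k \<le> m"
  shows "continuous_on I F"
  using assms
proof (induction rule: quad.induct)
  case (quad_add k N F p q a)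
  thus ?case by (intro continuous_on_add continuous_on_scaleR continuous_on_const pmult_continuous) auto
qed simp

lemma W_hn_bound:
  assumes t: "t \<in> I" and p: "1 \<le> order p" "order p + r \<le> k" "k \<le> Suc m"
    and b: "\<And>q. 1 \<le> order q \<Longrightarrow> order q \<le> k \<Longrightarrow> norm (W q t) \<le> b"
  shows "hn r (W p t) \<le> real (Suc CARD('n)) ^ r * b"
proof (rule jet_hn[where X = "\<lambda>p. W p t" and M = "Suc m"])
  show "has_D i (W q t) (W (inc (Some i) q) t)" if "order q < Suc m" for q i
    using that t by (intro spat) auto
qed (use p b in auto)

text \<open>The factor p is measured with derivatives up to order m + 1, hence by b, and q only up
  to order m, hence by a. The Sobolev indices m + 1 - order p and m - order q add up to at least m -
  2.\<close>

lemma W_product_bound: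
  assumes t: "t \<in> I" and p: "1 \<le> order p" "order p \<le> Suc m" and q: "1 \<le> order q" "order q \<le> m"
    and pq: "order p + order q \<le> m + 3"
    and a: "\<And>q. 1 \<le> order q \<Longrightarrow> order q \<le> m \<Longrightarrow> norm (W q t) \<le> a"
    and b: "\<And>q. 1 \<le> order q \<Longrightarrow> order q \<le> Suc m \<Longrightarrow> norm (W q t) \<le> b"
  shows "norm (pmult (W p t) (W q t)) \<le> jet_const CARD('n) m * (a * b)"
proof -
  let ?s1 = "Suc m - order p" and ?s2 = "m - order q"
  have s: "CARD('n) < 2 * (?s1 + ?s2)" by (rule big_le) (use p q pq in linarith)
  have a0: "0 \<le> a" "0 \<le> b" using a[OF q] b[OF p] norm_ge_zero order_trans by blast+
  have "norm (pmult (W p t) (W q t)) \<le> product_const (?s1 + ?s2) * hn ?s1 (W p t) * hn ?s2 (W q t)"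
    using p q t by (intro product_estimate(2)[OF s] W_Hs) auto
  also have "\<dots> \<le> product_const (2 * m + 1) * (real (Suc CARD('n)) ^ ?s1 * b) * (real (Suc CARD('n)) ^ ?s2 * a)"
    using p q a0 by (intro mult_mono product_const_mono W_hn_bound[OF t _ _ _ b] W_hn_bound[OF t _ _ _ a])
      (auto simp: product_const_nonneg)
  also have "\<dots> = product_const (2 * m + 1) * real (Suc CARD('n)) ^ (?s1 + ?s2) * (a * b)"
    by (simp add: power_add mult_ac)
  also have "\<dots> \<le> product_const (2 * m + 1) * real (Suc CARD('n)) ^ (2 * m + 1) * (a * b)"
    using a0 by (intro mult_right_mono mult_left_mono power_increasing product_const_nonneg) auto
  finally show ?thesis by (simp add: jet_const_def)
qed

lemma quad_bound:
  assumes "quad k N F" and t: "t \<in> I" and k: "k \<le> m"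
    and a: "\<And>q. 1 \<le> order q \<Longrightarrow> order q \<le> m \<Longrightarrow> norm (W q t) \<le> a"
    and b: "\<And>q. 1 \<le> order q \<Longrightarrow> order q \<le> Suc m \<Longrightarrow> norm (W q t) \<le> b"
  shows "norm (F t) \<le> real N * (\<delta> * (jet_const CARD('n) m * (a * b)))"
  using assms(1) k
proof (induction rule: quad.induct)
  case (quad_add k N F p q e)
  have *: "norm (pmult (W p t) (W q t)) \<le> jet_const CARD('n) m * (a * b)"
  \<comment> \<open>The factor of smaller order has order at most (m + 3)/2, which is at most m
    because m >= 3; the other one has order at most k + 1 <= m + 1.\<close>
  proof (cases "order q \<le> order p")
    case True
    show ?thesis by (rule W_product_bound[OF t _ _ _ _ _ a b]) (use quad_add True m3 in auto)
  next
    case False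
    show ?thesis unfolding pmult_commute[of "W p t"]
      by (rule W_product_bound[OF t _ _ _ _ _ a b]) (use quad_add False m3 in auto)
  qed
  have "norm (e *\<^sub>R pmult (W p t) (W q t)) \<le> \<delta> * (jet_const CARD('n) m * (a * b))"
    using quad_add * \<delta>(1) by (auto intro!: mult_mono)
  with quad_add norm_triangle_ineq[of "F t" "e *\<^sub>R pmult (W p t) (W q t)"]
  show ?case by (simp add: algebra_simps)
qed simp

definition wave_at :: "'n idx \<Rightarrow> (real \<Rightarrow> 'n l2) \<Rightarrow> bool" where
  "wave_at p G \<longleftrightarrow> (\<forall>t\<in>I. W (tt p) t - \<kappa> *\<^sub>R pmult (W iT t) (W (tt p) t)
     = c\<^sup>2 *\<^sub>R (\<Sum>i\<in>UNIV. W (xx i p) t) + \<mu> *\<^sub>R (\<Sum>i\<in>UNIV. pmult (W (iX i) t) (W (xt i p) t)) + G t)"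

text \<open>The terms of the product rule in which the derivative falls on one of the coefficients
  \<open>W iT\<close> and \<open>W (iX i)\<close>, brought to the right-hand side.\<close>

definition commutator :: "'n option \<Rightarrow> 'n idx \<Rightarrow> real \<Rightarrow> 'n l2" where
  "commutator d p t = \<kappa> *\<^sub>R pmult (W (inc d iT) t) (W (tt p) t)
     + \<mu> *\<^sub>R (\<Sum>i\<in>UNIV. pmult (W (inc d (iX i)) t) (W (xt i p) t))"

lemma quad_commutator:
  assumes "quad (Suc k) N G" "order p = k"
  shows "quad (Suc k) (N + 1 + CARD('n)) (\<lambda>t. G t + commutator d p t)"
proof -
  have "quad (Suc k) (Suc N) (\<lambda>t. G t + \<kappa> *\<^sub>R pmult (W (inc d iT) t) (W (tt p) t))"
    using assms \<delta> by (intro quad_add) auto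
  from quad_sum[OF finite this, of UNIV "\<lambda>i. inc d (iX i)" "\<lambda>i. xt i p"] assms
  show ?thesis by (simp add: commutator_def add.assoc)
qed

text \<open>The two sides of the equation for a predecessor are the same curve, so their derivatives
  in direction d agree. The order stays below m since the equation contains derivatives of order
  \<open>order p + 2\<close>.\<close>

lemma wave_all:
  assumes "order p = k" "\<And>q. order q \<le> k + 2 \<Longrightarrow> ok q" "k + 1 \<le> m"
  shows "\<exists>G. quad k (quad_count CARD('n) k) G \<and> wave_at p G"
  using assms
proof (induction k arbitrary: p)
  case 0
  hence "p = zidx" by (intro order_zeroD)
  thus ?case using quad_zero wave by (intro exI[of _ "\<lambda>t. 0"]) (simp add: wave_at_def)
next
  case (Suc k)
  obtain d p' where p: "p = inc d p'" "order p' = k" using order_SucE[OF Suc.prems(1)] .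
  have okk: "order q \<le> k + 3 \<Longrightarrow> ok q" for q using Suc.prems(2)[of q] by simp
  obtain G where G: "quad k (quad_count CARD('n) k) G" "wave_at p' G"
    using Suc.IH[OF p(2)] okk Suc.prems(3) by force
  obtain G' where G': "dirD d G G'" "quad (Suc k) (2 * quad_count CARD('n) k) G'"
    using quad_dir[OF G(1), of d] okk Suc.prems(3) by force
  have L: "dirD d (\<lambda>t. W (tt p') t - \<kappa> *\<^sub>R pmult (W iT t) (W (tt p') t))
     (\<lambda>t. W (inc d (tt p')) t - \<kappa> *\<^sub>R (pmult (W (inc d iT) t) (W (tt p') t) + pmult (W iT t) (W (inc d (tt p')) t)))"
    using p(2) Suc.prems(3) m3 by (intro dirD_diff dirD_scaleR dirD_W dirD_pmult okk) auto
  have R: "dirD d (\<lambda>t. c\<^sup>2 *\<^sub>R (\<Sum>i\<in>UNIV. W (xx i p') t) + \<mu> *\<^sub>R (\<Sum>i\<in>UNIV. pmult (W (iX i) t) (W (xt i p') t)) + G t)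
     (\<lambda>t. c\<^sup>2 *\<^sub>R (\<Sum>i\<in>UNIV. W (inc d (xx i p')) t)
       + \<mu> *\<^sub>R (\<Sum>i\<in>UNIV. pmult (W (inc d (iX i)) t) (W (xt i p') t) + pmult (W (iX i) t) (W (inc d (xt i p')) t)) + G' t)"
    using p(2) Suc.prems(3) m3
    by (intro dirD_add dirD_scaleR dirD_sum dirD_W dirD_pmult okk G'(1)) auto
  have "wave_at p (\<lambda>t. G' t + commutator d p' t)"
    unfolding wave_at_def
  proof
    fix t assume t: "t \<in> I"
    from dirD_unique[OF L R _ t] G(2)
    have "W (inc d (tt p')) t - \<kappa> *\<^sub>R (pmult (W (inc d iT) t) (W (tt p') t) + pmult (W iT t) (W (inc d (tt p')) t))
      = c\<^sup>2 *\<^sub>R (\<Sum>i\<in>UNIV. W (inc d (xx i p')) t)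
       + \<mu> *\<^sub>R (\<Sum>i\<in>UNIV. pmult (W (inc d (iX i)) t) (W (xt i p') t) + pmult (W (iX i) t) (W (inc d (xt i p')) t)) + G' t"
      by (simp add: wave_at_def)
    thus "W (tt p) t - \<kappa> *\<^sub>R pmult (W iT t) (W (tt p) t)
     = c\<^sup>2 *\<^sub>R (\<Sum>i\<in>UNIV. W (xx i p) t) + \<mu> *\<^sub>R (\<Sum>i\<in>UNIV. pmult (W (iX i) t) (W (xt i p) t)) + (G' t + commutator d p' t)"
      unfolding p(1) commutator_def inc_commute[of _ d] sum.distrib scaleR_add_right
      by (simp add: algebra_simps)
  qed
  moreover have "quad (Suc k) (quad_count CARD('n) (Suc k)) (\<lambda>t. G' t + commutator d p' t)"
    using quad_commutator[OF G'(2) p(2)] by simp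
  ultimately show ?case by blast
qed

text \<open>As f is differentiable only in L2, all regularity must come from the other factor:
  \<open>W q\<close> with order q <= 2 has m - order q >= m - 2 > n/2 derivatives left for the
  product estimate, one more being spent on the quotient.\<close>

lemma has_D_pmult_W:
  assumes "t \<in> I" "order q \<le> 2" "has_D i f f'"
  shows "has_D i (pmult (W q t) f) (pmult (W (inc (Some i) q) t) f + pmult (W q t) f')"
proof -
  let ?s = "m - order q"
  have s: "CARD('n) < 2 * (?s + 0)" by (rule big_le) (use assms in linarith)
  let ?F = "\<lambda>h. tau (h *\<^sub>R axis i 1) (W q t)" and ?G = "\<lambda>h. tau (h *\<^sub>R axis i 1) f"
  have H: "?F h \<in> Hs ?s" for h
  proof -
    have "W q t \<in> Hs ?s" using assms m3 by (intro W_Hs) auto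
    moreover have "invariant_contraction (tau (h *\<^sub>R axis i 1))"
      by (simp add: invariant_contraction_def bounded_linear_tau tau_tau add.commute)
    ultimately show ?thesis using invariant_contraction_hn by blast
  qed
  have q: "((\<lambda>h. hn ?s ((?F h - ?F 0) /\<^sub>R (h - 0) - W (inc (Some i) q) t)) \<longlongrightarrow> 0) (at 0 within UNIV)"
    using W_space_quotient_hn[of q ?s t i] assms m3 by simp
  have f: "((\<lambda>h. hn 0 ((?G h - ?G 0) /\<^sub>R (h - 0) - f')) \<longlongrightarrow> 0) (at 0 within UNIV)"
    using assms(3) unfolding has_D_quotient by (simp add: tendsto_norm_zero LIM_zero)
  have "((\<lambda>h. pmult (?F h) (?G h)) has_vector_derivative
        pmult (W (inc (Some i) q) t) (?G 0) + pmult (?F 0) f') (at 0 within UNIV)"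
    by (rule pmult_has_vector_derivative[OF s _ H _ _ _ q f]) (use assms m3 in \<open>auto intro!: W_Hs simp del: Hs.simps(2)\<close>)
  moreover have "pmult_ok (W q t) f"
    by (rule product_estimate(1)[OF s]) (use assms m3 in \<open>auto intro: W_Hs\<close>)
  hence "pmult (?F h) (?G h) = tau (h *\<^sub>R axis i 1) (pmult (W q t) f)" for h
    by (rule pmult_tau)
  ultimately show ?thesis by (simp add: has_D_def)
qed

lemma pmult_ok_L2: "t \<in> I \<Longrightarrow> order q \<le> 2 \<Longrightarrow> pmult_ok (W q t) f"
  by (rule product_estimate(1)[where ?s1.0 = "m - order q" and ?s2.0 = 0])
     (use big m3 in \<open>auto intro!: W_Hs\<close>)

text \<open>A second derivative lies in H^(m-2), a space of bounded functions, and its norm there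
  involves only derivatives up to order m. This is what allows the bound by a instead of b.\<close>

lemma pmult_L2_bound:
  assumes t: "t \<in> I" and q: "order q = 2"
    and a: "\<And>q. 1 \<le> order q \<Longrightarrow> order q \<le> m \<Longrightarrow> norm (W q t) \<le> a"
  shows "norm (pmult (W q t) f) \<le> jet_const CARD('n) m * a * norm f"
proof -
  have s: "CARD('n) < 2 * ((m - 2) + 0)" using big by simp
  have "norm (W q t) \<le> a" by (rule a) (use q m3 in auto)
  hence a0: "0 \<le> a" using norm_ge_zero order_trans by blast
  have "norm (pmult (W q t) f) \<le> product_const (m - 2 + 0) * hn (m - 2) (W q t) * hn 0 f"
    using q t m3 by (intro product_estimate(2)[OF s] W_Hs) auto
  also have "\<dots> \<le> product_const (2 * m + 1) * (real (Suc CARD('n)) ^ (m - 2) * a) * norm f"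
    using q m3 by (intro mult_mono product_const_mono W_hn_bound[OF t _ _ _ a])
      (auto simp: product_const_nonneg a0)
  also have "\<dots> \<le> product_const (2 * m + 1) * (real (Suc CARD('n)) ^ (2 * m + 1) * a) * norm f"
    using a0 by (intro mult_right_mono mult_left_mono power_increasing product_const_nonneg) auto
  finally show ?thesis by (simp add: jet_const_def mult.assoc)
qed

section \<open>The energy identity\<close>

definition en :: "(real \<Rightarrow> 'n l2) \<Rightarrow> ('n \<Rightarrow> real \<Rightarrow> 'n l2) \<Rightarrow> real \<Rightarrow> real" where
  "en z1 y t = (norm (z1 t))\<^sup>2 - \<kappa> * inner (pmult (W iT t) (z1 t)) (z1 t) + c\<^sup>2 * (\<Sum>i\<in>UNIV. (norm (y i t))\<^sup>2)"

text \<open>The first term is the source, the second the time derivative of the coefficient 1 -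
  \<kappa> u_t. The third arises from the gradient term, since 2 <grad u . grad z_t, z_t> = -
  <(Laplacian u) z_t, z_t>.\<close>

definition en_rate :: "(real \<Rightarrow> 'n l2) \<Rightarrow> (real \<Rightarrow> 'n l2) \<Rightarrow> real \<Rightarrow> real" where
  "en_rate z1 R t = 2 * inner (R t) (z1 t) - \<kappa> * inner (pmult (W (inc None iT) t) (z1 t)) (z1 t)
     - \<mu> * (\<Sum>i\<in>UNIV. inner (pmult (W (inc (Some i) (iX i)) t) (z1 t)) (z1 t))"

text \<open>Energy identity for a solution \<open>z\<close> of the linearized equation with source \<open>R\<close>; here \<open>z1 = z\<^sub>t\<close>,
  \<open>z2 = z\<^sub>t\<^sub>t\<close>, and \<open>y i\<close>, \<open>y1 i\<close>, \<open>y2 i\<close> are the derivatives \<open>i\<close>, \<open>i t\<close>, \<open>i i\<close> of \<open>z\<close>.\<close>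

lemma energy_derivative:
  assumes J: "J \<subseteq> I" and t: "t \<in> J"
    and z1: "(z1 has_vector_derivative z2) (at t within J)"
    and y: "\<And>i. (y i has_vector_derivative y1 i) (at t within J)"
    and y2: "\<And>i. has_D i (y i t) (y2 i)" and y1: "\<And>i. has_D i (z1 t) (y1 i)"
    and eq: "z2 - \<kappa> *\<^sub>R pmult (W iT t) z2 = c\<^sup>2 *\<^sub>R (\<Sum>i\<in>UNIV. y2 i)
        + \<mu> *\<^sub>R (\<Sum>i\<in>UNIV. pmult (W (iX i) t) (y1 i)) + R t"
  shows "(en z1 y has_vector_derivative en_rate z1 R t) (at t within J)"
proof -
  have tI: "t \<in> I" using J t by blast
  have s: "CARD('n) < 2 * (m - 1 + 0)" by (rule big_le) linarith
  have ok_iT: "ok (inc None iT)" using m3 by (intro ok_le) auto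
  have 1: "((\<lambda>s. hn (m - 1) ((W iT s - W iT t) /\<^sub>R (s - t) - W (inc None iT) t)) \<longlongrightarrow> 0) (at t within J)"
    using W_time_quotient_hn[OF ok_iT, of "m - 1" t] tI m3 J by (auto intro: tendsto_within_subset)
  have 2: "((\<lambda>s. hn 0 ((z1 s - z1 t) /\<^sub>R (s - t) - z2)) \<longlongrightarrow> 0) (at t within J)"
    using z1 unfolding has_vector_derivative_iff_quotient by (simp add: tendsto_norm_zero LIM_zero)
  have p: "((\<lambda>s. pmult (W iT s) (z1 s)) has_vector_derivative pmult (W (inc None iT) t) (z1 t) + pmult (W iT t) z2) (at t within J)"
    by (rule pmult_has_vector_derivative[OF s t _ _ _ _ 1 2]) (use J tI m3 in \<open>auto intro!: W_Hs\<close>)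
  note inn = bounded_bilinear.has_vector_derivative[OF bounded_bilinear_inner]
  let ?d = "(inner (z1 t) z2 + inner z2 (z1 t))
      - \<kappa> * (inner (pmult (W iT t) (z1 t)) z2 + inner (pmult (W (inc None iT) t) (z1 t) + pmult (W iT t) z2) (z1 t))
      + c\<^sup>2 * (\<Sum>i\<in>UNIV. inner (y i t) (y1 i) + inner (y1 i) (y i t))"
  have "((\<lambda>s. inner (z1 s) (z1 s) - \<kappa> * inner (pmult (W iT s) (z1 s)) (z1 s) + c\<^sup>2 * (\<Sum>i\<in>UNIV. inner (y i s) (y i s)))
      has_vector_derivative ?d) (at t within J)"
    by (intro has_vector_derivative_add has_vector_derivative_diff has_vector_derivative_mult_right
        has_vector_derivative_sum inn z1 p y)
  moreover have "en z1 y = (\<lambda>s. inner (z1 s) (z1 s) - \<kappa> * inner (pmult (W iT s) (z1 s)) (z1 s) + c\<^sup>2 * (\<Sum>i\<in>UNIV. inner (y i s) (y i s)))"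
    by (simp add: en_def[abs_def] power2_norm_eq_inner)
  moreover have "?d = en_rate z1 R t"
  proof -
    have e1: "inner (pmult (W iT t) (z1 t)) z2 = inner (pmult (W iT t) z2) (z1 t)"
      using inner_pmult_swap[OF pmult_ok_L2[OF tI, of iT] pmult_ok_L2[OF tI, of iT]] by (simp add: inner_commute)
    \<comment> \<open>Integration by parts; the resulting sum cancels against the Laplacian in
      \<open>eq\<close>.\<close>
    have e2: "inner (y1 i) (y i t) = - inner (y2 i) (z1 t)" for i
      using inner_has_D[OF y1 y2] by (simp add: inner_commute)
    \<comment> \<open>The derivative i of the product of the coefficient and z_t is integrated
      against z_t. The term with the derivative of z_t appears on both sides, so only the derivative
      of the coefficient is left.\<close>
    have e3: "2 * inner (pmult (W (iX i) t) (y1 i)) (z1 t) = - inner (pmult (W (inc (Some i) (iX i)) t) (z1 t)) (z1 t)" for i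
    proof -
      have "inner (pmult (W (inc (Some i) (iX i)) t) (z1 t) + pmult (W (iX i) t) (y1 i)) (z1 t) = - inner (pmult (W (iX i) t) (z1 t)) (y1 i)"
        by (rule inner_has_D[OF has_D_pmult_W[OF tI _ y1] y1]) simp
      also have "inner (pmult (W (iX i) t) (z1 t)) (y1 i) = inner (pmult (W (iX i) t) (y1 i)) (z1 t)"
        using inner_pmult_swap[OF pmult_ok_L2[OF tI, of "iX i"] pmult_ok_L2[OF tI, of "iX i"]] by (simp add: inner_commute)
      finally show ?thesis by (simp add: inner_add_left)
    qed
    have e4: "2 * inner (z2 - \<kappa> *\<^sub>R pmult (W iT t) z2) (z1 t)
        = 2 * c\<^sup>2 * (\<Sum>i\<in>UNIV. inner (y2 i) (z1 t)) + \<mu> * (\<Sum>i\<in>UNIV. 2 * inner (pmult (W (iX i) t) (y1 i)) (z1 t)) + 2 * inner (R t) (z1 t)"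
      unfolding eq inner_add_left inner_scaleR_left inner_sum_left by (simp add: sum_distrib_left[symmetric])
    have e5: "inner (y i t) (y1 i) = - inner (y2 i) (z1 t)" for i
      using e2[of i] by (simp add: inner_commute)
    have "?d = 2 * inner (z2 - \<kappa> *\<^sub>R pmult (W iT t) z2) (z1 t) - \<kappa> * inner (pmult (W (inc None iT) t) (z1 t)) (z1 t)
        - 2 * c\<^sup>2 * (\<Sum>i\<in>UNIV. inner (y2 i) (z1 t))"
      unfolding e1 e2 e5 inner_commute[of "z1 t" z2] inner_add_left inner_diff_left inner_scaleR_left sum.distrib sum_negf
      by (simp add: algebra_simps)
    thus ?thesis unfolding e4 e3 by (simp add: en_rate_def sum_negf)
  qed
  ultimately show ?thesis by simp
qed

lemma energy_has_integral:
  assumes "0 \<le> t" "t \<le> T" and "\<And>s. s \<in> {0..t} \<Longrightarrow> (en z1 y has_vector_derivative en_rate z1 R s) (at s within {0..t})"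
  shows "(en_rate z1 R has_integral en z1 y t - en z1 y 0) {0..t}"
  using assms by (intro fundamental_theorem_of_calculus) auto

end

section \<open>Difference quotients and the energy inequality\<close>

lemma quad_count_mono: "k \<le> l \<Longrightarrow> quad_count n k \<le> quad_count n l"
  by (induction l rule: dec_induct) auto

locale jets_top = jets m T c \<kappa> \<mu> W ok for m T c \<kappa> \<mu> and W :: "'n::finite idx \<Rightarrow> real \<Rightarrow> 'n l2" and ok +
  assumes top: "order p \<le> Suc m \<Longrightarrow> ok p"
begin

text \<open>Both kinds of difference quotients are handled together. In time they need \<tau> + h <=
  T, and for this reason the lemmas below carry the condition t + h <= T.\<close>

definition shift :: "'n option \<Rightarrow> real \<Rightarrow> (real \<Rightarrow> 'n l2) \<Rightarrow> real \<Rightarrow> 'n l2" where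
  "shift d h A \<tau> = (case d of None \<Rightarrow> A (\<tau> + h) | Some i \<Rightarrow> tau (h *\<^sub>R axis i 1) (A \<tau>))"

definition dquot :: "'n option \<Rightarrow> real \<Rightarrow> (real \<Rightarrow> 'n l2) \<Rightarrow> real \<Rightarrow> 'n l2" where
  "dquot d h A \<tau> = (shift d h A \<tau> - A \<tau>) /\<^sub>R h"

lemma shift_has_vector_derivative:
  assumes A: "\<And>s. s \<in> I \<Longrightarrow> (A has_vector_derivative A' s) (at s within I)"
    and h: "0 \<le> h" "t + h \<le> T" and \<tau>: "\<tau> \<in> {0..t}"
  shows "(shift d h A has_vector_derivative shift d h A' \<tau>) (at \<tau> within {0..t})"
proof (cases d)
  case None
  have s: "((\<lambda>s. s + h) has_vector_derivative 1) (at \<tau> within {0..t})"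
    by (auto intro!: derivative_eq_intros)
  have "(A has_vector_derivative A' (\<tau> + h)) (at (\<tau> + h) within (\<lambda>s. s + h) ` {0..t})"
    by (rule has_vector_derivative_within_subset[OF A]) (use h \<tau> in auto)
  from vector_diff_chain_within[OF s this] show ?thesis
    by (simp add: None shift_def[abs_def] o_def)
next
  case (Some i)
  have "(A has_vector_derivative A' \<tau>) (at \<tau> within {0..t})"
    by (rule has_vector_derivative_within_subset[OF A]) (use h \<tau> in auto)
  from bounded_linear.has_vector_derivative[OF bounded_linear_tau this] show ?thesis
    by (simp add: Some shift_def[abs_def])
qed

lemma dquot_has_vector_derivative:
  assumes A: "\<And>s. s \<in> I \<Longrightarrow> (A has_vector_derivative A' s) (at s within I)"
    and h: "0 \<le> h" "t + h \<le> T" and \<tau>: "\<tau> \<in> {0..t}"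
  shows "(dquot d h A has_vector_derivative dquot d h A' \<tau>) (at \<tau> within {0..t})"
proof -
  have "(A has_vector_derivative A' \<tau>) (at \<tau> within {0..t})"
    by (rule has_vector_derivative_within_subset[OF A]) (use h \<tau> in auto)
  from bounded_linear.has_vector_derivative[OF bounded_linear_scaleR_right
      has_vector_derivative_diff[OF shift_has_vector_derivative[OF A h \<tau>] this]]
  show ?thesis by (simp add: dquot_def[abs_def])
qed

lemma dquot_has_D:
  assumes A: "\<And>s. s \<in> I \<Longrightarrow> has_D i (A s) (B s)"
    and h: "0 \<le> h" "t + h \<le> T" and \<tau>: "\<tau> \<in> {0..t}"
  shows "has_D i (dquot d h A \<tau>) (dquot d h B \<tau>)"
proof -
  have "has_D i (shift d h A \<tau>) (shift d h B \<tau>)"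
    using assms by (cases d) (auto simp: shift_def intro: has_D_tau)
  moreover have "has_D i (A \<tau>) (B \<tau>)" using assms by auto
  ultimately show ?thesis unfolding dquot_def by (intro has_D_scaleR has_D_diff)
qed

lemma shift_pmult:
  assumes "\<And>s. s \<in> I \<Longrightarrow> pmult_ok (A s) (B s)" and h: "0 \<le> h" "t + h \<le> T" and \<tau>: "\<tau> \<in> {0..t}"
  shows "shift d h (\<lambda>s. pmult (A s) (B s)) \<tau> = pmult (shift d h A \<tau>) (shift d h B \<tau>)"
proof (cases d)
  case (Some i)
  have "pmult_ok (A \<tau>) (B \<tau>)" using assms by auto
  from pmult_tau[OF this] show ?thesis by (simp add: shift_def Some)
qed (simp add: shift_def)

lemma shift_add: "shift d h (\<lambda>s. A s + B s) \<tau> = shift d h A \<tau> + shift d h B \<tau>"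
  by (cases d) (simp_all add: shift_def tau_add)

lemma shift_diff: "shift d h (\<lambda>s. A s - B s) \<tau> = shift d h A \<tau> - shift d h B \<tau>"
  by (cases d) (simp_all add: shift_def tau_diff)

lemma shift_scaleR: "shift d h (\<lambda>s. e *\<^sub>R A s) \<tau> = e *\<^sub>R shift d h A \<tau>"
  by (cases d) (simp_all add: shift_def tau_scaleR)

lemma shift_sum: "shift d h (\<lambda>s. \<Sum>k\<in>K. A k s) \<tau> = (\<Sum>k\<in>K. shift d h (A k) \<tau>)"
  by (cases d) (simp_all add: shift_def linear_sum[OF bounded_linear.linear[OF bounded_linear_tau]] o_def)

lemma shift_Hs:
  assumes "\<And>s. s \<in> I \<Longrightarrow> A s \<in> Hs r" and h: "0 \<le> h" "t + h \<le> T" and \<tau>: "\<tau> \<in> {0..t}"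
  shows "shift d h A \<tau> \<in> Hs r"
proof (cases d)
  case (Some i)
  have "invariant_contraction (tau (h *\<^sub>R axis i 1))"
    by (simp add: invariant_contraction_def bounded_linear_tau tau_tau add.commute)
  moreover have "A \<tau> \<in> Hs r" using assms by auto
  ultimately show ?thesis using invariant_contraction_hn by (auto simp: shift_def Some)
qed (use assms in \<open>auto simp: shift_def\<close>)

lemma shift_norm_le:
  assumes "\<And>s. s \<in> I \<Longrightarrow> norm (A s) \<le> B" and h: "0 \<le> h" "t + h \<le> T" and \<tau>: "\<tau> \<in> {0..t}"
  shows "norm (shift d h A \<tau>) \<le> B"
  using assms by (cases d) (auto simp: shift_def)

text \<open>The mean value inequality, in time or along the translates, bounds the quotient by the
  derivative independently of h. These are the bounds needed for dominated convergence.\<close>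

lemma dquot_norm_le:
  assumes A: "dirD d A A'" and B: "\<And>s. s \<in> I \<Longrightarrow> norm (A' s) \<le> B"
    and h: "0 < h" "t + h \<le> T" and \<tau>: "\<tau> \<in> {0..t}"
  shows "norm (dquot d h A \<tau>) \<le> B"
proof -
  have "norm (shift d h A \<tau> - A \<tau>) \<le> B * h"
  proof (cases d)
    case None
    have "norm (A (\<tau> + h) - A \<tau>) \<le> B * norm ((\<tau> + h) - \<tau>)"
    proof (rule differentiable_bound[where S = I and f' = "\<lambda>s x. x *\<^sub>R A' s"])
      show "(A has_derivative (\<lambda>x. x *\<^sub>R A' s)) (at s within I)" if "s \<in> I" for s
        using A that by (auto simp: dirD_def None has_vector_derivative_def)
      show "onorm (\<lambda>x. x *\<^sub>R A' s) \<le> B" if "s \<in> I" for s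
        by (rule onorm_le) (use mult_right_mono[OF B[OF that] abs_ge_zero] in \<open>simp add: mult.commute\<close>)
    qed (use h \<tau> in auto)
    thus ?thesis using h by (simp add: shift_def None)
  next
    case (Some i)
    have "\<tau> \<in> I" using h \<tau> by auto
    hence "has_D i (A \<tau>) (A' \<tau>)" "norm (A' \<tau>) \<le> B" using A B by (auto simp: dirD_def Some)
    have "norm (tau (h *\<^sub>R axis i 1) (A \<tau>) - A \<tau>) \<le> \<bar>h\<bar> * norm (A' \<tau>)"
      by (rule tau_difference_bound) fact
    also have "\<dots> \<le> \<bar>h\<bar> * B" by (rule mult_left_mono) (fact, simp)
    finally show ?thesis using h by (simp add: shift_def Some mult.commute)
  qed
  hence le: "inverse h * norm (shift d h A \<tau> - A \<tau>) \<le> inverse h * (B * h)"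
    using h by (intro mult_left_mono) auto
  have "norm (dquot d h A \<tau>) = inverse h * norm (shift d h A \<tau> - A \<tau>)"
    using h by (simp add: dquot_def)
  also note le
  also have "inverse h * (B * h) = B" using h by simp
  finally show ?thesis .
qed

context
  fixes t :: real and hs :: "nat \<Rightarrow> real"
  assumes t: "0 \<le> t" "t < T" and hs: "\<And>k. 0 < hs k" "\<And>k. t + hs k \<le> T" "hs \<longlonglongrightarrow> 0"
begin

lemma hs_at_0: "filterlim hs (at 0) sequentially"
  using hs by (auto simp: filterlim_at less_imp_neq[symmetric] intro!: always_eventually)

lemma hs_at:
  assumes "\<tau> \<in> {0..t}" shows "filterlim (\<lambda>k. \<tau> + hs k) (at \<tau> within I) sequentially"
  unfolding filterlim_at
proof
  show "\<forall>\<^sub>F k in sequentially. \<tau> + hs k \<in> I \<and> \<tau> + hs k \<noteq> \<tau>"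
  proof (intro always_eventually allI)
    fix k show "\<tau> + hs k \<in> I \<and> \<tau> + hs k \<noteq> \<tau>" using hs(1)[of k] hs(2)[of k] assms by auto
  qed
  show "(\<lambda>k. \<tau> + hs k) \<longlonglongrightarrow> \<tau>" using tendsto_add[OF tendsto_const hs(3), of \<tau>] by simp
qed

lemma dquot_tendsto:
  assumes "dirD d A A'" "\<tau> \<in> {0..t}"
  shows "(\<lambda>k. dquot d (hs k) A \<tau>) \<longlonglongrightarrow> A' \<tau>"
proof -
  have \<tau>: "\<tau> \<in> I" using assms t by auto
  show ?thesis
  proof (cases d)
    case None
    have "((\<lambda>s. (A s - A \<tau>) /\<^sub>R (s - \<tau>)) \<longlongrightarrow> A' \<tau>) (at \<tau> within I)"
      using assms \<tau> by (auto simp: dirD_def None has_vector_derivative_iff_quotient)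
    from filterlim_compose[OF this hs_at[OF assms(2)]] show ?thesis
      by (simp add: dquot_def shift_def None)
  next
    case (Some i)
    have "((\<lambda>h. (tau (h *\<^sub>R axis i 1) (A \<tau>) - A \<tau>) /\<^sub>R h) \<longlongrightarrow> A' \<tau>) (at 0)"
      using assms \<tau> by (auto simp: dirD_def Some has_D_quotient)
    from filterlim_compose[OF this hs_at_0] show ?thesis
      by (simp add: dquot_def shift_def Some)
  qed
qed

lemma dquot_hn_tendsto:
  assumes "order q + r \<le> m" "\<tau> \<in> {0..t}"
  shows "(\<lambda>k. hn r (dquot d (hs k) (W q) \<tau> - W (inc d q) \<tau>)) \<longlonglongrightarrow> 0"
proof -
  have \<tau>: "\<tau> \<in> I" using assms t by auto
  show ?thesis
  proof (cases d)
    case None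
    have "ok (inc None q)" using assms by (intro top) simp
    from filterlim_compose[OF W_time_quotient_hn[OF this assms(1) \<tau>] hs_at[OF assms(2)]] show ?thesis
      by (simp add: dquot_def shift_def None)
  next
    case (Some i)
    from filterlim_compose[OF W_space_quotient_hn[OF assms(1) \<tau>] hs_at_0] show ?thesis
      by (simp add: dquot_def shift_def Some)
  qed
qed

lemma shift_tendsto:
  assumes "continuous_on I A" "\<tau> \<in> {0..t}"
  shows "(\<lambda>k. shift d (hs k) A \<tau>) \<longlonglongrightarrow> A \<tau>"
proof (cases d)
  case None
  have "(A \<longlongrightarrow> A \<tau>) (at \<tau> within I)" using assms t by (auto simp: continuous_on_def)
  from filterlim_compose[OF this hs_at[OF assms(2)]] show ?thesis by (simp add: shift_def None)
next
  case (Some i)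
  have "(\<lambda>k. tau (hs k *\<^sub>R axis i 1) (A \<tau>)) \<longlonglongrightarrow> tau (0 *\<^sub>R axis i 1) (A \<tau>)"
    by (rule continuous_on_tendsto_compose[OF tau_continuous]) (intro tendsto_intros hs(3), auto)
  thus ?thesis by (simp add: shift_def Some)
qed

end

text \<open>Finitely many continuous curves on a compact interval. The bound depends on the solution
  and is used only for domination.\<close>

lemma W_bounded: obtains B where "\<And>q s. order q \<le> Suc m \<Longrightarrow> s \<in> I \<Longrightarrow> norm (W q s) \<le> B"
proof -
  have "\<exists>B. \<forall>s\<in>I. norm (W q s) \<le> B" if "order q \<le> Suc m" for q
  proof -
    have "compact (W q ` I)" by (intro compact_continuous_image cont top that) simp
    from compact_imp_bounded[OF this] show ?thesis by (auto simp: bounded_iff)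
  qed
  then obtain b where b: "\<And>q s. order q \<le> Suc m \<Longrightarrow> s \<in> I \<Longrightarrow> norm (W q s) \<le> b q" by metis
  have fin: "finite {q :: 'n idx. order q \<le> Suc m}" by (rule finite_order_le)
  have "norm (W q s) \<le> (\<Sum>q\<in>{q. order q \<le> Suc m}. \<bar>b q\<bar>)" if "order q \<le> Suc m" "s \<in> I" for q s
  proof -
    have "norm (W q s) \<le> \<bar>b q\<bar>" using b[OF that] by linarith
    also have "\<dots> \<le> (\<Sum>q\<in>{q. order q \<le> Suc m}. \<bar>b q\<bar>)"
      using that fin by (intro member_le_sum) auto
    finally show ?thesis .
  qed
  thus thesis by (rule that)
qed

text \<open>The integrated identity makes sense for order p = m as well, although its differentiated
  form would need second derivatives of \<open>W p\<close>. The end t = T is excluded to leave room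
  for forward steps in time.\<close>

definition energy_rate_ok :: "'n idx \<Rightarrow> bool" where
  "energy_rate_ok p \<longleftrightarrow> (\<exists>R N. quad (order p) N R \<and> N \<le> quad_count CARD('n) m \<and>
     (\<forall>t\<in>{0..<T}. (en_rate (W (inc None p)) R has_integral
        en (W (inc None p)) (\<lambda>i. W (inc (Some i) p)) t - en (W (inc None p)) (\<lambda>i. W (inc (Some i) p)) 0) {0..t}))"

lemma W_vd: "order p \<le> m \<Longrightarrow> s \<in> I \<Longrightarrow> (W p has_vector_derivative W (inc None p) s) (at s within I)"
  by (intro deriv top) auto

lemma energy_rate_low:
  assumes "order p + 1 \<le> m" shows "energy_rate_ok p"
proof -
  obtain G where G: "quad (order p) (quad_count CARD('n) (order p)) G" "wave_at p G"
    using wave_all[OF refl, of p] top assms by (metis add_Suc_right le_trans Suc_eq_plus1 add_2_eq_Suc' not_less_eq_eq)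
  have "(en_rate (W (inc None p)) G has_integral
        en (W (inc None p)) (\<lambda>i. W (inc (Some i) p)) t - en (W (inc None p)) (\<lambda>i. W (inc (Some i) p)) 0) {0..t}"
    if t: "t \<in> {0..<T}" for t
  proof (rule energy_has_integral)
    fix s assume s: "s \<in> {0..t}"
    hence sI: "s \<in> I" using t by auto
    have sub: "(F has_vector_derivative F') (at s within {0..t})" if "(F has_vector_derivative F') (at s within I)" for F :: "real \<Rightarrow> 'n l2" and F'
      by (rule has_vector_derivative_within_subset[OF that]) (use t in auto)
    show "(en (W (inc None p)) (\<lambda>i. W (inc (Some i) p)) has_vector_derivative en_rate (W (inc None p)) G s) (at s within {0..t})"
    proof (rule energy_derivative[where ?z2.0 = "W (tt p) s" and ?y1.0 = "\<lambda>i. W (xt i p) s" and ?y2.0 = "\<lambda>i. W (xx i p) s"])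
      show "(W (inc (Some i) p) has_vector_derivative W (xt i p) s) (at s within {0..t})" for i
        using W_vd[of "inc (Some i) p" s] assms sI by (intro sub) (simp add: inc_commute[of None])
      show "W (tt p) s - \<kappa> *\<^sub>R pmult (W iT s) (W (tt p) s) = c\<^sup>2 *\<^sub>R (\<Sum>i\<in>UNIV. W (xx i p) s)
        + \<mu> *\<^sub>R (\<Sum>i\<in>UNIV. pmult (W (iX i) s) (W (xt i p) s)) + G s"
        using G(2) sI by (simp add: wave_at_def)
    qed (use assms s sI t in \<open>auto intro!: sub W_vd spat\<close>)
  qed (use t in auto)
  thus ?thesis unfolding energy_rate_ok_def
    using G(1) quad_count_mono[of "order p" m "CARD('n)"] assms by (intro exI[of _ G] exI conjI) auto
qed

lemma L2_pmult_ok: "t \<in> I \<Longrightarrow> f \<in> Hs (m - 1) \<Longrightarrow> pmult_ok (f :: 'n l2) g"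
  by (rule product_estimate(1)[where ?s1.0 = "m - 1" and ?s2.0 = 0]) (use big in auto)

text \<open>Differencing is arranged so that the coefficients next to the unknown remain unshifted,
  as \<open>energy_derivative\<close> requires; the differences of the coefficients, multiplied by
  shifted second derivatives, go into the source.\<close>

lemma difference_wave:
  fixes d :: "'n option"
  assumes G: "wave_at p G" and p: "order p + 1 = m"
    and h: "0 < h" "t + h \<le> T" and s: "s \<in> {0..t}"
  defines "q \<equiv> dquot d h"
  shows "q (W (tt p)) s - \<kappa> *\<^sub>R pmult (W iT s) (q (W (tt p)) s) = c\<^sup>2 *\<^sub>R (\<Sum>i\<in>UNIV. q (W (xx i p)) s)
     + \<mu> *\<^sub>R (\<Sum>i\<in>UNIV. pmult (W (iX i) s) (q (W (xt i p)) s))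
     + (\<kappa> *\<^sub>R pmult (q (W iT) s) (shift d h (W (tt p)) s)
        + \<mu> *\<^sub>R (\<Sum>i\<in>UNIV. pmult (q (W (iX i)) s) (shift d h (W (xt i p)) s)) + q G s)"
proof -
  let ?S = "\<lambda>A. shift d h A s"
  have h': "0 \<le> h" using h by simp
  have sI: "s \<in> I" using s h by auto
  have H: "W r s' \<in> Hs (m - 1)" if "s' \<in> I" "order r = 1" for r s'
    using that m3 by (intro W_Hs) auto
  have HS: "?S (W r) \<in> Hs (m - 1)" if "order r = 1" for r
    by (rule shift_Hs[OF H[OF _ that] h' h(2) s])
  \<comment> \<open>Discrete product rule: the difference of a product is (difference of the first)
    times (shifted second) plus (first) times (difference of the second).\<close>
  have P: "pmult (?S (W r)) (?S (W r')) - pmult (W r s) (W r' s)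
      = h *\<^sub>R (pmult (q (W r) s) (?S (W r')) + pmult (W r s) (q (W r') s))" if "order r = 1" for r r'
  proof -
    have ok1: "pmult_ok (?S (W r)) f" "pmult_ok (W r s) f" for f
      using L2_pmult_ok[OF sI] HS H[OF sI] that by auto
    have e1: "pmult (q (W r) s) (?S (W r')) = (pmult (?S (W r)) (?S (W r')) - pmult (W r s) (?S (W r'))) /\<^sub>R h"
      unfolding q_def dquot_def by (simp add: pmult_scaleR_left pmult_diff_left pmult_ok_diff ok1)
    have e2: "pmult (W r s) (q (W r') s) = (pmult (W r s) (?S (W r')) - pmult (W r s) (W r' s)) /\<^sub>R h"
      unfolding q_def dquot_def by (simp add: pmult_scaleR_right pmult_diff_right ok1)
    show ?thesis unfolding e1 e2 using h by (simp add: scaleR_add_right)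
  qed
  have Sp: "shift d h (\<lambda>t. pmult (W r t) (W r' t)) s = pmult (?S (W r)) (?S (W r'))" if "order r = 1" for r r'
    by (rule shift_pmult[OF _ h' h(2) s]) (use L2_pmult_ok H that in blast)
  have E0: "W (tt p) s' - \<kappa> *\<^sub>R pmult (W iT s') (W (tt p) s')
     = c\<^sup>2 *\<^sub>R (\<Sum>i\<in>UNIV. W (xx i p) s') + \<mu> *\<^sub>R (\<Sum>i\<in>UNIV. pmult (W (iX i) s') (W (xt i p) s')) + G s'" if "s' \<in> I" for s'
    using G that by (simp add: wave_at_def)
  have "shift d h (\<lambda>t. W (tt p) t - \<kappa> *\<^sub>R pmult (W iT t) (W (tt p) t)) s
     = shift d h (\<lambda>t. c\<^sup>2 *\<^sub>R (\<Sum>i\<in>UNIV. W (xx i p) t) + \<mu> *\<^sub>R (\<Sum>i\<in>UNIV. pmult (W (iX i) t) (W (xt i p) t)) + G t) s"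
  proof (cases d)
    case None
    have "s + h \<in> I" using s h by auto
    thus ?thesis using E0 by (simp add: shift_def None)
  qed (use E0 sI in \<open>simp add: shift_def\<close>)
  hence E1: "?S (W (tt p)) - \<kappa> *\<^sub>R pmult (?S (W iT)) (?S (W (tt p)))
     = c\<^sup>2 *\<^sub>R (\<Sum>i\<in>UNIV. ?S (W (xx i p))) + \<mu> *\<^sub>R (\<Sum>i\<in>UNIV. pmult (?S (W (iX i))) (?S (W (xt i p)))) + ?S G"
    by (simp add: shift_add shift_diff shift_scaleR shift_sum Sp)
  have hq: "h *\<^sub>R q A s = ?S A - A s" for A using h by (simp add: q_def dquot_def)
  have "h *\<^sub>R (q (W (tt p)) s - \<kappa> *\<^sub>R pmult (W iT s) (q (W (tt p)) s) - \<kappa> *\<^sub>R pmult (q (W iT) s) (?S (W (tt p))))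
      = h *\<^sub>R q (W (tt p)) s - \<kappa> *\<^sub>R (h *\<^sub>R (pmult (q (W iT) s) (?S (W (tt p))) + pmult (W iT s) (q (W (tt p)) s)))"
    by (simp add: scaleR_diff_right scaleR_add_right mult.commute)
  also have "\<dots> = (?S (W (tt p)) - W (tt p) s) - \<kappa> *\<^sub>R (pmult (?S (W iT)) (?S (W (tt p))) - pmult (W iT s) (W (tt p) s))"
    by (simp add: hq P)
  also have "\<dots> = (?S (W (tt p)) - \<kappa> *\<^sub>R pmult (?S (W iT)) (?S (W (tt p)))) - (W (tt p) s - \<kappa> *\<^sub>R pmult (W iT s) (W (tt p) s))"
    by (simp add: scaleR_diff_right)
  also have "\<dots> = c\<^sup>2 *\<^sub>R (\<Sum>i\<in>UNIV. ?S (W (xx i p)) - W (xx i p) s)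
      + \<mu> *\<^sub>R (\<Sum>i\<in>UNIV. pmult (?S (W (iX i))) (?S (W (xt i p))) - pmult (W (iX i) s) (W (xt i p) s)) + (?S G - G s)"
    unfolding E1 E0[OF sI] by (simp add: scaleR_diff_right sum_subtractf)
  also have "\<dots> = h *\<^sub>R (c\<^sup>2 *\<^sub>R (\<Sum>i\<in>UNIV. q (W (xx i p)) s)
     + \<mu> *\<^sub>R (\<Sum>i\<in>UNIV. pmult (q (W (iX i)) s) (?S (W (xt i p))) + pmult (W (iX i) s) (q (W (xt i p)) s)) + q G s)"
    by (simp add: hq[symmetric] P scaleR_add_right scaleR_sum_right sum.distrib mult.commute)
  finally have "q (W (tt p)) s - \<kappa> *\<^sub>R pmult (W iT s) (q (W (tt p)) s) - \<kappa> *\<^sub>R pmult (q (W iT) s) (?S (W (tt p)))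
     = c\<^sup>2 *\<^sub>R (\<Sum>i\<in>UNIV. q (W (xx i p)) s)
     + \<mu> *\<^sub>R (\<Sum>i\<in>UNIV. pmult (q (W (iX i)) s) (?S (W (xt i p))) + pmult (W (iX i) s) (q (W (xt i p)) s)) + q G s"
    using h by simp
  thus ?thesis by (simp add: sum.distrib scaleR_add_right algebra_simps)
qed

end

context jets_top
begin

lemma pmult_const_tendsto:
  assumes "\<tau> \<in> I" "order q \<le> 2" "F \<longlonglongrightarrow> f"
  shows "(\<lambda>k. pmult (W q \<tau>) (F k)) \<longlonglongrightarrow> pmult (W q \<tau>) f"
proof -
  have s: "CARD('n) < 2 * ((m - 2) + 0)" using big by simp
  have H: "W q \<tau> \<in> Hs (m - 2)" using assms m3 by (intro W_Hs) auto
  have z: "hn (m - 2) (W q \<tau> - W q \<tau>) = 0" using Hs_scaleR_hn[OF H, of 0] by simp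
  show ?thesis
    by (rule pmult_tendsto[OF s H]) (use H z assms(3) in \<open>auto simp: tendsto_norm_zero LIM_zero\<close>)
qed

lemma en_rate_tendsto:
  assumes \<tau>: "\<tau> \<in> I" and z: "(\<lambda>k. z k \<tau>) \<longlonglongrightarrow> z' \<tau>" and R: "(\<lambda>k. R k \<tau>) \<longlonglongrightarrow> R' \<tau>"
  shows "(\<lambda>k. en_rate (z k) (R k) \<tau>) \<longlonglongrightarrow> en_rate z' R' \<tau>"
  unfolding en_rate_def
  by (intro tendsto_intros pmult_const_tendsto \<tau> z R) auto

lemma en_tendsto:
  assumes \<tau>: "\<tau> \<in> I" and z: "(\<lambda>k. z k \<tau>) \<longlonglongrightarrow> z' \<tau>" and y: "\<And>i. (\<lambda>k. y k i \<tau>) \<longlonglongrightarrow> y' i \<tau>"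
  shows "(\<lambda>k. en (z k) (y k) \<tau>) \<longlonglongrightarrow> en z' y' \<tau>"
  unfolding en_def
  by (intro tendsto_intros pmult_const_tendsto \<tau> z y) auto

lemma en_rate_abs:
  assumes \<tau>: "\<tau> \<in> I" and a: "\<And>q. 1 \<le> order q \<Longrightarrow> order q \<le> m \<Longrightarrow> norm (W q \<tau>) \<le> a"
  shows "\<bar>en_rate z R \<tau>\<bar> \<le> 2 * (norm (R \<tau>) * norm (z \<tau>))
     + \<delta> * real (Suc CARD('n)) * (jet_const CARD('n) m * a * (norm (z \<tau>))\<^sup>2)"
proof -
  have p: "\<bar>inner (pmult (W q \<tau>) (z \<tau>)) (z \<tau>)\<bar> \<le> jet_const CARD('n) m * a * (norm (z \<tau>))\<^sup>2" if "order q = 2" for q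
  proof -
    have "\<bar>inner (pmult (W q \<tau>) (z \<tau>)) (z \<tau>)\<bar> \<le> norm (pmult (W q \<tau>) (z \<tau>)) * norm (z \<tau>)"
      by (rule Cauchy_Schwarz_ineq2)
    also have "\<dots> \<le> (jet_const CARD('n) m * a * norm (z \<tau>)) * norm (z \<tau>)"
      by (intro mult_right_mono pmult_L2_bound[OF \<tau> that a]) auto
    finally show ?thesis by (simp add: power2_eq_square mult_ac)
  qed
  let ?K = "jet_const CARD('n) m * a * (norm (z \<tau>))\<^sup>2"
  have K0: "0 \<le> ?K" using p[of "inc None iT"] by (simp add: order_trans[OF abs_ge_zero])
  have 1: "\<bar>2 * inner (R \<tau>) (z \<tau>)\<bar> \<le> 2 * (norm (R \<tau>) * norm (z \<tau>))"
    using Cauchy_Schwarz_ineq2[of "R \<tau>" "z \<tau>"] by simp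
  have 2: "\<bar>\<kappa> * inner (pmult (W (inc None iT) \<tau>) (z \<tau>)) (z \<tau>)\<bar> \<le> \<delta> * ?K"
    unfolding abs_mult using \<delta> p[of "inc None iT"] by (intro mult_mono) auto
  have 3: "\<bar>\<mu> * (\<Sum>i\<in>UNIV. inner (pmult (W (inc (Some i) (iX i)) \<tau>) (z \<tau>)) (z \<tau>))\<bar> \<le> \<delta> * (real CARD('n) * ?K)"
  proof -
    have "\<bar>\<Sum>i\<in>UNIV. inner (pmult (W (inc (Some i) (iX i)) \<tau>) (z \<tau>)) (z \<tau>)\<bar> \<le> (\<Sum>i\<in>(UNIV::'n set). ?K)"
      by (rule order_trans[OF sum_abs]) (intro sum_mono p, simp)
    thus ?thesis unfolding abs_mult using \<delta> by (intro mult_mono) auto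
  qed
  have "\<bar>en_rate z R \<tau>\<bar> \<le> \<bar>2 * inner (R \<tau>) (z \<tau>)\<bar> + \<bar>\<kappa> * inner (pmult (W (inc None iT) \<tau>) (z \<tau>)) (z \<tau>)\<bar>
     + \<bar>\<mu> * (\<Sum>i\<in>UNIV. inner (pmult (W (inc (Some i) (iX i)) \<tau>) (z \<tau>)) (z \<tau>))\<bar>"
    unfolding en_rate_def by linarith
  also have "\<dots> \<le> 2 * (norm (R \<tau>) * norm (z \<tau>)) + \<delta> * ?K + \<delta> * (real CARD('n) * ?K)"
    using 1 2 3 by linarith
  finally show ?thesis by (simp add: algebra_simps)
qed

lemma dquot_Hs:
  assumes "\<And>s. s \<in> I \<Longrightarrow> A s \<in> Hs r" and h: "0 \<le> h" "t + h \<le> T" and \<tau>: "\<tau> \<in> {0..t}"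
  shows "dquot d h A \<tau> \<in> Hs r"
proof -
  have "A \<tau> \<in> Hs r" using assms by auto
  moreover have "shift d h A \<tau> \<in> Hs r" by (rule shift_Hs[OF assms(1) h \<tau>])
  ultimately have "shift d h A \<tau> - A \<tau> \<in> Hs r" by (intro Hs_diff)
  thus ?thesis unfolding dquot_def by (rule Hs_scaleR_hn[THEN conjunct1])
qed

lemma dquot_hn_le:
  assumes B: "\<And>q s. order q \<le> Suc m \<Longrightarrow> s \<in> I \<Longrightarrow> norm (W q s) \<le> B"
    and h: "0 < h" "t + h \<le> T" and \<tau>: "\<tau> \<in> {0..t}" and q: "order q + r \<le> m"
  shows "hn r (dquot d h (W q) \<tau>) \<le> real (Suc CARD('n)) ^ r * B"
proof (rule jet_hn[where X = "\<lambda>q. dquot d h (W q) \<tau>", OF _ q])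
  show "has_D i (dquot d h (W q) \<tau>) (dquot d h (W (inc (Some i) q)) \<tau>)" if "order q < m" for q i
    using that h \<tau> by (intro dquot_has_D[OF spat]) auto
  show "norm (dquot d h (W q') \<tau>) \<le> B" if "order q' \<le> order q + r" for q'
    by (rule dquot_norm_le[OF dirD_W B h \<tau>]) (use that q in \<open>auto intro: top\<close>)
qed

text \<open>One direction d is split off p. The energy identity holds for the difference quotients
  in direction d of a derivative of order m - 1, and its integrated form passes to the limit by
  dominated convergence; derivatives of order m + 1 suffice for the limit.\<close>

lemma energy_rate_order_m:
  assumes pm: "order p = m" shows "energy_rate_ok p"
proof -
  obtain d p' where p: "p = inc d p'" "order p' = m - 1"
    using order_SucE[of p "m - 1"] pm m3 by auto
  have p'm: "order p' + 1 = m" "Suc (m - 1) = m" using p(2) m3 by auto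
  obtain G where G: "quad (m - 1) (quad_count CARD('n) (m - 1)) G" "wave_at p' G"
    using wave_all[OF p(2)] top p'm by force
  obtain G' where G': "dirD d G G'" "quad m (2 * quad_count CARD('n) (m - 1)) G'"
    using quad_dir[OF G(1), of d] top p'm by force
  define R where "R = (\<lambda>t. G' t + commutator d p' t)"
  have "quad m (quad_count CARD('n) (Suc (m - 1))) R"
    unfolding quad_count.simps R_def
    using quad_commutator[of "m - 1" "2 * quad_count CARD('n) (m - 1)" G' p' d] G'(2) p(2) unfolding p'm(2) by blast
  hence R: "quad (order p) (quad_count CARD('n) m) R" unfolding p'm(2) pm .
  obtain B where B: "\<And>q s. order q \<le> Suc m \<Longrightarrow> s \<in> I \<Longrightarrow> norm (W q s) \<le> B" using W_bounded by blast
  have "norm (W zidx 0) \<le> B" by (rule B) (use T in auto)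
  hence B0: "0 \<le> B" using norm_ge_zero order_trans by blast
  obtain BG where BG: "\<And>s. s \<in> I \<Longrightarrow> norm (G' s) \<le> BG"
  proof -
    have "compact (G' ` I)" by (intro compact_continuous_image quad_continuous[OF G'(2)] top) auto
    then obtain x where "\<forall>s\<in>I. norm (G' s) \<le> x" by (auto simp: bounded_iff dest!: compact_imp_bounded)
    thus thesis by (intro that[of x]) auto
  qed

  have vd: "\<And>q s. order q \<le> m \<Longrightarrow> s \<in> I \<Longrightarrow> (W q has_vector_derivative W (inc None q) s) (at s within I)"
    by (rule W_vd)
  have W1: "W r s \<in> Hs (m - 1)" if "order r = 1" "s \<in> I" for r s using that m3 by (intro W_Hs) auto
  have main: "(en_rate (W (inc None p)) R has_integral
        en (W (inc None p)) (\<lambda>i. W (inc (Some i) p)) t - en (W (inc None p)) (\<lambda>i. W (inc (Some i) p)) 0) {0..t}"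
    if t: "t \<in> {0..<T}" for t
  proof -
    \<comment> \<open>Positive steps tending to 0 with t + hs k <= T, available since t < T.\<close>
    define hs where "hs k = (T - t) / real (Suc k)" for k
    have hs1: "0 < hs k" for k using t by (simp add: hs_def)
    have hs2: "t + hs k \<le> T" for k
    proof -
      have "(T - t) / real (Suc k) \<le> (T - t) / 1" using t by (intro divide_left_mono) auto
      thus ?thesis by (simp add: hs_def)
    qed
    have "(\<lambda>k. (T - t) * (1 / real (Suc k))) \<longlonglongrightarrow> (T - t) * 0"
      by (intro tendsto_intros LIMSEQ_Suc lim_1_over_n)
    hence hs3: "hs \<longlonglongrightarrow> 0" by (simp add: hs_def[abs_def])
    have t': "0 \<le> t" "t < T" "t \<le> T" using t by auto
    note lims = dquot_tendsto[OF t'(1,2) hs1 hs2 hs3] dquot_hn_tendsto[OF t'(1,2) hs1 hs2 hs3] shift_tendsto[OF t'(1,2) hs1 hs2 hs3]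
    let ?q = "\<lambda>k. dquot d (hs k)" and ?S = "\<lambda>k. shift d (hs k)"
    define z1 where "z1 k = ?q k (W (inc None p'))" for k
    define y where "y k i = ?q k (W (inc (Some i) p'))" for k i
    define Rk where "Rk k s = \<kappa> *\<^sub>R pmult (?q k (W iT) s) (?S k (W (tt p')) s)
        + \<mu> *\<^sub>R (\<Sum>i\<in>UNIV. pmult (?q k (W (iX i)) s) (?S k (W (xt i p')) s)) + ?q k G s" for k s
    have int: "(en_rate (z1 k) (Rk k) has_integral en (z1 k) (y k) t - en (z1 k) (y k) 0) {0..t}" for k
    proof (rule energy_has_integral[OF t'(1,3)])
      fix s assume s: "s \<in> {0..t}"
      have h: "0 \<le> hs k" using hs1[of k] by simp
      show "(en (z1 k) (y k) has_vector_derivative en_rate (z1 k) (Rk k) s) (at s within {0..t})"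
      proof (rule energy_derivative[where ?z2.0 = "?q k (W (tt p')) s" and ?y1.0 = "\<lambda>i. ?q k (W (xt i p')) s" and ?y2.0 = "\<lambda>i. ?q k (W (xx i p')) s"])
        show "(y k i has_vector_derivative ?q k (W (xt i p')) s) (at s within {0..t})" for i
          unfolding y_def using p'm
          by (intro dquot_has_vector_derivative[OF _ h hs2 s]) (simp add: vd inc_commute[of "Some i" None])
        show "(z1 k has_vector_derivative ?q k (W (tt p')) s) (at s within {0..t})"
          unfolding z1_def using p'm by (intro dquot_has_vector_derivative[OF _ h hs2 s] vd) auto
        show "has_D i (y k i s) (?q k (W (xx i p')) s)" "has_D i (z1 k s) (?q k (W (xt i p')) s)" for i
          unfolding y_def z1_def using p'm by (auto intro!: dquot_has_D[OF spat h hs2 s])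
        show "?q k (W (tt p')) s - \<kappa> *\<^sub>R pmult (W iT s) (?q k (W (tt p')) s) = c\<^sup>2 *\<^sub>R (\<Sum>i\<in>UNIV. ?q k (W (xx i p')) s)
            + \<mu> *\<^sub>R (\<Sum>i\<in>UNIV. pmult (W (iX i) s) (?q k (W (xt i p')) s)) + Rk k s"
          unfolding Rk_def by (rule difference_wave[OF G(2) p'm(1) hs1 hs2 s])
      qed (use s t' in auto)
    qed
    have zlim: "(\<lambda>k. z1 k \<tau>) \<longlonglongrightarrow> W (inc None p) \<tau>" if "\<tau> \<in> {0..t}" for \<tau>
      unfolding z1_def p(1) inc_commute[of None] using that p'm by (intro lims(1) dirD_W top) auto
    have ylim: "(\<lambda>k. y k i \<tau>) \<longlonglongrightarrow> W (inc (Some i) p) \<tau>" if "\<tau> \<in> {0..t}" for \<tau> i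
      unfolding y_def p(1) inc_commute[of "Some i"] using that p'm by (intro lims(1) dirD_W top) auto
    have s0: "CARD('n) < 2 * ((m - 1) + 0)" by (rule big_le) linarith
    have plim: "(\<lambda>k. pmult (?q k (W r) \<tau>) (?S k (W r') \<tau>)) \<longlonglongrightarrow> pmult (W (inc d r) \<tau>) (W r' \<tau>)"
      if \<tau>: "\<tau> \<in> {0..t}" and r: "order r = 1" "order r' \<le> Suc m" for r r' \<tau>
    \<comment> \<open>The difference quotient converges in H^(m-1); the shifted factor, of order up
      to m + 1, converges only in L2.\<close>
    proof (rule pmult_tendsto[OF s0])
      show "W (inc d r) \<tau> \<in> Hs (m - 1)" using r \<tau> t' m3 by (intro W_Hs) auto
      show "\<forall>\<^sub>F k in sequentially. ?q k (W r) \<tau> \<in> Hs (m - 1)"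
        using r hs1 by (intro always_eventually allI dquot_Hs[OF W1 _ hs2 \<tau>]) (auto intro: less_imp_le)
      show "(\<lambda>k. hn (m - 1) (?q k (W r) \<tau> - W (inc d r) \<tau>)) \<longlonglongrightarrow> 0"
        using r m3 by (intro lims(2) \<tau>) auto
      have "(\<lambda>k. ?S k (W r') \<tau>) \<longlonglongrightarrow> W r' \<tau>" using r by (intro lims(3) \<tau> cont top) auto
      thus "(\<lambda>k. hn 0 (?S k (W r') \<tau> - W r' \<tau>)) \<longlonglongrightarrow> 0" by (simp add: tendsto_norm_zero LIM_zero)
    qed auto
    have Rlim: "(\<lambda>k. Rk k \<tau>) \<longlonglongrightarrow> R \<tau>" if \<tau>: "\<tau> \<in> {0..t}" for \<tau>
    proof -
      have "(\<lambda>k. Rk k \<tau>) \<longlonglongrightarrow> \<kappa> *\<^sub>R pmult (W (inc d iT) \<tau>) (W (tt p') \<tau>)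
         + \<mu> *\<^sub>R (\<Sum>i\<in>UNIV. pmult (W (inc d (iX i)) \<tau>) (W (xt i p') \<tau>)) + G' \<tau>"
        unfolding Rk_def using p'm \<tau> by (intro tendsto_intros plim lims(1) G'(1)) auto
      thus ?thesis by (simp add: R_def commutator_def add_ac)
    qed
    \<comment> \<open>\<open>C1\<close>, \<open>C2\<close> and \<open>C3\<close> depend on the
      solution. They dominate the integrands uniformly in k and do not enter the final
      estimate.\<close>
    define C1 where "C1 = product_const (m - 1) * (real (Suc CARD('n)) ^ (m - 1) * B) * B"
    have pb: "norm (pmult (?q k (W r) \<tau>) (?S k (W r') \<tau>)) \<le> C1"
      if \<tau>: "\<tau> \<in> {0..t}" and r: "order r = 1" "order r' \<le> Suc m" for r r' \<tau> k
    proof -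
      have h: "0 \<le> hs k" using hs1[of k] by simp
      have "norm (pmult (?q k (W r) \<tau>) (?S k (W r') \<tau>)) \<le> product_const (m - 1 + 0) * hn (m - 1) (?q k (W r) \<tau>) * hn 0 (?S k (W r') \<tau>)"
        by (intro product_estimate(2)[OF s0] dquot_Hs[OF W1 h hs2 \<tau>] r) auto
      also have "\<dots> \<le> product_const (m - 1 + 0) * (real (Suc CARD('n)) ^ (m - 1) * B) * B"
        using r m3 B0 h
        by (intro mult_mono dquot_hn_le[OF B hs1 hs2 \<tau>]) (auto simp: product_const_nonneg intro!: shift_norm_le[OF B h hs2 \<tau>])
      finally show ?thesis by (simp add: C1_def)
    qed
    define C2 where "C2 = \<kappa> * C1 + \<mu> * (real CARD('n) * C1) + BG"
    have Rb: "norm (Rk k \<tau>) \<le> C2" if \<tau>: "\<tau> \<in> {0..t}" for k \<tau>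
    proof -
      have "norm (\<kappa> *\<^sub>R pmult (?q k (W iT) \<tau>) (?S k (W (tt p')) \<tau>)) \<le> \<kappa> * C1"
        using \<kappa> p'm by (simp add: mult_left_mono pb[OF \<tau>])
      moreover have "norm (\<mu> *\<^sub>R (\<Sum>i\<in>UNIV. pmult (?q k (W (iX i)) \<tau>) (?S k (W (xt i p')) \<tau>))) \<le> \<mu> * (real CARD('n) * C1)"
      proof -
        have "norm (\<Sum>i\<in>UNIV. pmult (?q k (W (iX i)) \<tau>) (?S k (W (xt i p')) \<tau>)) \<le> (\<Sum>i\<in>(UNIV::'n set). C1)"
          using p'm by (intro sum_norm_le pb[OF \<tau>]) auto
        thus ?thesis using \<mu> by (simp add: mult_left_mono)
      qed
      moreover have "norm (?q k G \<tau>) \<le> BG" by (rule dquot_norm_le[OF G'(1) BG hs1 hs2 \<tau>])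
      ultimately show ?thesis unfolding Rk_def C2_def
        by (intro norm_triangle_le add_mono) auto
    qed
    have zb: "norm (z1 k \<tau>) \<le> B" if "\<tau> \<in> {0..t}" for k \<tau>
      unfolding z1_def by (rule dquot_norm_le[OF dirD_W B hs1 hs2 that]) (use p'm in \<open>auto intro: top\<close>)
    define C3 where "C3 = 2 * (C2 * B) + \<delta> * real (Suc CARD('n)) * (jet_const CARD('n) m * B * B\<^sup>2)"
    have eb: "norm (en_rate (z1 k) (Rk k) \<tau>) \<le> C3" if \<tau>: "\<tau> \<in> {0..t}" for k \<tau>
    proof -
      have "\<tau> \<in> I" using \<tau> t' by auto
      hence "\<bar>en_rate (z1 k) (Rk k) \<tau>\<bar> \<le> 2 * (norm (Rk k \<tau>) * norm (z1 k \<tau>))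
         + \<delta> * real (Suc CARD('n)) * (jet_const CARD('n) m * B * (norm (z1 k \<tau>))\<^sup>2)"
        by (rule en_rate_abs) (use B \<open>\<tau> \<in> I\<close> in auto)
      also have "\<dots> \<le> C3"
      proof -
        have C2: "0 \<le> C2" using Rb[OF \<tau>] norm_ge_zero order_trans by blast
        have "2 * (norm (Rk k \<tau>) * norm (z1 k \<tau>)) \<le> 2 * (C2 * B)"
          using Rb[OF \<tau>] zb[OF \<tau>] C2 by (intro mult_left_mono mult_mono) auto
        moreover have "\<delta> * real (Suc CARD('n)) * (jet_const CARD('n) m * B * (norm (z1 k \<tau>))\<^sup>2)
            \<le> \<delta> * real (Suc CARD('n)) * (jet_const CARD('n) m * B * B\<^sup>2)"
          using zb[OF \<tau>] B0 \<delta>(1) jet_const_nonneg by (intro mult_left_mono power_mono mult_nonneg_nonneg) auto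
        ultimately show ?thesis by (simp add: C3_def)
      qed
      finally show ?thesis by simp
    qed
    have dom: "en_rate (W (inc None p)) R integrable_on {0..t}"
      "(\<lambda>k. integral {0..t} (en_rate (z1 k) (Rk k))) \<longlonglongrightarrow> integral {0..t} (en_rate (W (inc None p)) R)"
    proof -
      have 1: "en_rate (z1 k) (Rk k) integrable_on {0..t}" for k using int by blast
      have 2: "(\<lambda>_. C3) integrable_on {0..t}" by (rule integrable_const_ivl)
      have 3: "(\<lambda>k. en_rate (z1 k) (Rk k) \<tau>) \<longlonglongrightarrow> en_rate (W (inc None p)) R \<tau>" if "\<tau> \<in> {0..t}" for \<tau>
        using that t' by (intro en_rate_tendsto zlim Rlim) auto
      show "en_rate (W (inc None p)) R integrable_on {0..t}"
        "(\<lambda>k. integral {0..t} (en_rate (z1 k) (Rk k))) \<longlonglongrightarrow> integral {0..t} (en_rate (W (inc None p)) R)"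
        using dominated_convergence[OF 1 2 eb 3] by auto
    qed
    have "integral {0..t} (en_rate (z1 k) (Rk k)) = en (z1 k) (y k) t - en (z1 k) (y k) 0" for k
      using int by (rule integral_unique)
    moreover have "(\<lambda>k. en (z1 k) (y k) t - en (z1 k) (y k) 0) \<longlonglongrightarrow>
        en (W (inc None p)) (\<lambda>i. W (inc (Some i) p)) t - en (W (inc None p)) (\<lambda>i. W (inc (Some i) p)) 0"
      using t' by (intro tendsto_diff en_tendsto zlim ylim) auto
    ultimately have "integral {0..t} (en_rate (W (inc None p)) R)
        = en (W (inc None p)) (\<lambda>i. W (inc (Some i) p)) t - en (W (inc None p)) (\<lambda>i. W (inc (Some i) p)) 0"
      using dom(2) LIMSEQ_unique by simp blast
    thus ?thesis using dom(1) by (metis integrable_integral)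
  qed
  show ?thesis unfolding energy_rate_ok_def using R main by blast
qed

text \<open>All contributions to \<open>en_rate\<close> are cubic: the source terms paired with z_t,
  and the n + 1 terms with a differentiated coefficient. In each of them one factor is measured by a
  and the two others by b.\<close>

lemma energy_inequality:
  assumes p: "order p \<le> m" and t: "t \<in> {0..<T}"
    and a: "\<And>s q. s \<in> I \<Longrightarrow> 1 \<le> order q \<Longrightarrow> order q \<le> m \<Longrightarrow> norm (W q s) \<le> a s"
    and b: "\<And>s q. s \<in> I \<Longrightarrow> 1 \<le> order q \<Longrightarrow> order q \<le> Suc m \<Longrightarrow> norm (W q s) \<le> b s"
    and ab: "(\<lambda>s. a s * (b s)\<^sup>2) integrable_on {0..t}"
  shows "en (W (inc None p)) (\<lambda>i. W (inc (Some i) p)) t \<le> en (W (inc None p)) (\<lambda>i. W (inc (Some i) p)) 0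
    + (2 * real (quad_count CARD('n) m) + real (Suc CARD('n))) * jet_const CARD('n) m * \<delta> * integral {0..t} (\<lambda>s. a s * (b s)\<^sup>2)"
proof -
  have "energy_rate_ok p"
    using energy_rate_low[of p] energy_rate_order_m[of p] p by (cases "order p = m") auto
  then obtain R N where R: "quad (order p) N R" "N \<le> quad_count CARD('n) m"
    "(en_rate (W (inc None p)) R has_integral
        en (W (inc None p)) (\<lambda>i. W (inc (Some i) p)) t - en (W (inc None p)) (\<lambda>i. W (inc (Some i) p)) 0) {0..t}"
    using t unfolding energy_rate_ok_def by blast
  let ?K = "(2 * real (quad_count CARD('n) m) + real (Suc CARD('n))) * jet_const CARD('n) m * \<delta>"
  have le: "en_rate (W (inc None p)) R s \<le> ?K * (a s * (b s)\<^sup>2)" if s: "s \<in> {0..t}" for s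
  proof -
    have sI: "s \<in> I" using s t by auto
    let ?z = "norm (W (inc None p) s)"
    have z: "?z \<le> b s" using b[OF sI, of "inc None p"] p by simp
    have "norm (W iT s) \<le> a s" by (rule a[OF sI]) (use m3 in auto)
    hence a0: "0 \<le> a s" using norm_ge_zero order_trans by blast
    have b0: "0 \<le> b s" using z norm_ge_zero order_trans by blast
    have J0: "0 \<le> jet_const CARD('n) m" by (rule jet_const_nonneg)
    have "norm (R s) \<le> real N * (\<delta> * (jet_const CARD('n) m * (a s * b s)))"
      by (rule quad_bound[OF R(1) sI p a[OF sI] b[OF sI]])
    also have "\<dots> \<le> real (quad_count CARD('n) m) * (\<delta> * (jet_const CARD('n) m * (a s * b s)))"
      using R(2) \<delta>(1) a0 b0 J0 by (intro mult_right_mono) auto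
    finally have "norm (R s) * ?z \<le> real (quad_count CARD('n) m) * (\<delta> * (jet_const CARD('n) m * (a s * b s))) * b s"
      using z \<delta>(1) a0 b0 J0 by (intro mult_mono) auto
    moreover have "\<delta> * real (Suc CARD('n)) * (jet_const CARD('n) m * a s * ?z\<^sup>2)
        \<le> \<delta> * real (Suc CARD('n)) * (jet_const CARD('n) m * a s * (b s)\<^sup>2)"
      using z \<delta>(1) a0 J0 by (intro mult_left_mono power_mono mult_nonneg_nonneg) auto
    moreover have "\<bar>en_rate (W (inc None p)) R s\<bar> \<le> 2 * (norm (R s) * ?z) + \<delta> * real (Suc CARD('n)) * (jet_const CARD('n) m * a s * ?z\<^sup>2)"
      by (rule en_rate_abs[OF sI a[OF sI]])
    ultimately have "\<bar>en_rate (W (inc None p)) R s\<bar> \<le> 2 * (real (quad_count CARD('n) m) * (\<delta> * (jet_const CARD('n) m * (a s * b s))) * b s)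
        + \<delta> * real (Suc CARD('n)) * (jet_const CARD('n) m * a s * (b s)\<^sup>2)" by linarith
    also have "\<dots> = ?K * (a s * (b s)\<^sup>2)" by (simp add: power2_eq_square algebra_simps)
    finally show ?thesis by linarith
  qed
  have "((\<lambda>s. ?K * (a s * (b s)\<^sup>2)) has_integral ?K * integral {0..t} (\<lambda>s. a s * (b s)\<^sup>2)) {0..t}"
    using integrable_integral[OF ab] by (rule has_integral_mult_right)
  from has_integral_le[OF R(3) this le] show ?thesis by linarith
qed

end

section \<open>Summation over all derivatives\<close>

definition dec :: "'n option \<Rightarrow> 'n idx \<Rightarrow> 'n idx" where "dec d p = p(d := p d - 1)"

lemma dec_inc [simp]: "dec d (inc d p) = p"
  by (auto simp: dec_def inc_def)

lemma inc_dec: "0 < p d \<Longrightarrow> inc d (dec d p) = p"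
  by (auto simp: dec_def inc_def)

definition space_support :: "'n::finite idx \<Rightarrow> nat" where
  "space_support p = card {i. 0 < p (Some i)}"

text \<open>Weights for the sum of the energies of all derivatives of order at most \<open>m\<close>. A mixed derivative
  \<open>q\<close> occurs in the energy of \<open>q - e\<^sub>t\<close> and in those of all \<open>q - e\<^sub>i\<close>; dividing by the size of the support
  keeps the total coefficient of \<open>q\<close> bounded independently of the dimension.\<close>

definition weight :: "real \<Rightarrow> 'n::finite idx \<Rightarrow> real" where
  "weight M p = (if p None = 0 then M else 2 * M / (real (space_support p) + 1))"

definition time_idx :: "nat \<Rightarrow> 'n::finite idx set" where
  "time_idx k = {q. order q \<le> k \<and> 1 \<le> q None}"

definition space_idx :: "nat \<Rightarrow> 'n::finite idx set" where
  "space_idx k = {p. order p \<le> k \<and> p None = 0}"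

lemma finite_time_idx: "finite (time_idx k)" and finite_space_idx: "finite (space_idx k)"
  unfolding time_idx_def space_idx_def by (auto intro: finite_subset[OF _ finite_order_le])

lemma space_support_dec:
  assumes "0 < q (Some i)"
  shows "space_support (dec (Some i) q) \<le> space_support q" "space_support q \<le> Suc (space_support (dec (Some i) q))"
proof -
  have 1: "{j. 0 < dec (Some i) q (Some j)} \<subseteq> {j. 0 < q (Some j)}" by (auto simp: dec_def split: if_splits)
  show "space_support (dec (Some i) q) \<le> space_support q"
    unfolding space_support_def by (rule card_mono[OF _ 1]) simp
  have "{j. 0 < q (Some j)} \<subseteq> insert i {j. 0 < dec (Some i) q (Some j)}" by (auto simp: dec_def)
  from card_mono[OF _ this] show "space_support q \<le> Suc (space_support (dec (Some i) q))"
    unfolding space_support_def by (simp add: card_insert_if split: if_splits)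
qed

text \<open>The weight that q receives through the gradient terms, from the energies of all its
  spatial predecessors.\<close>

definition weight_sum :: "real \<Rightarrow> 'n::finite idx \<Rightarrow> real" where
  "weight_sum M q = (\<Sum>i\<in>{i. 0 < q (Some i)}. weight M (dec (Some i) q))"

text \<open>With s the size of the support of q, there are s summands, each between 2M/(s + 1) and
  2M/s, as a predecessor has support s or s - 1. For s >= 1 the sum lies between 2Ms/(s + 1) >= M
  and 2M.\<close>

lemma weight_sum_bounds:
  assumes M: "0 \<le> M" and q: "1 \<le> q None"
  shows "0 < space_support q \<Longrightarrow> M \<le> weight_sum M q" "weight_sum M q \<le> 2 * M" "0 \<le> weight_sum M q"
proof -
  let ?s = "space_support q"
  have w: "2 * M / (real ?s + 1) \<le> weight M (dec (Some i) q)" "weight M (dec (Some i) q) \<le> 2 * M / real ?s"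
    if "0 < q (Some i)" for i
  proof -
    note sd = space_support_dec[of q i, OF that]
    have "{j. 0 < q (Some j)} \<noteq> {}" using that by blast
    hence s0: "0 < ?s" by (simp add: space_support_def card_gt_0_iff)
    have "weight M (dec (Some i) q) = 2 * M / (real (space_support (dec (Some i) q)) + 1)"
      using q by (simp add: weight_def dec_def)
    moreover have "2 * M / (real ?s + 1) \<le> 2 * M / (real (space_support (dec (Some i) q)) + 1)"
      using sd M by (intro divide_left_mono) auto
    moreover have "2 * M / (real (space_support (dec (Some i) q)) + 1) \<le> 2 * M / real ?s"
      using sd M s0 by (intro divide_left_mono) auto
    ultimately show "2 * M / (real ?s + 1) \<le> weight M (dec (Some i) q)" "weight M (dec (Some i) q) \<le> 2 * M / real ?s"
      by auto
  qed
  have "weight_sum M q \<le> (\<Sum>i\<in>{i. 0 < q (Some i)}. 2 * M / real ?s)"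
    unfolding weight_sum_def by (intro sum_mono w) auto
  also have "\<dots> = real ?s * (2 * M / real ?s)" by (simp add: space_support_def)
  also have "\<dots> \<le> 2 * M" using M by (cases "?s = 0") auto
  finally show "weight_sum M q \<le> 2 * M" .
  show "0 \<le> weight_sum M q"
    unfolding weight_sum_def using M by (intro sum_nonneg) (auto simp: weight_def)
  assume s: "0 < ?s"
  have "M \<le> real ?s * (2 * M / (real ?s + 1))"
  proof -
    have "M * (real ?s + 1) \<le> real ?s * (2 * M)"
      using M s mult_right_mono[of 1 "real ?s" M] by (simp add: algebra_simps)
    thus ?thesis by (simp add: field_simps)
  qed
  also have "\<dots> = (\<Sum>i\<in>{i. 0 < q (Some i)}. 2 * M / (real ?s + 1))" by (simp add: space_support_def)
  also have "\<dots> \<le> weight_sum M q" unfolding weight_sum_def by (intro sum_mono w) auto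
  finally show "M \<le> weight_sum M q" .
qed

text \<open>The sum over p is rearranged by the derivative q on which X is evaluated. Purely spatial
  p carry the constant weight M, so the spatial gradient terms appear with the multiplicities they
  have in \<open>energy_sum\<close>.\<close>

lemma weighted_reindex:
  fixes X :: "'n::finite idx \<Rightarrow> real"
  shows "(\<Sum>p\<in>{p. order p \<le> m}. weight M p * (e * X (inc None p) + f * (\<Sum>i\<in>UNIV. X (inc (Some i) p))))
    = f * M * (\<Sum>i\<in>UNIV. \<Sum>p\<in>space_idx m. X (inc (Some i) p))
      + (\<Sum>q\<in>time_idx (Suc m). (e * weight M (dec None q) + f * weight_sum M q) * X q)"
proof -
  let ?P = "{p :: 'n idx. order p \<le> m}"
  have fin: "finite ?P" by (rule finite_order_le)
  have split: "?P = space_idx m \<union> time_idx m" "space_idx m \<inter> time_idx m = {}"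
    by (auto simp: space_idx_def time_idx_def)
  have t: "(\<Sum>p\<in>?P. weight M p * X (inc None p)) = (\<Sum>q\<in>time_idx (Suc m). weight M (dec None q) * X q)"
  proof (rule sum.reindex_bij_witness[where i = "dec None" and j = "inc None"])
    fix q :: "'n idx" assume q: "q \<in> time_idx (Suc m)"
    hence e: "inc None (dec None q) = q" by (intro inc_dec) (simp add: time_idx_def)
    hence "order q = Suc (order (dec None q))" by (metis order_inc)
    thus "dec None q \<in> {p. order p \<le> m}" using q by (simp add: time_idx_def)
    show "inc None (dec None q) = q" by (rule e)
  qed (auto simp: time_idx_def)
  have si: "(\<Sum>p\<in>time_idx m. weight M p * X (inc (Some i) p))
      = (\<Sum>q\<in>time_idx (Suc m). if 0 < q (Some i) then weight M (dec (Some i) q) * X q else 0)" for i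
  proof -
    have "(\<Sum>p\<in>time_idx m. weight M p * X (inc (Some i) p))
      = (\<Sum>q\<in>{q\<in>time_idx (Suc m). 0 < q (Some i)}. weight M (dec (Some i) q) * X q)"
    proof (rule sum.reindex_bij_witness[where i = "dec (Some i)" and j = "inc (Some i)"])
      fix q :: "'n idx" assume q: "q \<in> {q\<in>time_idx (Suc m). 0 < q (Some i)}"
      hence e: "inc (Some i) (dec (Some i) q) = q" by (auto simp: inc_dec)
      hence "order q = Suc (order (dec (Some i) q))" by (metis order_inc)
      thus "dec (Some i) q \<in> time_idx m" using q by (auto simp: time_idx_def dec_def)
      show "inc (Some i) (dec (Some i) q) = q" by (rule e)
    qed (auto simp: time_idx_def inc_apply)
    thus ?thesis by (simp add: sum.inter_filter finite_time_idx)
  qed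
  have ws: "(\<Sum>i\<in>UNIV. if 0 < q (Some i) then weight M (dec (Some i) q) * X q else 0) = weight_sum M q * X q" for q :: "'n idx"
    by (simp add: weight_sum_def sum.inter_filter[symmetric] sum_distrib_right)
  have s: "(\<Sum>p\<in>?P. weight M p * (\<Sum>i\<in>UNIV. X (inc (Some i) p)))
      = M * (\<Sum>i\<in>UNIV. \<Sum>p\<in>space_idx m. X (inc (Some i) p)) + (\<Sum>q\<in>time_idx (Suc m). weight_sum M q * X q)"
  proof -
    have "(\<Sum>p\<in>?P. weight M p * (\<Sum>i\<in>UNIV. X (inc (Some i) p))) = (\<Sum>i\<in>UNIV. \<Sum>p\<in>?P. weight M p * X (inc (Some i) p))"
      by (simp add: sum_distrib_left sum.swap[of _ ?P])
    also have "\<dots> = (\<Sum>i\<in>UNIV. (\<Sum>p\<in>space_idx m. weight M p * X (inc (Some i) p)) + (\<Sum>p\<in>time_idx m. weight M p * X (inc (Some i) p)))"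
      unfolding split(1) by (intro sum.cong refl sum.union_disjoint finite_space_idx finite_time_idx split(2))
    also have "\<dots> = (\<Sum>i\<in>UNIV. M * (\<Sum>p\<in>space_idx m. X (inc (Some i) p)))
        + (\<Sum>i\<in>UNIV. \<Sum>q\<in>time_idx (Suc m). if 0 < q (Some i) then weight M (dec (Some i) q) * X q else 0)"
      unfolding si sum.distrib by (simp add: space_idx_def weight_def sum_distrib_left)
    also have "(\<Sum>i\<in>UNIV. \<Sum>q\<in>time_idx (Suc m). if 0 < q (Some i) then weight M (dec (Some i) q) * X q else 0)
        = (\<Sum>q\<in>time_idx (Suc m). weight_sum M q * X q)"
      by (subst sum.swap) (simp only: ws)
    finally show ?thesis by (simp add: sum_distrib_left)
  qed
  have "(\<Sum>p\<in>?P. weight M p * (e * X (inc None p) + f * (\<Sum>i\<in>UNIV. X (inc (Some i) p))))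
    = e * (\<Sum>p\<in>?P. weight M p * X (inc None p)) + f * (\<Sum>p\<in>?P. weight M p * (\<Sum>i\<in>UNIV. X (inc (Some i) p)))"
    by (simp add: sum_distrib_left sum.distrib[symmetric] algebra_simps)
  thus ?thesis unfolding t s by (simp add: sum_distrib_left sum.distrib[symmetric] algebra_simps)
qed

text \<open>The energy in terms of space-time multi-indices. The norm of the gradient in H^k counts
  a spatial derivative once for each direction in its support; derivatives with a time component are
  counted once.\<close>

definition energy_sum :: "('n::finite idx \<Rightarrow> real) \<Rightarrow> nat \<Rightarrow> real" where
  "energy_sum X k = (\<Sum>i\<in>UNIV. \<Sum>p\<in>space_idx k. X (inc (Some i) p)) + (\<Sum>q\<in>time_idx (Suc k). X q)"

text \<open>The factors 1/2 and 3/2 are the bounds of 1 - \<kappa> u_t, and M is the larger of 2 and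
  1/c^2, chosen to make every coefficient at least 1 in the lower bound.\<close>

lemma weighted_bounds:
  fixes X :: "'n::finite idx \<Rightarrow> real"
  assumes c: "0 < c" and X: "\<And>q. 0 \<le> X q"
  defines "M \<equiv> 1 / min (1 / 2) (c\<^sup>2)"
  shows "energy_sum X m \<le> (\<Sum>p\<in>{p. order p \<le> m}. weight M p * (1 / 2 * X (inc None p) + c\<^sup>2 * (\<Sum>i\<in>UNIV. X (inc (Some i) p))))"
    and "(\<Sum>p\<in>{p. order p \<le> m}. weight M p * (3 / 2 * X (inc None p) + c\<^sup>2 * (\<Sum>i\<in>UNIV. X (inc (Some i) p))))
      \<le> (3 + 2 * c\<^sup>2) / min (1 / 2) (c\<^sup>2) * energy_sum X m"
proof -
  have c2: "0 < c\<^sup>2" using c by simp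
  have mn: "0 < min (1 / 2) (c\<^sup>2)" using c2 by simp
  have M2: "2 \<le> M" and Mc: "1 \<le> c\<^sup>2 * M" and M0: "0 \<le> M"
    using c2 by (auto simp: M_def min_def field_simps)
  let ?S = "\<Sum>i\<in>UNIV. \<Sum>p\<in>space_idx m. X (inc (Some i) p)"
  have S0: "0 \<le> ?S" using X by (intro sum_nonneg)
  have wd: "0 \<le> weight M (dec None q)" "weight M (dec None q) \<le> 2 * M" for q :: "'n idx"
  proof -
    have "2 * M / (real s + 1) \<le> 2 * M / 1" for s using M0 by (intro divide_left_mono) auto
    thus "weight M (dec None q) \<le> 2 * M" using M0 by (simp add: weight_def)
  qed (use M0 in \<open>simp add: weight_def\<close>)
  \<comment> \<open>Without spatial part, q is controlled by the kinetic term, where the weight is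
    at least M >= 2. Otherwise the gradient terms suffice, as c^2 M >= 1.\<close>
  have low: "1 \<le> 1 / 2 * weight M (dec None q) + c\<^sup>2 * weight_sum M q" if "q \<in> time_idx (Suc m)" for q :: "'n idx"
  proof (cases "space_support q = 0")
    case True
    have "space_support (dec None q) = space_support q" by (simp add: space_support_def dec_def)
    hence "M \<le> weight M (dec None q)" using True M0 by (simp add: weight_def)
    moreover have "0 \<le> c\<^sup>2 * weight_sum M q" using weight_sum_bounds(3)[OF M0, of q] that by (simp add: time_idx_def)
    ultimately show ?thesis using M2 by linarith
  next
    case False
    hence "M \<le> weight_sum M q" using weight_sum_bounds(1)[OF M0, of q] that by (simp add: time_idx_def)
    hence "c\<^sup>2 * M \<le> c\<^sup>2 * weight_sum M q" using c2 by (intro mult_left_mono) auto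
    thus ?thesis using Mc wd(1)[of q] by linarith
  qed
  have B: "(3 + 2 * c\<^sup>2) / min (1 / 2) (c\<^sup>2) = 3 * M + 2 * (c\<^sup>2 * M)"
    by (simp add: M_def add_divide_distrib)
  \<comment> \<open>Origin of B: (3/2) 2M + c^2 2M = (3 + 2 c^2) M.\<close>
  have up: "3 / 2 * weight M (dec None q) + c\<^sup>2 * weight_sum M q \<le> 3 * M + 2 * (c\<^sup>2 * M)" if "q \<in> time_idx (Suc m)" for q :: "'n idx"
  proof -
    have "c\<^sup>2 * weight_sum M q \<le> c\<^sup>2 * (2 * M)"
      using weight_sum_bounds(2)[OF M0, of q] that by (intro mult_left_mono) (auto simp: time_idx_def)
    thus ?thesis using wd(2)[of q] by linarith
  qed
  have "1 * ?S \<le> c\<^sup>2 * M * ?S" using Mc S0 by (intro mult_right_mono)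
  moreover have "(\<Sum>q\<in>time_idx (Suc m). X q) \<le> (\<Sum>q\<in>time_idx (Suc m). (1 / 2 * weight M (dec None q) + c\<^sup>2 * weight_sum M q) * X q)"
  proof (rule sum_mono)
    fix q :: "'n idx" assume "q \<in> time_idx (Suc m)"
    from mult_right_mono[OF low[OF this] X[of q]]
    show "X q \<le> (1 / 2 * weight M (dec None q) + c\<^sup>2 * weight_sum M q) * X q" by simp
  qed
  ultimately show "energy_sum X m \<le> (\<Sum>p\<in>{p. order p \<le> m}. weight M p * (1 / 2 * X (inc None p) + c\<^sup>2 * (\<Sum>i\<in>UNIV. X (inc (Some i) p))))"
    unfolding weighted_reindex energy_sum_def by simp
  have "c\<^sup>2 * M * ?S \<le> (3 * M + 2 * (c\<^sup>2 * M)) * ?S"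
    using M0 c2 S0 mult_nonneg_nonneg[of "c\<^sup>2" M] by (intro mult_right_mono) auto
  moreover have "(\<Sum>q\<in>time_idx (Suc m). (3 / 2 * weight M (dec None q) + c\<^sup>2 * weight_sum M q) * X q)
      \<le> (\<Sum>q\<in>time_idx (Suc m). (3 * M + 2 * (c\<^sup>2 * M)) * X q)"
    by (intro sum_mono mult_right_mono up X)
  ultimately show "(\<Sum>p\<in>{p. order p \<le> m}. weight M p * (3 / 2 * X (inc None p) + c\<^sup>2 * (\<Sum>i\<in>UNIV. X (inc (Some i) p))))
      \<le> (3 + 2 * c\<^sup>2) / min (1 / 2) (c\<^sup>2) * energy_sum X m"
    unfolding weighted_reindex energy_sum_def B by (simp add: distrib_left sum_distrib_left)
qed

lemma energy_sum_member:
  assumes X: "\<And>q. 0 \<le> X q" and q: "1 \<le> order q" "order q \<le> Suc k"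
  shows "X q \<le> energy_sum X k"
proof -
  have nn: "0 \<le> (\<Sum>i\<in>UNIV. \<Sum>p\<in>space_idx k. X (inc (Some i) p))" "0 \<le> (\<Sum>q\<in>time_idx (Suc k). X q)"
    using X by (auto intro!: sum_nonneg)
  show ?thesis
  proof (cases "q None = 0")
    case False
    hence "X q \<le> (\<Sum>q\<in>time_idx (Suc k). X q)"
      using q X by (intro member_le_sum finite_time_idx) (auto simp: time_idx_def)
    thus ?thesis using nn by (simp add: energy_sum_def)
  next
    case True
    obtain d p where p: "q = inc d p" "order p = order q - 1" using order_SucE[of q "order q - 1"] q by auto
    obtain i where i: "d = Some i" using p True by (cases d) auto
    have "X q \<le> (\<Sum>p\<in>space_idx k. X (inc (Some i) p))"
      unfolding p(1) i using p i q True X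
      by (intro member_le_sum[of p "space_idx k" "\<lambda>p. X (inc (Some i) p)"] finite_space_idx) (auto simp: space_idx_def)
    also have "\<dots> \<le> (\<Sum>i\<in>UNIV. \<Sum>p\<in>space_idx k. X (inc (Some i) p))"
      using X by (intro member_le_sum[of i UNIV "\<lambda>i. \<Sum>p\<in>space_idx k. X (inc (Some i) p)"] sum_nonneg) auto
    finally show ?thesis using nn by (simp add: energy_sum_def)
  qed
qed

text \<open>The constant of \<open>energy_inequality\<close> summed with the weights; the summand 1
  ensures positivity. The type argument carries the dimension.\<close>

definition estimate_const :: "nat \<Rightarrow> real \<Rightarrow> 'n::finite itself \<Rightarrow> real" where
  "estimate_const m c _ = (\<Sum>p\<in>{p :: 'n idx. order p \<le> m}. weight (1 / min (1 / 2) (c\<^sup>2)) p)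
     * ((2 * real (quad_count CARD('n) m) + real (Suc CARD('n))) * jet_const CARD('n) m) + 1"

context jets_top
begin

definition En :: "nat \<Rightarrow> real \<Rightarrow> real" where
  "En k t = energy_sum (\<lambda>q. (norm (W q t))\<^sup>2) k"

lemma En_nonneg: "0 \<le> En k t"
  unfolding En_def energy_sum_def by (intro add_nonneg_nonneg sum_nonneg) auto

lemma En_bound: "1 \<le> order q \<Longrightarrow> order q \<le> Suc k \<Longrightarrow> norm (W q t) \<le> sqrt (En k t)"
  using energy_sum_member[of "\<lambda>q. (norm (W q t))\<^sup>2" q k]
  by (simp add: En_def real_le_rsqrt)

lemma En_continuous: "k \<le> m \<Longrightarrow> continuous_on I (En k)"
  unfolding En_def energy_sum_def
  by (intro continuous_intros cont top) (auto simp: space_idx_def time_idx_def)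

lemma en_bounds:
  assumes "t \<in> I"
  shows "1 / 2 * (norm (z1 t))\<^sup>2 + c\<^sup>2 * (\<Sum>i\<in>UNIV. (norm (y i t))\<^sup>2) \<le> en z1 y t"
    "en z1 y t \<le> 3 / 2 * (norm (z1 t))\<^sup>2 + c\<^sup>2 * (\<Sum>i\<in>UNIV. (norm (y i t))\<^sup>2)"
proof -
  have ok: "pmult_ok (W iT t) (z1 t)" using pmult_ok_L2[OF assms, of iT] by simp
  have "\<kappa> * inner (pmult (W iT t) (z1 t)) (z1 t) = inner (pmult (\<kappa> *\<^sub>R W iT t) (z1 t)) (z1 t)"
    by (simp add: pmult_scaleR_left[OF ok])
  also have "\<bar>\<dots>\<bar> \<le> norm (pmult (\<kappa> *\<^sub>R W iT t) (z1 t)) * norm (z1 t)" by (rule Cauchy_Schwarz_ineq2)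
  also have "\<dots> \<le> (1 / 2 * norm (z1 t)) * norm (z1 t)"
    by (intro mult_right_mono bounded_by_pmult(2) small assms) auto
  finally have "\<bar>\<kappa> * inner (pmult (W iT t) (z1 t)) (z1 t)\<bar> \<le> 1 / 2 * (norm (z1 t))\<^sup>2"
    by (simp add: power2_eq_square)
  thus "1 / 2 * (norm (z1 t))\<^sup>2 + c\<^sup>2 * (\<Sum>i\<in>UNIV. (norm (y i t))\<^sup>2) \<le> en z1 y t"
    "en z1 y t \<le> 3 / 2 * (norm (z1 t))\<^sup>2 + c\<^sup>2 * (\<Sum>i\<in>UNIV. (norm (y i t))\<^sup>2)"
    unfolding en_def by linarith+
qed

lemma energy_estimate_interior:
  assumes t: "t \<in> {0..<T}"
  shows "En m t \<le> (3 + 2 * c\<^sup>2) / min (1 / 2) (c\<^sup>2) * En m 0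
    + estimate_const m c TYPE('n) * \<delta> * integral {0..t} (\<lambda>s. sqrt (En (m - 1) s) * En m s)"
proof -
  define M where "M = 1 / min (1 / 2) (c\<^sup>2)"
  let ?P = "{p :: 'n idx. order p \<le> m}"
  let ?e = "\<lambda>p. en (W (inc None p)) (\<lambda>i. W (inc (Some i) p))"
  let ?K = "(2 * real (quad_count CARD('n) m) + real (Suc CARD('n))) * jet_const CARD('n) m"
  let ?Int = "integral {0..t} (\<lambda>s. sqrt (En (m - 1) s) * En m s)"
  have c2: "0 < c\<^sup>2" using c by simp
  have M0: "0 \<le> M" using c2 by (simp add: M_def)
  have w0: "0 \<le> weight M p" for p :: "'n idx" using M0 by (simp add: weight_def)
  have tI: "t \<in> I" "0 \<in> I" using t by auto
  have "continuous_on {0..t} (\<lambda>s. sqrt (En (m - 1) s) * En m s)"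
    using t by (intro continuous_intros continuous_on_subset[OF En_continuous]) auto
  hence int: "(\<lambda>s. sqrt (En (m - 1) s) * En m s) integrable_on {0..t}" by (rule integrable_continuous_interval)
  have Int0: "0 \<le> ?Int" using int En_nonneg by (intro integral_nonneg) auto
  have sq: "(\<lambda>s. sqrt (En (m - 1) s) * (sqrt (En m s))\<^sup>2) = (\<lambda>s. sqrt (En (m - 1) s) * En m s)"
    using En_nonneg by simp
  have step: "?e p t \<le> ?e p 0 + ?K * \<delta> * ?Int" if "order p \<le> m" for p
  proof -
    have "norm (W q s) \<le> sqrt (En (m - 1) s)" if "1 \<le> order q" "order q \<le> m" for q s
      using that m3 by (intro En_bound) auto
    moreover have "norm (W q s) \<le> sqrt (En m s)" if "1 \<le> order q" "order q \<le> Suc m" for q s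
      using that by (rule En_bound)
    moreover have "(\<lambda>s. sqrt (En (m - 1) s) * (sqrt (En m s))\<^sup>2) integrable_on {0..t}"
      unfolding sq by (rule int)
    ultimately have "?e p t \<le> ?e p 0 + ?K * \<delta> * integral {0..t} (\<lambda>s. sqrt (En (m - 1) s) * (sqrt (En m s))\<^sup>2)"
      by (intro energy_inequality that t)
    thus ?thesis unfolding sq .
  qed
  have "En m t \<le> (\<Sum>p\<in>?P. weight M p * (1 / 2 * (norm (W (inc None p) t))\<^sup>2 + c\<^sup>2 * (\<Sum>i\<in>UNIV. (norm (W (inc (Some i) p) t))\<^sup>2)))"
    unfolding En_def M_def by (rule weighted_bounds(1)[OF c]) simp
  also have "\<dots> \<le> (\<Sum>p\<in>?P. weight M p * ?e p t)"
    by (intro sum_mono mult_left_mono en_bounds(1) tI w0)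
  also have "\<dots> \<le> (\<Sum>p\<in>?P. weight M p * (?e p 0 + ?K * \<delta> * ?Int))"
    by (intro sum_mono mult_left_mono step w0) auto
  also have "\<dots> = (\<Sum>p\<in>?P. weight M p * ?e p 0) + (\<Sum>p\<in>?P. weight M p) * ?K * \<delta> * ?Int"
    by (simp add: distrib_left sum.distrib sum_distrib_right mult.assoc)
  also have "(\<Sum>p\<in>?P. weight M p * ?e p 0) \<le> (\<Sum>p\<in>?P. weight M p *
      (3 / 2 * (norm (W (inc None p) 0))\<^sup>2 + c\<^sup>2 * (\<Sum>i\<in>UNIV. (norm (W (inc (Some i) p) 0))\<^sup>2)))"
    by (intro sum_mono mult_left_mono en_bounds(2) tI w0)
  also have "\<dots> \<le> (3 + 2 * c\<^sup>2) / min (1 / 2) (c\<^sup>2) * En m 0"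
    unfolding En_def M_def by (rule weighted_bounds(2)[OF c]) simp
  also have "(\<Sum>p\<in>?P. weight M p) * ?K * \<delta> * ?Int \<le> estimate_const m c TYPE('n) * \<delta> * ?Int"
    using \<delta>(1) Int0 by (intro mult_right_mono) (auto simp: estimate_const_def M_def)
  finally show ?thesis by simp
qed

text \<open>Both sides are continuous in t on the closed interval, so the inequality extends from
  [0, T) to T.\<close>

lemma energy_estimate:
  assumes t: "t \<in> I"
  shows "En m t \<le> (3 + 2 * c\<^sup>2) / min (1 / 2) (c\<^sup>2) * En m 0
    + estimate_const m c TYPE('n) * \<delta> * integral {0..t} (\<lambda>s. sqrt (En (m - 1) s) * En m s)"
proof -
  have c1: "continuous_on I (\<lambda>s. sqrt (En (m - 1) s) * En m s)"
    by (intro continuous_intros En_continuous) auto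
  have c2: "continuous_on I (\<lambda>t. (3 + 2 * c\<^sup>2) / min (1 / 2) (c\<^sup>2) * En m 0
    + estimate_const m c TYPE('n) * \<delta> * integral {0..t} (\<lambda>s. sqrt (En (m - 1) s) * En m s) - En m t)"
    by (intro continuous_on_diff continuous_on_add continuous_on_mult continuous_on_const En_continuous
        indefinite_integral_continuous_1 integrable_continuous_interval c1) auto
  have cl: "closure {0..<T} = I" using T by simp
  have "0 \<le> (3 + 2 * c\<^sup>2) / min (1 / 2) (c\<^sup>2) * En m 0
    + estimate_const m c TYPE('n) * \<delta> * integral {0..t} (\<lambda>s. sqrt (En (m - 1) s) * En m s) - En m t"
    using c2 t unfolding cl[symmetric]
    by (rule continuous_ge_on_closure) (use energy_estimate_interior in force)
  thus ?thesis by simp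
qed

end

lemma estimate_const_pos: "0 < c \<Longrightarrow> 0 < estimate_const m c (T :: 'n::finite itself)"
  unfolding estimate_const_def
  by (intro add_nonneg_pos mult_nonneg_nonneg sum_nonneg jet_const_nonneg) (auto simp: weight_def)

section \<open>The highest time derivative\<close>

text \<open>Multiplication by \<kappa> u has operator norm at most 1/2, so the inverse of 1 -
  \<kappa> u has norm at most 2.\<close>

lemma one_minus_norm:
  assumes "bounded_by (1 / 2) (\<kappa> *\<^sub>R u)" "pmult_ok u g"
  shows "norm g \<le> 2 * norm (g - \<kappa> *\<^sub>R pmult u g)"
proof -
  have "norm (pmult (\<kappa> *\<^sub>R u) g) \<le> 1 / 2 * norm g" by (intro bounded_by_pmult(2) assms) simp
  hence "norm (\<kappa> *\<^sub>R pmult u g) \<le> 1 / 2 * norm g" by (simp add: pmult_scaleR_left[OF assms(2)])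
  moreover have "norm g \<le> norm (g - \<kappa> *\<^sub>R pmult u g) + norm (\<kappa> *\<^sub>R pmult u g)"
    using norm_triangle_ineq[of "g - \<kappa> *\<^sub>R pmult u g" "\<kappa> *\<^sub>R pmult u g"] by simp
  ultimately show ?thesis by linarith
qed

lemma one_minus_solvable:
  fixes u :: "'n::finite l2"
  assumes "bounded_by (1 / 2) (\<kappa> *\<^sub>R u)" and ok: "\<And>z. pmult_ok u z"
  shows "\<exists>z. z - \<kappa> *\<^sub>R pmult u z = y"
proof -
  \<comment> \<open>The quotient is set to 0 on the null set where the bound on \<kappa> u may fail
    and the denominator could vanish.\<close>
  let ?z = "\<lambda>x. if \<bar>\<kappa> * rep_l2 u x\<bar> \<le> 1 / 2 then rep_l2 y x / (1 - \<kappa> * rep_l2 u x) else 0"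
  have b: "AE x in lborel. \<bar>\<kappa> * rep_l2 u x\<bar> \<le> 1 / 2"
    using assms(1) rep_scaleR[of \<kappa> u] unfolding bounded_by_def by eventually_elim simp
  have le: "\<bar>?z x\<bar> \<le> 2 * \<bar>rep_l2 y x\<bar>" for x
  proof (cases "\<bar>\<kappa> * rep_l2 u x\<bar> \<le> 1 / 2")
    case True
    hence "1 / 2 \<le> 1 - \<kappa> * rep_l2 u x" by (simp add: abs_le_iff)
    hence "\<bar>rep_l2 y x\<bar> / (1 - \<kappa> * rep_l2 u x) \<le> \<bar>rep_l2 y x\<bar> / (1 / 2)" by (intro divide_left_mono) auto
    thus ?thesis using True \<open>1 / 2 \<le> 1 - \<kappa> * rep_l2 u x\<close> by simp
  qed simp
  have m: "?z \<in> borel_measurable borel" by measurable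
  have s: "sqint ?z" by (rule sqint_bound[OF sqint_rep[of y] m AE_I2[OF le]])
  define z where "z = abs_l2 ?z"
  have zz: "AE x in lborel. rep_l2 z x = ?z x" unfolding z_def by (rule rep_abs[OF s])
  have uz: "AE x in lborel. rep_l2 (\<kappa> *\<^sub>R u) x * rep_l2 z x = rep_l2 (z - y) x"
    using zz b rep_scaleR[of \<kappa> u] rep_diff[of z y]
  proof eventually_elim
    case (elim x)
    have "1 - \<kappa> * rep_l2 u x \<noteq> 0" using elim(2) by (auto simp: abs_le_iff)
    hence "?z x * (1 - \<kappa> * rep_l2 u x) = rep_l2 y x" using elim(2) by simp
    hence "rep_l2 z x * (1 - \<kappa> * rep_l2 u x) = rep_l2 y x" unfolding elim(1) .
    thus ?case unfolding elim(3,4) by (simp add: algebra_simps)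
  qed
  have "pmult (\<kappa> *\<^sub>R u) z = z - y" by (rule pmult_eqI[OF uz])
  hence "z - \<kappa> *\<^sub>R pmult u z = y" by (simp add: pmult_scaleR_left[OF ok])
  thus ?thesis ..
qed

lemma tidx_inc: "inc None (tidx k) = tidx (Suc k)"
  by (auto simp: tidx_def inc_def fun_eq_iff)

lemma inc_Some_neq_tidx: "inc (Some i) p \<noteq> tidx k"
proof
  assume "inc (Some i) p = tidx k"
  hence "inc (Some i) p (Some i) = tidx k (Some i)" by simp
  thus False by (simp add: inc_apply tidx_def)
qed

lemma order_tidx: "order (tidx k :: 'n::finite idx) = k"
  by (induction k) (simp_all add: tidx_inc[symmetric] del: One_nat_def, simp add: order_def tidx_def)

text \<open>The time derivative of order \<open>m + 1\<close> is obtained by solving the equation, differentiated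
  \<open>m - 2\<close> times in time, for the highest time derivative.\<close>

locale jets_base = jets m T c \<kappa> \<mu> W "\<lambda>p. order p \<le> Suc m \<and> p \<noteq> tidx (Suc m)"
  for m T c \<kappa> \<mu> and W :: "'n::finite idx \<Rightarrow> real \<Rightarrow> 'n l2"
begin

text \<open>Write A = 1 - \<kappa> u_t. The derivative X of order m in time satisfies A X = P, where
  P contains lower time derivatives and is differentiable. For the difference quotients, A(s)
  applied to that of X equals that of P plus \<kappa> times that of u_t multiplied by X(t). Since
  the inverses of A(s) are uniformly bounded, the quotient of X converges.\<close>

lemma top_derivative:
  obtains Z where "continuous_on I Z" "\<And>t. t \<in> I \<Longrightarrow> (W (tidx m) has_vector_derivative Z t) (at t within I)"
proof -
  define p :: "'n idx" where "p = tidx (m - 2)"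
  have op: "order p = m - 2" by (simp add: p_def order_tidx)
  have m2: "Suc (Suc (m - 2)) = m" "Suc (m - 2) = m - 1" using m3 by auto
  have ttp: "tt p = tidx m" by (simp add: p_def tidx_inc m2(1) del: One_nat_def)
  have okm: "order q \<le> m \<Longrightarrow> order q \<le> Suc m \<and> q \<noteq> tidx (Suc m)" for q :: "'n idx"
    by (auto simp: order_tidx)
  have okS: "order q \<le> m \<Longrightarrow> order (inc (Some i) q) \<le> Suc m \<and> inc (Some i) q \<noteq> tidx (Suc m)" for q :: "'n idx" and i
    by (simp add: inc_Some_neq_tidx)
  obtain N G where G: "quad (m - 2) N G" "wave_at p G"
  proof -
    have "\<exists>G. quad (m - 2) (quad_count CARD('n) (m - 2)) G \<and> wave_at p G"
      by (rule wave_all[OF op]) (use okm m3 in auto)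
    thus thesis using that by blast
  qed
  obtain G' where G': "dirD None G G'" "quad (m - 1) (2 * N) G'"
  proof -
    have "\<exists>F'. dirD None G F' \<and> quad (Suc (m - 2)) (2 * N) F'"
      by (rule quad_dir[OF G(1)]) (use okm m3 in auto)
    thus thesis using that unfolding m2(2) by blast
  qed
  define P where "P t = c\<^sup>2 *\<^sub>R (\<Sum>i\<in>UNIV. W (xx i p) t) + \<mu> *\<^sub>R (\<Sum>i\<in>UNIV. pmult (W (iX i) t) (W (xt i p) t)) + G t" for t
  define P' where "P' t = c\<^sup>2 *\<^sub>R (\<Sum>i\<in>UNIV. W (inc None (xx i p)) t)
    + \<mu> *\<^sub>R (\<Sum>i\<in>UNIV. pmult (W (inc None (iX i)) t) (W (xt i p) t) + pmult (W (iX i) t) (W (inc None (xt i p)) t)) + G' t" for t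
  have ok1: "order (inc None (xx i p)) \<le> Suc m \<and> inc None (xx i p) \<noteq> tidx (Suc m)"
    "order (inc None (xt i p)) \<le> Suc m \<and> inc None (xt i p) \<noteq> tidx (Suc m)" for i
    unfolding inc_commute[of None "Some i"] by (rule okS, use op m3 in simp)+
  have dP: "dirD None P P'"
    unfolding P_def P'_def using op m3
    by (intro dirD_add dirD_scaleR dirD_sum dirD_W dirD_pmult G'(1) ok1 okm) auto
  have cP': "continuous_on I P'"
    unfolding P'_def using op m3
    by (intro continuous_intros cont pmult_continuous ok1 okm quad_continuous[OF G'(2)]) auto
  let ?u = "W iT" and ?u' = "W (inc None iT)" and ?X = "W (tidx m)"
  have ok_u: "pmult_ok (?u t) g" if "t \<in> I" for t g using pmult_ok_L2[OF that, of iT] by simp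
  let ?A = "\<lambda>t g. g - \<kappa> *\<^sub>R pmult (?u t) g"
  have A_diff: "?A t (g - h) = ?A t g - ?A t h" if "t \<in> I" for t g h
    by (simp add: pmult_diff_right ok_u[OF that] scaleR_diff_right)
  have A_norm: "norm g \<le> 2 * norm (?A t g)" if "t \<in> I" for t g
    by (rule one_minus_norm[OF small[OF that] ok_u[OF that]])
  have AX: "?A t (?X t) = P t" if "t \<in> I" for t
    using G(2) that unfolding wave_at_def ttp P_def by blast
  \<comment> \<open>Formally differentiating A X = P gives A X' = P' + \<kappa> u_tt X, whose
    right-hand side is \<open>Y\<close>.\<close>
  define Y where "Y t = P' t + \<kappa> *\<^sub>R pmult (?u' t) (?X t)" for t
  have cY: "continuous_on I Y"
    unfolding Y_def using m3
    by (intro continuous_intros cP' pmult_continuous okm) (auto simp: order_tidx)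
  have "\<exists>z. ?A t z = Y t" if "t \<in> I" for t
    by (rule one_minus_solvable[OF small[OF that] ok_u[OF that]])
  then obtain Z where Z: "\<And>t. t \<in> I \<Longrightarrow> ?A t (Z t) = Y t" by metis
  have s0: "CARD('n) < 2 * ((m - 1) + 0)" by (rule big_le) linarith
  have uH: "?u t \<in> Hs (m - 1)" "?u' t \<in> Hs (m - 1)" if "t \<in> I" for t
    using that m3 by (auto intro!: W_Hs simp del: Hs.simps)
  have ev: "\<forall>\<^sub>F s in at t within I. s \<in> I" for t by (simp add: eventually_at_filter)
  have A_tendsto: "((\<lambda>s. ?A s g) \<longlongrightarrow> ?A t g) (at t within I)" if t: "t \<in> I" for t g
  proof -
    have "((\<lambda>s. pmult (?u s) g) \<longlongrightarrow> pmult (?u t) g) (at t within I)"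
    proof (rule pmult_tendsto[OF s0 uH(1)[OF t]])
      show "((\<lambda>s. hn (m - 1) (?u s - ?u t)) \<longlongrightarrow> 0) (at t within I)"
        using m3 t by (intro W_cont_hn okm) auto
      show "\<forall>\<^sub>F s in at t within I. ?u s \<in> Hs (m - 1)"
        using ev by eventually_elim (rule uH(1))
    qed auto
    thus ?thesis by (intro tendsto_diff tendsto_scaleR tendsto_const)
  qed
  \<comment> \<open>A(s) (Z(s) - Z(t)) = Y(s) - A(s) Z(t) tends to 0, and A(s) is uniformly
    invertible.\<close>
  have cZ: "continuous_on I Z"
    unfolding continuous_on_def
  proof
    fix t assume t: "t \<in> I"
    have "((\<lambda>s. Y s - ?A s (Z t)) \<longlongrightarrow> Y t - ?A t (Z t)) (at t within I)"
      using cY t by (intro tendsto_diff A_tendsto) (auto simp: continuous_on_def)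
    hence "((\<lambda>s. 2 * norm (Y s - ?A s (Z t))) \<longlongrightarrow> 2 * norm (Y t - ?A t (Z t))) (at t within I)"
      by (intro tendsto_mult tendsto_norm tendsto_const)
    hence l: "((\<lambda>s. 2 * norm (Y s - ?A s (Z t))) \<longlongrightarrow> 0) (at t within I)" using Z[OF t] by simp
    have "((\<lambda>s. Z s - Z t) \<longlongrightarrow> 0) (at t within I)"
    proof (rule Lim_null_comparison[OF _ l])
      show "\<forall>\<^sub>F s in at t within I. norm (Z s - Z t) \<le> 2 * norm (Y s - ?A s (Z t))"
        using ev
      proof eventually_elim
        case (elim s)
        have e: "?A s (Z s - Z t) = Y s - ?A s (Z t)" using A_diff[OF elim, of "Z s" "Z t"] Z[OF elim] by simp
        show ?case using A_norm[OF elim, of "Z s - Z t"] unfolding e .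
      qed
    qed
    thus "(Z \<longlongrightarrow> Z t) (at t within I)" by (rule LIM_zero_cancel)
  qed
  have dX: "(?X has_vector_derivative Z t) (at t within I)" if t: "t \<in> I" for t
  proof -
    let ?q = "\<lambda>F s. (F s - F t) /\<^sub>R (s - t)"
    have qu: "((\<lambda>s. pmult (?q ?u s) (?X t)) \<longlongrightarrow> pmult (?u' t) (?X t)) (at t within I)"
    proof (rule pmult_tendsto[OF s0 uH(2)[OF t]])
      show "((\<lambda>s. hn (m - 1) (?q ?u s - ?u' t)) \<longlongrightarrow> 0) (at t within I)"
        using m3 t by (intro W_time_quotient_hn okm) auto
      show "\<forall>\<^sub>F s in at t within I. ?q ?u s \<in> Hs (m - 1)"
        using ev by eventually_elim (intro Hs_scaleR_hn[THEN conjunct1] Hs_diff uH t)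
    qed auto
    have qP: "(?q P \<longlongrightarrow> P' t) (at t within I)"
      using dP t by (simp add: dirD_def has_vector_derivative_iff_quotient)
    have "((\<lambda>s. ?q P s + \<kappa> *\<^sub>R pmult (?q ?u s) (?X t) - ?A s (Z t)) \<longlongrightarrow> P' t + \<kappa> *\<^sub>R pmult (?u' t) (?X t) - ?A t (Z t)) (at t within I)"
      by (intro tendsto_diff tendsto_add tendsto_scaleR tendsto_const qP qu A_tendsto t)
    hence "((\<lambda>s. 2 * norm (?q P s + \<kappa> *\<^sub>R pmult (?q ?u s) (?X t) - ?A s (Z t))) \<longlongrightarrow> 2 * norm (P' t + \<kappa> *\<^sub>R pmult (?u' t) (?X t) - ?A t (Z t))) (at t within I)"
      by (intro tendsto_mult tendsto_norm tendsto_const)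
    hence l: "((\<lambda>s. 2 * norm (?q P s + \<kappa> *\<^sub>R pmult (?q ?u s) (?X t) - ?A s (Z t))) \<longlongrightarrow> 0) (at t within I)"
      unfolding Z[OF t] by (simp add: Y_def)
    have "((\<lambda>s. ?q ?X s - Z t) \<longlongrightarrow> 0) (at t within I)"
    proof (rule Lim_null_comparison[OF _ l])
      show "\<forall>\<^sub>F s in at t within I. norm (?q ?X s - Z t) \<le> 2 * norm (?q P s + \<kappa> *\<^sub>R pmult (?q ?u s) (?X t) - ?A s (Z t))"
        using ev
      proof eventually_elim
        case (elim s)
        have e1: "pmult (?u s) (?q ?X s) = (pmult (?u s) (?X s) - pmult (?u s) (?X t)) /\<^sub>R (s - t)"
          by (simp add: pmult_scaleR_right pmult_diff_right ok_u[OF elim])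
        have e2: "pmult (?q ?u s) (?X t) = (pmult (?u s) (?X t) - pmult (?u t) (?X t)) /\<^sub>R (s - t)"
          by (simp add: pmult_scaleR_left pmult_diff_left pmult_ok_diff ok_u[OF elim] ok_u[OF t])
        have "?A s (?q ?X s) = (?A s (?X s) - ?A t (?X t)) /\<^sub>R (s - t) + \<kappa> *\<^sub>R pmult (?q ?u s) (?X t)"
          unfolding e1 e2 by (simp add: scaleR_diff_right algebra_simps)
        hence "?A s (?q ?X s) = ?q P s + \<kappa> *\<^sub>R pmult (?q ?u s) (?X t)" unfolding AX[OF elim] AX[OF t] .
        hence e: "?A s (?q ?X s - Z t) = ?q P s + \<kappa> *\<^sub>R pmult (?q ?u s) (?X t) - ?A s (Z t)"
          using A_diff[OF elim, of "?q ?X s" "Z t"] by simp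
        show ?case using A_norm[OF elim, of "?q ?X s - Z t"] unfolding e .
      qed
    qed
    thus ?thesis unfolding has_vector_derivative_iff_quotient by (rule LIM_zero_cancel)
  qed
  show thesis by (rule that[OF cZ dX])
qed

lemma jets_top_extension:
  obtains Z where "jets_top m T c \<kappa> \<mu> (W(tidx (Suc m) := Z)) (\<lambda>p. order p \<le> Suc m)"
    "\<And>t. t \<in> I \<Longrightarrow> (W (tidx m) has_vector_derivative Z t) (at t within I)"
proof -
  obtain Z where Z: "continuous_on I Z" "\<And>t. t \<in> I \<Longrightarrow> (W (tidx m) has_vector_derivative Z t) (at t within I)"
    using top_derivative by blast
  have ne: "order p \<le> m \<Longrightarrow> p \<noteq> tidx (Suc m)" for p :: "'n idx" by (auto simp: order_tidx)
  have n1: "inc (Some i) p \<noteq> tidx (Suc m)" for i and p :: "'n idx" by (rule inc_Some_neq_tidx)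
  have "jets_top m T c \<kappa> \<mu> (W(tidx (Suc m) := Z)) (\<lambda>p. order p \<le> Suc m)"
  proof
    show "continuous_on I ((W(tidx (Suc m) := Z)) p)" if "order p \<le> Suc m" for p
      using cont[of p] Z(1) that by (cases "p = tidx (Suc m)") auto
    show "((W(tidx (Suc m) := Z)) p has_vector_derivative (W(tidx (Suc m) := Z)) (inc None p) t) (at t within I)"
      if "order (inc None p) \<le> Suc m" "t \<in> I" for p t
    proof (cases "p = tidx m")
      case True
      thus ?thesis using Z(2)[OF that(2)] ne[of "tidx m"] by (simp add: tidx_inc order_tidx)
    next
      case False
      hence "inc None p \<noteq> tidx (Suc m)" using tidx_inc[of m] by (metis dec_inc)
      thus ?thesis using deriv[of p t] that ne[of p] by simp
    qed
    show "has_D i ((W(tidx (Suc m) := Z)) p t) ((W(tidx (Suc m) := Z)) (inc (Some i) p) t)" if "order p \<le> m" "t \<in> I" for p t i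
      using spat[OF that, of i] ne[OF that(1)] n1[of i p] by simp
    have "tt (zidx :: 'n idx) \<noteq> tidx (Suc m)" by (rule ne) (use m3 in simp)
    moreover have "inc None (zidx :: 'n idx) \<noteq> tidx (Suc m)" by (rule ne) (use m3 in simp)
    ultimately show "(W(tidx (Suc m) := Z)) (tt zidx) t - \<kappa> *\<^sub>R pmult ((W(tidx (Suc m) := Z)) iT t) ((W(tidx (Suc m) := Z)) (tt zidx) t)
      = c\<^sup>2 *\<^sub>R (\<Sum>i\<in>UNIV. (W(tidx (Suc m) := Z)) (xx i zidx) t)
        + \<mu> *\<^sub>R (\<Sum>i\<in>UNIV. pmult ((W(tidx (Suc m) := Z)) (iX i) t) ((W(tidx (Suc m) := Z)) (xt i zidx) t))"
      "bounded_by (1 / 2) (\<kappa> *\<^sub>R (W(tidx (Suc m) := Z)) iT t)" if "t \<in> I" for t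
      using wave[OF that] small[OF that] by (simp_all add: n1)
  qed (use m3 big T c \<kappa> \<mu> in auto)
  thus thesis using that Z(2) by blast
qed

end

section \<open>Weak derivatives and curves in Sobolev spaces\<close>

lemma L2_space_measurable: "f \<in> L2_space \<Longrightarrow> f \<in> borel_measurable lebesgue"
  and L2_space_integrable: "f \<in> L2_space \<Longrightarrow> integrable lebesgue (\<lambda>x. (f x)\<^sup>2)"
  by (auto simp: L2_space_def)

lemma sqint_L2_space: assumes "sqint g" shows "g \<in> L2_space"
proof -
  have "g \<in> borel_measurable lebesgue" using assms by (intro measurable_completion) (auto simp: sqint_def)
  moreover have "integrable lebesgue (\<lambda>x. (g x)\<^sup>2)"
    using assms by (subst integrable_completion) (auto simp: sqint_def)
  ultimately show ?thesis by (simp add: L2_space_def)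
qed

lemma L2_space_borel:
  fixes f :: "real^'n::finite \<Rightarrow> real"
  assumes f: "f \<in> L2_space"
  shows "\<exists>g. sqint g \<and> (AE x in lebesgue. f x = g x)"
proof -
  obtain g where g: "g \<in> borel_measurable lborel" "AE x in lborel. f x = g x"
    using completion_ex_borel_measurable_real[OF L2_space_measurable[OF f]] by blast
  have AE: "AE x in lebesgue. f x = g x" using g(2) by (rule AE_completion)
  have gm: "g \<in> borel_measurable lebesgue" using g(1) by (rule measurable_completion)
  have "integrable lebesgue (\<lambda>x. (g x)\<^sup>2)"
    using L2_space_integrable[OF f]
    by (rule integrable_cong_AE_imp) (use gm AE in \<open>auto elim: eventually_mono\<close>)
  hence "integrable lborel (\<lambda>x. (g x)\<^sup>2)" using g(1) by (subst (asm) integrable_completion) auto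
  thus ?thesis using g(1) AE by (auto simp: sqint_def)
qed

text \<open>\<open>L2_space\<close> consists of Lebesgue measurable functions, \<open>l2\<close> of
  classes of Borel functions; a Borel version mediates between them.\<close>

definition of_fun :: "(real^'n::finite \<Rightarrow> real) \<Rightarrow> 'n l2" where
  "of_fun f = abs_l2 (SOME g. sqint g \<and> (AE x in lebesgue. f x = g x))"

lemma rep_of_fun:
  assumes "f \<in> L2_space" shows "AE x in lebesgue. rep_l2 (of_fun f) x = f x"
proof -
  let ?g = "SOME g. sqint g \<and> (AE x in lebesgue. f x = g x)"
  have g: "sqint ?g \<and> (AE x in lebesgue. f x = ?g x)" by (rule someI_ex[OF L2_space_borel[OF assms]])
  hence "AE x in lebesgue. rep_l2 (of_fun f) x = ?g x"
    unfolding of_fun_def by (intro AE_completion rep_abs) auto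
  with g show ?thesis by (auto elim: eventually_elim2)
qed

lemma of_fun_eqI:
  assumes "f \<in> L2_space" "AE x in lebesgue. f x = rep_l2 h x"
  shows "of_fun f = h"
proof -
  have "AE x in lebesgue. rep_l2 (of_fun f) x = rep_l2 h x"
    using rep_of_fun[OF assms(1)] assms(2) by eventually_elim simp
  thus ?thesis unfolding l2_eq_iff by (simp add: AE_completion_iff)
qed

lemma of_fun_eq_iff:
  assumes "f \<in> L2_space" "g \<in> L2_space"
  shows "of_fun f = of_fun g \<longleftrightarrow> (AE x in lebesgue. f x = g x)"
proof
  assume "of_fun f = of_fun g"
  thus "AE x in lebesgue. f x = g x"
    using rep_of_fun[OF assms(1)] rep_of_fun[OF assms(2)] by (auto elim: eventually_elim2)
next
  assume a: "AE x in lebesgue. f x = g x"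
  show "of_fun f = of_fun g"
    by (rule of_fun_eqI[OF assms(1)]) (use a rep_of_fun[OF assms(2)] in eventually_elim, simp)
qed

lemma rep_L2_space: "rep_l2 h \<in> L2_space"
  by (rule sqint_L2_space[OF sqint_rep])

lemma of_fun_rep: "of_fun (rep_l2 h) = h"
  by (rule of_fun_eqI[OF rep_L2_space]) simp

lemma rep_measurable_lebesgue: "rep_l2 h \<in> borel_measurable lebesgue"
  by (rule L2_space_measurable[OF rep_L2_space])

lemma norm_of_fun:
  assumes f: "f \<in> L2_space" shows "(norm (of_fun f))\<^sup>2 = (LINT x|lebesgue. (f x)\<^sup>2)"
proof -
  have "(norm (of_fun f))\<^sup>2 = (LINT x|lebesgue. (rep_l2 (of_fun f) x)\<^sup>2)"
    unfolding norm_rep by (rule integral_completion[symmetric]) simp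
  also have "\<dots> = (LINT x|lebesgue. (f x)\<^sup>2)"
    using rep_of_fun[OF f] borel_measurable_power[OF L2_space_measurable[OF f], of 2]
      borel_measurable_power[OF rep_measurable_lebesgue[of "of_fun f"], of 2]
    by (intro integral_cong_AE) (auto elim: eventually_mono)
  finally show ?thesis .
qed

lemma L2_space_cong:
  assumes "f \<in> L2_space" "g \<in> borel_measurable lebesgue" "AE x in lebesgue. f x = g x"
  shows "g \<in> L2_space"
proof -
  have "integrable lebesgue (\<lambda>x. (g x)\<^sup>2)"
    using L2_space_integrable[OF assms(1)]
    by (rule integrable_cong_AE_imp) (use assms in \<open>auto elim: eventually_mono\<close>)
  thus ?thesis using assms(2) by (simp add: L2_space_def)
qed

lemma L2_space_diff_of_fun:
  assumes f: "f \<in> L2_space" and g: "g \<in> L2_space"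
  shows "(\<lambda>x. f x - g x) \<in> L2_space" "of_fun (\<lambda>x. f x - g x) = of_fun f - of_fun g"
proof -
  have AE: "AE x in lebesgue. rep_l2 (of_fun f - of_fun g) x = f x - g x"
    using rep_of_fun[OF f] rep_of_fun[OF g] AE_completion[OF rep_diff[of "of_fun f" "of_fun g"]]
    by eventually_elim simp
  show d: "(\<lambda>x. f x - g x) \<in> L2_space"
    by (rule L2_space_cong[OF rep_L2_space _ AE]) (use f g in \<open>auto intro: borel_measurable_diff L2_space_measurable\<close>)
  show "of_fun (\<lambda>x. f x - g x) = of_fun f - of_fun g"
    by (rule of_fun_eqI[OF d]) (use AE in \<open>auto elim: eventually_mono\<close>)
qed

lemma L2_space_scale_of_fun:
  assumes f: "f \<in> L2_space"
  shows "(\<lambda>x. e * f x) \<in> L2_space" "of_fun (\<lambda>x. e * f x) = e *\<^sub>R of_fun f"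
proof -
  have AE: "AE x in lebesgue. rep_l2 (e *\<^sub>R of_fun f) x = e * f x"
    using rep_of_fun[OF f] AE_completion[OF rep_scaleR[of e "of_fun f"]]
    by eventually_elim simp
  show d: "(\<lambda>x. e * f x) \<in> L2_space"
    by (rule L2_space_cong[OF rep_L2_space _ AE]) (use f in \<open>auto intro: borel_measurable_times L2_space_measurable\<close>)
  show "of_fun (\<lambda>x. e * f x) = e *\<^sub>R of_fun f"
    by (rule of_fun_eqI[OF d]) (use AE in \<open>auto elim: eventually_mono\<close>)
qed

lemma L2_space_locally_integrable:
  fixes f :: "real^'n::finite \<Rightarrow> real"
  assumes f: "f \<in> L2_space" shows "locally_integrable f"
  unfolding locally_integrable_def
proof (intro allI impI)
  fix K :: "(real^'n) set" assume K: "compact K"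
  have Ks: "K \<in> sets borel" using K by (intro borel_compact)
  have em: "emeasure lebesgue K < \<infinity>"
    using emeasure_bounded_finite[OF compact_imp_bounded[OF K]] Ks by simp
  have ki: "integrable lebesgue (indicat_real K)" using Ks em by (intro integrable_real_indicator) auto
  show "set_integrable lebesgue K f"
    unfolding set_integrable_def
  proof (rule Bochner_Integration.integrable_bound)
    show "integrable lebesgue (\<lambda>x. indicat_real K x + (f x)\<^sup>2)"
      using ki L2_space_integrable[OF f] by simp
    show "(\<lambda>x. indicat_real K x *\<^sub>R f x) \<in> borel_measurable lebesgue"
      using ki L2_space_measurable[OF f] by (auto intro: borel_measurable_scaleR)
    show "AE x in lebesgue. norm (indicat_real K x *\<^sub>R f x) \<le> norm (indicat_real K x + (f x)\<^sup>2)"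
    proof (rule AE_I2)
      fix x
      have "0 \<le> (\<bar>f x\<bar> - 1)\<^sup>2" by simp
      hence "2 * \<bar>f x\<bar> \<le> 1 + (f x)\<^sup>2" by (simp add: power2_diff)
      moreover have "0 \<le> \<bar>f x\<bar>" by simp
      ultimately have "\<bar>f x\<bar> \<le> 1 + (f x)\<^sup>2" by linarith
      thus "norm (indicat_real K x *\<^sub>R f x) \<le> norm (indicat_real K x + (f x)\<^sup>2)"
        by (simp add: indicator_def)
    qed
  qed
qed

lemma locally_integrable_test:
  fixes g :: "real^'n::finite \<Rightarrow> real"
  assumes g: "locally_integrable g" and \<phi>: "test_function \<phi>"
  shows "integrable lebesgue (\<lambda>x. g x * \<phi> x)"
proof -
  obtain B R where BR: "0 < B" "0 < R" "\<And>x. \<bar>\<phi> x\<bar> \<le> B" "\<And>x. R < norm x \<Longrightarrow> \<phi> x = 0"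
    using test_function_bounds[OF \<phi>] by metis
  have gi: "integrable lebesgue (\<lambda>x. indicat_real (cball 0 R) x * g x)"
    using g by (simp add: locally_integrable_def set_integrable_def)
  have m: "\<phi> \<in> borel_measurable lebesgue"
    using smooth_fun_measurable[OF test_function_smooth[OF \<phi>]] by (intro measurable_completion) auto
  have "(\<lambda>x. g x * \<phi> x) = (\<lambda>x. (indicat_real (cball 0 R) x * g x) * \<phi> x)"
    using BR(4) by (auto simp: fun_eq_iff indicator_def)
  moreover have "integrable lebesgue (\<lambda>x. (indicat_real (cball 0 R) x * g x) * \<phi> x)"
  proof (rule Bochner_Integration.integrable_bound)
    show "integrable lebesgue (\<lambda>x. B * (indicat_real (cball 0 R) x * g x))" using gi by simp
    show "(\<lambda>x. indicat_real (cball 0 R) x * g x * \<phi> x) \<in> borel_measurable lebesgue"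
      by (rule borel_measurable_times[OF borel_measurable_integrable[OF gi] m])
    show "AE x in lebesgue. norm (indicat_real (cball 0 R) x * g x * \<phi> x) \<le> norm (B * (indicat_real (cball 0 R) x * g x))"
    proof (rule AE_I2)
      fix x
      have "\<bar>indicat_real (cball 0 R) x * g x\<bar> * \<bar>\<phi> x\<bar> \<le> \<bar>indicat_real (cball 0 R) x * g x\<bar> * B"
        by (intro mult_left_mono BR(3)) simp
      thus "norm (indicat_real (cball 0 R) x * g x * \<phi> x) \<le> norm (B * (indicat_real (cball 0 R) x * g x))"
        using BR(1) by (simp add: abs_mult mult_ac)
    qed
  qed
  ultimately show ?thesis by simp
qed

lemma locally_integrable_measurable:
  fixes g :: "real^'n::finite \<Rightarrow> real"
  assumes g: "locally_integrable g" shows "g \<in> borel_measurable lebesgue"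
proof (rule borel_measurable_LIMSEQ_real)
  show "(\<lambda>x. indicat_real (cball 0 (real k)) x * g x) \<in> borel_measurable lebesgue" for k
    using g[unfolded locally_integrable_def, rule_format, of "cball 0 (real k)"]
    by (auto simp: set_integrable_def)
  show "(\<lambda>k. indicat_real (cball 0 (real k)) x * g x) \<longlonglongrightarrow> g x" for x
  proof (rule tendsto_eventually)
    obtain N :: nat where N: "norm x \<le> real N" using real_arch_simple by blast
    show "\<forall>\<^sub>F k in sequentially. indicat_real (cball 0 (real k)) x * g x = g x"
      by (rule eventually_sequentiallyI[of N]) (use N in \<open>auto simp: indicator_def\<close>)
  qed
qed

text \<open>If some multi-index had no such list, the integral identities in
  \<open>is_weak_deriv\<close> would be vacuous for it and weak derivatives would not be
  unique.\<close>

lemma ex_list_count: "\<exists>is. count_list is = (\<alpha> :: 'n::finite \<Rightarrow> nat)"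
proof (induction "\<Sum>i\<in>UNIV. \<alpha> i" arbitrary: \<alpha>)
  case 0
  hence "\<alpha> = (\<lambda>_. 0)" by (auto simp: fun_eq_iff)
  thus ?case by (intro exI[of _ "[]"]) (simp add: fun_eq_iff)
next
  case (Suc k)
  have "\<exists>i. \<alpha> i \<noteq> 0"
  proof (rule ccontr)
    assume "\<nexists>i. \<alpha> i \<noteq> 0" thus False using Suc(2) by simp
  qed
  then obtain i where i: "\<alpha> i \<noteq> 0" by blast
  define \<beta> where "\<beta> = \<alpha>(i := \<alpha> i - 1)"
  have "(\<Sum>j\<in>UNIV. \<alpha> j) = (\<Sum>j\<in>UNIV. \<beta> j + (if j = i then 1 else 0))"
    using i by (intro sum.cong) (auto simp: \<beta>_def)
  hence "k = (\<Sum>j\<in>UNIV. \<beta> j)" using Suc(2) by (simp add: sum.distrib)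
  then obtain "is" where "count_list is = \<beta>" using Suc(1) by blast
  hence "count_list (i # is) = \<alpha>" using i by (auto simp: fun_eq_iff \<beta>_def)
  thus ?case by blast
qed

lemma weak_deriv_unique:
  assumes g: "is_weak_deriv \<alpha> f g" and h: "is_weak_deriv \<alpha> f h"
  shows "AE x in lebesgue. g x = h x"
proof -
  obtain "is" where is': "count_list is = \<alpha>" using ex_list_count by blast
  have lg: "locally_integrable g" "locally_integrable h" using g h by (auto simp: is_weak_deriv_def)
  have "AE x in lebesgue. g x - h x = 0"
  proof (rule locally_integrable_AE_zero)
    show "locally_integrable (\<lambda>x. g x - h x)"
      using lg by (auto simp: locally_integrable_def intro: set_integral_diff)
    fix \<phi> :: "real^'a \<Rightarrow> real" assume \<phi>: "test_function \<phi>"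
    have "(- 1) ^ mi_order \<alpha> * (LINT x|lebesgue. g x * \<phi> x) = (- 1) ^ mi_order \<alpha> * (LINT x|lebesgue. h x * \<phi> x)"
      using g[unfolded is_weak_deriv_def, THEN conjunct2, THEN conjunct2, rule_format, of \<phi> "is"]
        h[unfolded is_weak_deriv_def, THEN conjunct2, THEN conjunct2, rule_format, of \<phi> "is"] \<phi> is' by simp
    hence "(LINT x|lebesgue. g x * \<phi> x) = (LINT x|lebesgue. h x * \<phi> x)" by simp
    thus "(LINT x|lebesgue. (g x - h x) * \<phi> x) = 0"
      using locally_integrable_test[OF lg(1) \<phi>] locally_integrable_test[OF lg(2) \<phi>]
      by (simp add: left_diff_distrib)
  qed
  thus ?thesis by simp
qed

text \<open>The predicates \<open>is_weak_deriv \<alpha> f\<close> and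
  \<open>is_weak_deriv \<alpha> f'\<close> coincide, so the choice operator returns the same
  function: the equality holds everywhere and not merely almost everywhere.\<close>

lemma weak_deriv_cong:
  fixes f f' :: "real^'n::finite \<Rightarrow> real"
  assumes f: "f \<in> L2_space" "f' \<in> L2_space" "of_fun f = of_fun f'"
  shows "weak_deriv \<alpha> f = weak_deriv \<alpha> f'"
proof -
  have AE: "AE x in lebesgue. f x = f' x" using f of_fun_eq_iff by blast
  have "(LINT x|lebesgue. f x * iter_pderiv is \<phi> x) = (LINT x|lebesgue. f' x * iter_pderiv is \<phi> x)" if "test_function \<phi>" for \<phi> "is"
    using AE f locally_integrable_test[OF L2_space_locally_integrable test_function_iter[OF that]]
    by (intro integral_cong_AE) (auto elim: eventually_mono)
  hence "is_weak_deriv \<alpha> f = is_weak_deriv \<alpha> f'"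
    using f L2_space_locally_integrable by (auto simp: fun_eq_iff is_weak_deriv_def)
  thus ?thesis by (simp add: weak_deriv_def)
qed

lemma weak_deriv_eq:
  assumes "is_weak_deriv \<alpha> f g" "g \<in> L2_space"
  shows "is_weak_deriv \<alpha> f (weak_deriv \<alpha> f)" "weak_deriv \<alpha> f \<in> L2_space" "of_fun (weak_deriv \<alpha> f) = of_fun g"
proof -
  show w: "is_weak_deriv \<alpha> f (weak_deriv \<alpha> f)" unfolding weak_deriv_def
    by (rule someI[where P = "is_weak_deriv \<alpha> f", OF assms(1)])
  have AE: "AE x in lebesgue. g x = weak_deriv \<alpha> f x" by (rule weak_deriv_unique[OF assms(1) w])
  show L: "weak_deriv \<alpha> f \<in> L2_space"
    by (rule L2_space_cong[OF assms(2) _ AE]) (use w in \<open>auto simp: is_weak_deriv_def intro: locally_integrable_measurable\<close>)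
  show "of_fun (weak_deriv \<alpha> f) = of_fun g" using of_fun_eq_iff[OF assms(2) L] AE by simp
qed

lemma sobolev_L2: "f \<in> sobolev s \<Longrightarrow> f \<in> L2_space"
  by (simp add: sobolev_def)

lemma sobolev_weak_deriv:
  assumes "f \<in> sobolev s" "mi_order \<alpha> \<le> s"
  shows "is_weak_deriv \<alpha> f (weak_deriv \<alpha> f)" "weak_deriv \<alpha> f \<in> L2_space"
proof -
  obtain g where "g \<in> L2_space" "is_weak_deriv \<alpha> f g" using assms by (auto simp: sobolev_def)
  thus "is_weak_deriv \<alpha> f (weak_deriv \<alpha> f)" "weak_deriv \<alpha> f \<in> L2_space" using weak_deriv_eq by blast+
qed

definition wd :: "('n \<Rightarrow> nat) \<Rightarrow> (real^'n::finite \<Rightarrow> real) \<Rightarrow> 'n l2" where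
  "wd \<alpha> f = of_fun (weak_deriv \<alpha> f)"

lemma wd_cong: "f \<in> L2_space \<Longrightarrow> f' \<in> L2_space \<Longrightarrow> of_fun f = of_fun f' \<Longrightarrow> wd \<alpha> f = wd \<alpha> f'"
  unfolding wd_def by (subst weak_deriv_cong) auto

lemma finite_mi_order: "finite {\<alpha> :: 'n::finite \<Rightarrow> nat. mi_order \<alpha> \<le> s}"
proof (rule finite_subset)
  show "{\<alpha> :: 'n \<Rightarrow> nat. mi_order \<alpha> \<le> s} \<subseteq> PiE UNIV (\<lambda>_. {..s})"
  proof
    fix \<alpha> :: "'n \<Rightarrow> nat" assume "\<alpha> \<in> {\<alpha>. mi_order \<alpha> \<le> s}"
    hence "\<alpha> i \<le> s" for i using member_le_sum[of i UNIV \<alpha>] by (simp add: mi_order_def)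
    thus "\<alpha> \<in> PiE UNIV (\<lambda>_. {..s})" by auto
  qed
  show "finite (PiE (UNIV :: 'n set) (\<lambda>_. {..s}))" by (intro finite_PiE) auto
qed

lemma sobolev_norm_wd:
  assumes "f \<in> sobolev s"
  shows "(sobolev_norm s f)\<^sup>2 = (\<Sum>\<alpha> | mi_order \<alpha> \<le> s. (norm (wd \<alpha> f))\<^sup>2)"
proof -
  have "(\<Sum>\<alpha> | mi_order \<alpha> \<le> s. LINT x|lebesgue. (weak_deriv \<alpha> f x)\<^sup>2) = (\<Sum>\<alpha> | mi_order \<alpha> \<le> s. (norm (wd \<alpha> f))\<^sup>2)"
    unfolding wd_def using sobolev_weak_deriv(2)[OF assms] by (intro sum.cong refl) (simp add: norm_of_fun)
  thus ?thesis unfolding sobolev_norm_def by (simp add: sum_nonneg)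
qed

lemma norm_wd_le:
  assumes "f \<in> sobolev s" "mi_order \<alpha> \<le> s" shows "norm (wd \<alpha> f) \<le> sobolev_norm s f"
proof -
  have "(norm (wd \<alpha> f))\<^sup>2 \<le> (\<Sum>\<alpha> | mi_order \<alpha> \<le> s. (norm (wd \<alpha> f))\<^sup>2)"
    using assms finite_mi_order by (intro member_le_sum) auto
  hence "(norm (wd \<alpha> f))\<^sup>2 \<le> (sobolev_norm s f)\<^sup>2" using sobolev_norm_wd[OF assms(1)] by simp
  moreover have "0 \<le> sobolev_norm s f" by (simp add: sobolev_norm_def sum_nonneg)
  ultimately show ?thesis by (rule power2_le_imp_le)
qed

lemma sobolev_diff_wd:
  assumes f: "f \<in> sobolev s" and g: "g \<in> sobolev s"
  shows "(\<lambda>x. f x - g x) \<in> sobolev s" "mi_order \<alpha> \<le> s \<Longrightarrow> wd \<alpha> (\<lambda>x. f x - g x) = wd \<alpha> f - wd \<alpha> g"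
proof -
  have w: "is_weak_deriv \<alpha> (\<lambda>x. f x - g x) (\<lambda>x. weak_deriv \<alpha> f x - weak_deriv \<alpha> g x)" if "mi_order \<alpha> \<le> s" for \<alpha>
  proof -
    note wf = sobolev_weak_deriv(1)[OF f that] and wg = sobolev_weak_deriv(1)[OF g that]
    have li: "locally_integrable f" "locally_integrable g" "locally_integrable (weak_deriv \<alpha> f)" "locally_integrable (weak_deriv \<alpha> g)"
      using wf wg by (auto simp: is_weak_deriv_def)
    have d: "locally_integrable (\<lambda>x. a x - b x)" if "locally_integrable a" "locally_integrable b" for a b :: "real^'a \<Rightarrow> real"
      using that by (auto simp: locally_integrable_def intro: set_integral_diff)
    have "(LINT x|lebesgue. (f x - g x) * iter_pderiv is \<phi> x)
        = (- 1) ^ mi_order \<alpha> * (LINT x|lebesgue. (weak_deriv \<alpha> f x - weak_deriv \<alpha> g x) * \<phi> x)"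
      if \<phi>: "test_function \<phi>" "count_list is = \<alpha>" for \<phi> "is"
    proof -
      note t = locally_integrable_test[OF _ \<phi>(1)] and ti = locally_integrable_test[OF _ test_function_iter[OF \<phi>(1), of "is"]]
      have "(LINT x|lebesgue. (f x - g x) * iter_pderiv is \<phi> x) = (LINT x|lebesgue. f x * iter_pderiv is \<phi> x) - (LINT x|lebesgue. g x * iter_pderiv is \<phi> x)"
        using ti[OF li(1)] ti[OF li(2)] by (simp add: left_diff_distrib)
      also have "\<dots> = (- 1) ^ mi_order \<alpha> * ((LINT x|lebesgue. weak_deriv \<alpha> f x * \<phi> x) - (LINT x|lebesgue. weak_deriv \<alpha> g x * \<phi> x))"
        using wf wg \<phi> by (simp add: is_weak_deriv_def right_diff_distrib)
      also have "(LINT x|lebesgue. weak_deriv \<alpha> f x * \<phi> x) - (LINT x|lebesgue. weak_deriv \<alpha> g x * \<phi> x) = (LINT x|lebesgue. (weak_deriv \<alpha> f x - weak_deriv \<alpha> g x) * \<phi> x)"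
        using t[OF li(3)] t[OF li(4)] by (simp add: left_diff_distrib)
      finally show ?thesis .
    qed
    thus ?thesis using li d by (auto simp: is_weak_deriv_def)
  qed
  note L = L2_space_diff_of_fun[OF sobolev_weak_deriv(2)[OF f] sobolev_weak_deriv(2)[OF g]]
  show "(\<lambda>x. f x - g x) \<in> sobolev s"
    unfolding sobolev_def using w L(1) L2_space_diff_of_fun(1)[OF sobolev_L2[OF f] sobolev_L2[OF g]] by blast
  show "mi_order \<alpha> \<le> s \<Longrightarrow> wd \<alpha> (\<lambda>x. f x - g x) = wd \<alpha> f - wd \<alpha> g"
    unfolding wd_def using weak_deriv_eq(3)[OF w L(1)] L(2) by simp
qed

lemma sobolev_scale_wd:
  assumes f: "f \<in> sobolev s"
  shows "(\<lambda>x. e * f x) \<in> sobolev s" "mi_order \<alpha> \<le> s \<Longrightarrow> wd \<alpha> (\<lambda>x. e * f x) = e *\<^sub>R wd \<alpha> f"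
proof -
  have w: "is_weak_deriv \<alpha> (\<lambda>x. e * f x) (\<lambda>x. e * weak_deriv \<alpha> f x)" if "mi_order \<alpha> \<le> s" for \<alpha>
    using sobolev_weak_deriv(1)[OF f that]
    by (auto simp: is_weak_deriv_def locally_integrable_def mult.assoc intro!: set_integrable_mult_right)
  note L = L2_space_scale_of_fun[OF sobolev_weak_deriv(2)[OF f]]
  show "(\<lambda>x. e * f x) \<in> sobolev s"
    unfolding sobolev_def using w L(1) L2_space_scale_of_fun(1)[OF sobolev_L2[OF f]] by blast
  show "mi_order \<alpha> \<le> s \<Longrightarrow> wd \<alpha> (\<lambda>x. e * f x) = e *\<^sub>R wd \<alpha> f"
    unfolding wd_def using weak_deriv_eq(3)[OF w L(1)] L(2) by simp
qed

lemma mi_order_zero: "mi_order (\<lambda>_. 0) = 0" "mi_order \<alpha> = 0 \<Longrightarrow> \<alpha> = (\<lambda>_. 0)"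
  by (auto simp: mi_order_def fun_eq_iff)

lemma mi_order_add_unit: "mi_order (\<lambda>j. \<alpha> j + mi_unit i j) = Suc (mi_order \<alpha>)"
  by (simp add: mi_order_def mi_unit_def sum.distrib)

lemma is_weak_deriv_zero:
  assumes "f \<in> L2_space" shows "is_weak_deriv (\<lambda>_. 0) f f"
proof -
  have nil: "is = []" if "count_list is = (\<lambda>_. 0)" for "is" :: "'a list"
    using that by (metis count_list_0_iff list.set_intros(1) neq_Nil_conv)
  show ?thesis unfolding is_weak_deriv_def
  proof (intro conjI allI impI)
    fix \<phi> :: "real^'a \<Rightarrow> real" and "is" :: "'a list"
    assume "test_function \<phi> \<and> count_list is = (\<lambda>_. 0)"
    hence "is = []" using nil by simp
    thus "(LINT x|lebesgue. f x * iter_pderiv is \<phi> x) = (- 1) ^ mi_order (\<lambda>_ :: 'a. 0) * (LINT x|lebesgue. f x * \<phi> x)"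
      by (simp add: mi_order_zero)
  qed (use L2_space_locally_integrable[OF assms] in simp_all)
qed

lemma L2_sobolev_0: assumes f: "f \<in> L2_space" shows "f \<in> sobolev 0"
  unfolding sobolev_def
proof (intro CollectI conjI f allI impI)
  fix \<alpha> :: "'a \<Rightarrow> nat" assume "mi_order \<alpha> \<le> 0"
  hence "\<alpha> = (\<lambda>_. 0)" by (intro mi_order_zero(2)) simp
  thus "\<exists>g\<in>L2_space. is_weak_deriv \<alpha> f g" using is_weak_deriv_zero[OF f] f by blast
qed

lemma wd_zero: "f \<in> L2_space \<Longrightarrow> wd (\<lambda>_. 0) f = of_fun f"
  unfolding wd_def by (rule weak_deriv_eq(3)[OF is_weak_deriv_zero])

lemma sobolev_norm_0: "f \<in> L2_space \<Longrightarrow> sobolev_norm 0 f = norm (of_fun f)"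
proof -
  assume f: "f \<in> L2_space"
  have "{\<alpha> :: 'a \<Rightarrow> nat. mi_order \<alpha> \<le> 0} = {\<lambda>_. 0}" using mi_order_zero by auto
  hence "(sobolev_norm 0 f)\<^sup>2 = (norm (of_fun f))\<^sup>2"
    using sobolev_norm_wd[OF L2_sobolev_0[OF f]] wd_zero[OF f] by simp
  moreover have "0 \<le> sobolev_norm 0 f" by (simp add: sobolev_norm_def sum_nonneg)
  ultimately show ?thesis by (simp add: power2_eq_iff_nonneg)
qed

lemma inner_of_fun_test:
  assumes f: "f \<in> L2_space" and \<phi>: "test_function \<phi>"
  shows "inner (of_fun f) (abs_l2 \<phi>) = (LINT x|lebesgue. f x * \<phi> x)"
proof -
  have s: "sqint \<phi>" by (rule test_function_sqint[OF \<phi>])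
  have "inner (of_fun f) (abs_l2 \<phi>) = (LINT x|lborel. rep_l2 (of_fun f) x * \<phi> x)"
    using inner_abs[OF sqint_rep[of "of_fun f"] s] by simp
  also have "\<dots> = (LINT x|lebesgue. rep_l2 (of_fun f) x * \<phi> x)"
    using s by (intro integral_completion[symmetric]) (auto simp: sqint_def)
  also have "\<dots> = (LINT x|lebesgue. f x * \<phi> x)"
    using rep_of_fun[OF f] locally_integrable_test[OF L2_space_locally_integrable \<phi>] f rep_L2_space
    by (intro integral_cong_AE borel_measurable_integrable) (auto elim: eventually_mono)
  finally show ?thesis .
qed

lemma count_list_snoc: "count_list (is @ [i]) = (\<lambda>j. count_list is j + mi_unit i j)"
  by (auto simp: fun_eq_iff mi_unit_def)

lemma wd_has_D:
  assumes f: "f \<in> sobolev s" and \<alpha>: "Suc (mi_order \<alpha>) \<le> s"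
  shows "has_D i (wd \<alpha> f) (wd (\<lambda>j. \<alpha> j + mi_unit i j) f)"
proof (rule has_D_weak)
  let ?\<beta> = "\<lambda>j. \<alpha> j + mi_unit i j"
  fix \<phi> :: "real^'a \<Rightarrow> real" assume \<phi>: "test_function \<phi>"
  have \<beta>: "mi_order ?\<beta> \<le> s" using \<alpha> by (simp add: mi_order_add_unit)
  have \<alpha>': "mi_order \<alpha> \<le> s" using \<alpha> by simp
  obtain "is" where is': "count_list is = \<alpha>" using ex_list_count by blast
  have "(LINT x|lebesgue. f x * iter_pderiv is (pderiv_at i \<phi>) x) = (- 1) ^ mi_order \<alpha> * (LINT x|lebesgue. weak_deriv \<alpha> f x * pderiv_at i \<phi> x)"
    using sobolev_weak_deriv(1)[OF f \<alpha>'] test_function_pderiv[OF \<phi>] is' by (auto simp: is_weak_deriv_def)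
  \<comment> \<open>The list \<open>is @ [i]\<close> applies the derivative i first, so the
    left-hand sides of both identities agree. The orders differ by one, which produces the
    sign.\<close>
  moreover have "(LINT x|lebesgue. f x * iter_pderiv (is @ [i]) \<phi> x) = (- 1) ^ mi_order ?\<beta> * (LINT x|lebesgue. weak_deriv ?\<beta> f x * \<phi> x)"
    using sobolev_weak_deriv(1)[OF f \<beta>] \<phi> is' count_list_snoc[of "is" i] by (auto simp: is_weak_deriv_def)
  ultimately have "(- 1) ^ mi_order \<alpha> * ((LINT x|lebesgue. weak_deriv \<alpha> f x * pderiv_at i \<phi> x) + (LINT x|lebesgue. weak_deriv ?\<beta> f x * \<phi> x)) = 0"
    by (simp add: iter_pderiv_append mi_order_add_unit distrib_left)
  hence "(LINT x|lebesgue. weak_deriv \<alpha> f x * pderiv_at i \<phi> x) = - (LINT x|lebesgue. weak_deriv ?\<beta> f x * \<phi> x)"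
    by (simp add: eq_neg_iff_add_eq_0)
  thus "inner (wd \<alpha> f) (abs_l2 (pderiv_at i \<phi>)) = - inner (wd ?\<beta> f) (abs_l2 \<phi>)"
    unfolding wd_def
    by (simp add: inner_of_fun_test sobolev_weak_deriv(2)[OF f] \<alpha>' \<beta> \<phi> test_function_pderiv)
qed

text \<open>Converts the H^k norm of a component of the gradient, which occurs in
  \<open>energy\<close>, into norms of derivatives of the function itself.\<close>

lemma wd_weak_deriv_unit:
  assumes f: "f \<in> sobolev (Suc s)"
  shows "weak_deriv (mi_unit i) f \<in> sobolev s"
    "mi_order \<alpha> \<le> s \<Longrightarrow> wd \<alpha> (weak_deriv (mi_unit i) f) = wd (\<lambda>j. \<alpha> j + mi_unit i j) f"
proof -
  have u: "mi_order (mi_unit i) = 1" using mi_order_add_unit[of "\<lambda>_. 0" i] by (simp add: mi_order_zero)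
  let ?g = "weak_deriv (mi_unit i) f"
  have g: "is_weak_deriv (mi_unit i) f ?g" "?g \<in> L2_space" using sobolev_weak_deriv[OF f] u by auto
  have w: "is_weak_deriv \<alpha> ?g (weak_deriv (\<lambda>j. \<alpha> j + mi_unit i j) f)" if "mi_order \<alpha> \<le> s" for \<alpha>
  proof -
    let ?\<beta> = "\<lambda>j. \<alpha> j + mi_unit i j"
    have \<beta>: "mi_order ?\<beta> \<le> Suc s" using that by (simp add: mi_order_add_unit)
    note wb = sobolev_weak_deriv(1)[OF f \<beta>]
    have "(LINT x|lebesgue. ?g x * iter_pderiv is \<phi> x) = (- 1) ^ mi_order \<alpha> * (LINT x|lebesgue. weak_deriv ?\<beta> f x * \<phi> x)"
      if \<phi>: "test_function \<phi>" "count_list is = \<alpha>" for \<phi> "is"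
    proof -
      have c: "count_list [i] = mi_unit i" "count_list (i # is) = ?\<beta>" using \<phi>(2) by (auto simp: fun_eq_iff mi_unit_def)
      have "(LINT x|lebesgue. f x * iter_pderiv [i] (iter_pderiv is \<phi>) x) = (- 1) ^ mi_order (mi_unit i) * (LINT x|lebesgue. ?g x * iter_pderiv is \<phi> x)"
        using g(1) test_function_iter[OF \<phi>(1), of "is"] c(1) unfolding is_weak_deriv_def by blast
      moreover have "(LINT x|lebesgue. f x * iter_pderiv (i # is) \<phi> x) = (- 1) ^ mi_order ?\<beta> * (LINT x|lebesgue. weak_deriv ?\<beta> f x * \<phi> x)"
        using wb \<phi>(1) c(2) unfolding is_weak_deriv_def by blast
      ultimately show ?thesis by (simp add: u mi_order_add_unit)
    qed
    thus ?thesis using g wb by (auto simp: is_weak_deriv_def L2_space_locally_integrable)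
  qed
  have L: "weak_deriv (\<lambda>j. \<alpha> j + mi_unit i j) f \<in> L2_space" if "mi_order \<alpha> \<le> s" for \<alpha>
    using that by (intro sobolev_weak_deriv(2)[OF f]) (simp add: mi_order_add_unit)
  show "?g \<in> sobolev s" unfolding sobolev_def using g w L by blast
  show "mi_order \<alpha> \<le> s \<Longrightarrow> wd \<alpha> ?g = wd (\<lambda>j. \<alpha> j + mi_unit i j) f"
    unfolding wd_def using weak_deriv_eq(3)[OF w L] by simp
qed

text \<open>\<open>wd \<alpha>\<close> is linear on the Sobolev space and bounded by its norm, so it
  may be applied to the difference quotients.\<close>

lemma has_time_deriv_wd:
  assumes u: "has_time_deriv s T u g t" and t: "t \<in> {0..T}" and \<alpha>: "mi_order \<alpha> \<le> s"
  shows "((\<lambda>\<tau>. wd \<alpha> (u \<tau>)) has_vector_derivative wd \<alpha> g) (at t within {0..T})"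
proof -
  have us: "\<And>\<tau>. \<tau> \<in> {0..T} \<Longrightarrow> u \<tau> \<in> sobolev s" and g: "g \<in> sobolev s"
    and lim: "((\<lambda>\<tau>. sobolev_norm s (\<lambda>x. (u \<tau> x - u t x) / (\<tau> - t) - g x)) \<longlongrightarrow> 0) (at t within {0..T})"
    using u by (auto simp: has_time_deriv_def)
  have ev: "\<forall>\<^sub>F \<tau> in at t within {0..T}. norm ((wd \<alpha> (u \<tau>) - wd \<alpha> (u t)) /\<^sub>R (\<tau> - t) - wd \<alpha> g)
      \<le> sobolev_norm s (\<lambda>x. (u \<tau> x - u t x) / (\<tau> - t) - g x)"
    unfolding eventually_at_filter
  proof (intro always_eventually allI impI)
    fix \<tau> assume \<tau>: "\<tau> \<in> {0..T}"
    note d = sobolev_diff_wd[OF us[OF \<tau>] us[OF t]]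
    note sc = sobolev_scale_wd[OF d(1), where e = "inverse (\<tau> - t)"]
    note dd = sobolev_diff_wd[OF sc(1) g]
    have "wd \<alpha> (\<lambda>x. inverse (\<tau> - t) * (u \<tau> x - u t x) - g x) = (wd \<alpha> (u \<tau>) - wd \<alpha> (u t)) /\<^sub>R (\<tau> - t) - wd \<alpha> g"
      using d(2)[OF \<alpha>] sc(2)[OF \<alpha>] dd(2)[OF \<alpha>] by simp
    moreover have "(\<lambda>x. inverse (\<tau> - t) * (u \<tau> x - u t x) - g x) = (\<lambda>x. (u \<tau> x - u t x) / (\<tau> - t) - g x)"
      by (simp add: divide_inverse mult.commute)
    ultimately show "norm ((wd \<alpha> (u \<tau>) - wd \<alpha> (u t)) /\<^sub>R (\<tau> - t) - wd \<alpha> g)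
        \<le> sobolev_norm s (\<lambda>x. (u \<tau> x - u t x) / (\<tau> - t) - g x)"
      using norm_wd_le[OF dd(1) \<alpha>] by simp
  qed
  have "((\<lambda>\<tau>. (wd \<alpha> (u \<tau>) - wd \<alpha> (u t)) /\<^sub>R (\<tau> - t) - wd \<alpha> g) \<longlongrightarrow> 0) (at t within {0..T})"
    by (rule Lim_null_comparison[OF ev lim])
  thus ?thesis unfolding has_vector_derivative_iff_quotient by (rule LIM_zero_cancel)
qed

lemma continuous_in_sobolev_wd:
  assumes u: "continuous_in_sobolev s T u" and \<alpha>: "mi_order \<alpha> \<le> s"
  shows "continuous_on {0..T} (\<lambda>\<tau>. wd \<alpha> (u \<tau>))"
  unfolding continuous_on_def
proof
  fix t assume t: "t \<in> {0..T}"
  have us: "\<And>\<tau>. \<tau> \<in> {0..T} \<Longrightarrow> u \<tau> \<in> sobolev s"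
    and lim: "((\<lambda>\<tau>. sobolev_norm s (\<lambda>x. u \<tau> x - u t x)) \<longlongrightarrow> 0) (at t within {0..T})"
    using u t by (auto simp: continuous_in_sobolev_def)
  have ev: "\<forall>\<^sub>F \<tau> in at t within {0..T}. norm (wd \<alpha> (u \<tau>) - wd \<alpha> (u t)) \<le> sobolev_norm s (\<lambda>x. u \<tau> x - u t x)"
    unfolding eventually_at_filter
  proof (intro always_eventually allI impI)
    fix \<tau> assume \<tau>: "\<tau> \<in> {0..T}"
    note d = sobolev_diff_wd[OF us[OF \<tau>] us[OF t]]
    show "norm (wd \<alpha> (u \<tau>) - wd \<alpha> (u t)) \<le> sobolev_norm s (\<lambda>x. u \<tau> x - u t x)"
      using norm_wd_le[OF d(1) \<alpha>] d(2)[OF \<alpha>] by simp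
  qed
  have "((\<lambda>\<tau>. wd \<alpha> (u \<tau>) - wd \<alpha> (u t)) \<longlongrightarrow> 0) (at t within {0..T})"
    by (rule Lim_null_comparison[OF ev lim])
  thus "((\<lambda>\<tau>. wd \<alpha> (u \<tau>)) \<longlongrightarrow> wd \<alpha> (u t)) (at t within {0..T})" by (rule LIM_zero_cancel)
qed

lemma has_time_deriv_0:
  assumes u: "\<And>\<tau>. \<tau> \<in> {0..T} \<Longrightarrow> u \<tau> \<in> L2_space" and g: "g \<in> L2_space" and t: "t \<in> {0..T}"
  shows "has_time_deriv 0 T u g t \<longleftrightarrow> ((\<lambda>\<tau>. of_fun (u \<tau>)) has_vector_derivative of_fun g) (at t within {0..T})"
proof -
  have ev: "\<forall>\<^sub>F \<tau> in at t within {0..T}. sobolev_norm 0 (\<lambda>x. (u \<tau> x - u t x) / (\<tau> - t) - g x)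
      = norm ((of_fun (u \<tau>) - of_fun (u t)) /\<^sub>R (\<tau> - t) - of_fun g)"
    unfolding eventually_at_filter
  proof (intro always_eventually allI impI)
    fix \<tau> assume \<tau>: "\<tau> \<in> {0..T}"
    note d = L2_space_diff_of_fun[OF u[OF \<tau>] u[OF t]]
    note sc = L2_space_scale_of_fun[OF d(1), where e = "inverse (\<tau> - t)"]
    note dd = L2_space_diff_of_fun[OF sc(1) g]
    have "(\<lambda>x. inverse (\<tau> - t) * (u \<tau> x - u t x) - g x) = (\<lambda>x. (u \<tau> x - u t x) / (\<tau> - t) - g x)"
      by (simp add: divide_inverse mult.commute)
    thus "sobolev_norm 0 (\<lambda>x. (u \<tau> x - u t x) / (\<tau> - t) - g x) = norm ((of_fun (u \<tau>) - of_fun (u t)) /\<^sub>R (\<tau> - t) - of_fun g)"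
      using sobolev_norm_0[OF dd(1)] d(2) sc(2) dd(2) by simp
  qed
  have "((\<lambda>\<tau>. of_fun (u \<tau>)) has_vector_derivative of_fun g) (at t within {0..T})
      \<longleftrightarrow> ((\<lambda>\<tau>. norm ((of_fun (u \<tau>) - of_fun (u t)) /\<^sub>R (\<tau> - t) - of_fun g)) \<longlongrightarrow> 0) (at t within {0..T})"
    unfolding has_vector_derivative_iff_quotient tendsto_norm_zero_iff by (rule Lim_null)
  also have "\<dots> \<longleftrightarrow> ((\<lambda>\<tau>. sobolev_norm 0 (\<lambda>x. (u \<tau> x - u t x) / (\<tau> - t) - g x)) \<longlongrightarrow> 0) (at t within {0..T})"
    by (rule filterlim_cong[OF refl refl eventually_mono[OF ev]]) simp
  finally show ?thesis using u g by (auto simp: has_time_deriv_def L2_sobolev_0)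
qed

lemma vector_derivative_unique_I:
  assumes T: "0 < T" and t: "t \<in> {0..T}"
    and "(A has_vector_derivative a) (at t within {0..T})" "(B has_vector_derivative b) (at t within {0..T})"
    and "\<And>s. s \<in> {0..T} \<Longrightarrow> A s = B s"
  shows "a = b"
proof -
  have "(A has_vector_derivative b) (at t within {0..T})"
    by (rule has_vector_derivative_transform[OF t assms(5) assms(4)])
  thus ?thesis using vector_derivative_unique_within_closed_interval[of 0 T t A] T t assms(3)
    by (metis box_real(2))
qed

text \<open>Iterated time derivatives are only determined almost everywhere; \<open>C j\<close> are their classes.\<close>

lemma iterated_time_deriv:
  assumes T: "0 < T" and u: "\<And>t. t \<in> {0..T} \<Longrightarrow> u t \<in> L2_space" "\<And>t. t \<in> {0..T} \<Longrightarrow> of_fun (u t) = C 0 t"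
    and C: "\<And>j t. j < J \<Longrightarrow> t \<in> {0..T} \<Longrightarrow> (C j has_vector_derivative C (Suc j) t) (at t within {0..T})"
  shows "j \<le> J \<Longrightarrow> t \<in> {0..T} \<Longrightarrow> (time_deriv T ^^ j) u t \<in> L2_space \<and> of_fun ((time_deriv T ^^ j) u t) = C j t"
proof (induction j arbitrary: t)
  case (Suc j)
  let ?v = "(time_deriv T ^^ j) u"
  have v: "\<And>\<tau>. \<tau> \<in> {0..T} \<Longrightarrow> ?v \<tau> \<in> L2_space" "\<And>\<tau>. \<tau> \<in> {0..T} \<Longrightarrow> of_fun (?v \<tau>) = C j \<tau>"
    using Suc by auto
  have d: "((\<lambda>\<tau>. of_fun (?v \<tau>)) has_vector_derivative C (Suc j) t) (at t within {0..T})"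
    by (rule has_vector_derivative_transform[OF Suc.prems(2) v(2) C]) (use Suc.prems in auto)
  hence "has_time_deriv 0 T ?v (rep_l2 (C (Suc j) t)) t"
    using has_time_deriv_0[OF v(1) rep_L2_space Suc.prems(2)] by (simp add: of_fun_rep)
  hence s: "has_time_deriv 0 T ?v (time_deriv T ?v t) t" unfolding time_deriv_def[of T ?v]
    by (rule someI[where P = "\<lambda>g. has_time_deriv 0 T ?v g t"])
  hence L: "time_deriv T ?v t \<in> L2_space" by (auto simp: has_time_deriv_def intro: sobolev_L2)
  have "((\<lambda>\<tau>. of_fun (?v \<tau>)) has_vector_derivative of_fun (time_deriv T ?v t)) (at t within {0..T})"
    using s has_time_deriv_0[OF v(1) L Suc.prems(2)] by simp
  hence "of_fun (time_deriv T ?v t) = C (Suc j) t"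
    by (rule vector_derivative_unique_I[OF T Suc.prems(2) _ d]) simp
  thus ?case using L by simp
qed (use u in simp)

lemma rep_sum: "AE x in lborel. rep_l2 (\<Sum>k\<in>J. f k) x = (\<Sum>k\<in>J. rep_l2 (f k) x)"
proof (induction J rule: infinite_finite_induct)
  case (insert k J)
  show ?case using insert.IH rep_add[of "f k" "\<Sum>k\<in>J. f k"]
    by eventually_elim (simp add: insert.hyps)
qed (use rep_scaleR[of 0] in auto)

lemma of_fun_wave:
  fixes a1 a2 :: "real^'n::finite \<Rightarrow> real" and l b d :: "'n \<Rightarrow> real^'n \<Rightarrow> real"
  assumes L: "a1 \<in> L2_space" "a2 \<in> L2_space" "\<And>i. l i \<in> L2_space" "\<And>i. b i \<in> L2_space" "\<And>i. d i \<in> L2_space"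
    and ok: "pmult_ok (of_fun a1) (of_fun a2)" "\<And>i. pmult_ok (of_fun (b i)) (of_fun (d i))"
    and eq: "AE x in lebesgue. a2 x - c\<^sup>2 * (\<Sum>i\<in>UNIV. l i x) = \<kappa> * a1 x * a2 x + \<mu> * (\<Sum>i\<in>UNIV. b i x * d i x)"
  shows "of_fun a2 - \<kappa> *\<^sub>R pmult (of_fun a1) (of_fun a2)
    = c\<^sup>2 *\<^sub>R (\<Sum>i\<in>UNIV. of_fun (l i)) + \<mu> *\<^sub>R (\<Sum>i\<in>UNIV. pmult (of_fun (b i)) (of_fun (d i)))"
proof -
  let ?A = "pmult (of_fun a1) (of_fun a2)" and ?L = "\<Sum>i\<in>UNIV. of_fun (l i)"
    and ?B = "\<Sum>i\<in>UNIV. pmult (of_fun (b i)) (of_fun (d i))"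
  have fin: "AE x in lebesgue. \<forall>i. P i x" if "\<And>i. AE x in lebesgue. P i x" for P :: "'n \<Rightarrow> real^'n \<Rightarrow> bool"
    using that by (simp add: AE_all_countable)
  have r: "AE x in lebesgue. \<forall>i. rep_l2 (of_fun (l i)) x = l i x"
    "AE x in lebesgue. \<forall>i. rep_l2 (pmult (of_fun (b i)) (of_fun (d i))) x = rep_l2 (of_fun (b i)) x * rep_l2 (of_fun (d i)) x"
    "AE x in lebesgue. \<forall>i. rep_l2 (of_fun (b i)) x = b i x" "AE x in lebesgue. \<forall>i. rep_l2 (of_fun (d i)) x = d i x"
    by (intro fin rep_of_fun L AE_completion[OF rep_pmult] ok)+
  note s = AE_completion[OF rep_diff] AE_completion[OF rep_add] AE_completion[OF rep_scaleR] AE_completion[OF rep_sum]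
  have "AE x in lebesgue. rep_l2 (of_fun a2 - \<kappa> *\<^sub>R ?A) x = rep_l2 (c\<^sup>2 *\<^sub>R ?L + \<mu> *\<^sub>R ?B) x"
    using eq r s(1)[of "of_fun a2" "\<kappa> *\<^sub>R ?A"] s(2)[of "c\<^sup>2 *\<^sub>R ?L" "\<mu> *\<^sub>R ?B"]
      s(3)[of \<kappa> ?A] s(3)[of "c\<^sup>2" ?L] s(3)[of \<mu> ?B] s(4)[of "\<lambda>i. of_fun (l i)" UNIV]
      s(4)[of "\<lambda>i. pmult (of_fun (b i)) (of_fun (d i))" UNIV]
      rep_of_fun[OF L(1)] rep_of_fun[OF L(2)] AE_completion[OF rep_pmult[OF ok(1)]]
    by eventually_elim (simp add: algebra_simps)
  thus ?thesis unfolding l2_eq_iff by (simp add: AE_completion_iff)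
qed

lemma bounded_by_of_Linf:
  fixes f :: "real^'n::finite \<Rightarrow> real"
  assumes f: "f \<in> L2_space" and b: "Linf_norm f < ereal (1 / (2 * \<kappa>))" and \<kappa>: "0 < \<kappa>"
  shows "bounded_by (1 / 2) (\<kappa> *\<^sub>R of_fun f)"
proof -
  have "AE x in lebesgue. ereal (norm (f x)) \<le> Linf_norm f" unfolding Linf_norm_def by (rule esssup_AE)
  hence "AE x in lebesgue. \<bar>rep_l2 (\<kappa> *\<^sub>R of_fun f) x\<bar> \<le> 1 / 2"
    using rep_of_fun[OF f] AE_completion[OF rep_scaleR[of \<kappa> "of_fun f"]]
  proof eventually_elim
    case (elim x)
    have "ereal (norm (f x)) < ereal (1 / (2 * \<kappa>))" using elim(1) b by (rule le_less_trans)
    hence "\<bar>f x\<bar> < 1 / (2 * \<kappa>)" by simp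
    hence "\<kappa> * \<bar>f x\<bar> \<le> 1 / 2" using \<kappa> by (simp add: field_simps)
    thus ?case using elim \<kappa> by (simp add: abs_mult)
  qed
  thus ?thesis unfolding bounded_by_def by (simp add: AE_completion_iff)
qed

section \<open>The solution as a family of derivatives\<close>

definition mk_idx :: "nat \<Rightarrow> ('n \<Rightarrow> nat) \<Rightarrow> 'n::finite idx" where
  "mk_idx j \<alpha> d = (case d of None \<Rightarrow> j | Some i \<Rightarrow> \<alpha> i)"

lemma mk_idx_simps [simp]: "mk_idx j \<alpha> None = j" "mk_idx j \<alpha> (Some i) = \<alpha> i"
  by (simp_all add: mk_idx_def)

lemma mk_idx_eta: "mk_idx (q None) (\<lambda>i. q (Some i)) = q"
  by (rule ext) (simp add: mk_idx_def split: option.split)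

lemma order_mi_order: "order q = q None + mi_order (\<lambda>i. q (Some i))"
  unfolding order_def mi_order_def by (simp add: UNIV_option_conv sum.reindex)

lemma inc_Some_mi: "(\<lambda>j. inc (Some i) q (Some j)) = (\<lambda>j. q (Some j) + mi_unit i j)"
  by (auto simp: inc_apply mi_unit_def fun_eq_iff)

lemma tidx_zero: "tidx 0 = (\<lambda>_. 0)"
  by (simp add: tidx_def fun_eq_iff)

lemma mk_idx_zero: "mk_idx j (\<lambda>_. 0) = tidx j"
  by (rule ext) (simp add: mk_idx_def tidx_def split: option.split)

lemma sum_space_idx:
  fixes X :: "'n::finite idx \<Rightarrow> real"
  shows "(\<Sum>q\<in>space_idx k. X q) = (\<Sum>\<alpha> | mi_order \<alpha> \<le> k. X (mk_idx 0 \<alpha>))"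
proof (rule sum.reindex_bij_witness[where i = "mk_idx 0" and j = "\<lambda>q i. q (Some i)"])
  fix q :: "'n idx" assume q: "q \<in> space_idx k"
  show eta: "mk_idx 0 (\<lambda>i. q (Some i)) = q" using mk_idx_eta[of q] q by (simp add: space_idx_def)
  show "X (mk_idx 0 (\<lambda>i. q (Some i))) = X q" by (simp add: eta)
qed (auto simp: space_idx_def order_mi_order)

lemma sum_time_idx:
  fixes X :: "'n::finite idx \<Rightarrow> real"
  shows "(\<Sum>q\<in>time_idx k. X q) = (\<Sum>j = 1..k. \<Sum>\<alpha> | mi_order \<alpha> \<le> k - j. X (mk_idx j \<alpha>))"
proof -
  have "(\<Sum>j = 1..k. \<Sum>\<alpha> | mi_order \<alpha> \<le> k - j. X (mk_idx j \<alpha>))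
      = (\<Sum>(j, \<alpha>) \<in> (SIGMA j : {1..k}. {\<alpha>. mi_order \<alpha> \<le> k - j}). X (mk_idx j \<alpha>))"
    by (rule sum.Sigma) (auto simp: finite_mi_order)
  also have "\<dots> = (\<Sum>q\<in>time_idx k. X q)"
    by (rule sum.reindex_bij_witness[where j = "\<lambda>(j, \<alpha>). mk_idx j \<alpha>" and i = "\<lambda>q. (q None, \<lambda>i. q (Some i))"])
       (auto simp: time_idx_def order_mi_order mk_idx_eta)
  finally show ?thesis by simp
qed

lemma sobolev_mono: "f \<in> sobolev s \<Longrightarrow> r \<le> s \<Longrightarrow> f \<in> sobolev r"
  by (auto simp: sobolev_def)



text \<open>Each membership of the solution in \<open>C_sobolev\<close> supplies its own family of
  derivatives: \<open>v r j\<close> is the derivative of order j in time, taken in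
  H^(m+1-r).\<close>

locale sobolev_curve =
  fixes m :: nat and T :: real and u :: "real \<Rightarrow> real^'n::finite \<Rightarrow> real" and v :: "nat \<Rightarrow> nat \<Rightarrow> real \<Rightarrow> real^'n \<Rightarrow> real"
  assumes T: "0 < T" and v_0: "r \<le> m \<Longrightarrow> v r 0 = u"
    and v_cont: "r \<le> m \<Longrightarrow> j \<le> r \<Longrightarrow> continuous_in_sobolev (m + 1 - r) T (v r j)"
    and v_deriv: "r \<le> m \<Longrightarrow> j < r \<Longrightarrow> t \<in> {0..T} \<Longrightarrow> has_time_deriv (m + 1 - r) T (v r j) (v r (Suc j) t) t"
begin

lemma v_sobolev: "r \<le> m \<Longrightarrow> j \<le> r \<Longrightarrow> t \<in> {0..T} \<Longrightarrow> v r j t \<in> sobolev (m + 1 - r)"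
  using v_cont by (auto simp: continuous_in_sobolev_def)

lemma v_L2: "r \<le> m \<Longrightarrow> j \<le> r \<Longrightarrow> t \<in> {0..T} \<Longrightarrow> v r j t \<in> L2_space"
  using v_sobolev sobolev_L2 by blast

lemma v_has_vector_derivative:
  assumes "r \<le> m" "j < r" "t \<in> {0..T}"
  shows "((\<lambda>\<tau>. of_fun (v r j \<tau>)) has_vector_derivative of_fun (v r (Suc j) t)) (at t within {0..T})"
proof -
  have "((\<lambda>\<tau>. wd (\<lambda>_. 0) (v r j \<tau>)) has_vector_derivative wd (\<lambda>_. 0) (v r (Suc j) t)) (at t within {0..T})"
    by (rule has_time_deriv_wd[OF v_deriv[OF assms] assms(3)]) (simp add: mi_order_zero)
  hence "((\<lambda>\<tau>. wd (\<lambda>_. 0) (v r j \<tau>)) has_vector_derivative of_fun (v r (Suc j) t)) (at t within {0..T})"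
    using assms by (simp add: wd_zero v_L2)
  thus ?thesis
    by (rule has_vector_derivative_transform[OF assms(3), rotated]) (use assms in \<open>simp add: wd_zero v_L2\<close>)
qed

text \<open>Every family differentiates the same curve in L2, and derivatives there are unique as
  classes; by induction on j the families agree.\<close>

lemma of_fun_v: "j \<le> r \<Longrightarrow> r \<le> m \<Longrightarrow> t \<in> {0..T} \<Longrightarrow> of_fun (v r j t) = of_fun (v j j t)"
proof (induction j arbitrary: r t)
  case (Suc j)
  have 1: "j < r" "r \<le> m" "j < Suc j" "Suc j \<le> m" using Suc.prems by auto
  show ?case
  proof (rule vector_derivative_unique_I[OF T Suc.prems(3) v_has_vector_derivative[OF 1(2,1) Suc.prems(3)]
        v_has_vector_derivative[OF 1(4,3) Suc.prems(3)]])
    fix s assume s: "s \<in> {0..T}"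
    show "of_fun (v r j s) = of_fun (v (Suc j) j s)"
      using Suc.IH[of r s] Suc.IH[of "Suc j" s] 1 s by simp
  qed
qed (simp add: v_0)

text \<open>The diagonal member \<open>v j j\<close> is the derivative of order j in the smoothest
  space available for it, H^(m+1-j). For time order m + 1 no such member is given; that entry of
  \<open>W\<close> is overwritten later.\<close>

definition W :: "'n idx \<Rightarrow> real \<Rightarrow> 'n l2" where
  "W p t = wd (\<lambda>i. p (Some i)) (v (p None) (p None) t)"

lemma W_tidx: "j \<le> m \<Longrightarrow> t \<in> {0..T} \<Longrightarrow> W (tidx j) t = of_fun (v j j t)"
  by (simp add: W_def tidx_def wd_zero v_L2)

lemma W_tidx_deriv:
  assumes "j < m" "t \<in> {0..T}"
  shows "(W (tidx j) has_vector_derivative W (tidx (Suc j)) t) (at t within {0..T})"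
proof -
  have d: "((\<lambda>\<tau>. of_fun (v (Suc j) j \<tau>)) has_vector_derivative W (tidx (Suc j)) t) (at t within {0..T})"
    using v_has_vector_derivative[of "Suc j" j t] assms by (simp add: W_tidx)
  have eq: "W (tidx j) \<tau> = of_fun (v (Suc j) j \<tau>)" if "\<tau> \<in> {0..T}" for \<tau>
    using assms that of_fun_v[of j "Suc j" \<tau>] by (simp add: W_tidx)
  show ?thesis by (rule has_vector_derivative_transform[OF assms(2) eq d])
qed

lemma time_deriv_class:
  assumes j: "j \<le> m" "t \<in> {0..T}"
  shows "(time_deriv T ^^ j) u t \<in> L2_space" "of_fun ((time_deriv T ^^ j) u t) = W (tidx j) t"
proof -
  have *: "(time_deriv T ^^ j) u t \<in> L2_space \<and> of_fun ((time_deriv T ^^ j) u t) = W (tidx j) t"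
  proof (rule iterated_time_deriv[where C = "\<lambda>j. W (tidx j)" and J = m, OF T])
    show "u t \<in> L2_space" "of_fun (u t) = W (tidx 0) t" if "t \<in> {0..T}" for t
      using v_L2[OF _ _ that, of 0 0] v_0[of 0] W_tidx[OF _ that, of 0] by auto
  qed (use j W_tidx_deriv in auto)
  thus "(time_deriv T ^^ j) u t \<in> L2_space" "of_fun ((time_deriv T ^^ j) u t) = W (tidx j) t" by auto
qed

lemma wd_time_deriv:
  assumes "j \<le> m" "t \<in> {0..T}"
  shows "weak_deriv \<alpha> ((time_deriv T ^^ j) u t) = weak_deriv \<alpha> (v j j t)"
proof (rule weak_deriv_cong[OF time_deriv_class(1)[OF assms] v_L2])
  show "of_fun ((time_deriv T ^^ j) u t) = of_fun (v j j t)"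
    unfolding time_deriv_class(2)[OF assms] by (rule W_tidx[OF assms])
qed (use assms in auto)

lemma W_cont:
  assumes "order p \<le> Suc m" "p \<noteq> tidx (Suc m)"
  shows "p None \<le> m" "continuous_on {0..T} (W p)"
proof -
  show le: "p None \<le> m"
  proof (rule ccontr)
    assume "\<not> p None \<le> m"
    hence a: "p None = Suc m" "mi_order (\<lambda>i. p (Some i)) = 0" using assms(1) by (auto simp: order_mi_order)
    have "p = mk_idx (Suc m) (\<lambda>_. 0)"
      using mk_idx_eta[of p] unfolding a(1) mi_order_zero(2)[OF a(2)] by simp
    thus False using assms(2) by (simp add: mk_idx_zero)
  qed
  show "continuous_on {0..T} (W p)"
    unfolding W_def[abs_def]
    by (rule continuous_in_sobolev_wd[OF v_cont]) (use assms le in \<open>auto simp: order_mi_order\<close>)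
qed

text \<open>In the family r = j + 1 the member of index j can still be differentiated, with one
  spatial derivative less. As classes it agrees with the diagonal member
  \<open>v j j\<close>.\<close>

lemma W_deriv:
  assumes p: "order (inc None p) \<le> Suc m" "inc None p \<noteq> tidx (Suc m)" and t: "t \<in> {0..T}"
  shows "(W p has_vector_derivative W (inc None p) t) (at t within {0..T})"
proof -
  let ?j = "p None" and ?\<alpha> = "\<lambda>i. p (Some i)"
  have j: "Suc ?j \<le> m" using W_cont(1)[OF p] by simp
  have \<alpha>: "mi_order ?\<alpha> \<le> m + 1 - Suc ?j" using p(1) by (simp add: order_mi_order[of p])
  have W': "W (inc None p) t = wd ?\<alpha> (v (Suc ?j) (Suc ?j) t)" by (simp add: W_def inc_apply)
  have "((\<lambda>\<tau>. wd ?\<alpha> (v (Suc ?j) ?j \<tau>)) has_vector_derivative W (inc None p) t) (at t within {0..T})"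
    unfolding W' by (rule has_time_deriv_wd[OF v_deriv[OF j lessI t] t \<alpha>])
  thus ?thesis
  proof (rule has_vector_derivative_transform[OF t, rotated])
    fix \<tau> assume \<tau>: "\<tau> \<in> {0..T}"
    show "W p \<tau> = wd ?\<alpha> (v (Suc ?j) ?j \<tau>)"
      unfolding W_def by (intro wd_cong v_L2 of_fun_v[symmetric]) (use j \<tau> in auto)
  qed
qed

lemma W_spat:
  assumes p: "order p \<le> m" and t: "t \<in> {0..T}"
  shows "has_D i (W p t) (W (inc (Some i) p) t)"
proof -
  have "p None \<le> m" "Suc (mi_order (\<lambda>i. p (Some i))) \<le> m + 1 - p None" using p by (auto simp: order_mi_order)
  thus ?thesis unfolding W_def inc_Some_mi inc_None_simps using v_sobolev t by (intro wd_has_D) simp_all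
qed

lemma W_Hs: "t \<in> {0..T} \<Longrightarrow> order p + r \<le> Suc m \<Longrightarrow> W p t \<in> Hs r"
  by (rule jet_Hs[where X = "\<lambda>p. W p t" and M = "Suc m"]) (auto intro: W_spat)

lemma W_jets_base:
  assumes m3: "3 \<le> m" and big: "CARD('n) < 2 * (m - 2)" and c: "0 < c" and pos: "0 < \<alpha>" "0 < \<beta>" "0 < \<epsilon>"
    and sol: "kuznetsov_solution T c \<alpha> \<beta> \<epsilon> u0 u1 u"
    and small: "\<And>t. t \<in> {0..T} \<Longrightarrow> Linf_norm (time_deriv T u t) < ereal (1 / (2 * \<alpha> * \<epsilon>))"
  shows "jets_base m T c (\<alpha> * \<epsilon>) (\<beta> * \<epsilon>) W"
proof
  fix t assume t: "t \<in> {0..T}"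
  let ?a1 = "time_deriv T u t" and ?a2 = "(time_deriv T ^^ 2) u t"
  have a1: "?a1 \<in> L2_space" "of_fun ?a1 = W (inc None zidx) t"
    and a2: "?a2 \<in> L2_space" "of_fun ?a2 = W (inc None (inc None zidx)) t"
    using time_deriv_class[OF _ t, of 1] time_deriv_class[OF _ t, of 2] m3
    unfolding tidx_zero[symmetric] tidx_inc by (auto simp: numeral_2_eq_2)
  have us: "u t \<in> sobolev (Suc m)" using v_sobolev[of 0 0 t] v_0[of 0] t by simp
  have as: "v 1 1 t \<in> sobolev m" using v_sobolev[of 1 1 t] m3 t by simp
  have mo: "mi_order (mi_unit i) = 1" "mi_order (\<lambda>j. 2 * mi_unit i j) = 2" for i :: 'n
    by (simp_all add: mi_order_def mi_unit_def sum_distrib_left[symmetric])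
  let ?l = "\<lambda>i. weak_deriv (\<lambda>j. 2 * mi_unit i j) (u t)" and ?b = "\<lambda>i. weak_deriv (mi_unit i) (u t)"
    and ?d = "\<lambda>i. weak_deriv (mi_unit i) ?a1"
  have d: "?d i = weak_deriv (mi_unit i) (v 1 1 t)" for i
    using wd_time_deriv[of 1 t "mi_unit i"] m3 t by simp
  have L: "?l i \<in> L2_space" "?b i \<in> L2_space" "?d i \<in> L2_space" for i
    unfolding d using sobolev_weak_deriv(2)[OF us, of "\<lambda>j. 2 * mi_unit i j"]
      sobolev_weak_deriv(2)[OF us, of "mi_unit i"] sobolev_weak_deriv(2)[OF as, of "mi_unit i"] m3
    by (simp_all add: mo)
  have W: "of_fun (?l i) = W (inc (Some i) (inc (Some i) zidx)) t" "of_fun (?b i) = W (inc (Some i) zidx) t"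
    "of_fun (?d i) = W (inc (Some i) (inc None zidx)) t" for i
  proof -
    have ix: "(\<lambda>j. inc (Some i) zidx (Some j)) = mi_unit i" "(\<lambda>j. inc (Some i) (inc None zidx) (Some j)) = mi_unit i"
      "(\<lambda>j. inc (Some i) (inc (Some i) zidx) (Some j)) = (\<lambda>j. 2 * mi_unit i j)"
      by (auto simp: fun_eq_iff inc_apply mi_unit_def)
    show "of_fun (?l i) = W (inc (Some i) (inc (Some i) zidx)) t" "of_fun (?b i) = W (inc (Some i) zidx) t"
      "of_fun (?d i) = W (inc (Some i) (inc None zidx)) t"
      unfolding d by (simp_all add: W_def wd_def v_0 ix)
  qed
  have ok: "pmult_ok (W p t) (W q t)" if "order p = 1" "order q = 2" for p q
  proof (rule product_estimate(1)[of m 0])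
    show "CARD('n) < 2 * (m + 0)" using big by simp
  qed (use that t in \<open>auto intro: W_Hs\<close>)
  have "AE x in lebesgue. ?a2 x - c\<^sup>2 * (\<Sum>i\<in>UNIV. ?l i x)
      = \<alpha> * \<epsilon> * ?a1 x * ?a2 x + \<beta> * \<epsilon> * (\<Sum>i\<in>UNIV. ?b i x * ?d i x)"
    using sol t by (auto simp: kuznetsov_solution_def weak_laplacian_def weak_grad_def inner_vec_def)
  from of_fun_wave[OF a1(1) a2(1) L _ _ this, unfolded a1(2) a2(2) W]
  show "W (inc None (inc None zidx)) t - (\<alpha> * \<epsilon>) *\<^sub>R pmult (W (inc None zidx) t) (W (inc None (inc None zidx)) t)
      = c\<^sup>2 *\<^sub>R (\<Sum>i\<in>UNIV. W (inc (Some i) (inc (Some i) zidx)) t)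
        + (\<beta> * \<epsilon>) *\<^sub>R (\<Sum>i\<in>UNIV. pmult (W (inc (Some i) zidx) t) (W (inc (Some i) (inc None zidx)) t))"
    by (simp add: ok)
  show "bounded_by (1 / 2) ((\<alpha> * \<epsilon>) *\<^sub>R W (inc None zidx) t)"
    using bounded_by_of_Linf[OF a1(1), of "\<alpha> * \<epsilon>"] small[OF t] pos by (simp add: a1(2) mult.assoc)
qed (use m3 big c T pos W_cont(2) W_deriv W_spat in \<open>auto simp: inc_Some_neq_tidx order_tidx\<close>)

text \<open>The choices hidden in \<open>time_deriv\<close> and \<open>weak_deriv\<close> affect
  only null sets, so all norms in \<open>energy\<close> are norms of the classes
  \<open>W q t\<close>, with Z in the place of order m + 1 in time.\<close>

lemma energy_eq:
  fixes Z :: "real \<Rightarrow> 'n l2"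
  assumes Z: "\<And>t. t \<in> {0..T} \<Longrightarrow> (W (tidx m) has_vector_derivative Z t) (at t within {0..T})"
    and k: "k \<le> m" and t: "t \<in> {0..T}"
  shows "energy T k u t = energy_sum (\<lambda>q. (norm ((W(tidx (Suc m) := Z)) q t))\<^sup>2) k"
proof -
  define W' where "W' = W(tidx (Suc m) := Z)"
  have ne: "p \<noteq> tidx (Suc m)" if "p None \<le> m" for p :: "'n idx" using that by (auto simp: tidx_def)
  have us: "u t \<in> sobolev (Suc m)" using v_sobolev[of 0 0 t] v_0[of 0] t by simp
  have "(sobolev_norm k (weak_deriv (mi_unit i) (u t)))\<^sup>2 = (\<Sum>p\<in>space_idx k. (norm (W' (inc (Some i) p) t))\<^sup>2)" for i
  proof -
    have "weak_deriv (mi_unit i) (u t) \<in> sobolev k" by (rule sobolev_mono[OF wd_weak_deriv_unit(1)[OF us] k])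
    hence "(sobolev_norm k (weak_deriv (mi_unit i) (u t)))\<^sup>2
        = (\<Sum>\<alpha> | mi_order \<alpha> \<le> k. (norm (wd \<alpha> (weak_deriv (mi_unit i) (u t))))\<^sup>2)"
      by (rule sobolev_norm_wd)
    also have "\<dots> = (\<Sum>\<alpha> | mi_order \<alpha> \<le> k. (norm (W' (inc (Some i) (mk_idx 0 \<alpha>)) t))\<^sup>2)"
      using k wd_weak_deriv_unit(2)[OF us]
      by (intro sum.cong refl) (simp add: W'_def inc_Some_neq_tidx W_def inc_Some_mi v_0)
    finally show ?thesis by (simp add: sum_space_idx)
  qed
  moreover have "(sobolev_norm (k + 1 - j) ((time_deriv T ^^ j) u t))\<^sup>2
      = (\<Sum>\<alpha> | mi_order \<alpha> \<le> Suc k - j. (norm (W' (mk_idx j \<alpha>) t))\<^sup>2)" if j: "j \<in> {1..k+1}" for j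
  proof (cases "j \<le> m")
    case True
    have "v j j t \<in> sobolev (k + 1 - j)" by (rule sobolev_mono[OF v_sobolev[OF True order_refl t]]) (use k in simp)
    hence "(sobolev_norm (k + 1 - j) (v j j t))\<^sup>2 = (\<Sum>\<alpha> | mi_order \<alpha> \<le> k + 1 - j. (norm (wd \<alpha> (v j j t)))\<^sup>2)"
      by (rule sobolev_norm_wd)
    moreover have "sobolev_norm (k + 1 - j) ((time_deriv T ^^ j) u t) = sobolev_norm (k + 1 - j) (v j j t)"
      by (simp add: sobolev_norm_def wd_time_deriv[OF True t])
    moreover have "W' (mk_idx j \<alpha>) t = wd \<alpha> (v j j t)" for \<alpha>
      using True by (simp add: W'_def ne W_def)
    ultimately show ?thesis by simp
  next
    case False
    hence jm: "j = Suc m" "k = m" using j k by auto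
    \<comment> \<open>For j = m + 1 only an L2 norm occurs, and uniqueness of time derivatives
      identifies its class with Z.\<close>
    have *: "(time_deriv T ^^ Suc m) u t \<in> L2_space \<and> of_fun ((time_deriv T ^^ Suc m) u t) = W' (tidx (Suc m)) t"
    proof (rule iterated_time_deriv[where C = "\<lambda>j. W' (tidx j)" and J = "Suc m", OF T])
      show "u t \<in> L2_space" "of_fun (u t) = W' (tidx 0) t" if "t \<in> {0..T}" for t
        using time_deriv_class[OF _ that, of 0] by (auto simp: W'_def ne tidx_def)
      show "(W' (tidx j) has_vector_derivative W' (tidx (Suc j)) t) (at t within {0..T})"
        if "j < Suc m" "t \<in> {0..T}" for j t
      proof (cases "j = m")
        case True thus ?thesis using Z[OF that(2)] ne[of "tidx m"] by (simp add: W'_def tidx_def)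
      next
        case False
        hence "j < m" using that by simp
        thus ?thesis using W_tidx_deriv[OF _ that(2), of j] ne[of "tidx j"] ne[of "tidx (Suc j)"]
          by (simp add: W'_def tidx_def)
      qed
    qed (use t in auto)
    have "{\<alpha> :: 'n \<Rightarrow> nat. mi_order \<alpha> \<le> 0} = {\<lambda>_. 0}" using mi_order_zero by auto
    thus ?thesis using sobolev_norm_0[of "(time_deriv T ^^ Suc m) u t"] * jm by (simp add: mk_idx_zero)
  qed
  ultimately show ?thesis
    unfolding energy_def energy_sum_def sum_time_idx W'_def[symmetric]
    by (intro arg_cong2[where f = "(+)"] sum.cong) (simp_all add: weak_grad_def)
qed

lemma energy_bound:
  assumes m3: "3 \<le> m" and big: "CARD('n) < 2 * (m - 2)" and c: "0 < c" and pos: "0 < \<alpha>" "0 < \<beta>" "0 < \<epsilon>"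
    and sol: "kuznetsov_solution T c \<alpha> \<beta> \<epsilon> u0 u1 u"
    and small: "\<And>t. t \<in> {0..T} \<Longrightarrow> Linf_norm (time_deriv T u t) < ereal (1 / (2 * \<alpha> * \<epsilon>))"
    and t: "t \<in> {0..T}"
  shows "energy T m u t \<le> (3 + 2 * c\<^sup>2) / min (1 / 2) (c\<^sup>2) * energy T m u 0
    + estimate_const m c TYPE('n) * max \<alpha> \<beta> * \<epsilon>
      * integral {0..t} (\<lambda>\<tau>. energy T (m - 1) u \<tau> powr (1 / 2) * energy T m u \<tau>)"
proof -
  interpret J: jets_base m T c "\<alpha> * \<epsilon>" "\<beta> * \<epsilon>" W
    by (rule W_jets_base[OF m3 big c pos sol small])
  obtain Z where Z: "jets_top m T c (\<alpha> * \<epsilon>) (\<beta> * \<epsilon>) (W(tidx (Suc m) := Z)) (\<lambda>p. order p \<le> Suc m)"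
    "\<And>t. t \<in> {0..T} \<Longrightarrow> (W (tidx m) has_vector_derivative Z t) (at t within {0..T})"
    using J.jets_top_extension by blast
  interpret K: jets_top m T c "\<alpha> * \<epsilon>" "\<beta> * \<epsilon>" "W(tidx (Suc m) := Z)" "\<lambda>p. order p \<le> Suc m" by (rule Z(1))
  have En: "energy T k u s = K.En k s" if "k \<le> m" "s \<in> {0..T}" for k s
    unfolding K.En_def by (rule energy_eq[OF Z(2) that])
  have "integral {0..t} (\<lambda>\<tau>. energy T (m - 1) u \<tau> powr (1 / 2) * energy T m u \<tau>)
      = integral {0..t} (\<lambda>s. sqrt (K.En (m - 1) s) * K.En m s)"
    by (rule integral_cong) (use t in \<open>simp add: En powr_half_sqrt K.En_nonneg\<close>)
  moreover have "max (\<alpha> * \<epsilon>) (\<beta> * \<epsilon>) = max \<alpha> \<beta> * \<epsilon>" using pos by (simp add: max_mult_distrib_right)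
  ultimately show ?thesis using K.energy_estimate[OF t] En[of m t] En[of m 0] T t
    by (simp add: mult.assoc K.\<delta>_def)
qed

end

theorem proposition2:
  fixes m :: nat and c :: real
  assumes "c > 0" and "int m \<ge> \<lfloor>real CARD('n::finite) / 2 + 3\<rfloor>"
  shows "\<exists>D>0. \<forall>\<alpha> \<beta> \<epsilon> M1 M2 T (u0 :: real^'n \<Rightarrow> real) u1 u.
     \<alpha> > 0 \<and> \<beta> > 0 \<and> \<epsilon> > 0 \<and> M1 > 0 \<and> M2 > 0 \<and> T > 0 \<and>
     kuznetsov_solution T c \<alpha> \<beta> \<epsilon> u0 u1 u \<and>
     (\<forall>r\<le>m. u \<in> C_sobolev r (m + 1 - r) T) \<and>
     (\<forall>t\<in>{0..T}. Linf_norm (time_deriv T u t) < ereal (1 / (2 * \<alpha> * \<epsilon>)) \<and>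
        Linf_norm (u t) < ereal M1 \<and> Linf_norm (weak_grad (u t)) < ereal M2) \<longrightarrow>
     (\<forall>t\<in>{0..T}. energy T m u t
        \<le> (3 + 2 * c\<^sup>2) / min (1 / 2) (c\<^sup>2) * energy T m u 0
          + D * max \<alpha> \<beta> * \<epsilon>
            * integral {0..t} (\<lambda>\<tau>. energy T (m - 1) u \<tau> powr (1 / 2) * energy T m u \<tau>))"
proof (intro exI[of _ "estimate_const m c TYPE('n)"] conjI allI impI ballI)
  show "0 < estimate_const m c TYPE('n)" by (rule estimate_const_pos[OF assms(1)])
  fix \<alpha> \<beta> \<epsilon> M1 M2 T t and u0 u1 :: "real^'n \<Rightarrow> real" and u
  assume h: "\<alpha> > 0 \<and> \<beta> > 0 \<and> \<epsilon> > 0 \<and> M1 > 0 \<and> M2 > 0 \<and> T > 0 \<and>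
     kuznetsov_solution T c \<alpha> \<beta> \<epsilon> u0 u1 u \<and>
     (\<forall>r\<le>m. u \<in> C_sobolev r (m + 1 - r) T) \<and>
     (\<forall>t\<in>{0..T}. Linf_norm (time_deriv T u t) < ereal (1 / (2 * \<alpha> * \<epsilon>)) \<and>
        Linf_norm (u t) < ereal M1 \<and> Linf_norm (weak_grad (u t)) < ereal M2)"
    and t: "t \<in> {0..T}"
  \<comment> \<open>The bound on the integer part means n/2 + 3 < m + 1, that is, n < 2 (m -
    2).\<close>
  have "real CARD('n) / 2 + 3 < of_int \<lfloor>real CARD('n) / 2 + 3\<rfloor> + 1" by linarith
  also have "\<dots> \<le> of_int (int m) + 1" using assms(2) by (intro add_right_mono of_int_le_iff[THEN iffD2])
  finally have "real CARD('n) + 4 < real (2 * m)" by simp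
  hence m: "CARD('n) + 4 < 2 * m" by linarith
  \<comment> \<open>The witnesses of \<open>C_sobolev\<close> may differ from one r to another,
    hence a choice over r.\<close>
  have "\<forall>r. \<exists>v. r \<le> m \<longrightarrow> v 0 = u \<and> (\<forall>j\<le>r. continuous_in_sobolev (m + 1 - r) T (v j)) \<and>
     (\<forall>j<r. \<forall>t\<in>{0..T}. has_time_deriv (m + 1 - r) T (v j) (v (Suc j) t) t)"
    using h unfolding C_sobolev_def by blast
  from choice[OF this] obtain v where v: "\<And>r. r \<le> m \<Longrightarrow> v r 0 = u \<and>
     (\<forall>j\<le>r. continuous_in_sobolev (m + 1 - r) T (v r j)) \<and>
     (\<forall>j<r. \<forall>t\<in>{0..T}. has_time_deriv (m + 1 - r) T (v r j) (v r (Suc j) t) t)" by blast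
  interpret sobolev_curve m T u v by unfold_locales (use h v in auto)
  have "0 < CARD('n)" by simp
  hence "3 \<le> m" "CARD('n) < 2 * (m - 2)" using m by linarith+
  thus "energy T m u t \<le> (3 + 2 * c\<^sup>2) / min (1 / 2) (c\<^sup>2) * energy T m u 0
    + estimate_const m c TYPE('n) * max \<alpha> \<beta> * \<epsilon>
      * integral {0..t} (\<lambda>\<tau>. energy T (m - 1) u \<tau> powr (1 / 2) * energy T m u \<tau>)"
    by (rule energy_bound[OF _ _ assms(1) _ _ _ _ _ t]) (use h in auto)
qed

end
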